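(* Let $(R,\mathfrak n)$ be a Noetherian local ring with $\dim R>0$, maximal ideal $\mathfrak n$ and infinite residue field $k=R/\mathfrak n$, let $J=I_0$ be an $\mathfrak n$-primary ideal, and let $I_1,\ldots,I_s$ be ideals of $R$ such that $I=I_1\cdots I_s$ is non-nilpotent. Let $k_0,\ldots,k_s$ be non-negative integers with $k_0+\cdots+k_s=\dim R/(0:I^\infty)-1$. Then the following statements hold. (i) If $e(J^{[k_0+1]},I_1^{[k_1]},\ldots,I_s^{[k_s]};R)\neq0$, then for any superficial sequence $x_1,\ldots,x_n$ of $(I_1,\ldots,I_s)$ with respect to $J$ consisting of $m_0\le k_0$ elements of $I_0$, $\ldots$, $m_s\le k_s$ elements of $I_s$ we have $\dim R/((x_1,\ldots,x_n):I^\infty)=\dim R/(0:I^\infty)-n$ and $e(\bar J^{[k_0+1-m_0]},\bar I_1^{[k_1-m_1]},\ldots,\bar I_s^{[k_s-m_s]};\overline R)\neq0$, where $\bar J,\bar I_1,\ldots,\bar I_s$ are the images of $J,I_1,\ldots,I_s$ in $\overline R=R/(x_1,\ldots,x_n)$. (ii) If there exists a superficial sequence $x_1,\ldots,x_n$ of $(I_1,\ldots,I_s)$ with respect to $J$ consisting of $m_0\le k_0$ elements of $I_0$, $\ldots$, $m_s\le k_s$ elements of $I_s$ such that $\dim R/((x_1,\ldots,x_n):I^\infty)=\dim R/(0:I^\infty)-n$ and $e(\bar J^{[k_0+1-m_0]},\bar I_1^{[k_1-m_1]},\ldots,\bar I_s^{[k_s-m_s]};\overline R)\neq0$, where $\bar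 J,\bar I_1,\ldots,\bar I_s$ are the images of $J,I_1,\ldots,I_s$ in $\overline R=R/(x_1,\ldots,x_n)$, then $e(J^{[k_0+1]},I_1^{[k_1]},\ldots,I_s^{[k_s]};R)\neq0$. (iii) Suppose that $e(J^{[k_0+1]},I_1^{[k_1]},\ldots,I_s^{[k_s]};R)\neq0$ and that $x_1,\ldots,x_n$ is a superficial sequence of $(I_1,\ldots,I_s)$ with respect to $J$ consisting of $m_0\le k_0$ elements of $I_0$, $\ldots$, $m_s\le k_s$ elements of $I_s$. Let $\overline R=R/(x_1,\ldots,x_n)$ and let $\bar J,\bar I_1,\ldots,\bar I_s$ be the images of $J,I_1,\ldots,I_s$ in $\overline R$. Then $$e(J^{[k_0+1]},I_1^{[k_1]},\ldots,I_s^{[k_s]};R)=e(\bar J^{[k_0+1-m_0]},\bar I_1^{[k_1-m_1]},\ldots,\bar I_s^{[k_s-m_s]};\overline R).$$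
   Context: For ideals $\mathfrak a,\mathfrak b$ of $R$, $\mathfrak a:\mathfrak b^\infty=\bigcup_{n\ge0}(\mathfrak a:\mathfrak b^n)$. "$n_0,\ldots,n_s\gg0$" means all $n_j\ge N$ for some integer $N$. Mixed multiplicities of ideals. Let $q=\dim R/(0:I^\infty)$ and $$T=\bigoplus_{n,n_1,\ldots,n_s\ge0}\frac{J^nI_1^{n_1}\cdots I_s^{n_s}}{J^{n+1}I_1^{n_1}\cdots I_s^{n_s}},$$ a finitely generated standard $(s+1)$-graded algebra over the Artinian local ring $R/J$. It is known that $\dim T^\triangle=q$, where $T^\triangle=\bigoplus_{n\ge 0}T_{(n,\ldots,n)}$ is the diagonal subring of $T$, and that for all large $n,n_1,\ldots,n_s$ the length of $J^nI_1^{n_1}\cdots I_s^{n_s}/J^{n+1}I_1^{n_1}\cdots I_s^{n_s}$ is a polynomial in $n,n_1,\ldots,n_s$ of total degree $q-1$. Its terms of total degree $q-1$ are written $$\sum_{k_0+k_1+\cdots+k_s=q-1}e(J^{[k_0+1]},I_1^{[k_1]},\ldots,I_s^{[k_s]};R)\frac{n^{k_0}n_1^{k_1}\cdots n_s^{k_s}}{k_0!k_1!\cdots k_s!},$$ and $e(J^{[k_0+1]},I_1^{[k_1]},\ldots,I_s^{[k_s]};R)$ is called the mixed multiplicity of $J,I_1,\ldots,I_s$ of type $(k_0,k_1,\ldots,k_s)$. The mixed multiplicities $e(\bar J^{[\cdot]},\bar I_1^{[\cdot]},\ldots,\bar I_s^{[\cdot]};\overline R)$ are defined in the same way for the ring $\overline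 R$ and the ideals $\bar J,\bar I_1,\ldots,\bar I_s$. Superficial sequences. Let $\mathfrak I=I_0$ be an ideal of $R$ such that $\mathfrak I I_1\cdots I_s$ is non-nilpotent. An element $x\in R$ is a superficial element of $(I_1,\ldots,I_s)$ with respect to $\mathfrak I$ if there exists $i\in\{0,1,\ldots,s\}$ such that $x\in I_i$ and (a) $(\mathfrak I I_0^{n_0}\cdots I_i^{n_i+1}\cdots I_s^{n_s}:x)\cap I_0^{n_0}\cdots I_s^{n_s}=\mathfrak I I_0^{n_0}\cdots I_i^{n_i}\cdots I_s^{n_s}$ for all $n_0,\ldots,n_s\gg0$; (b) $(x)\cap I_0^{n_0}\cdots I_i^{n_i+1}\cdots I_s^{n_s}=xI_0^{n_0}\cdots I_i^{n_i}\cdots I_s^{n_s}$ for all $n_0,\ldots,n_s\gg0$. A sequence $x_1,\ldots,x_t$ in $R$ is a superficial sequence of $(I_1,\ldots,I_s)$ with respect to $\mathfrak I$ if for each $i=0,\ldots,t-1$ the image of $x_{i+1}$ in $R_i=R/(x_1,\ldots,x_i)$ is a superficial element of $(I_1R_i,\ldots,I_sR_i)$ with respect to $\mathfrak I R_i$ (in the ring $R_i$). In the proposition $\mathfrak I=I_0=J$. *)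

theory Defs
  imports "HOL-Algebra.Algebra" "HOL-Library.Poly_Mapping" "HOL-Library.Extended_Nat"
begin

section \<open>Commutative algebra\<close>

locale noetherian_local_ring = noetherian_ring R + cring R for R (structure) +
  fixes \<nn> :: "'a set"
  assumes maximal: "maximalideal \<nn> R"
    and maximal_unique: "maximalideal M R \<Longrightarrow> M = \<nn>"

text \<open>Supremum of the lengths of strict chains of prime ideals.  The supremum of the empty set is
  \<open>0\<close> in \<^typ>\<open>enat\<close>, so the zero ring gets dimension \<open>0\<close> here.\<close>
definition krull_dim :: "('a, 'b) ring_scheme \<Rightarrow> enat" where
  "krull_dim R = Sup {enat n | n. \<exists>P :: nat \<Rightarrow> 'a set.
     (\<forall>i\<le>n. primeideal (P i) R) \<and> (\<forall>i<n. P i \<subset> P (Suc i))}"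

definition ideal_radical :: "('a, 'b) ring_scheme \<Rightarrow> 'a set \<Rightarrow> 'a set" where
  "ideal_radical R Q = {a \<in> carrier R. \<exists>n::nat. a [^]\<^bsub>R\<^esub> n \<in> Q}"

definition is_primary_to :: "('a, 'b) ring_scheme \<Rightarrow> 'a set \<Rightarrow> 'a set \<Rightarrow> bool" where
  "is_primary_to R P Q \<longleftrightarrow> ideal Q R \<and> Q \<noteq> carrier R \<and>
     (\<forall>a\<in>carrier R. \<forall>b\<in>carrier R. a \<otimes>\<^bsub>R\<^esub> b \<in> Q \<longrightarrow> a \<in> Q \<or> (\<exists>n::nat. b [^]\<^bsub>R\<^esub> n \<in> Q)) \<and>
     ideal_radical R Q = P"

text \<open>Powers and products of ideals are taken in the commutative monoid \<^const>\<open>ideals_set\<close>,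
  whose unit is the whole ring.\<close>
definition nilpotent_ideal :: "('a, 'b) ring_scheme \<Rightarrow> 'a set \<Rightarrow> bool" where
  "nilpotent_ideal R A \<longleftrightarrow> (\<exists>n::nat. A [^]\<^bsub>ideals_set R\<^esub> n = {\<zero>\<^bsub>R\<^esub>})"

definition colon :: "('a, 'b) ring_scheme \<Rightarrow> 'a set \<Rightarrow> 'a set \<Rightarrow> 'a set" where
  "colon R A B = {r \<in> carrier R. \<forall>b\<in>B. r \<otimes>\<^bsub>R\<^esub> b \<in> A}"

definition saturation :: "('a, 'b) ring_scheme \<Rightarrow> 'a set \<Rightarrow> 'a set \<Rightarrow> 'a set" where
  "saturation R A B = (\<Union>n::nat. colon R A (B [^]\<^bsub>ideals_set R\<^esub> n))"

definition image_mod :: "('a, 'b) ring_scheme \<Rightarrow> 'a set \<Rightarrow> 'a set \<Rightarrow> 'a set set" where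
  "image_mod R Q A = (\<lambda>a. Q +>\<^bsub>R\<^esub> a) ` A"

definition module_length :: "('a, 'c) ring_scheme \<Rightarrow> ('a, 'b, 'd) module_scheme \<Rightarrow> enat" where
  "module_length R M = Sup {enat n | n. \<exists>H :: nat \<Rightarrow> 'b set.
     (\<forall>i\<le>n. submodule (H i) R M) \<and> (\<forall>i<n. H i \<subset> H (Suc i))}"

text \<open>The \<open>R\<close>-module \<open>A / B\<close> for ideals \<open>B \<subseteq> A\<close>.  The record type of modules extends that of rings;
  its multiplicative fields are irrelevant for modules.\<close>
definition ideal_quotient_module ::
    "('a, 'b) ring_scheme \<Rightarrow> 'a set \<Rightarrow> 'a set \<Rightarrow> ('a, 'a set) module" where
  "ideal_quotient_module R A B =
     \<lparr>carrier = (\<lambda>a. B +>\<^bsub>R\<^esub> a) ` A, monoid.mult = undefined, one = undefined,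
      ring.zero = B, add = set_add R, smult = (\<lambda>r C. \<Union>c\<in>C. B +>\<^bsub>R\<^esub> (r \<otimes>\<^bsub>R\<^esub> c))\<rparr>"

section \<open>Mixed multiplicities\<close>

text \<open>Throughout, a family \<open>I\<close> and a bound \<open>s\<close> encode the ideals \<open>I 0, \<dots>, I s\<close>, where \<open>I 0\<close> plays the
  role of \<open>J\<close> (and of the ideal with respect to which superficial elements are taken).
  Values of the family beyond \<open>s\<close> are never used.\<close>

definition ideal_product :: "('a, 'b) ring_scheme \<Rightarrow> (nat \<Rightarrow> 'a set) \<Rightarrow> nat \<Rightarrow> 'a set" where
  "ideal_product R I s = (\<Otimes>\<^bsub>ideals_set R\<^esub> i\<in>{1..s}. I i)"

definition ideal_monomial ::
    "('a, 'b) ring_scheme \<Rightarrow> (nat \<Rightarrow> 'a set) \<Rightarrow> nat \<Rightarrow> (nat \<Rightarrow> nat) \<Rightarrow> 'a set" where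
  "ideal_monomial R I s n = (\<Otimes>\<^bsub>ideals_set R\<^esub> i\<in>{0..s}. I i [^]\<^bsub>ideals_set R\<^esub> n i)"

definition for_large :: "nat \<Rightarrow> ((nat \<Rightarrow> nat) \<Rightarrow> bool) \<Rightarrow> bool" where
  "for_large s P \<longleftrightarrow> (\<exists>N. \<forall>n. (\<forall>j\<le>s. N \<le> n j) \<longrightarrow> P n)"

definition hilbert_function ::
    "('a, 'b) ring_scheme \<Rightarrow> (nat \<Rightarrow> 'a set) \<Rightarrow> nat \<Rightarrow> (nat \<Rightarrow> nat) \<Rightarrow> enat" where
  "hilbert_function R I s n = module_length R
     (ideal_quotient_module R (ideal_monomial R I s n) (ideal_monomial R I s (n(0 := Suc (n 0)))))"

text \<open>Polynomials in the variables \<open>X\<^sub>0, X\<^sub>1, \<dots>\<close> are finitely supported maps from monomials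
  (finitely supported maps from variables to exponents) to coefficients.\<close>
type_synonym multipoly = "(nat \<Rightarrow>\<^sub>0 nat) \<Rightarrow>\<^sub>0 rat"

definition multipoly_eval :: "multipoly \<Rightarrow> (nat \<Rightarrow> nat) \<Rightarrow> rat" where
  "multipoly_eval P n = (\<Sum>\<mu>\<in>Poly_Mapping.keys P.
     Poly_Mapping.lookup P \<mu> *
     (\<Prod>i\<in>Poly_Mapping.keys \<mu>. of_nat (n i) ^ Poly_Mapping.lookup \<mu> i))"

definition is_hilbert_polynomial ::
    "('a, 'b) ring_scheme \<Rightarrow> (nat \<Rightarrow> 'a set) \<Rightarrow> nat \<Rightarrow> multipoly \<Rightarrow> bool" where
  "is_hilbert_polynomial R I s P \<longleftrightarrow>
     (\<forall>\<mu>\<in>Poly_Mapping.keys P. Poly_Mapping.keys \<mu> \<subseteq> {0..s}) \<and>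
     for_large s (\<lambda>n. \<exists>l. hilbert_function R I s n = enat l \<and> of_nat l = multipoly_eval P n)"

definition exponents :: "nat \<Rightarrow> (nat \<Rightarrow> nat) \<Rightarrow> (nat \<Rightarrow>\<^sub>0 nat)" where
  "exponents s k = (\<Sum>i\<in>{0..s}. Poly_Mapping.single i (k i))"

text \<open>\<open>mixed_multiplicity R I s k\<close> is \<open>e(J\<^bsup>[k\<^sub>0+1]\<^esup>, I\<^sub>1\<^bsup>[k\<^sub>1]\<^esup>, \<dots>, I\<^sub>s\<^bsup>[k\<^sub>s]\<^esup>; R)\<close> with \<open>J = I 0\<close>; note the shift
  \<open>k\<^sub>0 + 1\<close>.  It is unspecified unless \<open>k\<^sub>0 + \<dots> + k\<^sub>s = dim R/(0 : (I\<^sub>1 \<cdots> I\<^sub>s)\<^sup>\<infinity>) - 1\<close>.  That the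
  polynomial has exactly this total degree is a theorem and not part of the definition.\<close>
definition mixed_multiplicity ::
    "('a, 'b) ring_scheme \<Rightarrow> (nat \<Rightarrow> 'a set) \<Rightarrow> nat \<Rightarrow> (nat \<Rightarrow> nat) \<Rightarrow> rat" where
  "mixed_multiplicity R I s k = (THE e.
     krull_dim (R Quot saturation R {\<zero>\<^bsub>R\<^esub>} (ideal_product R I s)) = enat (\<Sum>i\<in>{0..s}. k i) + 1 \<and>
     (\<exists>P. is_hilbert_polynomial R I s P \<and>
       Poly_Mapping.lookup P (exponents s k) = e / (\<Prod>i\<in>{0..s}. fact (k i))))"

section \<open>Superficial sequences\<close>

text \<open>The paper fixes, before this definition, an ideal \<open>\<II> = I 0\<close> such that the product of all the
  ideals is non-nilpotent; this is not built into the definition, so that no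
  such condition is imposed on the successive quotient rings below.\<close>
definition superficial_at ::
    "('a, 'b) ring_scheme \<Rightarrow> (nat \<Rightarrow> 'a set) \<Rightarrow> nat \<Rightarrow> nat \<Rightarrow> 'a \<Rightarrow> bool" where
  "superficial_at R I s i x \<longleftrightarrow> i \<le> s \<and> x \<in> I i \<and>
     for_large s (\<lambda>n.
       colon R (I 0 \<cdot>\<^bsub>R\<^esub> ideal_monomial R I s (n(i := Suc (n i)))) {x} \<inter> ideal_monomial R I s n
         = I 0 \<cdot>\<^bsub>R\<^esub> ideal_monomial R I s n) \<and>
     for_large s (\<lambda>n.
       PIdl\<^bsub>R\<^esub> x \<inter> ideal_monomial R I s (n(i := Suc (n i)))
         = (\<lambda>a. x \<otimes>\<^bsub>R\<^esub> a) ` ideal_monomial R I s n)"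

definition superficial_element ::
    "('a, 'b) ring_scheme \<Rightarrow> (nat \<Rightarrow> 'a set) \<Rightarrow> nat \<Rightarrow> 'a \<Rightarrow> bool" where
  "superficial_element R I s x \<longleftrightarrow> (\<exists>i. superficial_at R I s i x)"

abbreviation quot_by :: "('a, 'b) ring_scheme \<Rightarrow> 'a list \<Rightarrow> 'a set ring" where
  "quot_by R xs \<equiv> R Quot (Idl\<^bsub>R\<^esub> (set xs))"

abbreviation image_by :: "('a, 'b) ring_scheme \<Rightarrow> 'a list \<Rightarrow> 'a set \<Rightarrow> 'a set set" where
  "image_by R xs A \<equiv> image_mod R (Idl\<^bsub>R\<^esub> (set xs)) A"

definition superficial_sequence ::
    "('a, 'b) ring_scheme \<Rightarrow> (nat \<Rightarrow> 'a set) \<Rightarrow> nat \<Rightarrow> 'a list \<Rightarrow> bool" where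
  "superficial_sequence R I s xs \<longleftrightarrow> set xs \<subseteq> carrier R \<and>
     (\<forall>j<length xs. superficial_element (quot_by R (take j xs))
        (\<lambda>i. image_by R (take j xs) (I i)) s (Idl\<^bsub>R\<^esub> (set (take j xs)) +>\<^bsub>R\<^esub> (xs ! j)))"

text \<open>A superficial sequence consisting of \<open>m i\<close> elements of \<open>I i\<close> for \<open>i = 0, \<dots>, s\<close>.  An element may lie
  in several of the ideals; \<open>\<iota>\<close> records which one each entry is counted for, and
  the entry must be superficial with respect to that same index.\<close>
definition superficial_sequence_of_type ::
    "('a, 'b) ring_scheme \<Rightarrow> (nat \<Rightarrow> 'a set) \<Rightarrow> nat \<Rightarrow> (nat \<Rightarrow> nat) \<Rightarrow> 'a list \<Rightarrow> bool" where
  "superficial_sequence_of_type R I s m xs \<longleftrightarrow> set xs \<subseteq> carrier R \<and>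
     (\<exists>\<iota>. (\<forall>j<length xs. xs ! j \<in> I (\<iota> j) \<and>
            superficial_at (quot_by R (take j xs)) (\<lambda>i. image_by R (take j xs) (I i)) s (\<iota> j)
              (Idl\<^bsub>R\<^esub> (set (take j xs)) +>\<^bsub>R\<^esub> (xs ! j))) \<and>
          (\<forall>i\<le>s. card {j. j < length xs \<and> \<iota> j = i} = m i))"

lemma superficial_sequence_of_type_imp:
  "superficial_sequence_of_type R I s m xs \<Longrightarrow> superficial_sequence R I s xs"
  unfolding superficial_sequence_of_type_def superficial_sequence_def superficial_element_def
  by blast

end

theory Submission
  imports Defs "HOL-Computational_Algebra.Polynomial"
begin

text \<open>All rings \<open>R / a\<close> with \<open>a = (x\<^sub>1, \<dots>, x\<^sub>j)\<close> are treated through ideals of \<open>R\<close> containing \<open>a\<close>.  The Hilbert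
  polynomial of \<open>R\<close> exists by the multigraded Hilbert--Serre theorem, and a superficial \<open>x \<in> I\<^sub>i\<close> makes
  the Hilbert polynomial of \<open>R / ((x) + a)\<close> the backward difference in the \<open>i\<close>-th variable of that of \<open>R / a\<close>.  Hence the
  coefficient that defines the mixed multiplicity of type \<open>k\<close>, multiplied by the factorials, equals the one
  of type \<open>k - m\<close> modulo the sequence.  Two facts about \<open>q(a) = dim R / (a : I\<^sup>\<infinity>)\<close> turn this into a
  statement about multiplicities.  The degree of the polynomial is less than \<open>q(a)\<close>, by the linear Artin--Rees
  lemma and a comparison with the Hilbert--Samuel function of \<open>J\<close>.  A superficial element lowers \<open>q\<close> by at
  least one, since primes minimal over \<open>a\<close> that do not contain \<open>I\<close> also do not contain \<open>x\<close>.  So a nonzero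
  coefficient forces each step to lower \<open>q\<close> by exactly one.\<close>

text \<open>Iterated quotients would change the type of the elements at each step, so length,
  dimension and Hilbert polynomial are relative to an ideal \<open>a\<close> of the one ring
  \<open>R\<close> (\<open>ilen\<close>, \<open>pdim\<close>, \<open>hlen\<close>,
  \<open>is_hilb\<close>). \<open>mixed_multiplicity\<close> is a definite description guarded by an
  equation for the dimension, and this equation is not known at the intermediate steps. The
  induction along the sequence therefore carries raw coefficients with the inequality
  \<open>q \<le> |k| + 1\<close>; equality is recovered at the end from a nonzero coefficient. The
  inequality keeps the total degree at most \<open>|k|\<close>, and it is in this top degree that a
  backward difference just shifts exponents and multiplies by a factor. The degree bound hides an
  off-by-one: Hilbert-Samuel growth bounds a sum of about \<open>T\<close> values along a ray by
  \<open>O(T^q)\<close>, so a single value has degree at most \<open>q - 1\<close>. All these values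
  are compared with one quotient \<open>R / (J^m + b)\<close>, and the exponent \<open>q\<close>
  survives because \<open>m\<close> is linear in \<open>T\<close>; this is the reason for the linear
  form of Artin-Rees.\<close>

no_notation Sum_Type.Plus (infixr \<open><+>\<close> 65)

section \<open>Polynomials in several variables\<close>

definition mono_val :: "(nat \<Rightarrow>\<^sub>0 nat) \<Rightarrow> (nat \<Rightarrow> nat) \<Rightarrow> rat" where
  "mono_val \<mu> n = (\<Prod>i\<in>Poly_Mapping.keys \<mu>. of_nat (n i) ^ Poly_Mapping.lookup \<mu> i)"

definition vars_le :: "nat \<Rightarrow> multipoly \<Rightarrow> bool" where
  "vars_le s P \<longleftrightarrow> (\<forall>\<mu>\<in>Poly_Mapping.keys P. Poly_Mapping.keys \<mu> \<subseteq> {0..s})"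

definition tdeg :: "nat \<Rightarrow> (nat \<Rightarrow>\<^sub>0 nat) \<Rightarrow> nat" where
  "tdeg s \<mu> = (\<Sum>i\<in>{0..s}. Poly_Mapping.lookup \<mu> i)"

definition deg_le :: "nat \<Rightarrow> nat \<Rightarrow> multipoly \<Rightarrow> bool" where
  "deg_le s d P \<longleftrightarrow> (\<forall>\<mu>\<in>Poly_Mapping.keys P. tdeg s \<mu> \<le> d)"

text \<open>Missing exponents are 0 and contribute factors 1, so monomials with different supports
  can be compared over one index set.\<close>

lemma mono_val_superset:
  assumes "finite S" "Poly_Mapping.keys \<mu> \<subseteq> S"
  shows "mono_val \<mu> n = (\<Prod>i\<in>S. of_nat (n i) ^ Poly_Mapping.lookup \<mu> i)"
  unfolding mono_val_def by (rule prod.mono_neutral_left) (use assms in \<open>auto simp: in_keys_iff\<close>)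

lemma mono_val_add: "mono_val (\<mu> + \<nu>) n = mono_val \<mu> n * mono_val \<nu> n"
proof -
  let ?S = "Poly_Mapping.keys \<mu> \<union> Poly_Mapping.keys \<nu>"
  have "Poly_Mapping.keys (\<mu> + \<nu>) \<subseteq> ?S" by (rule Poly_Mapping.keys_add)
  then show ?thesis
    by (simp add: mono_val_superset[of ?S] lookup_add power_add prod.distrib)
qed

lemma mono_val_0 [simp]: "mono_val 0 n = 1"
  by (simp add: mono_val_def)

lemma mono_val_single: "mono_val (Poly_Mapping.single i p) n = of_nat (n i) ^ p"
  by (subst mono_val_superset[of "{i}"]) auto

lemma mono_val_cong: "(\<And>i. i \<in> Poly_Mapping.keys \<mu> \<Longrightarrow> n i = n' i) \<Longrightarrow> mono_val \<mu> n = mono_val \<mu> n'"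
  unfolding mono_val_def by (rule prod.cong) auto

lemma eval_superset:
  assumes "finite S" "Poly_Mapping.keys P \<subseteq> S"
  shows "multipoly_eval P n = (\<Sum>\<mu>\<in>S. Poly_Mapping.lookup P \<mu> * mono_val \<mu> n)"
  unfolding multipoly_eval_def mono_val_def
  by (rule sum.mono_neutral_left) (use assms in \<open>auto simp: in_keys_iff\<close>)

lemma eval_add: "multipoly_eval (P + Q) n = multipoly_eval P n + multipoly_eval Q n"
proof -
  let ?S = "Poly_Mapping.keys P \<union> Poly_Mapping.keys Q"
  have "Poly_Mapping.keys (P + Q) \<subseteq> ?S" by (rule Poly_Mapping.keys_add)
  then show ?thesis
    by (simp add: eval_superset[of ?S] lookup_add distrib_right sum.distrib)
qed

lemma eval_single: "multipoly_eval (Poly_Mapping.single \<mu> c) n = c * mono_val \<mu> n"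
  by (subst eval_superset[of "{\<mu>}"]) auto

lemma eval_0 [simp]: "multipoly_eval 0 n = 0"
  by (simp add: multipoly_eval_def)

lemma eval_sum: "multipoly_eval (sum F A) n = (\<Sum>a\<in>A. multipoly_eval (F a) n)"
  by (induction A rule: infinite_finite_induct) (auto simp: eval_add)

lemma eval_uminus: "multipoly_eval (- P) n = - multipoly_eval P n"
  using eval_add[of P "- P" n] by simp

lemma eval_diff: "multipoly_eval (P - Q) n = multipoly_eval P n - multipoly_eval Q n"
  using eval_add[of P "- Q" n] by (simp add: eval_uminus)

lemma poly_mapping_as_sum:
  fixes P :: "'k \<Rightarrow>\<^sub>0 'c::comm_monoid_add"
  shows "P = (\<Sum>\<mu>\<in>Poly_Mapping.keys P. Poly_Mapping.single \<mu> (Poly_Mapping.lookup P \<mu>))"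
proof (rule poly_mapping_eqI)
  fix \<nu>
  show "Poly_Mapping.lookup P \<nu> = Poly_Mapping.lookup
      (\<Sum>\<mu>\<in>Poly_Mapping.keys P. Poly_Mapping.single \<mu> (Poly_Mapping.lookup P \<mu>)) \<nu>"
    by (simp add: lookup_sum lookup_single when_def in_keys_iff sum.delta)
qed

lemma eval_mult: "multipoly_eval (P * Q) n = multipoly_eval P n * multipoly_eval Q n"
proof -
  have "P * Q = (\<Sum>\<mu>\<in>Poly_Mapping.keys P. \<Sum>\<nu>\<in>Poly_Mapping.keys Q.
     Poly_Mapping.single (\<mu> + \<nu>) (Poly_Mapping.lookup P \<mu> * Poly_Mapping.lookup Q \<nu>))"
    by (subst (1) poly_mapping_as_sum[of P], subst (1) poly_mapping_as_sum[of Q])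
       (simp add: sum_product mult_single)
  then show ?thesis
    unfolding multipoly_eval_def[of P] multipoly_eval_def[of Q]
    by (simp add: eval_sum eval_single mono_val_add sum_product mono_val_def[symmetric] mult_ac)
qed

lemma vars_le_0 [simp]: "vars_le s 0"
  by (simp add: vars_le_def)

lemma vars_le_add: "vars_le s P \<Longrightarrow> vars_le s Q \<Longrightarrow> vars_le s (P + Q)"
  unfolding vars_le_def using Poly_Mapping.keys_add[of P Q] by blast

lemma vars_le_uminus: "vars_le s P \<Longrightarrow> vars_le s (- P)"
  by (simp add: vars_le_def in_keys_iff)

lemma vars_le_diff: "vars_le s P \<Longrightarrow> vars_le s Q \<Longrightarrow> vars_le s (P - Q)"
  using vars_le_add[of s P "- Q"] by (simp add: vars_le_uminus)

lemma vars_le_mult: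
  assumes "vars_le s P" "vars_le s Q"
  shows "vars_le s (P * Q)"
  unfolding vars_le_def
proof
  fix \<mu> assume "\<mu> \<in> Poly_Mapping.keys (P * Q)"
  then obtain a b where "a \<in> Poly_Mapping.keys P" "b \<in> Poly_Mapping.keys Q" "\<mu> = a + b"
    using Poly_Mapping.keys_mult[of P Q] by blast
  then show "Poly_Mapping.keys \<mu> \<subseteq> {0..s}"
    using assms Poly_Mapping.keys_add[of a b] unfolding vars_le_def by blast
qed

lemma vars_le_single: "Poly_Mapping.keys \<mu> \<subseteq> {0..s} \<Longrightarrow> vars_le s (Poly_Mapping.single \<mu> c)"
  by (auto simp: vars_le_def split: if_splits)

lemma lookup_exponents:
  "Poly_Mapping.lookup (exponents s k) j = (if j \<le> s then k j else 0)"
  unfolding exponents_def by (auto simp: lookup_sum lookup_single when_def sum.delta)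

lemma tdeg_exponents [simp]: "tdeg s (exponents s k) = (\<Sum>i\<in>{0..s}. k i)"
  by (simp add: tdeg_def lookup_exponents)

lemma tdeg_add: "tdeg s (\<mu> + \<nu>) = tdeg s \<mu> + tdeg s \<nu>"
  by (simp add: tdeg_def lookup_add sum.distrib)

lemma tdeg_single: "i \<le> s \<Longrightarrow> tdeg s (Poly_Mapping.single i p) = p"
  by (simp add: tdeg_def lookup_single when_def sum.delta)

lemma deg_le_add: "deg_le s d P \<Longrightarrow> deg_le s d Q \<Longrightarrow> deg_le s d (P + Q)"
  unfolding deg_le_def using Poly_Mapping.keys_add[of P Q] by blast

lemma deg_le_0 [simp]: "deg_le s d 0"
  by (simp add: deg_le_def)

lemma deg_le_single: "tdeg s \<mu> \<le> d \<Longrightarrow> deg_le s d (Poly_Mapping.single \<mu> c)"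
  by (auto simp: deg_le_def split: if_splits)

lemma vars_le_sum: "(\<And>a. a \<in> A \<Longrightarrow> vars_le s (F a)) \<Longrightarrow> vars_le s (sum F A)"
  by (induction A rule: infinite_finite_induct) (auto intro: vars_le_add)

lemma deg_le_sum: "(\<And>a. a \<in> A \<Longrightarrow> deg_le s d (F a)) \<Longrightarrow> deg_le s d (sum F A)"
  by (induction A rule: infinite_finite_induct) (auto intro: deg_le_add)

subsection \<open>Backward differences\<close>

text \<open>The binomial term \<open>l = p\<close> cancels against \<open>x ^ p\<close>; this is
  where a difference loses one degree.\<close>

lemma power_backward_diff:
  fixes x :: "'a::comm_ring_1"
  shows "x ^ p - (x - 1) ^ p = (\<Sum>l<p. - (of_nat (p choose l) * (- 1) ^ (p - l)) * x ^ l)"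
proof -
  have "(x - 1) ^ p = (\<Sum>l\<le>p. of_nat (p choose l) * x ^ l * (- 1) ^ (p - l))"
    using binomial_ring[of x "- 1" p] by simp
  also have "\<dots> = (\<Sum>l<p. of_nat (p choose l) * x ^ l * (- 1) ^ (p - l)) + x ^ p"
    by (simp add: lessThan_Suc_atMost[symmetric])
  finally show ?thesis by (simp add: sum_negf mult_ac)
qed

text \<open>The evaluation clause asks for \<open>1 \<le> n i\<close> because \<open>n i - 1\<close>
  is truncated subtraction. The coefficient clause speaks of total degree \<open>d\<close>: there a
  backward difference has the coefficients of the partial derivative in variable \<open>i\<close>,
  while in lower degrees further binomial terms enter.\<close>

definition is_bdiff :: "nat \<Rightarrow> nat \<Rightarrow> nat \<Rightarrow> multipoly \<Rightarrow> multipoly \<Rightarrow> bool" where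
  "is_bdiff s i d P Q \<longleftrightarrow> vars_le s Q \<and> deg_le s d Q \<and>
     (\<forall>n. 1 \<le> n i \<longrightarrow> multipoly_eval Q n = multipoly_eval P n - multipoly_eval P (n(i := n i - 1))) \<and>
     (\<forall>\<kappa>. tdeg s \<kappa> = d \<longrightarrow> Poly_Mapping.lookup Q \<kappa>
        = of_nat (Suc (Poly_Mapping.lookup \<kappa> i)) * Poly_Mapping.lookup P (\<kappa> + Poly_Mapping.single i 1))"

lemma is_bdiff_add:
  "is_bdiff s i d P Q \<Longrightarrow> is_bdiff s i d P' Q' \<Longrightarrow> is_bdiff s i d (P + P') (Q + Q')"
  unfolding is_bdiff_def eval_add lookup_add distrib_left
  by (elim conjE, intro conjI allI impI) (simp_all add: vars_le_add deg_le_add del: of_nat_Suc One_nat_def)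

lemma is_bdiff_0: "is_bdiff s i d 0 0"
  by (simp add: is_bdiff_def)

lemma is_bdiff_sum:
  "(\<And>a. a \<in> A \<Longrightarrow> is_bdiff s i d (F a) (G a)) \<Longrightarrow> is_bdiff s i d (sum F A) (sum G A)"
  by (induction A rule: infinite_finite_induct) (auto intro: is_bdiff_add is_bdiff_0)

text \<open>Among the summands only \<open>l = p - 1\<close> can reach total degree
  \<open>d\<close>, and its coefficient is \<open>c * p\<close>; this is the source of the factor in
  \<open>is_bdiff\<close>.\<close>

lemma is_bdiff_monomial:
  assumes i: "i \<le> s" and keys: "Poly_Mapping.keys \<nu> \<subseteq> {0..s}" and \<nu>i: "Poly_Mapping.lookup \<nu> i = 0"
    and deg: "tdeg s \<nu> + p \<le> Suc d"
  shows "is_bdiff s i d (Poly_Mapping.single (\<nu> + Poly_Mapping.single i p) c)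
     (\<Sum>l<p. Poly_Mapping.single (\<nu> + Poly_Mapping.single i l) (c * - (of_nat (p choose l) * (- 1) ^ (p - l))))"
    (is "is_bdiff s i d ?P (\<Sum>l<p. ?Q l)")
proof -
  have keys': "Poly_Mapping.keys (\<nu> + Poly_Mapping.single i l) \<subseteq> {0..s}" for l
    using Poly_Mapping.keys_add[of \<nu> "Poly_Mapping.single i l"] keys i by (auto split: if_splits)
  have "multipoly_eval (\<Sum>l<p. ?Q l) n = multipoly_eval ?P n - multipoly_eval ?P (n(i := n i - 1))"
    if "1 \<le> n i" for n
  proof -
    have "mono_val \<nu> (n(i := n i - 1)) = mono_val \<nu> n"
      using \<nu>i by (intro mono_val_cong) (auto simp: in_keys_iff)
    then have "multipoly_eval ?P n - multipoly_eval ?P (n(i := n i - 1))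
        = c * mono_val \<nu> n * (of_nat (n i) ^ p - (of_nat (n i) - 1) ^ p)"
      using that by (simp add: eval_single mono_val_add mono_val_single of_nat_diff algebra_simps)
    also have "\<dots> = multipoly_eval (\<Sum>l<p. ?Q l) n"
      unfolding power_backward_diff eval_sum sum_distrib_left
      by (rule sum.cong) (simp_all add: eval_single mono_val_add mono_val_single mult_ac)
    finally show ?thesis by simp
  qed
  moreover have "vars_le s (\<Sum>l<p. ?Q l)"
    by (intro vars_le_sum vars_le_single keys')
  moreover have "deg_le s d (\<Sum>l<p. ?Q l)"
    by (intro deg_le_sum deg_le_single) (use deg i in \<open>simp add: tdeg_add tdeg_single\<close>)
  moreover have "Poly_Mapping.lookup (\<Sum>l<p. ?Q l) \<kappa> = of_nat (Suc (Poly_Mapping.lookup \<kappa> i)) *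
      Poly_Mapping.lookup ?P (\<kappa> + Poly_Mapping.single i 1)" if \<kappa>: "tdeg s \<kappa> = d" for \<kappa>
  proof (cases "\<kappa> + Poly_Mapping.single i 1 = \<nu> + Poly_Mapping.single i p")
    case True
    have "Suc (Poly_Mapping.lookup \<kappa> i) = p"
      using arg_cong[OF True, of "\<lambda>f. Poly_Mapping.lookup f i"] \<nu>i by (simp add: lookup_add)
    then obtain p' where p': "p = Suc p'" "Poly_Mapping.lookup \<kappa> i = p'" by auto
    have \<kappa>eq: "\<kappa> = \<nu> + Poly_Mapping.single i p'"
    proof -
      have "Poly_Mapping.single i p = Poly_Mapping.single i p' + Poly_Mapping.single i (1::nat)"
        by (simp add: single_add[symmetric] p')
      with True show ?thesis by (simp add: add.assoc[symmetric])
    qed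
    \<comment> \<open>For \<open>l = p - 1\<close> the binomial coefficient is \<open>p\<close>, and
      the sign from \<open>(- 1) ^ 1\<close> cancels the outer minus.\<close>
    have "Poly_Mapping.lookup (?Q l) \<kappa> = (if l = p' then c * of_nat p else 0)" if "l < p" for l
    proof (cases "l = p'")
      case True then show ?thesis using p' \<kappa>eq by simp
    next
      case False
      then have "\<nu> + Poly_Mapping.single i l \<noteq> \<kappa>"
        unfolding \<kappa>eq
        by (metis add_left_cancel lookup_single_eq)
      then show ?thesis using False by (simp add: lookup_single when_def)
    qed
    then have "Poly_Mapping.lookup (\<Sum>l<p. ?Q l) \<kappa> = (\<Sum>l<p. if l = p' then c * of_nat p else 0)"
      by (simp add: lookup_sum)
    also have "\<dots> = c * of_nat p" using p' by (simp add: sum.delta)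
    finally show ?thesis using True p' by (simp add: lookup_single)
  next
    case False
    \<comment> \<open>The degree forces \<open>l = p - 1\<close>: \<open>\<kappa>\<close> has total
      degree \<open>d\<close>, while \<open>\<nu>\<close> together with \<open>p\<close> has at most
      \<open>d + 1\<close>.\<close>
    have "\<nu> + Poly_Mapping.single i l \<noteq> \<kappa>" if "l < p" for l
    proof
      assume eq: "\<nu> + Poly_Mapping.single i l = \<kappa>"
      then have "tdeg s \<nu> + l = d" using \<kappa> i by (auto simp: tdeg_add tdeg_single)
      then have "p = l + 1" using deg that by linarith
      then have "\<kappa> + Poly_Mapping.single i 1 = \<nu> + Poly_Mapping.single i p"
        unfolding eq[symmetric] \<open>p = l + 1\<close> single_add by (simp add: add.assoc)
      with False show False by simp
    qed
    then have "Poly_Mapping.lookup (\<Sum>l<p. ?Q l) \<kappa> = 0"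
      by (simp add: lookup_sum lookup_single when_def)
    moreover have "Poly_Mapping.lookup ?P (\<kappa> + Poly_Mapping.single i 1) = 0"
      using False by (simp add: lookup_single when_def)
    ultimately show ?thesis by simp
  qed
  ultimately show ?thesis unfolding is_bdiff_def by blast
qed

text \<open>Both sides of \<open>is_bdiff\<close> are additive, so single monomials suffice; each is
  a power of variable \<open>i\<close> times a monomial free of it.\<close>

lemma backward_difference:
  assumes P: "vars_le s P" "deg_le s (Suc d) P" and i: "i \<le> s"
  shows "\<exists>Q. is_bdiff s i d P Q"
proof -
  have "\<exists>Q. is_bdiff s i d (Poly_Mapping.single \<mu> (Poly_Mapping.lookup P \<mu>)) Q"
    if \<mu>: "\<mu> \<in> Poly_Mapping.keys P" for \<mu>
  proof -
    define p where "p = Poly_Mapping.lookup \<mu> i"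
    define \<nu> where "\<nu> = \<mu> - Poly_Mapping.single i p"
    have eq: "\<mu> = \<nu> + Poly_Mapping.single i p"
      by (rule poly_mapping_eqI) (auto simp: \<nu>_def p_def lookup_add lookup_minus lookup_single when_def)
    have \<nu>i: "Poly_Mapping.lookup \<nu> i = 0" by (simp add: \<nu>_def p_def lookup_minus)
    have "Poly_Mapping.keys \<nu> \<subseteq> Poly_Mapping.keys \<mu>"
      by (auto simp: in_keys_iff \<nu>_def lookup_minus)
    then have keys: "Poly_Mapping.keys \<nu> \<subseteq> {0..s}"
      using P(1) \<mu> unfolding vars_le_def by blast
    have "tdeg s \<mu> \<le> Suc d" using P(2) \<mu> by (auto simp: deg_le_def)
    then have "tdeg s \<nu> + p \<le> Suc d" using i eq by (simp add: tdeg_add tdeg_single)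
    from is_bdiff_monomial[OF i keys \<nu>i this] show ?thesis unfolding eq by blast
  qed
  then obtain G where "\<And>\<mu>. \<mu> \<in> Poly_Mapping.keys P \<Longrightarrow>
      is_bdiff s i d (Poly_Mapping.single \<mu> (Poly_Mapping.lookup P \<mu>)) (G \<mu>)" by metis
  from is_bdiff_sum[of "Poly_Mapping.keys P" s i d
      "\<lambda>\<mu>. Poly_Mapping.single \<mu> (Poly_Mapping.lookup P \<mu>)" G, OF this]
  have "is_bdiff s i d P (sum G (Poly_Mapping.keys P))"
    unfolding poly_mapping_as_sum[of P, symmetric] .
  then show ?thesis by blast
qed

subsection \<open>Uniqueness\<close>

lemma base_digits_inj:
  fixes a b :: "nat \<Rightarrow> nat"
  assumes "(\<Sum>i<m. a i * E ^ i) = (\<Sum>i<m. b i * E ^ i)"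
    and "\<And>i. i < m \<Longrightarrow> a i < E" "\<And>i. i < m \<Longrightarrow> b i < E"
  shows "\<forall>i<m. a i = b i"
  using assms
proof (induction m arbitrary: a b)
  case 0
  then show ?case by simp
next
  case (Suc m)
  have shift: "(\<Sum>i<Suc m. c i * E ^ i) = c 0 + E * (\<Sum>i<m. c (Suc i) * E ^ i)" for c :: "nat \<Rightarrow> nat"
    by (subst sum.lessThan_Suc_shift) (simp add: sum_distrib_left mult_ac)
  have *: "a 0 + E * (\<Sum>i<m. a (Suc i) * E ^ i) = b 0 + E * (\<Sum>i<m. b (Suc i) * E ^ i)"
    using Suc.prems(1) unfolding shift .
  have a0: "a 0 < E" and b0: "b 0 < E" using Suc.prems by auto
  have "a 0 = b 0"
    using arg_cong[OF *, of "\<lambda>x. x mod E"] a0 b0 by simp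
  moreover have "(\<Sum>i<m. a (Suc i) * E ^ i) = (\<Sum>i<m. b (Suc i) * E ^ i)"
    using * \<open>a 0 = b 0\<close> a0 by simp
  then have "\<forall>i<m. a (Suc i) = b (Suc i)"
    by (rule Suc.IH) (use Suc.prems in auto)
  ultimately show ?case by (auto simp: less_Suc_eq_0_disj)
qed

text \<open>Kronecker substitution: variable \<open>i\<close> becomes \<open>t^(E^i)\<close> with
  \<open>E\<close> above every exponent. Uniqueness of base-\<open>E\<close> digits sends distinct
  monomials to distinct powers of \<open>t\<close>, so all coefficients of \<open>P\<close> appear
  in a univariate polynomial with infinitely many roots.\<close>

lemma multipoly_zero:
  assumes P: "vars_le s P"
    and zero: "\<And>n. (\<And>i. i \<le> s \<Longrightarrow> N \<le> n i) \<Longrightarrow> multipoly_eval P n = 0"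
  shows "P = 0"
proof -
  let ?K = "Poly_Mapping.keys P"
  define E where "E = Suc (\<Sum>\<mu>\<in>?K. \<Sum>i\<in>{0..s}. Poly_Mapping.lookup \<mu> i)"
  have E: "Poly_Mapping.lookup \<mu> i < E" if "\<mu> \<in> ?K" "i \<le> s" for \<mu> i
  proof -
    have "Poly_Mapping.lookup \<mu> i \<le> (\<Sum>i\<in>{0..s}. Poly_Mapping.lookup \<mu> i)"
      by (rule member_le_sum) (use that in auto)
    also have "\<dots> \<le> (\<Sum>\<mu>\<in>?K. \<Sum>i\<in>{0..s}. Poly_Mapping.lookup \<mu> i)"
      by (rule member_le_sum[where f = "\<lambda>\<mu>. \<Sum>i\<in>{0..s}. Poly_Mapping.lookup \<mu> i"]) (use that in auto)
    finally show ?thesis by (simp add: E_def)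
  qed
  define \<phi> where "\<phi> \<mu> = (\<Sum>i<Suc s. Poly_Mapping.lookup \<mu> i * E ^ i)" for \<mu> :: "nat \<Rightarrow>\<^sub>0 nat"
  have inj: "inj_on \<phi> ?K"
  proof (rule inj_onI)
    fix \<mu> \<nu> assume \<mu>: "\<mu> \<in> ?K" and \<nu>: "\<nu> \<in> ?K" and eq: "\<phi> \<mu> = \<phi> \<nu>"
    have *: "\<forall>i<Suc s. Poly_Mapping.lookup \<mu> i = Poly_Mapping.lookup \<nu> i"
      by (rule base_digits_inj[where E = E]) (use eq E \<mu> \<nu> in \<open>auto simp: \<phi>_def\<close>)
    show "\<mu> = \<nu>"
    proof (rule poly_mapping_eqI)
      fix i
      show "Poly_Mapping.lookup \<mu> i = Poly_Mapping.lookup \<nu> i"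
      proof (cases "i \<le> s")
        case False
        then have "i \<notin> Poly_Mapping.keys \<mu>" "i \<notin> Poly_Mapping.keys \<nu>"
          using P \<mu> \<nu> unfolding vars_le_def by fastforce+
        then show ?thesis by (simp add: in_keys_iff)
      qed (use * in auto)
    qed
  qed
  define p where "p = (\<Sum>\<mu>\<in>?K. Polynomial.monom (Poly_Mapping.lookup P \<mu>) (\<phi> \<mu>))"
  have eval_p: "poly p (of_nat t) = multipoly_eval P (\<lambda>i. t ^ (E ^ i))" for t :: nat
  proof -
    have "mono_val \<mu> (\<lambda>i. t ^ (E ^ i)) = of_nat t ^ \<phi> \<mu>" if "\<mu> \<in> ?K" for \<mu>
    proof -
      have "Poly_Mapping.keys \<mu> \<subseteq> {..<Suc s}"
        using P that unfolding vars_le_def by fastforce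
      then show ?thesis
        by (subst mono_val_superset[of "{..<Suc s}"])
           (simp_all add: \<phi>_def power_sum power_mult[symmetric] mult_ac del: prod.lessThan_Suc sum.lessThan_Suc)
    qed
    then show ?thesis
      by (simp add: p_def poly_sum poly_monom eval_superset[of ?K])
  qed
  have "p = 0"
  proof (rule ccontr)
    assume "p \<noteq> 0"
    then have "finite {x. poly p x = 0}" by (rule poly_roots_finite)
    moreover have "of_nat ` {t. N \<le> t} \<subseteq> {x. poly p x = 0}"
    proof (clarsimp simp: eval_p)
      fix t assume "N \<le> t"
      show "multipoly_eval P (\<lambda>i. t ^ (E ^ i)) = 0"
      proof (rule zero)
        fix i
        \<comment> \<open>Since \<open>E\<close> is positive, the substituted points reach the
          region where \<open>P\<close> is known to vanish.\<close>
        have "t \<le> t ^ (E ^ i)"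
          by (cases "t = 0") (auto intro!: self_le_power simp: E_def)
        then show "N \<le> t ^ (E ^ i)" using \<open>N \<le> t\<close> by simp
      qed
    qed
    ultimately have "finite (of_nat ` {t. N \<le> t} :: rat set)" by (rule finite_subset[rotated])
    then have "finite {t. N \<le> t}" by (rule finite_imageD) (simp add: inj_on_def)
    then show False using infinite_Ici[of N] by (simp add: atLeast_def)
  qed
  show "P = 0"
  proof (rule ccontr)
    assume "P \<noteq> 0"
    then obtain \<mu> where \<mu>: "\<mu> \<in> ?K" using keys_eq_empty by (metis ex_in_conv poly_mapping_eqI in_keys_iff lookup_zero)
    have "Polynomial.coeff p (\<phi> \<mu>) = (\<Sum>\<nu>\<in>?K. if \<nu> = \<mu> then Poly_Mapping.lookup P \<nu> else 0)"
      unfolding p_def coeff_sum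
      by (intro sum.cong refl) (use inj \<mu> in \<open>auto simp: inj_on_def\<close>)
    also have "\<dots> = Poly_Mapping.lookup P \<mu>" using \<mu> by (simp add: sum.delta')
    finally show False using \<open>p = 0\<close> \<mu> by (simp add: in_keys_iff)
  qed
qed

lemma multipoly_eqI:
  assumes "vars_le s P" "vars_le s Q"
    and "\<And>n. (\<And>i. i \<le> s \<Longrightarrow> N \<le> n i) \<Longrightarrow> multipoly_eval P n = multipoly_eval Q n"
  shows "P = Q"
  using multipoly_zero[of s "P - Q" N] assms by (simp add: vars_le_diff eval_diff)

subsection \<open>Polynomial functions\<close>

text \<open>The closure rules make sums, products and substitutions immediate, which is awkward with
  coefficient maps; \<open>polyfun_imp_multipoly\<close> returns to coefficients.\<close>

inductive polyfun :: "nat \<Rightarrow> ((nat \<Rightarrow> nat) \<Rightarrow> rat) \<Rightarrow> bool" for s where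
  const: "polyfun s (\<lambda>n. c)"
| var: "i \<le> s \<Longrightarrow> polyfun s (\<lambda>n. of_nat (n i))"
| add: "polyfun s f \<Longrightarrow> polyfun s g \<Longrightarrow> polyfun s (\<lambda>n. f n + g n)"
| mult: "polyfun s f \<Longrightarrow> polyfun s g \<Longrightarrow> polyfun s (\<lambda>n. f n * g n)"

lemma polyfun_imp_multipoly:
  assumes "polyfun s f"
  shows "\<exists>P. vars_le s P \<and> multipoly_eval P = f"
  using assms
proof induction
  case (const c)
  show ?case
    by (rule exI[of _ "Poly_Mapping.single 0 c"]) (auto simp: eval_single vars_le_single)
next
  case (var i)
  then show ?case
    by (intro exI[of _ "Poly_Mapping.single (Poly_Mapping.single i 1) 1"])
       (auto simp: eval_single vars_le_single mono_val_single)
next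
  case (add f g)
  then obtain P Q where "vars_le s P" "multipoly_eval P = f" "vars_le s Q" "multipoly_eval Q = g"
    by blast
  then show ?case by (intro exI[of _ "P + Q"]) (auto simp: eval_add vars_le_add)
next
  case (mult f g)
  then obtain P Q where "vars_le s P" "multipoly_eval P = f" "vars_le s Q" "multipoly_eval Q = g"
    by blast
  then show ?case by (intro exI[of _ "P * Q"]) (auto simp: eval_mult vars_le_mult)
qed

lemma polyfun_uminus: "polyfun s f \<Longrightarrow> polyfun s (\<lambda>n. - f n)"
  using polyfun.mult[OF polyfun.const[of s "-1"]] by simp

lemma polyfun_diff: "polyfun s f \<Longrightarrow> polyfun s g \<Longrightarrow> polyfun s (\<lambda>n. f n - g n)"
  using polyfun.add[OF _ polyfun_uminus, of s f g] by simp

lemma polyfun_sum: "(\<And>a. a \<in> A \<Longrightarrow> polyfun s (F a)) \<Longrightarrow> polyfun s (\<lambda>n. \<Sum>a\<in>A. F a n)"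
  by (induction A rule: infinite_finite_induct) (auto intro: polyfun.intros)

lemma polyfun_prod: "(\<And>a. a \<in> A \<Longrightarrow> polyfun s (F a)) \<Longrightarrow> polyfun s (\<lambda>n. \<Prod>a\<in>A. F a n)"
  by (induction A rule: infinite_finite_induct) (auto intro: polyfun.intros)

lemma polyfun_power: "polyfun s f \<Longrightarrow> polyfun s (\<lambda>n. f n ^ p)"
  by (induction p) (auto intro: polyfun.intros)

lemma polyfun_mono_val: "Poly_Mapping.keys \<mu> \<subseteq> {0..s} \<Longrightarrow> polyfun s (mono_val \<mu>)"
  unfolding mono_val_def[abs_def] by (intro polyfun_prod polyfun_power polyfun.var) auto

lemma polyfun_subst:
  assumes "polyfun s f" "\<And>i. i \<le> s \<Longrightarrow> polyfun r (\<lambda>n. of_nat (g n i))"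
  shows "polyfun r (\<lambda>n. f (g n))"
  using assms by induction (auto intro: polyfun.intros)

text \<open>The difference \<open>(x + 1)^(p + 1) - x^(p + 1)\<close> is \<open>(p + 1) x^p\<close>
  plus lower powers, whose antidifferences exist by induction on \<open>p\<close>. The factor
  \<open>h\<close> is independent of coordinate \<open>i\<close> and acts as a constant.\<close>

lemma antidifference_power:
  assumes i: "i \<le> s" and h: "polyfun s h" "\<And>n x. h (n(i := x)) = h n"
  shows "\<exists>F. polyfun s F \<and> (\<forall>n. F (n(i := Suc (n i))) - F n = h n * of_nat (n i) ^ p)"
proof (induction p rule: less_induct)
  case (less p)
  then obtain F where F: "\<And>l. l < p \<Longrightarrow> polyfun s (F l)"
    "\<And>l n. l < p \<Longrightarrow> F l (n(i := Suc (n i))) - F l n = h n * of_nat (n i) ^ l"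
    by metis
  \<comment> \<open>Coefficients of the lower powers in that expansion, divided by
    \<open>p + 1\<close>.\<close>
  define c :: "nat \<Rightarrow> rat" where "c l = of_nat (Suc p choose l) / of_nat (Suc p)" for l
  define G where "G n = h n * of_nat (n i) ^ Suc p * (1 / of_nat (Suc p)) - (\<Sum>l<p. c l * F l n)" for n
  have "polyfun s G"
    unfolding G_def[abs_def]
    by (intro polyfun_diff polyfun_sum polyfun.mult polyfun.const polyfun_power polyfun.var h i F) auto
  moreover have "G (n(i := Suc (n i))) - G n = h n * of_nat (n i) ^ p" for n
  proof -
    let ?x = "of_nat (n i) :: rat"
    have "(?x + 1) ^ Suc p = (\<Sum>l\<le>Suc p. of_nat (Suc p choose l) * ?x ^ l)"
      using binomial_ring[of ?x 1 "Suc p"] by simp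
    also have "\<dots> = (\<Sum>l<p. of_nat (Suc p choose l) * ?x ^ l) + of_nat (Suc p) * ?x ^ p + ?x ^ Suc p"
      by (simp add: lessThan_Suc_atMost[symmetric] del: binomial_Suc_Suc)
    finally have bin: "(?x + 1) ^ Suc p - ?x ^ Suc p
        = (\<Sum>l<p. of_nat (Suc p choose l) * ?x ^ l) + of_nat (Suc p) * ?x ^ p" by simp
    have "G (n(i := Suc (n i))) - G n
        = h n * (((?x + 1) ^ Suc p - ?x ^ Suc p) / of_nat (Suc p))
          - (\<Sum>l<p. c l * (F l (n(i := Suc (n i))) - F l n))"
      unfolding G_def by (simp add: h right_diff_distrib sum_subtractf diff_divide_distrib add.commute
          del: power_Suc of_nat_Suc) (simp add: add.commute)
    also have "(\<Sum>l<p. c l * (F l (n(i := Suc (n i))) - F l n)) = (\<Sum>l<p. c l * (h n * ?x ^ l))"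
      by (rule sum.cong) (auto simp: F)
    also have "((?x + 1) ^ Suc p - ?x ^ Suc p) / of_nat (Suc p) = (\<Sum>l<p. c l * ?x ^ l) + ?x ^ p"
      unfolding bin c_def by (simp add: add_divide_distrib sum_divide_distrib del: of_nat_Suc binomial_Suc_Suc)
    also have "h n * ((\<Sum>l<p. c l * ?x ^ l) + ?x ^ p) - (\<Sum>l<p. c l * (h n * ?x ^ l)) = h n * ?x ^ p"
      by (simp add: distrib_left sum_distrib_left mult_ac)
    finally show ?thesis .
  qed
  ultimately show ?case by blast
qed

lemma antidifference:
  assumes i: "i \<le> s" and g: "polyfun s g"
  shows "\<exists>F. polyfun s F \<and> (\<forall>n. F (n(i := Suc (n i))) - F n = g n)"
proof -
  obtain P where P: "vars_le s P" "multipoly_eval P = g" using polyfun_imp_multipoly[OF g] by blast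
  have "\<exists>F. polyfun s F \<and> (\<forall>n. F (n(i := Suc (n i))) - F n = mono_val \<mu> n)"
    if \<mu>: "\<mu> \<in> Poly_Mapping.keys P" for \<mu>
  proof -
    define p where "p = Poly_Mapping.lookup \<mu> i"
    define \<nu> where "\<nu> = \<mu> - Poly_Mapping.single i p"
    have eq: "\<mu> = \<nu> + Poly_Mapping.single i p"
      by (rule poly_mapping_eqI) (auto simp: \<nu>_def p_def lookup_add lookup_minus lookup_single when_def)
    have "i \<notin> Poly_Mapping.keys \<nu>" by (simp add: \<nu>_def p_def lookup_minus in_keys_iff)
    then have "mono_val \<nu> (n(i := x)) = mono_val \<nu> n" for n x
      by (intro mono_val_cong) auto
    moreover have "Poly_Mapping.keys \<nu> \<subseteq> Poly_Mapping.keys \<mu>"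
      by (auto simp: in_keys_iff \<nu>_def lookup_minus)
    then have "polyfun s (mono_val \<nu>)"
      using P(1) \<mu> unfolding vars_le_def by (intro polyfun_mono_val) blast
    ultimately show ?thesis
      using antidifference_power[OF i, of "mono_val \<nu>" p] by (simp add: eq mono_val_add mono_val_single)
  qed
  then obtain F where F: "\<And>\<mu>. \<mu> \<in> Poly_Mapping.keys P \<Longrightarrow> polyfun s (F \<mu>)"
     "\<And>\<mu> n. \<mu> \<in> Poly_Mapping.keys P \<Longrightarrow> F \<mu> (n(i := Suc (n i))) - F \<mu> n = mono_val \<mu> n"
    by metis
  let ?G = "\<lambda>n. \<Sum>\<mu>\<in>Poly_Mapping.keys P. Poly_Mapping.lookup P \<mu> * F \<mu> n"
  have "polyfun s ?G" by (intro polyfun_sum polyfun.mult polyfun.const F)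
  moreover have "?G (n(i := Suc (n i))) - ?G n = g n" for n
    unfolding P(2)[symmetric] eval_superset[OF finite_keys order_refl] sum_subtractf[symmetric]
    by (rule sum.cong) (auto simp: F right_diff_distrib[symmetric])
  ultimately show ?thesis by blast
qed

section \<open>Functions that are eventually polynomial\<close>

definition ev_polyfun :: "nat \<Rightarrow> ((nat \<Rightarrow> nat) \<Rightarrow> rat) \<Rightarrow> bool" where
  "ev_polyfun s f \<longleftrightarrow> (\<exists>g. polyfun s g \<and> for_large s (\<lambda>n. f n = g n))"

lemma for_large_mono: "for_large s P \<Longrightarrow> (\<And>n. P n \<Longrightarrow> Q n) \<Longrightarrow> for_large s Q"
  unfolding for_large_def by blast

lemma for_large_conj: "for_large s P \<Longrightarrow> for_large s Q \<Longrightarrow> for_large s (\<lambda>n. P n \<and> Q n)"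
  unfolding for_large_def
proof (elim exE)
  fix M N assume "\<forall>n. (\<forall>j\<le>s. M \<le> n j) \<longrightarrow> P n" "\<forall>n. (\<forall>j\<le>s. N \<le> n j) \<longrightarrow> Q n"
  then show "\<exists>N. \<forall>n. (\<forall>j\<le>s. N \<le> n j) \<longrightarrow> P n \<and> Q n"
    by (intro exI[of _ "max M N"]) auto
qed

lemma for_large_True: "(\<And>n. P n) \<Longrightarrow> for_large s P"
  by (auto simp: for_large_def)

lemma for_large_Ball:
  "finite A \<Longrightarrow> (\<And>a. a \<in> A \<Longrightarrow> for_large s (P a)) \<Longrightarrow> for_large s (\<lambda>n. \<forall>a\<in>A. P a n)"
proof (induction A rule: finite_induct)
  case empty
  then show ?case by (intro for_large_True) simp
next
  case (insert a A)
  then have "for_large s (\<lambda>n. P a n \<and> (\<forall>a\<in>A. P a n))" by (intro for_large_conj) auto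
  then show ?case by simp
qed

lemma ev_polyfun_diff:
  assumes "ev_polyfun s f" "ev_polyfun s g"
  shows "ev_polyfun s (\<lambda>n. f n - g n)"
proof -
  obtain f' g' where f': "polyfun s f'" "for_large s (\<lambda>n. f n = f' n)"
    and g': "polyfun s g'" "for_large s (\<lambda>n. g n = g' n)"
    using assms unfolding ev_polyfun_def by blast
  have "for_large s (\<lambda>n. f n - g n = f' n - g' n)"
    by (rule for_large_mono[OF for_large_conj[OF f'(2) g'(2)]]) auto
  then show ?thesis unfolding ev_polyfun_def using polyfun_diff[OF f'(1) g'(1)] by blast
qed

text \<open>Start at the corner \<open>(N, ..., N)\<close>, beyond which all difference formulas
  hold, and move to \<open>n\<close> one coordinate at a time. Along direction \<open>j\<close> the
  change of \<open>f\<close> telescopes to the change of an antidifference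
  \<open>G j\<close>.\<close>

lemma ev_polyfun_of_differences:
  assumes dep: "\<And>n n'. (\<And>i. i \<le> s \<Longrightarrow> n i = n' i) \<Longrightarrow> f n = f n'"
    and diff: "\<And>i. i \<le> s \<Longrightarrow> ev_polyfun s (\<lambda>n. f (n(i := Suc (n i))) - f n)"
  shows "ev_polyfun s f"
proof -
  have "\<forall>i. \<exists>g. i \<le> s \<longrightarrow> polyfun s g \<and> for_large s (\<lambda>n. f (n(i := Suc (n i))) - f n = g n)"
    using diff unfolding ev_polyfun_def by blast
  from choice[OF this] obtain g where g: "\<And>i. i \<le> s \<Longrightarrow> polyfun s (g i)"
    "\<And>i. i \<le> s \<Longrightarrow> for_large s (\<lambda>n. f (n(i := Suc (n i))) - f n = g i n)"
    by blast
  have "for_large s (\<lambda>n. \<forall>i\<in>{..s}. f (n(i := Suc (n i))) - f n = g i n)"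
    by (rule for_large_Ball) (use g in auto)
  then obtain N where N: "\<And>n i. \<forall>j\<le>s. N \<le> n j \<Longrightarrow> i \<le> s \<Longrightarrow> f (n(i := Suc (n i))) - f n = g i n"
    unfolding for_large_def by auto
  have "\<forall>i. \<exists>G. i \<le> s \<longrightarrow> polyfun s G \<and> (\<forall>n. G (n(i := Suc (n i))) - G n = g i n)"
  proof
    fix i
    show "\<exists>G. i \<le> s \<longrightarrow> polyfun s G \<and> (\<forall>n. G (n(i := Suc (n i))) - G n = g i n)"
      using antidifference[of i s "g i"] g(1)[of i] by (cases "i \<le> s") auto
  qed
  from choice[OF this] obtain G where G: "\<And>i. i \<le> s \<Longrightarrow> polyfun s (G i)"
    "\<And>i n. i \<le> s \<Longrightarrow> G i (n(i := Suc (n i))) - G i n = g i n"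
    by blast
  \<comment> \<open>Coordinates before \<open>j\<close> have their final value, the others still sit
    at \<open>N\<close>. At \<open>j = Suc s\<close> this agrees with \<open>n\<close> up to
    coordinate \<open>s\<close>, which is enough by \<open>dep\<close>.\<close>
  define cut where "cut j n = (\<lambda>i. if i < j then n i else N)" for j and n :: "nat \<Rightarrow> nat"
  have "\<exists>h. polyfun s h \<and> (\<forall>n. (\<forall>j\<le>s. N \<le> n j) \<longrightarrow> f (cut j n) = h n)" if "j \<le> Suc s" for j
    using that
  proof (induction j)
    case 0
    show ?case by (rule exI[of _ "\<lambda>n. f (\<lambda>i. N)"]) (auto simp: cut_def intro: polyfun.const)
  next
    case (Suc j)
    then obtain h where h: "polyfun s h" "\<And>n. \<forall>j\<le>s. N \<le> n j \<Longrightarrow> f (cut j n) = h n"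
      using Suc_leD by blast
    have j: "j \<le> s" using Suc.prems by simp
    have cut: "polyfun s (\<lambda>n. G j (cut m n))" for m
    proof (rule polyfun_subst[OF G(1)[OF j]])
      show "polyfun s (\<lambda>n. of_nat (cut m n i))" if "i \<le> s" for i
        using that by (cases "i < m") (simp_all add: cut_def polyfun.var polyfun.const)
    qed
    have tele: "f ((cut j n)(j := N + k)) - f (cut j n)
        = G j ((cut j n)(j := N + k)) - G j (cut j n)" if "\<forall>j\<le>s. N \<le> n j" for n k
    proof (induction k)
      case 0
      have "(cut j n)(j := N) = cut j n" by (auto simp: cut_def)
      then show ?case by simp
    next
      case (Suc k)
      define m where "m = (cut j n)(j := N + k)"
      have m: "m(j := Suc (m j)) = (cut j n)(j := N + Suc k)" by (simp add: m_def)
      have "\<forall>j\<le>s. N \<le> m j" using that by (auto simp: cut_def m_def)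
      from N[OF this j] G(2)[OF j, of m] Suc.IH[folded m_def] show ?case
        unfolding m by linarith
    qed
    have cutS: "cut (Suc j) n = (cut j n)(j := N + (n j - N))" if "\<forall>j\<le>s. N \<le> n j" for n
      using that j by (auto simp: cut_def fun_eq_iff less_Suc_eq)
    show ?case
    proof (intro exI conjI allI impI)
      show "polyfun s (\<lambda>n. h n + (G j (cut (Suc j) n) - G j (cut j n)))"
        by (intro polyfun.add polyfun_diff h cut)
    next
      fix n assume n: "\<forall>j\<le>s. N \<le> n j"
      show "f (cut (Suc j) n) = h n + (G j (cut (Suc j) n) - G j (cut j n))"
        using tele[OF n, of "n j - N"] h(2)[OF n] unfolding cutS[OF n, symmetric] by simp
    qed
  qed
  from this[OF order_refl] obtain h
    where h: "polyfun s h" "\<And>n. \<forall>j\<le>s. N \<le> n j \<Longrightarrow> f (cut (Suc s) n) = h n"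
    by blast
  have "f (cut (Suc s) n) = f n" for n by (rule dep) (auto simp: cut_def)
  with h have "for_large s (\<lambda>n. f n = h n)" unfolding for_large_def by metis
  with h(1) show ?thesis unfolding ev_polyfun_def by blast
qed

subsection \<open>Growth\<close>

text \<open>If the degree \<open>d\<close> were at least \<open>q\<close>, the sum over
  \<open>T \<le> t < 2T\<close> alone would be at least a constant times \<open>T^(d + 1)\<close>,
  too much for \<open>C (2T)^q\<close>.\<close>

lemma degree_less_of_sum_bound:
  fixes p :: "real poly"
  assumes p0: "p \<noteq> 0" and nonneg: "\<And>t. t0 \<le> t \<Longrightarrow> 0 \<le> poly p (real t)"
    and bound: "\<And>T. (\<Sum>t\<in>{t0..<T}. poly p (real t)) \<le> C * real T ^ q"
  shows "Polynomial.degree p < q"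
proof (rule ccontr)
  assume "\<not> Polynomial.degree p < q"
  then have q: "q \<le> Polynomial.degree p" by simp
  let ?d = "Polynomial.degree p"
  have lc: "0 < Polynomial.lead_coeff p"
  proof (rule ccontr)
    assume "\<not> 0 < Polynomial.lead_coeff p"
    then have "0 < Polynomial.lead_coeff (- p)" using p0 by (simp add: leading_coeff_0_iff less_le)
    from poly_pinfty_gt_lc[OF this] obtain x where "\<And>y. x \<le> y \<Longrightarrow> poly (- p) y \<ge> Polynomial.lead_coeff (- p)"
      by blast
    with nonneg[of "max t0 (nat \<lceil>x\<rceil>)"] \<open>0 < Polynomial.lead_coeff (- p)\<close> show False
      by (smt (verit) max.cobounded1 max.cobounded2 of_nat_ceiling of_nat_le_iff poly_minus)
  qed
  \<comment> \<open>Half the leading coefficient: after subtracting \<open>\<alpha> x^d\<close> the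
    leading coefficient is still positive, which gives the lower bound \<open>low\<close>.\<close>
  define \<alpha> where "\<alpha> = Polynomial.lead_coeff p / 2"
  define r where "r = p - Polynomial.monom \<alpha> ?d"
  have "\<alpha> > 0" using lc by (simp add: \<alpha>_def)
  have cr: "Polynomial.coeff r ?d = \<alpha>" by (simp add: r_def \<alpha>_def)
  have "Polynomial.degree r \<le> ?d"
    unfolding r_def by (intro degree_diff_le) (auto simp: degree_monom_le)
  moreover have "?d \<le> Polynomial.degree r" by (rule le_degree) (use cr \<open>\<alpha> > 0\<close> in simp)
  ultimately have "Polynomial.lead_coeff r = \<alpha>" using cr by simp
  with poly_pinfty_gt_lc[of r] \<open>\<alpha> > 0\<close> obtain x where x: "\<And>y. x \<le> y \<Longrightarrow> poly r y \<ge> \<alpha>" by auto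
  have low: "\<alpha> * y ^ ?d \<le> poly p y" if "x \<le> y" for y
    using x[OF that] \<open>\<alpha> > 0\<close> by (simp add: r_def poly_monom)
  \<comment> \<open>Past \<open>t0\<close> and the threshold of \<open>low\<close>, and so large
    that \<open>\<alpha> T > C 2^q\<close>.\<close>
  define T where "T = Max {1, t0, nat \<lceil>x\<rceil>, nat \<lceil>C * 2 ^ q / \<alpha>\<rceil> + 1}"
  have T: "1 \<le> T" "t0 \<le> T" "nat \<lceil>x\<rceil> \<le> T" "nat \<lceil>C * 2 ^ q / \<alpha>\<rceil> + 1 \<le> T"
    unfolding T_def by (intro Max_ge; simp)+
  have xT: "x \<le> real t" if "T \<le> t" for t
    using T(3) that by (meson le_trans of_nat_ceiling of_nat_le_iff order_trans)
  have "\<alpha> * real T ^ Suc ?d = (\<Sum>t\<in>{T..<2*T}. \<alpha> * real T ^ ?d)" by simp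
  also have "\<dots> \<le> (\<Sum>t\<in>{T..<2*T}. poly p (real t))"
  proof (rule sum_mono)
    fix t assume "t \<in> {T..<2*T}"
    then have t: "T \<le> t" by simp
    have "\<alpha> * real T ^ ?d \<le> \<alpha> * real t ^ ?d"
      using t \<open>\<alpha> > 0\<close> by (intro mult_left_mono power_mono) auto
    also have "\<dots> \<le> poly p (real t)" by (rule low[OF xT[OF t]])
    finally show "\<alpha> * real T ^ ?d \<le> poly p (real t)" .
  qed
  also have "\<dots> \<le> (\<Sum>t\<in>{t0..<2*T}. poly p (real t))"
    by (rule sum_mono2) (use T nonneg in auto)
  also have "\<dots> \<le> C * real (2 * T) ^ q" by (rule bound)
  also have "\<dots> = C * 2 ^ q * real T ^ q" by (simp add: power_mult_distrib)
  finally have "\<alpha> * real T ^ Suc ?d \<le> C * 2 ^ q * real T ^ q" .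
  moreover have "\<alpha> * (real T * real T ^ q) \<le> \<alpha> * real T ^ Suc ?d"
    using T(1) q \<open>\<alpha> > 0\<close> by (simp add: power_increasing)
  ultimately have "(\<alpha> * real T) * real T ^ q \<le> (C * 2 ^ q) * real T ^ q"
    by (simp add: mult_ac)
  then have "\<alpha> * real T \<le> C * 2 ^ q" using T(1) by simp
  then have "real T \<le> C * 2 ^ q / \<alpha>" using \<open>\<alpha> > 0\<close> by (simp add: field_simps)
  with T(4) show False by linarith
qed

text \<open>Restriction to a ray turns the total degree into the degree of a univariate polynomial,
  provided that the form of top degree does not vanish at the direction \<open>c\<close> of the
  ray.\<close>

lemma tdeg_less_of_sum_bound:
  assumes P: "vars_le s P"
    and nonneg: "for_large s (\<lambda>n. 0 \<le> multipoly_eval P n)"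
    and bound: "\<And>c. (\<And>i. i \<le> s \<Longrightarrow> 1 \<le> c i) \<Longrightarrow> \<exists>t0 C. \<forall>T.
      (\<Sum>t\<in>{t0..<T}. multipoly_eval P (\<lambda>i. t * c i)) \<le> of_nat C * of_nat T ^ q"
    and \<mu>: "\<mu> \<in> Poly_Mapping.keys P"
  shows "tdeg s \<mu> < q"
proof -
  let ?K = "Poly_Mapping.keys P"
  define d where "d = Max (tdeg s ` ?K)"
  have d_max: "tdeg s \<nu> \<le> d" if "\<nu> \<in> ?K" for \<nu>
    unfolding d_def using that by (intro Max_ge) auto
  have "d \<in> tdeg s ` ?K" unfolding d_def using \<mu> by (intro Max_in) auto
  then obtain \<nu> where \<nu>: "\<nu> \<in> ?K" "tdeg s \<nu> = d" by blast
  define K where "K = {\<nu> \<in> ?K. tdeg s \<nu> = d}"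
  \<comment> \<open>The homogeneous part of top degree \<open>d\<close>; its value at
    \<open>c\<close> is the coefficient of \<open>t^d\<close> on the ray, and
    \<open>multipoly_zero\<close> supplies a positive \<open>c\<close> at which it is
    nonzero.\<close>
  define L where "L = (\<Sum>\<nu>\<in>K. Poly_Mapping.single \<nu> (Poly_Mapping.lookup P \<nu>))"
  have "finite K" by (simp add: K_def)
  have "Poly_Mapping.lookup L \<nu> = Poly_Mapping.lookup P \<nu>"
    using \<nu> \<open>finite K\<close> by (simp add: L_def lookup_sum lookup_single when_def sum.delta' K_def)
  then have "L \<noteq> 0" using \<nu> by (auto simp: in_keys_iff)
  have "vars_le s L"
    unfolding L_def using P by (intro vars_le_sum vars_le_single) (auto simp: K_def vars_le_def)
  with \<open>L \<noteq> 0\<close> multipoly_zero[of s L 1] obtain c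
    where c: "\<And>i. i \<le> s \<Longrightarrow> 1 \<le> c i" "multipoly_eval L c \<noteq> 0"
    by metis
  obtain t0 C where C: "\<And>T. (\<Sum>t\<in>{t0..<T}. multipoly_eval P (\<lambda>i. t * c i)) \<le> of_nat C * of_nat T ^ q"
    using bound[of c] c by blast
  obtain N where N: "\<And>n. \<forall>j\<le>s. N \<le> n j \<Longrightarrow> 0 \<le> multipoly_eval P n"
    using nonneg unfolding for_large_def by blast
  define p :: "real poly" where
    "p = (\<Sum>\<nu>\<in>?K. Polynomial.monom (of_rat (Poly_Mapping.lookup P \<nu> * mono_val \<nu> c)) (tdeg s \<nu>))"
  have scale: "mono_val \<nu> (\<lambda>i. t * c i) = of_nat t ^ tdeg s \<nu> * mono_val \<nu> c" if "\<nu> \<in> ?K" for \<nu> t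
  proof -
    have "Poly_Mapping.keys \<nu> \<subseteq> {0..s}" using P that by (auto simp: vars_le_def)
    then show ?thesis
      by (simp add: mono_val_superset[of "{0..s}"] tdeg_def power_mult_distrib prod.distrib power_sum)
  qed
  have eval: "poly p (real t) = of_rat (multipoly_eval P (\<lambda>i. t * c i))" for t
    unfolding p_def eval_superset[OF finite_keys order_refl] of_rat_sum poly_sum poly_monom
    by (rule sum.cong) (auto simp: scale of_rat_mult of_rat_power mult_ac)
  have "Polynomial.coeff p d = (\<Sum>\<nu>\<in>?K. if tdeg s \<nu> = d then of_rat (Poly_Mapping.lookup P \<nu> * mono_val \<nu> c) else 0)"
    unfolding p_def coeff_sum by (rule sum.cong) auto
  also have "\<dots> = (\<Sum>\<nu>\<in>K. of_rat (Poly_Mapping.lookup P \<nu> * mono_val \<nu> c))"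
    unfolding K_def by (rule sum.inter_filter[symmetric]) simp
  also have "\<dots> = of_rat (multipoly_eval L c)"
    by (simp add: L_def eval_sum eval_single of_rat_sum)
  finally have "Polynomial.coeff p d \<noteq> 0" using c(2) by simp
  then have "p \<noteq> 0" "d \<le> Polynomial.degree p" by (auto intro: le_degree)
  have nn: "0 \<le> poly p (real t)" if "N \<le> t" for t
  proof -
    have "N \<le> t * c j" if "j \<le> s" for j
      using mult_le_mono[OF \<open>N \<le> t\<close> c(1)[OF that]] by simp
    then show ?thesis unfolding eval by (simp add: N)
  qed
  \<comment> \<open>Nonnegativity is known from \<open>N\<close> on, so the sum starts at
    \<open>max N t0\<close>; the omitted finite part may be negative, and its absolute value
    enlarges the constant.\<close>
  have "Polynomial.degree p < q"
  proof (rule degree_less_of_sum_bound[where ?t0.0 = "max N t0" and C = "real C + \<bar>\<Sum>t\<in>{t0..<max N t0}. poly p (real t)\<bar>"])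
    fix T
    show "(\<Sum>t\<in>{max N t0..<T}. poly p (real t)) \<le> (real C + \<bar>\<Sum>t\<in>{t0..<max N t0}. poly p (real t)\<bar>) * real T ^ q"
    proof (cases "max N t0 < T")
      case True
      have "(\<Sum>t\<in>{t0..<T}. poly p (real t)) \<le> of_rat (of_nat C * of_nat T ^ q)"
        unfolding eval of_rat_sum[symmetric] of_rat_less_eq by (rule C)
      then have "(\<Sum>t\<in>{t0..<T}. poly p (real t)) \<le> real C * real T ^ q"
        by (simp add: of_rat_mult of_rat_power)
      moreover have "(\<Sum>t\<in>{t0..<T}. poly p (real t))
          = (\<Sum>t\<in>{t0..<max N t0}. poly p (real t)) + (\<Sum>t\<in>{max N t0..<T}. poly p (real t))"
        using True by (subst sum.atLeastLessThan_concat) auto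
      moreover have "\<bar>\<Sum>t\<in>{t0..<max N t0}. poly p (real t)\<bar> * 1
          \<le> \<bar>\<Sum>t\<in>{t0..<max N t0}. poly p (real t)\<bar> * real T ^ q"
        using True by (intro mult_left_mono one_le_power) auto
      ultimately show ?thesis by (simp add: distrib_right abs_if split: if_splits)
    next
      case False
      then have "{max N t0..<T} = {}" by auto
      then show ?thesis by (simp only: sum.empty) (intro mult_nonneg_nonneg; simp)
    qed
  qed (use nn \<open>p \<noteq> 0\<close> in auto)
  then show ?thesis using d_max[OF \<mu>] \<open>d \<le> _\<close> by linarith
qed

section \<open>Lengths of intervals of ideals\<close>

text \<open>A nonempty bounded set of extended naturals attains its supremum, so the two suprema are
  themselves an instance of the assumed bound.\<close>

lemma enat_Sup_add_le:
  fixes L :: enat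
  assumes "S \<noteq> {}" "T \<noteq> {}" "\<And>s t. s \<in> S \<Longrightarrow> t \<in> T \<Longrightarrow> s + t \<le> L"
  shows "Sup S + Sup T \<le> L"
proof (cases L)
  case (enat x)
  have attained: "Sup U \<in> U" if "U \<noteq> {}" "\<And>u. u \<in> U \<Longrightarrow> u \<le> enat x" for U
  proof -
    have "finite U" by (rule finite_enat_bounded) (use that in auto)
    then show ?thesis using that(1) by (simp add: Sup_enat_def)
  qed
  obtain s0 t0 where "s0 \<in> S" "t0 \<in> T" using assms by blast
  have "s \<le> enat x" if "s \<in> S" for s
    using assms(3)[OF that \<open>t0 \<in> T\<close>] enat by (metis le_iff_add order_trans)
  moreover have "t \<le> enat x" if "t \<in> T" for t
    using assms(3)[OF \<open>s0 \<in> S\<close> that] enat by (metis le_iff_add add.commute order_trans)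
  ultimately show ?thesis using assms(1,2) by (intro assms(3) attained) auto
qed simp

section \<open>Sums, intersections and multiples of ideals\<close>

context cring
begin

lemma add_minus_cancel_left: "b \<in> carrier R \<Longrightarrow> c \<in> carrier R \<Longrightarrow> (b \<oplus> c) \<ominus> b = c"
  by (simp add: a_minus_def a_comm[of b c] a_assoc r_neg)

lemma add_minus_cancel_right: "b \<in> carrier R \<Longrightarrow> c \<in> carrier R \<Longrightarrow> (b \<oplus> c) \<ominus> c = b"
  by (simp add: a_minus_def a_assoc r_neg)

lemma minus_add_cancel: "b \<in> carrier R \<Longrightarrow> c \<in> carrier R \<Longrightarrow> (b \<ominus> c) \<oplus> c = b"
  by (simp add: a_minus_def a_assoc l_neg)

lemma mult_minus_distrib:
  "x \<in> carrier R \<Longrightarrow> b \<in> carrier R \<Longrightarrow> c \<in> carrier R \<Longrightarrow> x \<otimes> (b \<ominus> c) = x \<otimes> b \<ominus> x \<otimes> c"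
  by (simp add: a_minus_def r_distr r_minus)

lemma ideal_carr: "ideal A R \<Longrightarrow> a \<in> A \<Longrightarrow> a \<in> carrier R"
  by (rule ideal.Icarr)

lemma ideal_subset: "ideal A R \<Longrightarrow> A \<subseteq> carrier R"
  by (auto intro: ideal_carr)

lemma ideal_0: "ideal A R \<Longrightarrow> \<zero> \<in> A"
  by (simp add: additive_subgroup.zero_closed ideal.axioms(1))

lemma ideal_add: "ideal A R \<Longrightarrow> a \<in> A \<Longrightarrow> b \<in> A \<Longrightarrow> a \<oplus> b \<in> A"
  by (simp add: additive_subgroup.a_closed ideal.axioms(1))

lemma ideal_neg: "ideal A R \<Longrightarrow> a \<in> A \<Longrightarrow> \<ominus> a \<in> A"
  by (simp add: additive_subgroup.a_inv_closed ideal.axioms(1))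

lemma ideal_minus: "ideal A R \<Longrightarrow> a \<in> A \<Longrightarrow> b \<in> A \<Longrightarrow> a \<ominus> b \<in> A"
  by (simp add: a_minus_def ideal_add ideal_neg)

lemma ideal_lmult: "ideal A R \<Longrightarrow> a \<in> A \<Longrightarrow> r \<in> carrier R \<Longrightarrow> r \<otimes> a \<in> A"
  by (rule ideal.I_l_closed)

lemma ideal_rmult: "ideal A R \<Longrightarrow> a \<in> A \<Longrightarrow> r \<in> carrier R \<Longrightarrow> a \<otimes> r \<in> A"
  by (rule ideal.I_r_closed)

lemma idealI_mult:
  assumes "A \<subseteq> carrier R" "\<zero> \<in> A" "\<And>a b. a \<in> A \<Longrightarrow> b \<in> A \<Longrightarrow> a \<oplus> b \<in> A"
    "\<And>r a. r \<in> carrier R \<Longrightarrow> a \<in> A \<Longrightarrow> r \<otimes> a \<in> A"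
  shows "ideal A R"
proof (rule idealI)
  show "ring R" by (rule ring_axioms)
  have neg: "\<ominus> a \<in> A" if "a \<in> A" for a
    using assms(4)[of "\<ominus> \<one>" a] that assms(1) l_minus[of \<one> a] by auto
  show "subgroup A (add_monoid R)"
    by (rule add.subgroupI) (use assms neg in \<open>auto simp: a_inv_def[symmetric]\<close>)
  show "x \<otimes> a \<in> A" if "a \<in> A" "x \<in> carrier R" for a x using assms(4) that by blast
  show "a \<otimes> x \<in> A" if "a \<in> A" "x \<in> carrier R" for a x
    using assms(4)[of x a] that assms(1) m_comm[of a x] by auto
qed

lemma isum_mem: "x \<in> A <+> B \<longleftrightarrow> (\<exists>a\<in>A. \<exists>b\<in>B. x = a \<oplus> b)"
  by (auto simp: set_add_def')

lemma isum_ideal: "ideal A R \<Longrightarrow> ideal B R \<Longrightarrow> ideal (A <+> B) R"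
  by (rule add_ideals)

lemma isum_upper1:
  assumes A: "ideal A R" and B: "ideal B R" shows "A \<subseteq> A <+> B"
proof
  fix a assume "a \<in> A"
  moreover have "a \<oplus> \<zero> = a" using \<open>a \<in> A\<close> A by (simp add: ideal_carr)
  ultimately show "a \<in> A <+> B" unfolding isum_mem using ideal_0[OF B] by metis
qed

lemma isum_comm: "ideal A R \<Longrightarrow> ideal B R \<Longrightarrow> A <+> B = B <+> A"
  by (rule set_add_comm[OF ideal_subset ideal_subset])

lemma isum_upper2: "ideal A R \<Longrightarrow> ideal B R \<Longrightarrow> B \<subseteq> A <+> B"
  using isum_upper1[of B A] by (simp only: isum_comm[of A B])

lemma isum_least: "ideal C R \<Longrightarrow> A \<subseteq> C \<Longrightarrow> B \<subseteq> C \<Longrightarrow> A <+> B \<subseteq> C"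
  by (auto simp: isum_mem intro!: ideal_add)

lemma isum_le_iff: "ideal A R \<Longrightarrow> ideal B R \<Longrightarrow> ideal C R \<Longrightarrow> A <+> B \<subseteq> C \<longleftrightarrow> A \<subseteq> C \<and> B \<subseteq> C"
  using isum_upper1[of A B] isum_upper2[of A B] isum_least[of C A B] by blast

lemma isum_mono: "A \<subseteq> A' \<Longrightarrow> B \<subseteq> B' \<Longrightarrow> A <+> B \<subseteq> A' <+> B'"
  unfolding set_add_def' by blast

lemma isum_absorb: "ideal A R \<Longrightarrow> ideal B R \<Longrightarrow> B \<subseteq> A \<Longrightarrow> A <+> B = A"
  by (intro subset_antisym isum_least isum_upper1) auto

lemma isum_absorb2: "ideal A R \<Longrightarrow> ideal B R \<Longrightarrow> A \<subseteq> B \<Longrightarrow> A <+> B = B"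
  by (intro subset_antisym isum_least isum_upper2) auto

lemma isum_assoc:
  "ideal A R \<Longrightarrow> ideal B R \<Longrightarrow> ideal C R \<Longrightarrow> (A <+> B) <+> C = A <+> (B <+> C)"
  by (simp add: add.set_mult_assoc[folded set_add_def] ideal_subset)

lemma modular_law:
  assumes A: "ideal A R" and B: "ideal B R" and C: "ideal C R" and "B \<subseteq> A"
  shows "A \<inter> (B <+> C) \<subseteq> B <+> (A \<inter> C)"
proof
  fix x assume "x \<in> A \<inter> (B <+> C)"
  then obtain b c where bc: "x \<in> A" "b \<in> B" "c \<in> C" "x = b \<oplus> c" by (auto simp: isum_mem)
  have "x \<ominus> b = c"
    unfolding bc(4) by (rule add_minus_cancel_left) (use bc B C in \<open>auto intro: ideal_carr\<close>)
  then have "c \<in> A" using bc \<open>B \<subseteq> A\<close> ideal_minus[OF A, of x b] by auto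
  then show "x \<in> B <+> (A \<inter> C)" using bc by (auto simp: isum_mem)
qed

lemma inter_ideal: "ideal A R \<Longrightarrow> ideal B R \<Longrightarrow> ideal (A \<inter> B) R"
  by (rule i_intersect)

definition scale :: "'a \<Rightarrow> 'a set \<Rightarrow> 'a set" where
  "scale x A = (\<lambda>a. x \<otimes> a) ` A"

text \<open>This is \<open>(V : x) \<inter> U\<close>, the kernel of multiplication by
  \<open>x\<close> from \<open>U\<close> to \<open>R / V\<close>.\<close>

definition preimage :: "'a \<Rightarrow> 'a set \<Rightarrow> 'a set \<Rightarrow> 'a set" where
  "preimage x V U = {u \<in> U. x \<otimes> u \<in> V}"

lemma scale_ideal:
  assumes "x \<in> carrier R" "ideal A R"
  shows "ideal (scale x A) R"
proof (rule idealI_mult)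
  show "scale x A \<subseteq> carrier R" using assms by (auto simp: scale_def ideal_carr)
  show "\<zero> \<in> scale x A"
    unfolding scale_def by (rule image_eqI[of _ _ \<zero>]) (use assms in \<open>auto simp: ideal_0\<close>)
  show "a \<oplus> b \<in> scale x A" if ab: "a \<in> scale x A" "b \<in> scale x A" for a b
  proof -
    obtain a' b' where "a' \<in> A" "b' \<in> A" "a = x \<otimes> a'" "b = x \<otimes> b'"
      using ab unfolding scale_def by blast
    then show ?thesis
      using assms unfolding scale_def
      by (intro image_eqI[of _ _ "a' \<oplus> b'"]) (auto simp: r_distr ideal_carr ideal_add)
  qed
  show "r \<otimes> a \<in> scale x A" if ra: "r \<in> carrier R" "a \<in> scale x A" for r a
  proof -
    obtain a' where "a' \<in> A" "a = x \<otimes> a'" using ra unfolding scale_def by blast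
    then show ?thesis
      using assms ra unfolding scale_def
      by (intro image_eqI[of _ _ "r \<otimes> a'"]) (auto simp: m_lcomm ideal_carr ideal_lmult)
  qed
qed

lemma preimage_ideal:
  assumes "x \<in> carrier R" "ideal V R" "ideal U R"
  shows "ideal (preimage x V U) R"
  by (rule idealI_mult)
     (use assms in \<open>auto simp: preimage_def ideal_carr ideal_0 ideal_add ideal_lmult r_distr m_lcomm\<close>)

lemma scale_subset: "x \<in> carrier R \<Longrightarrow> ideal A R \<Longrightarrow> scale x A \<subseteq> A"
  by (auto simp: scale_def ideal_lmult)

lemma scale_mono: "A \<subseteq> B \<Longrightarrow> scale x A \<subseteq> scale x B"
  by (auto simp: scale_def)

lemma scale_carrier: "x \<in> carrier R \<Longrightarrow> scale x (carrier R) = PIdl x"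
  by (auto simp: scale_def cgenideal_def m_comm)

subsection \<open>Chains of ideals\<close>

definition ideal_chain :: "'a set \<Rightarrow> 'a set \<Rightarrow> (nat \<Rightarrow> 'a set) \<Rightarrow> nat \<Rightarrow> bool" where
  "ideal_chain A B H n \<longleftrightarrow> (\<forall>i\<le>n. ideal (H i) R \<and> A \<subseteq> H i \<and> H i \<subseteq> B) \<and> (\<forall>i<n. H i \<subset> H (Suc i))"

text \<open>For \<open>A \<subseteq> B\<close> this is the length of the module
  \<open>B / A\<close>, read off from the ideals between \<open>A\<close> and \<open>B\<close> so
  that no quotient module has to be formed.\<close>

definition ilen :: "'a set \<Rightarrow> 'a set \<Rightarrow> enat" where
  "ilen A B = Sup {enat n | n. \<exists>H. ideal_chain A B H n}"

lemma ideal_chainD: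
  assumes "ideal_chain A B H n"
  shows "i \<le> n \<Longrightarrow> ideal (H i) R" "i \<le> n \<Longrightarrow> A \<subseteq> H i" "i \<le> n \<Longrightarrow> H i \<subseteq> B" "i < n \<Longrightarrow> H i \<subset> H (Suc i)"
  using assms unfolding ideal_chain_def by blast+

lemma ilen_leI: "(\<And>H n. ideal_chain A B H n \<Longrightarrow> enat n \<le> L) \<Longrightarrow> ilen A B \<le> L"
  unfolding ilen_def by (rule Sup_least) blast

lemma ilen_geI: "ideal_chain A B H n \<Longrightarrow> enat n \<le> ilen A B"
  unfolding ilen_def by (rule Sup_upper) blast

lemma ilen_map:
  assumes f: "\<And>H. ideal H R \<Longrightarrow> A \<subseteq> H \<Longrightarrow> H \<subseteq> B \<Longrightarrow> ideal (f H) R \<and> A' \<subseteq> f H \<and> f H \<subseteq> B'"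
    and strict: "\<And>H H'. ideal H R \<Longrightarrow> ideal H' R \<Longrightarrow> A \<subseteq> H \<Longrightarrow> H \<subset> H' \<Longrightarrow> H' \<subseteq> B \<Longrightarrow> f H \<subset> f H'"
  shows "ilen A B \<le> ilen A' B'"
proof (rule ilen_leI)
  fix H n assume H: "ideal_chain A B H n"
  have "ideal_chain A' B' (\<lambda>i. f (H i)) n"
    unfolding ideal_chain_def
  proof (intro conjI allI impI)
    fix i assume "i \<le> n"
    then show "ideal (f (H i)) R" "A' \<subseteq> f (H i)" "f (H i) \<subseteq> B'"
      using H f by (auto simp: ideal_chain_def)
  next
    fix i assume "i < n"
    then show "f (H i) \<subset> f (H (Suc i))"
      using H by (intro strict) (auto simp: ideal_chain_def)
  qed
  then show "enat n \<le> ilen A' B'" by (rule ilen_geI)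
qed

lemma ilen_mono: "A' \<subseteq> A \<Longrightarrow> B \<subseteq> B' \<Longrightarrow> ilen A B \<le> ilen A' B'"
  by (rule ilen_map[where f = "\<lambda>x. x"]) auto

lemma ilen_self [simp]: "ilen A A = 0"
proof -
  have "ilen A A \<le> 0"
  proof (rule ilen_leI)
    fix H n assume H: "ideal_chain A A H n"
    have "n = 0"
    proof (rule ccontr)
      assume "n \<noteq> 0"
      then show False
        using ideal_chainD(2)[OF H, of 0] ideal_chainD(3)[OF H, of 1] ideal_chainD(4)[OF H, of 0] by force
    qed
    then show "enat n \<le> 0" by (simp add: zero_enat_def)
  qed
  then show ?thesis by simp
qed

text \<open>Repetitions are deleted, and the cardinality counts the strict steps that remain. The
  clause on the last member is what lets the induction append the next one.\<close>

lemma strict_chain_of_weak: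
  assumes "\<And>i. i \<le> n \<Longrightarrow> ideal (f i) R \<and> A \<subseteq> f i \<and> f i \<subseteq> B"
    and "\<And>i. i < n \<Longrightarrow> f i \<subseteq> f (Suc i)"
  shows "\<exists>H. ideal_chain A B H (card {i. i < n \<and> f i \<noteq> f (Suc i)})
     \<and> H (card {i. i < n \<and> f i \<noteq> f (Suc i)}) = f n"
  using assms
proof (induction n)
  case 0
  then show ?case by (intro exI[of _ f]) (auto simp: ideal_chain_def)
next
  case (Suc n)
  let ?c = "card {i. i < n \<and> f i \<noteq> f (Suc i)}"
  obtain H where H: "ideal_chain A B H ?c" "H ?c = f n"
    using Suc.IH Suc.prems by force
  show ?case
  proof (cases "f n = f (Suc n)")
    case True
    then have "{i. i < Suc n \<and> f i \<noteq> f (Suc i)} = {i. i < n \<and> f i \<noteq> f (Suc i)}"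
      by (auto simp: less_Suc_eq)
    then show ?thesis using H True by auto
  next
    case False
    then have "{i. i < Suc n \<and> f i \<noteq> f (Suc i)} = insert n {i. i < n \<and> f i \<noteq> f (Suc i)}"
      by (auto simp: less_Suc_eq)
    then have c: "card {i. i < Suc n \<and> f i \<noteq> f (Suc i)} = Suc ?c" by simp
    have "f n \<subset> f (Suc n)" using False Suc.prems(2)[of n] by auto
    then have "ideal_chain A B (H(Suc ?c := f (Suc n))) (Suc ?c)"
      using H Suc.prems(1)[of "Suc n"] unfolding ideal_chain_def
      by (auto simp: le_Suc_eq less_Suc_eq)
    then show ?thesis unfolding c by (intro exI[of _ "H(Suc ?c := f (Suc n))"] conjI fun_upd_same)
  qed
qed

lemma weak_chain_ilen:
  assumes "\<And>i. i \<le> n \<Longrightarrow> ideal (f i) R \<and> A \<subseteq> f i \<and> f i \<subseteq> B"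
    and "\<And>i. i < n \<Longrightarrow> f i \<subseteq> f (Suc i)"
  shows "enat (card {i. i < n \<and> f i \<noteq> f (Suc i)}) \<le> ilen A B"
proof -
  obtain H where "ideal_chain A B H (card {i. i < n \<and> f i \<noteq> f (Suc i)})"
    using strict_chain_of_weak[of n f A B, OF assms] by auto
  then show ?thesis by (rule ilen_geI)
qed

section \<open>Additivity of length and isomorphism theorems\<close>

lemma ilen_add_ge:
  assumes A: "ideal A R" and B: "ideal B R" and C: "ideal C R" and AB: "A \<subseteq> B" and BC: "B \<subseteq> C"
  shows "ilen A B + ilen B C \<le> ilen A C"
  unfolding ilen_def[of A B] ilen_def[of B C]
proof (rule enat_Sup_add_le)
  show "{enat n |n. \<exists>H. ideal_chain A B H n} \<noteq> {}"
    using A AB by (auto simp: ideal_chain_def intro!: exI[of _ 0] exI[of _ "\<lambda>_. A"])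
  show "{enat n |n. \<exists>H. ideal_chain B C H n} \<noteq> {}"
    using B BC by (auto simp: ideal_chain_def intro!: exI[of _ 0] exI[of _ "\<lambda>_. B"])
  fix a b assume "a \<in> {enat n |n. \<exists>H. ideal_chain A B H n}" "b \<in> {enat n |n. \<exists>H. ideal_chain B C H n}"
  then obtain p H q G where ab: "a = enat p" "b = enat q" and H: "ideal_chain A B H p" and G: "ideal_chain B C G q"
    by blast
  \<comment> \<open>At the joint from \<open>p\<close> to \<open>Suc p\<close> there may be
    equality, since \<open>H\<close> ends inside \<open>B\<close> and \<open>G\<close> starts above
    it; the other \<open>p + q\<close> steps stay strict.\<close>
  define f where "f i = (if i \<le> p then H i else G (i - Suc p))" for i
  have "enat (card {i. i < Suc (p + q) \<and> f i \<noteq> f (Suc i)}) \<le> ilen A C"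
  proof (rule weak_chain_ilen)
    fix i assume "i \<le> Suc (p + q)"
    then show "ideal (f i) R \<and> A \<subseteq> f i \<and> f i \<subseteq> C"
    proof (cases "i \<le> p")
      case True
      then show ?thesis using ideal_chainD[OF H, of i] BC unfolding f_def by auto
    next
      case False
      then have "i - Suc p \<le> q" using \<open>i \<le> Suc (p + q)\<close> by simp
      then show ?thesis using ideal_chainD[OF G, of "i - Suc p"] AB False unfolding f_def by auto
    qed
  next
    fix i assume i: "i < Suc (p + q)"
    show "f i \<subseteq> f (Suc i)"
    proof (cases "i < p")
      case False
      then show ?thesis
      proof (cases "i = p")
        case True
        then have "f i \<subseteq> B" "B \<subseteq> f (Suc i)"
          using ideal_chainD(3)[OF H, of p] ideal_chainD(2)[OF G, of 0] by (simp_all add: f_def)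
        then show ?thesis by blast
      next
        case neq: False
        then have "Suc i - Suc p = Suc (i - Suc p)" "i - Suc p < q" using i False by auto
        then show ?thesis using G False neq by (auto simp: f_def ideal_chain_def)
      qed
    qed (use H in \<open>auto simp: f_def ideal_chain_def\<close>)
  qed
  moreover have "{..<p} \<union> Suc ` {p..<p + q} \<subseteq> {i. i < Suc (p + q) \<and> f i \<noteq> f (Suc i)}"
  proof
    fix i assume "i \<in> {..<p} \<union> Suc ` {p..<p + q}"
    then show "i \<in> {i. i < Suc (p + q) \<and> f i \<noteq> f (Suc i)}"
    proof
      assume "i \<in> {..<p}"
      then show ?thesis using H by (auto simp: f_def ideal_chain_def)
    next
      assume "i \<in> Suc ` {p..<p + q}"
      then obtain j where j: "i = Suc j" "p \<le> j" "j < p + q"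
        by (metis Suc_less_eq atLeastLessThan_iff imageE)
      then have "G (j - p) \<subset> G (Suc (j - p))" using G by (auto simp: ideal_chain_def)
      moreover have "Suc (j - p) = Suc j - p" using j by auto
      ultimately show ?thesis using j by (auto simp: f_def)
    qed
  qed
  then have "card ({..<p} \<union> Suc ` {p..<p + q}) \<le> card {i. i < Suc (p + q) \<and> f i \<noteq> f (Suc i)}"
    by (intro card_mono) auto
  moreover have "card ({..<p} \<union> Suc ` {p..<p + q}) = p + q"
    by (subst card_Un_disjoint) (auto simp: card_image simp del: image_Suc_atLeastLessThan)
  ultimately have "enat (p + q) \<le> ilen A C"
    by (metis enat_ord_simps(1) order_trans)
  then show "a + b \<le> ilen A C" by (simp add: ab)
qed

text \<open>Intersect a chain with \<open>B\<close>, and add \<open>B\<close> to it. If neither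
  trace moves in a step, the modular law makes the two members equal, so every strict step is
  counted in at least one trace.\<close>

lemma ilen_add_le:
  assumes A: "ideal A R" and B: "ideal B R" and C: "ideal C R" and AB: "A \<subseteq> B" and BC: "B \<subseteq> C"
  shows "ilen A C \<le> ilen A B + ilen B C"
proof (rule ilen_leI)
  fix H n assume chain: "ideal_chain A C H n"
  note H = ideal_chainD[OF chain]
  define P where "P = {i. i < n \<and> H i \<inter> B \<noteq> H (Suc i) \<inter> B}"
  define Q where "Q = {i. i < n \<and> H i <+> B \<noteq> H (Suc i) <+> B}"
  have "enat (card P) \<le> ilen A B"
    unfolding P_def
  proof (rule weak_chain_ilen)
    show "ideal (H i \<inter> B) R \<and> A \<subseteq> H i \<inter> B \<and> H i \<inter> B \<subseteq> B" if "i \<le> n" for i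
      using H(1,2)[OF that] AB inter_ideal[OF _ B, of "H i"] by blast
    show "H i \<inter> B \<subseteq> H (Suc i) \<inter> B" if "i < n" for i
      using H(4)[OF that] by blast
  qed
  moreover have "enat (card Q) \<le> ilen B C"
    unfolding Q_def
  proof (rule weak_chain_ilen)
    show "ideal (H i <+> B) R \<and> B \<subseteq> H i <+> B \<and> H i <+> B \<subseteq> C" if "i \<le> n" for i
      using H(1,3)[OF that] BC B C by (intro conjI isum_ideal isum_upper2 isum_least)
    show "H i <+> B \<subseteq> H (Suc i) <+> B" if "i < n" for i
      using H(4)[OF that] by (intro isum_mono) auto
  qed
  moreover have "{..<n} \<subseteq> P \<union> Q"
  proof
    fix i assume "i \<in> {..<n}"
    then have i: "i < n" by simp
    show "i \<in> P \<union> Q"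
    proof (rule ccontr)
      assume "i \<notin> P \<union> Q"
      then have eq: "H i \<inter> B = H (Suc i) \<inter> B" "H i <+> B = H (Suc i) <+> B" using i by (auto simp: P_def Q_def)
      have I: "ideal (H i) R" "ideal (H (Suc i)) R" using H i by auto
      have sub: "H i \<subseteq> H (Suc i)" using H(4)[OF i] by blast
      have "H (Suc i) \<subseteq> H (Suc i) \<inter> (H i <+> B)"
        unfolding eq(2) using isum_upper1[OF I(2) B] by blast
      also have "\<dots> \<subseteq> H i <+> (H (Suc i) \<inter> B)" by (rule modular_law[OF I(2) I(1) B sub])
      also have "\<dots> \<subseteq> H i" unfolding eq(1)[symmetric] by (rule isum_least[OF I(1)]) auto
      finally show False using H(4)[OF i] by blast
    qed
  qed
  then have "card {..<n} \<le> card (P \<union> Q)" by (intro card_mono) (auto simp: P_def Q_def)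
  then have "n \<le> card P + card Q" using card_Un_le[of P Q] by simp
  then have "enat n \<le> enat (card P) + enat (card Q)" by simp
  ultimately show "enat n \<le> ilen A B + ilen B C" using add_mono order_trans by blast
qed

lemma ilen_add:
  assumes "ideal A R" "ideal B R" "ideal C R" "A \<subseteq> B" "B \<subseteq> C"
  shows "ilen A C = ilen A B + ilen B C"
  by (rule antisym[OF ilen_add_le[OF assms] ilen_add_ge[OF assms]])

text \<open>Second isomorphism theorem: the modular law makes both
  \<open>H \<mapsto> H \<inter> A\<close> and \<open>H \<mapsto> H <+> B\<close> strictly
  monotone.\<close>

lemma ilen_diamond:
  assumes A: "ideal A R" and B: "ideal B R"
  shows "ilen B (A <+> B) = ilen (A \<inter> B) A"
proof (rule antisym)
  show "ilen B (A <+> B) \<le> ilen (A \<inter> B) A"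
  proof (rule ilen_map[where f = "\<lambda>H. H \<inter> A"])
    fix H H' assume H: "ideal H R" "ideal H' R" "B \<subseteq> H" "H \<subset> H'" "H' \<subseteq> A <+> B"
    have "H' \<subseteq> H" if eq: "H \<inter> A = H' \<inter> A"
    proof -
      have BH': "B \<subseteq> H'" using H by blast
      have "H' \<subseteq> H' \<inter> (B <+> A)" using H isum_comm[OF A B] by blast
      also have "\<dots> \<subseteq> B <+> (H' \<inter> A)" by (rule modular_law[OF H(2) B A BH'])
      also have "\<dots> \<subseteq> H" unfolding eq[symmetric] using H(1,3) by (intro isum_least) auto
      finally show ?thesis .
    qed
    then show "H \<inter> A \<subset> H' \<inter> A" using H by blast
  next
    fix H assume "ideal H R" "B \<subseteq> H" "H \<subseteq> A <+> B"
    then show "ideal (H \<inter> A) R \<and> A \<inter> B \<subseteq> H \<inter> A \<and> H \<inter> A \<subseteq> A"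
      using inter_ideal[of H A] A by blast
  qed
  show "ilen (A \<inter> B) A \<le> ilen B (A <+> B)"
  proof (rule ilen_map[where f = "\<lambda>H. H <+> B"])
    fix H assume H: "ideal H R" "A \<inter> B \<subseteq> H" "H \<subseteq> A"
    then show "ideal (H <+> B) R \<and> B \<subseteq> H <+> B \<and> H <+> B \<subseteq> A <+> B"
      using A B by (intro conjI isum_ideal isum_upper2 isum_mono order_refl)
  next
    fix H H' assume H: "ideal H R" "ideal H' R" "A \<inter> B \<subseteq> H" "H \<subset> H'" "H' \<subseteq> A"
    have "H' \<subseteq> H" if eq: "H <+> B = H' <+> B"
    proof -
      have "H' \<subseteq> H' \<inter> (H <+> B)" unfolding eq using isum_upper1[OF H(2) B] by blast
      also have "\<dots> \<subseteq> H <+> (H' \<inter> B)" by (rule modular_law[OF H(2) H(1) B]) (use H in auto)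
      also have "\<dots> \<subseteq> H" using H by (intro isum_least) auto
      finally show ?thesis .
    qed
    then show "H <+> B \<subset> H' <+> B" using H isum_mono[of H H' B B] by blast
  qed
qed

text \<open>Multiplication by \<open>x\<close> induces an isomorphism from
  \<open>U / preimage x V U\<close> onto \<open>(xU + V) / V\<close>.\<close>

lemma ilen_scale:
  assumes x: "x \<in> carrier R" and U: "ideal U R" and V: "ideal V R"
  shows "ilen V (scale x U <+> V) = ilen (preimage x V U) U"
proof (rule antisym)
  have sU: "ideal (scale x U) R" by (rule scale_ideal[OF x U])
  show "ilen (preimage x V U) U \<le> ilen V (scale x U <+> V)"
  proof (rule ilen_map[where f = "\<lambda>H. scale x H <+> V"])
    fix H assume H: "ideal H R" "preimage x V U \<subseteq> H" "H \<subseteq> U"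
    show "ideal (scale x H <+> V) R \<and> V \<subseteq> scale x H <+> V \<and> scale x H <+> V \<subseteq> scale x U <+> V"
      by (intro conjI isum_ideal scale_ideal isum_upper2 isum_mono scale_mono x H V order_refl)
  next
    fix H H' assume H: "ideal H R" "ideal H' R" "preimage x V U \<subseteq> H" "H \<subset> H'" "H' \<subseteq> U"
    have "H' \<subseteq> H" if eq: "scale x H <+> V = scale x H' <+> V"
    proof
      fix h' assume h': "h' \<in> H'"
      then have "x \<otimes> h' \<in> scale x H'" by (simp add: scale_def)
      then have "x \<otimes> h' \<in> scale x H <+> V"
        unfolding eq using isum_upper1[OF scale_ideal[OF x H(2)] V] by blast
      then obtain h v where hv: "h \<in> H" "v \<in> V" "x \<otimes> h' = x \<otimes> h \<oplus> v"
        by (auto simp: isum_mem scale_def)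
      have car: "h' \<in> carrier R" "h \<in> carrier R" "v \<in> carrier R"
        using h' hv H V by (auto intro: ideal_carr)
      have "x \<otimes> (h' \<ominus> h) = v"
        using car x by (simp add: mult_minus_distrib hv(3) add_minus_cancel_left)
      moreover have "h' \<ominus> h \<in> U" using h' hv H by (intro ideal_minus[OF U]) auto
      ultimately have "h' \<ominus> h \<in> preimage x V U" using hv by (simp add: preimage_def)
      then have "(h' \<ominus> h) \<oplus> h \<in> H" using H hv by (intro ideal_add) auto
      moreover have "(h' \<ominus> h) \<oplus> h = h'" using car by (simp add: minus_add_cancel)
      ultimately show "h' \<in> H" by simp
    qed
    then show "scale x H <+> V \<subset> scale x H' <+> V"
      using H isum_mono[OF scale_mono, of H H' V V x] by blast
  qed
  show "ilen V (scale x U <+> V) \<le> ilen (preimage x V U) U"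
  proof (rule ilen_map[where f = "\<lambda>H. preimage x H U"])
    fix H assume H: "ideal H R" "V \<subseteq> H" "H \<subseteq> scale x U <+> V"
    show "ideal (preimage x H U) R \<and> preimage x V U \<subseteq> preimage x H U \<and> preimage x H U \<subseteq> U"
      using H preimage_ideal[OF x H(1) U] by (auto simp: preimage_def)
  next
    fix H H' assume H: "ideal H R" "ideal H' R" "V \<subseteq> H" "H \<subset> H'" "H' \<subseteq> scale x U <+> V"
    obtain w where w: "w \<in> H'" "w \<notin> H" using H by blast
    then obtain u v where uv: "u \<in> U" "v \<in> V" "w = x \<otimes> u \<oplus> v"
      using H(5) by (fastforce simp: isum_mem scale_def)
    have car: "u \<in> carrier R" "v \<in> carrier R" using uv U V by (auto intro: ideal_carr)
    have "w \<ominus> v = x \<otimes> u"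
      unfolding uv(3) using car x by (simp add: add_minus_cancel_right)
    moreover have "w \<ominus> v \<in> H'" using w uv H by (intro ideal_minus) auto
    ultimately have "u \<in> preimage x H' U" using uv by (simp add: preimage_def)
    moreover have "u \<notin> preimage x H U"
      using w uv H ideal_add[OF H(1)] by (auto simp: preimage_def)
    moreover have "preimage x H U \<subseteq> preimage x H' U" using H by (auto simp: preimage_def)
    ultimately show "preimage x H U \<subset> preimage x H' U" by blast
  qed
qed

text \<open>Multiplication by \<open>x\<close> maps \<open>R / ((y) + c)\<close> onto the kernel of
  the projection from \<open>R / ((xy) + c)\<close> to \<open>R / ((x) + c)\<close>.\<close>

lemma ilen_sum_prod_le:
  assumes c: "ideal c R" and x: "x \<in> carrier R" and y: "y \<in> carrier R"
  shows "ilen (PIdl (x \<otimes> y) <+> c) (carrier R) \<le> ilen (PIdl x <+> c) (carrier R) + ilen (PIdl y <+> c) (carrier R)"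
proof -
  let ?V = "PIdl (x \<otimes> y) <+> c"
  have V: "ideal ?V R" and Px: "ideal (PIdl x) R" and Py: "ideal (PIdl y) R" and Pxy: "ideal (PIdl (x \<otimes> y)) R"
    using c x y by (auto intro: isum_ideal cgenideal_ideal)
  have xV: "ideal (PIdl x <+> ?V) R" by (intro isum_ideal Px V)
  have "PIdl (x \<otimes> y) \<subseteq> PIdl x"
    using x y by (intro cgenideal_minimal Px) (use x y in \<open>auto simp: cgenideal_def m_comm intro!: exI[of _ y]\<close>)
  then have eq: "PIdl x <+> ?V = PIdl x <+> c"
    by (simp add: isum_assoc[symmetric] Px Pxy c isum_absorb)
  have "ilen ?V (carrier R) = ilen ?V (PIdl x <+> ?V) + ilen (PIdl x <+> ?V) (carrier R)"
    by (rule ilen_add[OF V xV oneideal isum_upper2[OF Px V] ideal_subset[OF xV]])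
  also have "ilen ?V (PIdl x <+> ?V) = ilen (preimage x ?V (carrier R)) (carrier R)"
    using ilen_scale[OF x oneideal V] by (simp add: scale_carrier x)
  also have "\<dots> \<le> ilen (PIdl y <+> c) (carrier R)"
  proof (rule ilen_mono[OF _ order_refl])
    have "PIdl y \<subseteq> preimage x ?V (carrier R)"
    proof (rule cgenideal_minimal[OF preimage_ideal[OF x V oneideal]])
      have "x \<otimes> y \<in> ?V"
        using cgenideal_self[of "x \<otimes> y"] isum_upper1[OF Pxy c] x y by auto
      then show "y \<in> preimage x ?V (carrier R)" using y by (simp add: preimage_def)
    qed
    moreover have "c \<subseteq> preimage x ?V (carrier R)"
      using isum_upper2[OF Pxy c] ideal_lmult[OF c _ x] ideal_carr[OF c] by (auto simp: preimage_def)
    ultimately show "PIdl y <+> c \<subseteq> preimage x ?V (carrier R)"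
      by (intro isum_least preimage_ideal x V oneideal)
  qed
  finally show ?thesis unfolding eq by (simp add: add.commute add_mono)
qed

lemma ilen_power_le:
  assumes c: "ideal c R" and x: "x \<in> carrier R"
  shows "ilen (PIdl (x [^] (m::nat)) <+> c) (carrier R) \<le> of_nat m * ilen (PIdl x <+> c) (carrier R)"
proof (induction m)
  case 0
  have "PIdl \<one> = carrier R" by (force simp: cgenideal_def)
  then have "PIdl \<one> <+> c = carrier R" using c by (simp add: isum_absorb oneideal ideal_subset)
  then show ?case by simp
next
  case (Suc m)
  have "ilen (PIdl (x [^] Suc m) <+> c) (carrier R)
      \<le> ilen (PIdl (x [^] m) <+> c) (carrier R) + ilen (PIdl x <+> c) (carrier R)"
    using ilen_sum_prod_le[OF c, of "x [^] m" x] x by simp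
  also have "\<dots> \<le> of_nat m * ilen (PIdl x <+> c) (carrier R) + ilen (PIdl x <+> c) (carrier R)"
    by (intro add_mono Suc.IH order_refl)
  finally show ?case by (simp add: distrib_right add.commute)
qed

end

section \<open>Multigraded families of ideals\<close>

text \<open>Entries beyond \<open>s\<close> are 0, so that each degree has one representative and
  boxes are finite.\<close>

definition degrees :: "nat \<Rightarrow> (nat \<Rightarrow> nat) set" where
  "degrees s = {n. \<forall>j>s. n j = 0}"

definition inc :: "nat \<Rightarrow> nat \<Rightarrow> (nat \<Rightarrow> nat) \<Rightarrow> (nat \<Rightarrow> nat)" where
  "inc i p n = n(i := n i + p)"

definition dec :: "nat \<Rightarrow> nat \<Rightarrow> (nat \<Rightarrow> nat) \<Rightarrow> (nat \<Rightarrow> nat)" where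
  "dec i p n = n(i := n i - p)"

lemma inc_degrees: "n \<in> degrees s \<Longrightarrow> i \<le> s \<Longrightarrow> inc i p n \<in> degrees s"
  by (auto simp: degrees_def inc_def)

lemma dec_degrees: "n \<in> degrees s \<Longrightarrow> dec i p n \<in> degrees s"
  by (auto simp: degrees_def dec_def)

lemma inc_inc: "inc i p (inc j q n) = inc j q (inc i p n)"
  by (auto simp: inc_def fun_eq_iff)

lemma inc_add: "inc i p (inc i q n) = inc i (p + q) n"
  by (auto simp: inc_def fun_eq_iff)

lemma dec_add: "dec i p (dec i q n) = dec i (p + q) n"
  by (auto simp: dec_def fun_eq_iff)

lemma dec_inc: "dec i p (inc i p n) = n"
  by (auto simp: inc_def dec_def)

lemma inc_dec: "p \<le> n i \<Longrightarrow> inc i p (dec i p n) = n"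
  by (auto simp: inc_def dec_def)

lemma inc_dec_comm: "p \<le> n i \<Longrightarrow> inc j q (dec i p n) = dec i p (inc j q n)"
  by (auto simp: inc_def dec_def fun_eq_iff)

lemma inc_0 [simp]: "inc i 0 n = n"
  by (simp add: inc_def)

lemma dec_0 [simp]: "dec i 0 n = n"
  by (simp add: dec_def)

lemma inc_apply: "inc i p n j = (if j = i then n i + p else n j)"
  by (simp add: inc_def)

lemma dec_apply: "dec i p n j = (if j = i then n i - p else n j)"
  by (simp add: dec_def)

lemma finite_degree_box: "finite {n \<in> degrees s. \<forall>j\<le>s. n j \<le> D}"
proof (rule finite_subset)
  show "{n \<in> degrees s. \<forall>j\<le>s. n j \<le> D} \<subseteq> {n. \<forall>j. (j \<in> {..s} \<longrightarrow> n j \<in> {..D}) \<and> (j \<notin> {..s} \<longrightarrow> n j = 0)}"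
    by (auto simp: degrees_def)
  show "finite {n. \<forall>j. (j \<in> {..s} \<longrightarrow> n j \<in> {..D}) \<and> (j \<notin> {..s} \<longrightarrow> n j = (0::nat))}"
    by (rule finite_set_of_finite_funs) auto
qed

locale noetherian_cring = noetherian_ring R + cring R for R (structure)

context cring
begin

lemma scale_subset_iff: "scale x A \<subseteq> B \<longleftrightarrow> (\<forall>a\<in>A. x \<otimes> a \<in> B)"
  by (auto simp: scale_def)

lemma scale_mem: "a \<in> A \<Longrightarrow> x \<otimes> a \<in> scale x A"
  by (auto simp: scale_def)

lemma scale_zero_set: "x \<in> carrier R \<Longrightarrow> scale x {\<zero>} = {\<zero>}"
  by (simp add: scale_def)

lemma scale_one: "A \<subseteq> carrier R \<Longrightarrow> scale \<one> A = A"
  by (force simp: scale_def)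

lemma scale_scale:
  "x \<in> carrier R \<Longrightarrow> y \<in> carrier R \<Longrightarrow> A \<subseteq> carrier R \<Longrightarrow> scale x (scale y A) = scale (x \<otimes> y) A"
  by (auto simp: scale_def image_image m_assoc subset_iff intro!: image_cong)

lemma scale_sum:
  assumes "x \<in> carrier R" "A \<subseteq> carrier R" "B \<subseteq> carrier R"
  shows "scale x (A <+> B) = scale x A <+> scale x B"
proof -
  have "x \<otimes> (a \<oplus> b) = x \<otimes> a \<oplus> x \<otimes> b" if "a \<in> A" "b \<in> B" for a b
    using that assms by (auto simp: r_distr subset_iff)
  then have "{x \<otimes> (a \<oplus> b) | a b. a \<in> A \<and> b \<in> B} = {x \<otimes> a \<oplus> x \<otimes> b | a b. a \<in> A \<and> b \<in> B}"
    by metis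
  moreover have "scale x (A <+> B) = {x \<otimes> (a \<oplus> b) | a b. a \<in> A \<and> b \<in> B}"
    unfolding scale_def set_add_def' by blast
  moreover have "scale x A <+> scale x B = {x \<otimes> a \<oplus> x \<otimes> b | a b. a \<in> A \<and> b \<in> B}"
    unfolding scale_def set_add_def' by blast
  ultimately show ?thesis by simp
qed

lemma preimage_subset: "preimage x V U \<subseteq> U"
  by (auto simp: preimage_def)

lemma subset_preimage_iff: "A \<subseteq> preimage x V U \<longleftrightarrow> A \<subseteq> U \<and> scale x A \<subseteq> V"
  by (auto simp: preimage_def scale_def)

text \<open>A finitely generated multigraded module is encoded by ideals \<open>V n \<subseteq> U n\<close> with \<open>U n / V n\<close> as its piece of
  degree \<open>n\<close>.  A pair \<open>(i, y)\<close> in \<open>Y\<close> stands for a variable of degree \<open>e\<^sub>i\<close> that acts as multiplication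
  by \<open>y\<close>.  Finite generation means that far out each piece is spanned by what the variables produce.\<close>
definition stable :: "nat \<Rightarrow> (nat \<times> 'a) set \<Rightarrow> ((nat \<Rightarrow> nat) \<Rightarrow> 'a set) \<Rightarrow> bool" where
  "stable s Y U \<longleftrightarrow> (\<forall>n\<in>degrees s. ideal (U n) R \<and> (\<forall>(i, y)\<in>Y. scale y (U n) \<subseteq> U (inc i 1 n)))"

definition actors :: "nat \<Rightarrow> (nat \<times> 'a) set \<Rightarrow> bool" where
  "actors s Y \<longleftrightarrow> finite Y \<and> (\<forall>(i, y)\<in>Y. i \<le> s \<and> y \<in> carrier R)"

definition acts_into ::
    "(nat \<times> 'a) set \<Rightarrow> ((nat \<Rightarrow> nat) \<Rightarrow> 'a set) \<Rightarrow> (nat \<Rightarrow> nat) \<Rightarrow> 'a set \<Rightarrow> bool" where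
  "acts_into Y U n W \<longleftrightarrow> (\<forall>i y. (i, y) \<in> Y \<longrightarrow> 0 < n i \<longrightarrow> scale y (U (dec i 1 n)) \<subseteq> W)"

text \<open>In all but finitely many degrees, \<open>U n\<close> lies in the sum of
  \<open>V n\<close> and the ideals \<open>y U (n - e_i)\<close> over the actors. Testing against
  arbitrary ideals \<open>W\<close> avoids writing finite sums of ideals.\<close>

definition generated_beyond :: "nat \<Rightarrow> (nat \<times> 'a) set \<Rightarrow> ((nat \<Rightarrow> nat) \<Rightarrow> 'a set) \<Rightarrow>
    ((nat \<Rightarrow> nat) \<Rightarrow> 'a set) \<Rightarrow> nat \<Rightarrow> bool" where
  "generated_beyond s Y U V D \<longleftrightarrow> (\<forall>n\<in>degrees s. \<forall>j\<le>s. D < n j \<longrightarrow>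
     (\<forall>W. ideal W R \<longrightarrow> V n \<subseteq> W \<longrightarrow> acts_into Y U n W \<longrightarrow> U n \<subseteq> W))"

definition generated :: "nat \<Rightarrow> (nat \<times> 'a) set \<Rightarrow> ((nat \<Rightarrow> nat) \<Rightarrow> 'a set) \<Rightarrow>
    ((nat \<Rightarrow> nat) \<Rightarrow> 'a set) \<Rightarrow> bool" where
  "generated s Y U V \<longleftrightarrow> (\<exists>D. generated_beyond s Y U V D)"

lemma generatedD:
  assumes "generated_beyond s Y U V D" "n \<in> degrees s" "j \<le> s" "D < n j" "ideal W R" "V n \<subseteq> W"
    "acts_into Y U n W"
  shows "U n \<subseteq> W"
  using assms(1)[unfolded generated_beyond_def, rule_format, OF assms(2-7)] .

lemma generatedI:
  assumes "\<And>n j W. n \<in> degrees s \<Longrightarrow> j \<le> s \<Longrightarrow> D < n j \<Longrightarrow> ideal W R \<Longrightarrow> V n \<subseteq> W \<Longrightarrow>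
    acts_into Y U n W \<Longrightarrow> U n \<subseteq> W"
  shows "generated s Y U V"
  unfolding generated_def generated_beyond_def
  by (intro exI[of _ D] ballI allI impI) (rule assms)

lemma acts_intoI:
  "(\<And>i y. (i, y) \<in> Y \<Longrightarrow> 0 < n i \<Longrightarrow> scale y (U (dec i 1 n)) \<subseteq> W) \<Longrightarrow> acts_into Y U n W"
  unfolding acts_into_def by (intro allI impI)

lemma acts_intoD:
  "acts_into Y U n W \<Longrightarrow> (i, y) \<in> Y \<Longrightarrow> 0 < n i \<Longrightarrow> scale y (U (dec i 1 n)) \<subseteq> W"
  unfolding acts_into_def by (elim allE impE)

lemma stableD:
  assumes "stable s Y U" "n \<in> degrees s"
  shows "ideal (U n) R" "(i, y) \<in> Y \<Longrightarrow> scale y (U n) \<subseteq> U (inc i 1 n)"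
proof -
  have *: "ideal (U n) R" "\<forall>(i, y)\<in>Y. scale y (U n) \<subseteq> U (inc i 1 n)"
    using bspec[OF assms(1)[unfolded stable_def] assms(2)] by simp_all
  show "ideal (U n) R" by (rule *)
  show "scale y (U n) \<subseteq> U (inc i 1 n)" if "(i, y) \<in> Y"
    using bspec[OF *(2) that] by simp
qed

lemma stable_subset: "stable s Y U \<Longrightarrow> Y' \<subseteq> Y \<Longrightarrow> stable s Y' U"
  unfolding stable_def by blast

lemma stable_pow:
  assumes U: "stable s Y U" and iy: "(i, y) \<in> Y" and Y: "actors s Y" and n: "n \<in> degrees s"
  shows "scale (y [^] (p::nat)) (U n) \<subseteq> U (inc i p n)"
proof (induction p)
  case 0
  then show ?case using ideal_subset[OF stableD(1)[OF U n]] by (simp add: scale_one)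
next
  case (Suc p)
  have y: "y \<in> carrier R" and i: "i \<le> s" using Y iy by (auto simp: actors_def)
  have n': "inc i p n \<in> degrees s" using n i by (rule inc_degrees)
  have "scale (y [^] Suc p) (U n) = scale y (scale (y [^] p) (U n))"
    using y ideal_subset[OF stableD(1)[OF U n]] by (simp add: scale_scale m_comm)
  also have "\<dots> \<subseteq> scale y (U (inc i p n))" by (rule scale_mono[OF Suc.IH])
  also have "\<dots> \<subseteq> U (inc i 1 (inc i p n))" by (rule stableD(2)[OF U n' iy])
  finally show ?case by (simp add: inc_add)
qed

lemma stable_dec:
  assumes U: "stable s Y U" and iy: "(i, y) \<in> Y" and n: "n \<in> degrees s" and "0 < n i"
  shows "scale y (U (dec i 1 n)) \<subseteq> U n"
  using stableD(2)[OF U dec_degrees[OF n] iy, of i 1] \<open>0 < n i\<close> by (simp add: inc_dec Suc_le_eq)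

text \<open>The image of the actor \<open>y\<close> in degree \<open>n\<close>. Where
  \<open>n i = 0\<close> nothing arrives; the case distinction is needed because \<open>dec\<close>
  truncates and would give \<open>y U n\<close> there.\<close>

definition shift :: "nat \<Rightarrow> 'a \<Rightarrow> ((nat \<Rightarrow> nat) \<Rightarrow> 'a set) \<Rightarrow> (nat \<Rightarrow> nat) \<Rightarrow> 'a set" where
  "shift i y U n = (if n i = 0 then {\<zero>} else scale y (U (dec i 1 n)))"

lemma shift_ideal:
  assumes "stable s Y U" "y \<in> carrier R" "n \<in> degrees s"
  shows "ideal (shift i y U n) R"
  unfolding shift_def
  using zeroideal scale_ideal[OF assms(2) stableD(1)[OF assms(1) dec_degrees[OF assms(3)]]] by simp

lemma shift_stable:
  assumes U: "stable s Y U" and y: "y \<in> carrier R" and n: "n \<in> degrees s"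
    and jz: "(j, z) \<in> Y" and z: "z \<in> carrier R"
  shows "scale z (shift i y U n) \<subseteq> shift i y U (inc j 1 n)"
proof (cases "n i = 0")
  case True
  have "inc j 1 n \<in> degrees s \<or> \<not> j \<le> s" using n by (auto intro: inc_degrees)
  have "\<zero> \<in> shift i y U (inc j 1 n)"
  proof (cases "inc j 1 n i = 0")
    case False
    then have "j = i" "dec i 1 (inc j 1 n) = n" using True by (auto simp: inc_apply dec_inc split: if_splits)
    moreover have "\<zero> \<in> scale y (U n)"
      using ideal_0[OF scale_ideal[OF y stableD(1)[OF U n]]] .
    ultimately show ?thesis using False by (simp add: shift_def)
  qed (simp add: shift_def)
  then show ?thesis using True z by (simp add: shift_def scale_zero_set)
next
  case False
  have U': "U (dec i 1 n) \<subseteq> carrier R"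
    by (rule ideal_subset[OF stableD(1)[OF U dec_degrees[OF n]]])
  have "scale z (scale y (U (dec i 1 n))) = scale y (scale z (U (dec i 1 n)))"
    using U' y z by (simp add: scale_scale m_comm)
  also have "\<dots> \<subseteq> scale y (U (inc j 1 (dec i 1 n)))"
    by (intro scale_mono stableD(2)[OF U _ jz] dec_degrees n)
  also have "inc j 1 (dec i 1 n) = dec i 1 (inc j 1 n)"
    using False by (simp add: inc_dec_comm)
  finally show ?thesis using False by (simp add: shift_def inc_apply)
qed

lemma stable_sum:
  assumes "stable s Y U" "stable s Y V" "actors s Y"
  shows "stable s Y (\<lambda>n. U n <+> V n)"
  unfolding stable_def
proof (intro ballI conjI)
  fix n assume n: "n \<in> degrees s"
  note U = stableD[OF assms(1) n] and V = stableD[OF assms(2) n]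
  show "ideal (U n <+> V n) R" by (intro isum_ideal U V)
  fix iy assume "iy \<in> Y"
  then obtain i y where iy: "iy = (i, y)" "(i, y) \<in> Y" by (cases iy) auto
  then have "y \<in> carrier R" using assms(3) by (auto simp: actors_def)
  then have "scale y (U n <+> V n) = scale y (U n) <+> scale y (V n)"
    by (rule scale_sum[OF _ ideal_subset[OF U(1)] ideal_subset[OF V(1)]])
  also have "\<dots> \<subseteq> U (inc i 1 n) <+> V (inc i 1 n)"
    by (intro isum_mono U(2) V(2) iy(2))
  finally have "scale y (U n <+> V n) \<subseteq> U (inc i 1 n) <+> V (inc i 1 n)" .
  then show "case iy of (i, y) \<Rightarrow> scale y (U n <+> V n) \<subseteq> U (inc i 1 n) <+> V (inc i 1 n)"
    by (simp add: iy)
qed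

lemma stable_shift_sum:
  assumes "stable s Y U" "stable s Y V" "actors s Y" "y \<in> carrier R"
  shows "stable s Y (\<lambda>n. V n <+> shift i y U n)"
proof (rule stable_sum[OF assms(2) _ assms(3)])
  show "stable s Y (shift i y U)"
    unfolding stable_def
  proof (intro ballI conjI)
    fix n assume n: "n \<in> degrees s"
    show "ideal (shift i y U n) R" by (rule shift_ideal[OF assms(1,4) n])
    fix jz assume jz: "jz \<in> Y"
    obtain j z where eq: "jz = (j, z)" by (cases jz)
    then have "z \<in> carrier R" using assms(3) jz by (auto simp: actors_def)
    then show "case jz of (j, z) \<Rightarrow> scale z (shift i y U n) \<subseteq> shift i y U (inc j 1 n)"
      using shift_stable[OF assms(1,4) n] jz eq by simp
  qed
qed

text \<open>What \<open>y\<close> contributes to degree \<open>n\<close> has been moved into the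
  lower family, so the remaining actors generate.\<close>

lemma generated_cokernel:
  assumes gen: "generated s (insert (i, y) Y) U V"
    and U: "stable s Y' U" and V: "stable s Y' V" and y: "y \<in> carrier R"
  shows "generated s Y U (\<lambda>n. V n <+> shift i y U n)"
proof -
  obtain D where D: "generated_beyond s (insert (i, y) Y) U V D"
    using gen unfolding generated_def by (elim exE)
  show ?thesis
  proof (rule generatedI[of s D])
    fix n j W assume n: "n \<in> degrees s" and j: "j \<le> s" "D < n j" and W: "ideal W R"
      and sub: "V n <+> shift i y U n \<subseteq> W" and Y: "acts_into Y U n W"
    have VW: "V n \<subseteq> W" and sW: "shift i y U n \<subseteq> W"
      using sub isum_le_iff[OF stableD(1)[OF V n] shift_ideal[OF U y n, of i] W] by simp_all
    show "U n \<subseteq> W"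
    proof (rule generatedD[OF D n j W VW acts_intoI])
      fix j z assume jz: "(j, z) \<in> insert (i, y) Y" "0 < n j"
      show "scale z (U (dec j 1 n)) \<subseteq> W"
      proof (cases "(j, z) \<in> Y")
        case True
        then show ?thesis by (rule acts_intoD[OF Y _ jz(2)])
      next
        case False
        then have "j = i" "z = y" using jz by simp_all
        then show ?thesis using sW jz by (simp add: shift_def)
      qed
    qed
  qed
qed

end

section \<open>Hilbert's basis theorem for graded families\<close>

context noetherian_cring
begin

lemma increasing_union:
  assumes "\<And>p. ideal (F p) R" "\<And>p. F p \<subseteq> F (Suc p)"
  shows "\<exists>p::nat. (\<Union>q. F q) = F p"
proof -
  have mono: "F p \<subseteq> F q" if "p \<le> q" for p q by (rule lift_Suc_mono_le[of F, OF assms(2) that])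
  have total: "F p \<subseteq> F q \<or> F q \<subseteq> F p" for p q
    using mono[of p q] mono[of q p] nat_le_linear[of p q] by blast
  have "subset.chain {I. ideal I R} (range F)"
    unfolding subset_chain_def
  proof (intro conjI ballI)
    show "range F \<subseteq> {I. ideal I R}" using assms(1) by blast
    fix A B assume "A \<in> range F" "B \<in> range F"
    then obtain p q where "A = F p" "B = F q" by blast
    then show "A \<subseteq> B \<or> B \<subseteq> A" using total[of p q] by blast
  qed
  then have "\<Union> (range F) \<in> range F" by (rule ideal_chain_is_trivial[rotated]) simp
  then show ?thesis by auto
qed

lemma increasing_union_ideal:
  assumes "\<And>p. ideal (F p) R" "\<And>p. F p \<subseteq> F (Suc p)"
  shows "ideal (\<Union>q::nat. F q) R"
  using increasing_union[of F] assms by auto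

lemma increasing_union_finite:
  assumes "finite B" "\<And>p n. n \<in> B \<Longrightarrow> ideal (F p n) R" "\<And>p n. n \<in> B \<Longrightarrow> F p n \<subseteq> F (Suc p) n"
  shows "\<exists>p::nat. \<forall>n\<in>B. (\<Union>q. F q n) = F p n"
proof -
  have "\<forall>n\<in>B. \<exists>p. (\<Union>q. F q n) = F p n"
    using increasing_union[of "\<lambda>p. F p n" for n] assms(2,3) by simp
  then obtain P where P: "\<And>n. n \<in> B \<Longrightarrow> (\<Union>q. F q n) = F (P n) n" by metis
  define p where "p = Max (insert 0 (P ` B))"
  have "(\<Union>q. F q n) = F p n" if n: "n \<in> B" for n
  proof
    have "P n \<le> p" unfolding p_def using assms(1) n by (intro Max_ge) auto
    then have "F (P n) n \<subseteq> F p n"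
      by (rule lift_Suc_mono_le[of "\<lambda>p. F p n", OF assms(3)[OF n]])
    then show "(\<Union>q. F q n) \<subseteq> F p n" using P[OF n] by simp
  qed auto
  then show ?thesis by blast
qed

text \<open>A multigraded form of Hilbert's basis theorem: by induction on the actors, a submodule \<open>N\<close> of a
  finitely generated graded module is finitely generated.  For the actor \<open>y\<close> one filters \<open>N\<close> by the
  powers of \<open>y\<close> and studies the submodules of leading coefficients \<open>{m. y\<^sup>p m \<in> N + y\<^sup>p\<^sup>+\<^sup>1 U}\<close>.\<close>
lemma generated_submodule:
  assumes "actors s Y" "stable s Y U" "stable s Y V" "stable s Y N"
    and "\<And>n. n \<in> degrees s \<Longrightarrow> V n \<subseteq> N n" "\<And>n. n \<in> degrees s \<Longrightarrow> N n \<subseteq> U n"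
    and "generated s Y U V"
  shows "generated s Y N V"
proof -
  have "finite Y" using assms(1) by (simp add: actors_def)
  then show ?thesis using assms
  proof (induction Y arbitrary: U V N rule: finite_induct)
    case empty
    obtain D where D: "generated_beyond s {} U V D"
      using empty.prems(7) unfolding generated_def by (elim exE)
    show ?case
    proof (rule generatedI[of s D])
      fix n j W assume n: "n \<in> degrees s" and "j \<le> s" "D < n j" "ideal W R" "V n \<subseteq> W"
      then have "U n \<subseteq> W" by (rule generatedD[OF D]) (simp add: acts_into_def)
      then show "N n \<subseteq> W" using empty.prems(6)[OF n] by (rule subset_trans[rotated])
    qed
  next
    case (insert iy Y)
    obtain i y where iy_eq: "iy = (i, y)" by (cases iy)
    note prems = insert.prems[unfolded iy_eq]
    let ?Y0 = "insert (i, y) Y"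
    note Y0 = prems(1) and U = prems(2) and V = prems(3) and N = prems(4) and VN = prems(5) and NU = prems(6)
    have iy: "(i, y) \<in> ?Y0" by simp
    have i: "i \<le> s" and y: "y \<in> carrier R" using Y0 by (auto simp: actors_def)
    have Y: "actors s Y" using Y0 by (auto simp: actors_def)
    note yp = nat_pow_closed[OF y]
    have UY: "stable s Y U" and VY: "stable s Y V" and NY: "stable s Y N"
      using stable_subset[of s ?Y0 _ Y] U V N by auto
    \<comment> \<open>Modulo the image of \<open>y\<close> the family \<open>U\<close> is generated
      by the actors in \<open>Y\<close> alone, so the induction hypothesis applies to every family
      between \<open>V'\<close> and \<open>U\<close>.\<close>
    define V' where "V' n = V n <+> shift i y U n" for n
    have V': "stable s Y V'" unfolding V'_def by (rule stable_shift_sum[OF UY VY Y y])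
    have gen': "generated s Y U V'"
      unfolding V'_def by (rule generated_cokernel[OF prems(7) U V y])
    \<comment> \<open>Both \<open>N (n + p e_i)\<close> and \<open>y^(p+1) U (n - e_i)\<close> live
      in degree \<open>n + p e_i\<close>. A member of \<open>M p n\<close> is thus a coefficient at
      \<open>y^p\<close> of an element of \<open>N\<close>, up to higher powers of
      \<open>y\<close>.\<close>
    define Z where "Z p n = N (inc i p n) <+> shift i (y [^] Suc p) U n" for p n
    define M where "M p n = preimage (y [^] p) (Z p n) (U n)" for p n
    have Uid: "ideal (U n) R" and Vid: "ideal (V n) R" and Nid: "ideal (N n) R" if "n \<in> degrees s" for n
      using stableD(1)[OF U that] stableD(1)[OF V that] stableD(1)[OF N that] by auto
    have sh: "ideal (shift i (y [^] (p::nat)) U n) R" if "n \<in> degrees s" for p n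
      by (rule shift_ideal[OF U yp that])
    have Nid': "ideal (N (inc i p n)) R" if "n \<in> degrees s" for p n
      by (rule Nid[OF inc_degrees[OF that i]])
    have Zid: "ideal (Z p n) R" if "n \<in> degrees s" for p n
      unfolding Z_def by (rule isum_ideal[OF Nid'[OF that] sh[OF that]])
    have Mid: "ideal (M p n) R" if "n \<in> degrees s" for p n
      unfolding M_def by (rule preimage_ideal[OF yp Zid[OF that] Uid[OF that]])
    have MU: "M p n \<subseteq> U n" for p n unfolding M_def by (rule preimage_subset)
    have yM: "scale (y [^] p) (M p n) \<subseteq> Z p n" for p n
      using subset_preimage_iff[of "M p n" "y [^] p" "Z p n" "U n"] unfolding M_def by simp
    have shiftU: "shift i y U n \<subseteq> U n" if n: "n \<in> degrees s" for n
      using stable_dec[OF U iy n] ideal_0[OF Uid[OF n]] by (auto simp: shift_def)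
    have shift_pow: "scale (y [^] (p::nat)) (shift i (y [^] (q::nat)) U n) = shift i (y [^] (p + q)) U n"
      if n: "n \<in> degrees s" for p q n
      using ideal_subset[OF Uid[OF dec_degrees[OF n, of i 1]]] yp
      by (auto simp: shift_def scale_zero_set scale_scale nat_pow_mult y)
    have V'M: "V' n \<subseteq> M p n" if n: "n \<in> degrees s" for p n
      unfolding V'_def
    proof (rule isum_least[OF Mid[OF n]])
      have "scale (y [^] p) (V n) \<subseteq> V (inc i p n)" by (rule stable_pow[OF V iy Y0 n])
      also have "\<dots> \<subseteq> N (inc i p n)" by (rule VN[OF inc_degrees[OF n i]])
      also have "\<dots> \<subseteq> Z p n" unfolding Z_def by (rule isum_upper1[OF Nid'[OF n] sh[OF n]])
      finally show "V n \<subseteq> M p n"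
        unfolding M_def subset_preimage_iff using VN[OF n] NU[OF n] by blast
      have "scale (y [^] p) (shift i y U n) = shift i (y [^] Suc p) U n"
        using shift_pow[OF n, of p 1] y by simp
      also have "\<dots> \<subseteq> Z p n" unfolding Z_def by (rule isum_upper2[OF Nid'[OF n] sh[OF n]])
      finally show "shift i y U n \<subseteq> M p n"
        unfolding M_def subset_preimage_iff using shiftU[OF n] by blast
    qed
    have Mst: "stable s Y (M p)" for p
      unfolding stable_def
    proof (intro ballI conjI)
      fix n assume n: "n \<in> degrees s"
      show "ideal (M p n) R" by (rule Mid[OF n])
      fix jz assume jz: "jz \<in> Y"
      obtain j z where eq: "jz = (j, z)" by (cases jz)
      have jz': "(j, z) \<in> Y" "(j, z) \<in> ?Y0" using jz eq by auto
      have z: "z \<in> carrier R" and j: "j \<le> s" using jz' Y by (auto simp: actors_def)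
      have n': "inc j 1 n \<in> degrees s" by (rule inc_degrees[OF n j])
      have "scale (y [^] p) (scale z (M p n)) = scale z (scale (y [^] p) (M p n))"
        using ideal_subset[OF Mid[OF n]] z yp by (simp add: scale_scale m_comm)
      also have "\<dots> \<subseteq> scale z (Z p n)" by (rule scale_mono[OF yM])
      also have "\<dots> = scale z (N (inc i p n)) <+> scale z (shift i (y [^] Suc p) U n)"
        unfolding Z_def by (rule scale_sum[OF z ideal_subset[OF Nid'[OF n]] ideal_subset[OF sh[OF n]]])
      also have "\<dots> \<subseteq> N (inc j 1 (inc i p n)) <+> shift i (y [^] Suc p) U (inc j 1 n)"
        by (intro isum_mono stableD(2)[OF N inc_degrees[OF n i] jz'(2)] shift_stable[OF U yp n jz'(2) z])
      also have "\<dots> = Z p (inc j 1 n)" unfolding Z_def by (simp add: inc_inc)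
      finally have "scale (y [^] p) (scale z (M p n)) \<subseteq> Z p (inc j 1 n)" .
      moreover have "scale z (M p n) \<subseteq> U (inc j 1 n)"
        using scale_mono[OF MU] stableD(2)[OF U n jz'(2)] by (rule subset_trans)
      ultimately have "scale z (M p n) \<subseteq> M p (inc j 1 n)"
        unfolding M_def[of p "inc j 1 n"] subset_preimage_iff by (intro conjI)
      then show "case jz of (j, z) \<Rightarrow> scale z (M p n) \<subseteq> M p (inc j 1 n)" by (simp add: eq)
    qed
    have Minc: "M p n \<subseteq> M (Suc p) n" if n: "n \<in> degrees s" for p n
    proof -
      have "scale (y [^] Suc p) (M p n) = scale y (scale (y [^] p) (M p n))"
        using ideal_subset[OF Mid[OF n]] y by (simp add: scale_scale m_comm)
      also have "\<dots> \<subseteq> scale y (Z p n)" by (rule scale_mono[OF yM])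
      also have "\<dots> = scale y (N (inc i p n)) <+> scale y (shift i (y [^] Suc p) U n)"
        unfolding Z_def by (rule scale_sum[OF y ideal_subset[OF Nid'[OF n]] ideal_subset[OF sh[OF n]]])
      also have "scale y (shift i (y [^] Suc p) U n) = shift i (y [^] Suc (Suc p)) U n"
        using shift_pow[OF n, of 1 "Suc p"] y by simp
      also have "scale y (N (inc i p n)) <+> shift i (y [^] Suc (Suc p)) U n \<subseteq> Z (Suc p) n"
        unfolding Z_def
        using stableD(2)[OF N inc_degrees[OF n i] iy, of p] by (intro isum_mono) (auto simp: inc_add)
      finally show ?thesis
        unfolding M_def[of "Suc p"] subset_preimage_iff using MU[of p n] by blast
    qed
    have genM: "generated s Y (M p) V'" for p
      by (rule insert.IH[OF Y UY V' Mst V'M MU gen'])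
    \<comment> \<open>Each degree has its own stage where the chain \<open>M p n\<close> stops. The
      union is again a family between \<open>V'\<close> and \<open>U\<close>, hence generated, and
      this yields one stage \<open>p0\<close> for all degrees.\<close>
    define M' where "M' n = (\<Union>p. M p n)" for n
    have M'id: "ideal (M' n) R" if "n \<in> degrees s" for n
      unfolding M'_def by (rule increasing_union_ideal[of "\<lambda>p. M p n", OF Mid[OF that] Minc[OF that]])
    have MM': "M p n \<subseteq> M' n" for p n unfolding M'_def by blast
    have "stable s Y M'"
      unfolding stable_def
    proof (intro ballI conjI)
      fix n assume n: "n \<in> degrees s"
      show "ideal (M' n) R" by (rule M'id[OF n])
      fix jz assume jz: "jz \<in> Y"
      obtain j z where eq: "jz = (j, z)" by (cases jz)
      have "scale z (M p n) \<subseteq> M p (inc j 1 n)" for p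
        by (rule stableD(2)[OF Mst n]) (use jz eq in simp)
      then have "scale z (M' n) \<subseteq> M' (inc j 1 n)"
        unfolding M'_def scale_subset_iff by fast
      then show "case jz of (j, z) \<Rightarrow> scale z (M' n) \<subseteq> M' (inc j 1 n)" by (simp add: eq)
    qed
    moreover have "V' n \<subseteq> M' n" if "n \<in> degrees s" for n
      using V'M[OF that, of 0] MM'[of 0 n] by (rule subset_trans)
    moreover have "M' n \<subseteq> U n" for n unfolding M'_def using MU by (rule UN_least)
    ultimately have genM': "generated s Y M' V'"
      by (intro insert.IH[OF Y UY V' _ _ _ gen'])
    obtain D' where D': "generated_beyond s Y M' V' D'"
      using genM' unfolding generated_def by (elim exE)
    obtain p0 where p0: "\<And>n. n \<in> degrees s \<Longrightarrow> \<forall>j\<le>s. n j \<le> D' \<Longrightarrow> M' n = M p0 n"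
      using increasing_union_finite[OF finite_degree_box[of s D'], of M] Mid Minc unfolding M'_def by auto
    \<comment> \<open>The equality on the finite box spreads to all degrees by generation, with
      induction on the total degree.\<close>
    have M'M: "M' n \<subseteq> M p0 n" if "n \<in> degrees s" for n
      using that
    proof (induction "\<Sum>j\<le>s. n j" arbitrary: n rule: less_induct)
      case less
      show ?case
      proof (cases "\<forall>j\<le>s. n j \<le> D'")
        case True
        then show ?thesis using p0[OF less.prems] by simp
      next
        case False
        then obtain j1 where j1: "j1 \<le> s" "D' < n j1" by (auto simp: not_le)
        show ?thesis
        proof (rule generatedD[OF D' less.prems j1 Mid[OF less.prems] V'M[OF less.prems] acts_intoI])
          fix j z assume jz: "(j, z) \<in> Y" and pos: "0 < n j"
          have j: "j \<le> s" using jz Y by (auto simp: actors_def)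
          have "(\<Sum>l\<le>s. dec j 1 n l) < (\<Sum>l\<le>s. n l)"
            by (rule sum_strict_mono_ex1) (use j pos in \<open>auto simp: dec_apply intro!: bexI[of _ j]\<close>)
          then have "M' (dec j 1 n) \<subseteq> M p0 (dec j 1 n)"
            by (rule less.hyps[OF _ dec_degrees[OF less.prems]])
          then have "scale z (M' (dec j 1 n)) \<subseteq> scale z (M p0 (dec j 1 n))" by (rule scale_mono)
          also have "\<dots> \<subseteq> M p0 n" by (rule stable_dec[OF Mst jz less.prems pos])
          finally show "scale z (M' (dec j 1 n)) \<subseteq> M p0 n" .
        qed
      qed
    qed
    have "\<forall>p. \<exists>D. generated_beyond s Y (M p) V' D"
      using genM unfolding generated_def by (rule allI)
    from choice[OF this] obtain Dp where Dp: "\<forall>p. generated_beyond s Y (M p) V' (Dp p)"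
      by (elim exE)
    \<comment> \<open>For \<open>p \<le> p0\<close> the generation of \<open>M p\<close> is applied
      in degree \<open>n - p e_i\<close>; the summand \<open>p0\<close> keeps coordinate
      \<open>j0\<close> above \<open>Dp p\<close> after this subtraction.\<close>
    define D where "D = Max (Dp ` {..p0}) + p0"
    have D: "Dp p + p0 \<le> D" if "p \<le> p0" for p
      unfolding D_def using that by (intro add_mono Max_ge) auto
    show ?case
      unfolding iy_eq
    proof (rule generatedI[of s D])
      fix n j0 W0 assume n: "n \<in> degrees s" and j0: "j0 \<le> s" "D < n j0" and W0: "ideal W0 R"
        and VW0: "V n \<subseteq> W0" and YW0: "acts_into ?Y0 N n W0"
      \<comment> \<open>Intersecting with \<open>N n\<close> keeps the inclusions assumed for
        \<open>W0\<close>, and \<open>W \<subseteq> N n\<close> is what the modular law requires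
        later.\<close>
      define W where "W = W0 \<inter> N n"
      have W: "ideal W R" unfolding W_def by (rule inter_ideal[OF W0 Nid[OF n]])
      have VW: "V n \<subseteq> W" unfolding W_def using VW0 VN[OF n] by blast
      have YW: "scale z (N (dec j 1 n)) \<subseteq> W" if "(j, z) \<in> ?Y0" "0 < n j" for j z
        unfolding W_def using acts_intoD[OF YW0 that] stable_dec[OF N that(1) n that(2)] by blast
      \<comment> \<open>The filtration of \<open>U n\<close> by powers of \<open>y\<close>, with
        \<open>V n\<close> added. It contains \<open>U n\<close> at \<open>p = 0\<close> and has
        shrunk to \<open>V n\<close> once \<open>p > n i\<close>.\<close>
      define S where "S p = (if p \<le> n i then scale (y [^] p) (U (dec i p n)) else {\<zero>}) <+> V n" for p
      have S1: "ideal (if p \<le> n i then scale (y [^] p) (U (dec i p n)) else {\<zero>}) R" for p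
        using scale_ideal[OF yp Uid[OF dec_degrees[OF n]]] zeroideal by simp
      have Sid: "ideal (S p) R" for p unfolding S_def by (rule isum_ideal[OF S1 Vid[OF n]])
      have WS: "ideal (W <+> S p) R" for p by (rule isum_ideal[OF W Sid])
      have VWS: "V n \<subseteq> W <+> S p" for p using VW isum_upper1[OF W Sid] by (rule subset_trans)
      \<comment> \<open>A member of \<open>N n\<close> in \<open>S p\<close> is
        \<open>y^p m + v\<close> with \<open>m\<close> in \<open>M p d\<close>, so it suffices that
        multiplication by \<open>y^p\<close> maps \<open>M p d\<close> into
        \<open>W <+> S (Suc p)\<close>; that is \<open>MQ\<close>.\<close>
      have step: "N n \<inter> S p \<subseteq> W <+> S (Suc p)" for p
      proof (cases "p \<le> n i")
        case False
        have "S p \<subseteq> V n"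
          using False ideal_0[OF Vid[OF n]] unfolding S_def by (intro isum_least[OF Vid[OF n]]) auto
        then show ?thesis using VWS[of "Suc p"] by blast
      next
        case p: True
        define d where "d = dec i p n"
        have d: "d \<in> degrees s" unfolding d_def by (rule dec_degrees[OF n])
        have dn: "inc i p d = n" unfolding d_def by (rule inc_dec[of p n i, OF p])
        define Q where "Q = preimage (y [^] p) (W <+> S (Suc p)) (U d)"
        have Q: "ideal Q R" unfolding Q_def by (rule preimage_ideal[OF yp WS Uid[OF d]])
        have shS: "shift i (y [^] Suc p) U d \<subseteq> W <+> S (Suc p)"
        proof -
          have "shift i (y [^] Suc p) U d \<subseteq> S (Suc p)"
          proof (cases "d i = 0")
            case True
            then show ?thesis using ideal_0[OF Sid] by (simp add: shift_def)
          next
            case False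
            then have "Suc p \<le> n i" by (simp add: d_def dec_apply)
            moreover have "dec i 1 d = dec i (Suc p) n" by (simp add: d_def dec_add)
            ultimately show ?thesis
              using False isum_upper1[OF S1 Vid[OF n], of "Suc p"] by (simp add: shift_def S_def)
          qed
          then show ?thesis using isum_upper2[OF W Sid, of "Suc p"] by (rule subset_trans)
        qed
        have MQ: "M p d \<subseteq> Q"
        proof (cases "p \<le> p0")
          case True
          have "Dp p < d j0"
            using j0 D[OF True] True by (auto simp: d_def dec_apply)
          then show ?thesis
          proof (rule generatedD[OF spec[OF Dp, of p] d j0(1) _ Q])
            show "V' d \<subseteq> Q"
              unfolding V'_def
            proof (rule isum_least[OF Q])
              have "scale (y [^] p) (V d) \<subseteq> V n"
                using stable_pow[OF V iy Y0 d, of p] by (simp add: dn)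
              then show "V d \<subseteq> Q"
                unfolding Q_def subset_preimage_iff using VWS[of "Suc p"] VN[OF d] NU[OF d] by blast
              have "scale (y [^] p) (shift i y U d) = shift i (y [^] Suc p) U d"
                using shift_pow[OF d, of p 1] y by simp
              then show "shift i y U d \<subseteq> Q"
                unfolding Q_def subset_preimage_iff using shS shiftU[OF d] by simp
            qed
            show "acts_into Y (M p) d Q"
            proof (rule acts_intoI)
              fix j z assume jz: "(j, z) \<in> Y" and pos: "0 < d j"
              have z: "z \<in> carrier R" using jz Y by (auto simp: actors_def)
              have jz0: "(j, z) \<in> ?Y0" using jz by simp
              define e where "e = dec j 1 d"
              have e: "e \<in> degrees s" unfolding e_def by (rule dec_degrees[OF d])
              have ed: "inc j 1 e = d" unfolding e_def using pos by (simp add: inc_dec)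
              have en: "inc i p e = dec j 1 n"
                unfolding e_def using pos dn by (simp add: inc_dec_comm)
              have nj: "0 < n j" using pos by (auto simp: d_def dec_apply split: if_splits)
              have "scale (y [^] p) (scale z (M p e)) = scale z (scale (y [^] p) (M p e))"
                using ideal_subset[OF Mid[OF e]] z yp by (simp add: scale_scale m_comm)
              also have "\<dots> \<subseteq> scale z (Z p e)" by (rule scale_mono[OF yM])
              also have "\<dots> = scale z (N (inc i p e)) <+> scale z (shift i (y [^] Suc p) U e)"
                unfolding Z_def by (rule scale_sum[OF z ideal_subset[OF Nid'[OF e]] ideal_subset[OF sh[OF e]]])
              also have "\<dots> \<subseteq> W <+> S (Suc p)"
              proof (rule isum_least[OF WS])
                show "scale z (N (inc i p e)) \<subseteq> W <+> S (Suc p)"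
                  unfolding en using YW[OF jz0 nj] isum_upper1[OF W Sid] by (rule subset_trans)
                have "scale z (shift i (y [^] Suc p) U e) \<subseteq> shift i (y [^] Suc p) U d"
                  using shift_stable[OF U yp e jz0 z] by (simp only: ed)
                then show "scale z (shift i (y [^] Suc p) U e) \<subseteq> W <+> S (Suc p)"
                  using shS by (rule subset_trans)
              qed
              finally have "scale (y [^] p) (scale z (M p e)) \<subseteq> W <+> S (Suc p)" .
              moreover have "scale z (M p e) \<subseteq> U d"
                using scale_mono[OF MU] stableD(2)[OF U e jz0] unfolding ed by (rule subset_trans)
              ultimately show "scale z (M p (dec j 1 d)) \<subseteq> Q"
                unfolding Q_def subset_preimage_iff e_def by simp
            qed
          qed
        next
          case False
          \<comment> \<open>Past \<open>p0\<close> no new coefficients occur: for \<open>m\<close>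
            in \<open>M p0 d\<close>, \<open>y^p0 m\<close> lies in \<open>N\<close> up to a higher
            power of \<open>y\<close>, and the surplus \<open>y^(r+1)\<close> ends with an actor
            step from \<open>N (n - e_i)\<close> into \<open>W\<close>.\<close>
          then obtain r where r: "p = Suc r + p0" by (metis less_iff_Suc_add not_le add.commute add_Suc_right)
          have "M p d \<subseteq> M p0 d" using MM'[of p d] M'M[OF d] by (rule subset_trans)
          then have "scale (y [^] p) (M p d) \<subseteq> scale (y [^] p) (M p0 d)" by (rule scale_mono)
          also have "\<dots> = scale (y [^] Suc r) (scale (y [^] p0) (M p0 d))"
            unfolding r using ideal_subset[OF Mid[OF d]] yp y by (simp only: scale_scale nat_pow_mult)
          also have "\<dots> \<subseteq> scale (y [^] Suc r) (Z p0 d)" by (rule scale_mono[OF yM])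
          also have "\<dots> = scale (y [^] Suc r) (N (inc i p0 d)) <+> scale (y [^] Suc r) (shift i (y [^] Suc p0) U d)"
            unfolding Z_def by (rule scale_sum[OF yp ideal_subset[OF Nid'[OF d]] ideal_subset[OF sh[OF d]]])
          also have "\<dots> \<subseteq> W <+> S (Suc p)"
          proof (rule isum_least[OF WS])
            have np: "0 < n i" using p r by simp
            have "dec i 1 n = inc i r (inc i p0 d)"
              using p r by (auto simp: d_def inc_def dec_def)
            then have "scale (y [^] r) (N (inc i p0 d)) \<subseteq> N (dec i 1 n)"
              using stable_pow[OF N iy Y0 inc_degrees[OF d i]] by simp
            then have "scale y (scale (y [^] r) (N (inc i p0 d))) \<subseteq> W"
              using YW[OF iy np] scale_mono by blast
            moreover have "scale y (scale (y [^] r) (N (inc i p0 d))) = scale (y [^] Suc r) (N (inc i p0 d))"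
              using ideal_subset[OF Nid'[OF d]] y by (simp add: scale_scale m_comm)
            ultimately show "scale (y [^] Suc r) (N (inc i p0 d)) \<subseteq> W <+> S (Suc p)"
              using isum_upper1[OF W Sid] by blast
            have "scale (y [^] Suc r) (shift i (y [^] Suc p0) U d) = shift i (y [^] Suc p) U d"
              unfolding shift_pow[OF d] r by simp
            then show "scale (y [^] Suc r) (shift i (y [^] Suc p0) U d) \<subseteq> W <+> S (Suc p)"
              using shS by simp
          qed
          finally show ?thesis
            unfolding Q_def subset_preimage_iff using MU[of p d] by blast
        qed
        show ?thesis
        proof
          fix w assume w: "w \<in> N n \<inter> S p"
          then have "w \<in> scale (y [^] p) (U d) <+> V n" using p unfolding S_def d_def by simp
          then obtain x v where "x \<in> scale (y [^] p) (U d)" and v: "v \<in> V n" and "w = x \<oplus> v"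
            unfolding isum_mem by blast
          then obtain m where m: "m \<in> U d" and wmv: "w = y [^] p \<otimes> m \<oplus> v"
            unfolding scale_def by blast
          have carr: "y [^] p \<otimes> m \<in> carrier R" "v \<in> carrier R"
            using ideal_carr[OF Uid[OF d] m] ideal_carr[OF Vid[OF n] v] yp by auto
          have "y [^] p \<otimes> m = w \<ominus> v" unfolding wmv by (rule add_minus_cancel_right[OF carr, symmetric])
          moreover have "w \<ominus> v \<in> N n"
            using w v VN[OF n] by (intro ideal_minus[OF Nid[OF n]]) auto
          ultimately have "y [^] p \<otimes> m \<in> N (inc i p d)" by (simp add: dn)
          then have "y [^] p \<otimes> m \<in> Z p d"
            unfolding Z_def using isum_upper1[OF Nid'[OF d] sh[OF d]] by blast
          then have "m \<in> M p d" using m by (simp add: M_def preimage_def)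
          then have "m \<in> Q" using MQ by blast
          then have "y [^] p \<otimes> m \<in> W <+> S (Suc p)" by (simp add: Q_def preimage_def)
          moreover have "v \<in> W <+> S (Suc p)" using v VWS by blast
          ultimately show "w \<in> W <+> S (Suc p)" unfolding wmv by (rule ideal_add[OF WS])
        qed
      qed
      have "N n \<subseteq> W <+> (N n \<inter> S p)" for p
      proof (induction p)
        case 0
        have "N n \<subseteq> S 0"
          unfolding S_def using NU[OF n] isum_upper1[OF Uid[OF n] Vid[OF n]] ideal_subset[OF Uid[OF n]]
          by (simp add: scale_one)
        then show ?case using isum_upper2[OF W inter_ideal[OF Nid[OF n] Sid], of 0] by blast
      next
        case (Suc p)
        have WN: "W \<subseteq> N n" unfolding W_def by blast
        have "N n \<inter> S p \<subseteq> N n \<inter> (W <+> S (Suc p))" using step by blast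
        also have "\<dots> \<subseteq> W <+> (N n \<inter> S (Suc p))" by (rule modular_law[OF Nid[OF n] W Sid WN])
        finally have "W <+> (N n \<inter> S p) \<subseteq> W <+> (N n \<inter> S (Suc p))"
          by (intro isum_least isum_ideal W inter_ideal Nid[OF n] Sid isum_upper1)
        with Suc.IH show ?case by (rule subset_trans)
      qed
      \<comment> \<open>At \<open>Suc (n i)\<close> the filtration is exhausted.\<close>
      from this[of "Suc (n i)"] have "N n \<subseteq> W <+> (N n \<inter> S (Suc (n i)))" .
      moreover have "S (Suc (n i)) \<subseteq> W"
        unfolding S_def using VW ideal_0[OF W] by (intro isum_least[OF W]) auto
      then have "W <+> (N n \<inter> S (Suc (n i))) \<subseteq> W" by (intro isum_least[OF W]) auto
      ultimately show "N n \<subseteq> W0" unfolding W_def by blast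
    qed
  qed
qed

end

section \<open>Hilbert functions of multigraded families\<close>

lemma enat_finite_le: "a \<le> b \<Longrightarrow> b \<noteq> \<infinity> \<Longrightarrow> a \<noteq> (\<infinity>::enat)"
  by (cases a; cases b) auto

lemma ev_polyfun_cong:
  assumes "ev_polyfun s f" "for_large s (\<lambda>n. f n = g n)"
  shows "ev_polyfun s g"
proof -
  obtain h where h: "polyfun s h" "for_large s (\<lambda>n. f n = h n)"
    using assms(1) unfolding ev_polyfun_def by (elim exE conjE)
  have "for_large s (\<lambda>n. g n = h n)"
    by (rule for_large_mono[OF for_large_conj[OF h(2) assms(2)]]) auto
  then show ?thesis unfolding ev_polyfun_def using h(1) by (intro exI conjI)
qed

lemma ev_polyfun_const: "ev_polyfun s (\<lambda>n. c)"
  unfolding ev_polyfun_def by (intro exI[of _ "\<lambda>n. c"] conjI polyfun.const for_large_True) simp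

lemma for_large_Suc: "for_large s P \<Longrightarrow> for_large s (\<lambda>n. P (n(i := Suc (n i))))"
  unfolding for_large_def
proof (elim exE)
  fix N assume N: "\<forall>n. (\<forall>j\<le>s. N \<le> n j) \<longrightarrow> P n"
  have "\<forall>j\<le>s. N \<le> (n(i := Suc (n i))) j" if "\<forall>j\<le>s. N \<le> n j" for n
    using that by (auto intro: le_SucI)
  then show "\<exists>N. \<forall>n. (\<forall>j\<le>s. N \<le> n j) \<longrightarrow> P (n(i := Suc (n i)))"
    using N by (intro exI[of _ N] allI impI) simp
qed

lemma ev_polyfun_Suc:
  assumes "ev_polyfun s f"
  shows "ev_polyfun s (\<lambda>n. f (n(i := Suc (n i))))"
proof -
  obtain h where h: "polyfun s h" "for_large s (\<lambda>n. f n = h n)"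
    using assms(1) unfolding ev_polyfun_def by (elim exE conjE)
  have "polyfun s (\<lambda>n. of_nat ((n(i := Suc (n i))) j))" if "j \<le> s" for j
  proof (cases "j = i")
    case True
    then show ?thesis
      using polyfun.add[OF polyfun.const[of s 1] polyfun.var[OF that]] by simp
  qed (simp add: polyfun.var that)
  then have "polyfun s (\<lambda>n. h (n(i := Suc (n i))))"
    by (rule polyfun_subst[OF h(1)])
  then show ?thesis
    unfolding ev_polyfun_def using for_large_Suc[OF h(2), of i] by (intro exI conjI)
qed

definition cut :: "nat \<Rightarrow> (nat \<Rightarrow> nat) \<Rightarrow> (nat \<Rightarrow> nat)" where
  "cut s n = (\<lambda>j. if j \<le> s then n j else 0)"

lemma cut_degrees: "cut s n \<in> degrees s"
  by (simp add: cut_def degrees_def)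

lemma cut_inc: "i \<le> s \<Longrightarrow> cut s (n(i := Suc (n i))) = inc i 1 (cut s n)"
  by (auto simp: cut_def inc_def fun_eq_iff)

lemma cut_apply: "j \<le> s \<Longrightarrow> cut s n j = n j"
  by (simp add: cut_def)

context cring
begin

text \<open>\<open>cut\<close> moves the argument into \<open>degrees s\<close>. Lengths are shown
  finite wherever the value of \<open>the_enat\<close> matters.\<close>

definition hilb :: "nat \<Rightarrow> ((nat \<Rightarrow> nat) \<Rightarrow> 'a set) \<Rightarrow> ((nat \<Rightarrow> nat) \<Rightarrow> 'a set) \<Rightarrow> (nat \<Rightarrow> nat) \<Rightarrow> rat" where
  "hilb s V U n = of_nat (the_enat (ilen (V (cut s n)) (U (cut s n))))"

text \<open>For the kernel of an actor \<open>y\<close>: there \<open>y\<close> produces only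
  elements of \<open>V\<close>, which the test ideals contain anyway.\<close>

lemma generated_remove:
  assumes gen: "generated s Y U V" and V: "\<And>n. n \<in> degrees s \<Longrightarrow> 0 < n i \<Longrightarrow> scale y (U (dec i 1 n)) \<subseteq> V n"
  shows "generated s (Y - {(i, y)}) U V"
proof -
  obtain D where D: "generated_beyond s Y U V D" using gen unfolding generated_def by (elim exE)
  show ?thesis
  proof (rule generatedI[of s D])
    fix n j W assume n: "n \<in> degrees s" and j: "j \<le> s" "D < n j" and W: "ideal W R" and VW: "V n \<subseteq> W"
      and Y: "acts_into (Y - {(i, y)}) U n W"
    show "U n \<subseteq> W"
    proof (rule generatedD[OF D n j W VW acts_intoI])
      fix k z assume kz: "(k, z) \<in> Y" "0 < n k"
      show "scale z (U (dec k 1 n)) \<subseteq> W"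
      proof (cases "(k, z) = (i, y)")
        case True
        then have "scale z (U (dec k 1 n)) \<subseteq> V n" using V[OF n] kz by simp
        then show ?thesis using VW by (rule subset_trans)
      next
        case False
        then have "(k, z) \<in> Y - {(i, y)}" using kz by blast
        then show ?thesis by (rule acts_intoD[OF Y _ kz(2)])
      qed
    qed
  qed
qed

lemma the_enat_add: "a \<noteq> \<infinity> \<Longrightarrow> b \<noteq> \<infinity> \<Longrightarrow> the_enat (a + b) = the_enat a + the_enat b"
  by (cases a; cases b) auto

text \<open>A direction without actors carries no elements far out, and an actor \<open>y\<close> of degree \<open>i\<close> expresses
  the difference in direction \<open>i\<close> through the kernel and cokernel of \<open>y\<close>, on which \<open>y\<close> is not needed.\<close>
lemma generated_no_actor:
  assumes Y: "actors s Y" and V: "stable s Y V"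
    and gen: "generated s Y U V" and i: "i \<le> s" "\<And>y. (i, y) \<notin> Y"
  shows "\<exists>D. \<forall>n\<in>degrees s. D < n i \<longrightarrow> U n \<subseteq> V n"
proof -
  obtain D where D: "generated_beyond s Y U V D" using gen unfolding generated_def by (elim exE)
  have "U n \<subseteq> V n" if "n \<in> degrees s" "D < n i" for n
    using that
  proof (induction "\<Sum>j\<le>s. n j" arbitrary: n rule: less_induct)
    case less
    show ?case
    proof (rule generatedD[OF D less.prems(1) i(1) less.prems(2) stableD(1)[OF V less.prems(1)] order_refl acts_intoI])
      fix j z assume jz: "(j, z) \<in> Y" and pos: "0 < n j"
      have j: "j \<le> s" using jz Y by (auto simp: actors_def)
      have ji: "j \<noteq> i" using jz i(2) by blast
      have "(\<Sum>l\<le>s. dec j 1 n l) < (\<Sum>l\<le>s. n l)"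
        by (rule sum_strict_mono_ex1) (use j pos in \<open>auto simp: dec_apply intro!: bexI[of _ j]\<close>)
      then have "U (dec j 1 n) \<subseteq> V (dec j 1 n)"
        by (rule less.hyps[OF _ dec_degrees[OF less.prems(1)]]) (use ji less.prems in \<open>simp add: dec_apply\<close>)
      then have "scale z (U (dec j 1 n)) \<subseteq> scale z (V (dec j 1 n))" by (rule scale_mono)
      also have "\<dots> \<subseteq> V n" by (rule stable_dec[OF V jz less.prems(1) pos])
      finally show "scale z (U (dec j 1 n)) \<subseteq> V n" .
    qed
  qed
  then show ?thesis by blast
qed

text \<open>Exact sequence of kernel, source, target and cokernel for multiplication by
  \<open>y\<close> from degree \<open>n\<close> to degree \<open>n + e_i\<close>. The identity is
  stated with sums because lengths may be infinite.\<close>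

lemma ilen_actor:
  assumes Y: "actors s Y" and U: "stable s Y U" and V: "stable s Y V" and iy: "(i, y) \<in> Y"
    and VU: "\<And>n. n \<in> degrees s \<Longrightarrow> V n \<subseteq> U n" and n: "n \<in> degrees s"
  defines "C \<equiv> \<lambda>n. V n <+> shift i y U n" and "K \<equiv> \<lambda>n. preimage y (V (inc i 1 n)) (U n)"
  shows "ilen (V (inc i 1 n)) (U (inc i 1 n)) + ilen (V n) (K n)
    = ilen (C (inc i 1 n)) (U (inc i 1 n)) + ilen (V n) (U n)"
proof -
  have i: "i \<le> s" and y: "y \<in> carrier R" using Y iy by (auto simp: actors_def)
  have n': "inc i 1 n \<in> degrees s" by (rule inc_degrees[OF n i])
  note Un = stableD(1)[OF U n] and Vn = stableD(1)[OF V n]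
  note Un' = stableD(1)[OF U n'] and Vn' = stableD(1)[OF V n']
  have yU: "ideal (scale y (U n)) R" by (rule scale_ideal[OF y Un])
  have C: "C (inc i 1 n) = scale y (U n) <+> V (inc i 1 n)"
    unfolding C_def shift_def dec_inc using isum_comm[OF Vn' yU] by (simp add: inc_apply)
  have Cid: "ideal (C (inc i 1 n)) R" unfolding C by (rule isum_ideal[OF yU Vn'])
  have VC: "V (inc i 1 n) \<subseteq> C (inc i 1 n)" unfolding C by (rule isum_upper2[OF yU Vn'])
  have CU: "C (inc i 1 n) \<subseteq> U (inc i 1 n)"
    unfolding C by (rule isum_least[OF Un' stableD(2)[OF U n iy] VU[OF n']])
  have Kid: "ideal (K n) R" unfolding K_def by (rule preimage_ideal[OF y Vn' Un])
  have VK: "V n \<subseteq> K n"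
    unfolding K_def subset_preimage_iff using VU[OF n] stableD(2)[OF V n iy] by simp
  have KU: "K n \<subseteq> U n" unfolding K_def by (rule preimage_subset)
  have "ilen (V (inc i 1 n)) (U (inc i 1 n)) = ilen (K n) (U n) + ilen (C (inc i 1 n)) (U (inc i 1 n))"
    using ilen_add[OF Vn' Cid Un' VC CU] ilen_scale[OF y Un Vn'] unfolding C K_def by simp
  moreover have "ilen (V n) (U n) = ilen (V n) (K n) + ilen (K n) (U n)"
    by (rule ilen_add[OF Vn Kid Un VK KU])
  ultimately show ?thesis by (simp add: ac_simps)
qed

end

section \<open>The Hilbert-Serre theorem\<close>

context noetherian_cring
begin

text \<open>A function is eventually polynomial once its differences in all directions are. Each
  direction is treated separately: it has no actor, or one of its actors is removed for the
  induction hypothesis.\<close>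

theorem hilbert_serre:
  assumes "actors s Y" "stable s Y U" "stable s Y V" "\<And>n. n \<in> degrees s \<Longrightarrow> V n \<subseteq> U n"
    "generated s Y U V" "\<And>n. n \<in> degrees s \<Longrightarrow> ilen (V n) (U n) \<noteq> \<infinity>"
  shows "ev_polyfun s (hilb s V U)"
proof -
  have "finite Y" using assms(1) by (simp add: actors_def)
  then show ?thesis using assms
  proof (induction Y arbitrary: U V rule: finite_psubset_induct)
    case (psubset Y)
    note Y = psubset.prems(1) and U = psubset.prems(2) and V = psubset.prems(3) and VU = psubset.prems(4)
      and gen = psubset.prems(5) and fin = psubset.prems(6)
    show ?case
    proof (rule ev_polyfun_of_differences)
      fix n n' :: "nat \<Rightarrow> nat" assume "\<And>i. i \<le> s \<Longrightarrow> n i = n' i"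
      then have "cut s n = cut s n'" by (auto simp: cut_def)
      then show "hilb s V U n = hilb s V U n'" by (simp add: hilb_def)
    next
      fix i assume i: "i \<le> s"
      show "ev_polyfun s (\<lambda>n. hilb s V U (n(i := Suc (n i))) - hilb s V U n)"
      proof (cases "\<exists>y. (i, y) \<in> Y")
        case False
        then obtain D where D: "\<forall>n\<in>degrees s. D < n i \<longrightarrow> U n \<subseteq> V n"
          using generated_no_actor[OF Y V gen i] by blast
        have zero: "hilb s V U n = 0" if "D < n i" for n
        proof -
          have "U (cut s n) \<subseteq> V (cut s n)"
            using bspec[OF D cut_degrees[of s n]] that i by (simp add: cut_apply)
          then have "U (cut s n) = V (cut s n)" using VU[OF cut_degrees[of s n]] by (rule antisym)
          then show ?thesis by (simp add: hilb_def zero_enat_def)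
        qed
        have "for_large s (\<lambda>n. 0 = hilb s V U (n(i := Suc (n i))) - hilb s V U n)"
          unfolding for_large_def
        proof (intro exI[of _ "Suc D"] allI impI)
          fix n assume "\<forall>j\<le>s. Suc D \<le> n j"
          then have "D < n i" using i by (auto simp: Suc_le_eq)
          then show "0 = hilb s V U (n(i := Suc (n i))) - hilb s V U n" by (simp add: zero)
        qed
        then show ?thesis by (rule ev_polyfun_cong[OF ev_polyfun_const])
      next
        case True
        then obtain y where iy: "(i, y) \<in> Y" by blast
        let ?Y = "Y - {(i, y)}"
        have sub: "?Y \<subset> Y" using iy by blast
        have Y': "actors s ?Y" using Y by (auto simp: actors_def)
        have y: "y \<in> carrier R" using Y iy by (auto simp: actors_def)
        note U' = stable_subset[OF U psubset_imp_subset[OF sub]]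
          and V' = stable_subset[OF V psubset_imp_subset[OF sub]]
        define C where "C = (\<lambda>n. V n <+> shift i y U n)"
        define K where "K = (\<lambda>n. preimage y (V (inc i 1 n)) (U n))"
        have ins: "insert (i, y) ?Y = Y" using iy by blast
        have C: "stable s ?Y C" unfolding C_def by (rule stable_shift_sum[OF U' V' Y' y])
        have genC: "generated s ?Y U C"
          unfolding C_def by (rule generated_cokernel[OF _ U V y]) (use gen ins in simp)
        have CU: "C n \<subseteq> U n" if n: "n \<in> degrees s" for n
          unfolding C_def
        proof (rule isum_least[OF stableD(1)[OF U n] VU[OF n]])
          show "shift i y U n \<subseteq> U n"
            using stable_dec[OF U iy n] ideal_0[OF stableD(1)[OF U n]] by (auto simp: shift_def)
        qed
        have K: "stable s Y K"
          unfolding stable_def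
        proof (intro ballI conjI)
          fix n assume n: "n \<in> degrees s"
          have n': "inc i 1 n \<in> degrees s" by (rule inc_degrees[OF n i])
          show Kn: "ideal (K n) R"
            unfolding K_def by (rule preimage_ideal[OF y stableD(1)[OF V n'] stableD(1)[OF U n]])
          fix jz assume jz: "jz \<in> Y"
          obtain j z where eq: "jz = (j, z)" by (cases jz)
          have z: "z \<in> carrier R" using jz eq Y by (auto simp: actors_def)
          have jz': "(j, z) \<in> Y" using jz eq by simp
          have KU: "K n \<subseteq> U n" unfolding K_def by (rule preimage_subset)
          have "scale y (scale z (K n)) = scale z (scale y (K n))"
            using ideal_subset[OF Kn] y z by (simp add: scale_scale m_comm)
          also have "\<dots> \<subseteq> scale z (V (inc i 1 n))"
            by (rule scale_mono) (simp add: K_def preimage_def scale_subset_iff)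
          also have "\<dots> \<subseteq> V (inc j 1 (inc i 1 n))" by (rule stableD(2)[OF V n' jz'])
          finally have "scale y (scale z (K n)) \<subseteq> V (inc i 1 (inc j 1 n))" by (simp only: inc_inc)
          moreover have "scale z (K n) \<subseteq> U (inc j 1 n)"
            using scale_mono[OF KU] stableD(2)[OF U n jz'] by (rule subset_trans)
          ultimately have "scale z (K n) \<subseteq> K (inc j 1 n)"
            unfolding K_def[THEN fun_cong, of "inc j 1 n"] subset_preimage_iff by (intro conjI)
          then show "case jz of (j, z) \<Rightarrow> scale z (K n) \<subseteq> K (inc j 1 n)" by (simp add: eq)
        qed
        have VK: "V n \<subseteq> K n" if n: "n \<in> degrees s" for n
          unfolding K_def subset_preimage_iff using VU[OF n] stableD(2)[OF V n iy] by simp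
        have KU: "K n \<subseteq> U n" for n unfolding K_def by (rule preimage_subset)
        \<comment> \<open>The basis theorem enters here: the kernel is a submodule and needs its own
          finite generation, first with all actors; then \<open>y\<close> is dropped because it
          sends the kernel into \<open>V\<close>.\<close>
        have "generated s Y K V" by (rule generated_submodule[OF Y U V K VK KU gen])
        moreover have "scale y (K (dec i 1 n)) \<subseteq> V n" if "0 < n i" for n
          using that by (auto simp: K_def preimage_def scale_subset_iff inc_dec)
        ultimately have genK: "generated s ?Y K V" by (rule generated_remove)
        have finC: "ilen (C n) (U n) \<noteq> \<infinity>" and finK: "ilen (V n) (K n) \<noteq> \<infinity>" if n: "n \<in> degrees s" for n
        proof -
          note Cid = stableD(1)[OF C n] and Vid = stableD(1)[OF V n]
          have "V n \<subseteq> C n" unfolding C_def by (rule isum_upper1[OF Vid shift_ideal[OF U y n]])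
          then have "ilen (C n) (U n) \<le> ilen (V n) (U n)" by (rule ilen_mono) simp
          then show "ilen (C n) (U n) \<noteq> \<infinity>" by (rule enat_finite_le[OF _ fin[OF n]])
          have "ilen (V n) (K n) \<le> ilen (V n) (U n)" by (rule ilen_mono) (simp_all add: KU)
          then show "ilen (V n) (K n) \<noteq> \<infinity>" by (rule enat_finite_le[OF _ fin[OF n]])
        qed
        have evC: "ev_polyfun s (hilb s C U)" by (rule psubset.IH[OF sub Y' U' C CU genC finC])
        have evK: "ev_polyfun s (hilb s V K)"
          by (rule psubset.IH[OF sub Y' stable_subset[OF K psubset_imp_subset[OF sub]] V' VK genK finK])
        have "hilb s C U (n(i := Suc (n i))) - hilb s V K n = hilb s V U (n(i := Suc (n i))) - hilb s V U n" for n
        proof -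
          let ?n = "cut s n"
          have n: "?n \<in> degrees s" by (rule cut_degrees)
          have n': "inc i 1 ?n \<in> degrees s" by (rule inc_degrees[OF n i])
          have "the_enat (ilen (V (inc i 1 ?n)) (U (inc i 1 ?n))) + the_enat (ilen (V ?n) (K ?n))
              = the_enat (ilen (C (inc i 1 ?n)) (U (inc i 1 ?n))) + the_enat (ilen (V ?n) (U ?n))"
            using arg_cong[OF ilen_actor[OF Y U V iy VU n], of the_enat] fin[OF n] fin[OF n'] finC[OF n'] finK[OF n]
            unfolding C_def K_def by (simp add: the_enat_add)
          from arg_cong[OF this, of "of_nat :: nat \<Rightarrow> rat"] show ?thesis
            unfolding hilb_def cut_inc[OF i] by (simp add: algebra_simps)
        qed
        then have "(\<lambda>n. hilb s V U (n(i := Suc (n i))) - hilb s V U n)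
            = (\<lambda>n. hilb s C U (n(i := Suc (n i))) - hilb s V K n)" by simp
        then show ?thesis by (simp add: ev_polyfun_diff ev_polyfun_Suc evC evK)
      qed
    qed
  qed
qed

end

section \<open>Products of ideals and the Artin--Rees lemma\<close>

context cring
begin

lemma prod_ideal: "ideal A R \<Longrightarrow> ideal B R \<Longrightarrow> ideal (A \<cdot> B) R"
  by (rule ideal_prod_is_ideal)

lemma prod_mem: "a \<in> A \<Longrightarrow> b \<in> B \<Longrightarrow> a \<otimes> b \<in> A \<cdot> B"
  by (rule ideal_prod.prod)

lemma prod_le_iff:
  assumes C: "ideal C R"
  shows "A \<cdot> B \<subseteq> C \<longleftrightarrow> (\<forall>a\<in>A. \<forall>b\<in>B. a \<otimes> b \<in> C)"
proof
  assume sub: "A \<cdot> B \<subseteq> C"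
  show "\<forall>a\<in>A. \<forall>b\<in>B. a \<otimes> b \<in> C"
    by (intro ballI subsetD[OF sub] prod_mem)
next
  assume mem: "\<forall>a\<in>A. \<forall>b\<in>B. a \<otimes> b \<in> C"
  show "A \<cdot> B \<subseteq> C"
  proof
    fix x assume "x \<in> A \<cdot> B"
    then show "x \<in> C"
      by (induction rule: ideal_prod.induct) (simp_all add: mem ideal_add[OF C])
  qed
qed

lemma ideal_prod_mono: "ideal A' R \<Longrightarrow> ideal B' R \<Longrightarrow> A \<subseteq> A' \<Longrightarrow> B \<subseteq> B' \<Longrightarrow> A \<cdot> B \<subseteq> A' \<cdot> B'"
  by (subst prod_le_iff) (auto simp: subset_iff intro: prod_ideal prod_mem)

lemma prod_subset1: "ideal A R \<Longrightarrow> ideal B R \<Longrightarrow> A \<cdot> B \<subseteq> A"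
  using ideal_prod_inter[of A B] by simp

lemma prod_subset2: "ideal A R \<Longrightarrow> ideal B R \<Longrightarrow> A \<cdot> B \<subseteq> B"
  using ideal_prod_inter[of A B] by simp

lemma prod_one: "ideal A R \<Longrightarrow> carrier R \<cdot> A = A"
  using ideal_prod_one[of A] ideal_prod_commute[of A "carrier R"] oneideal by simp

lemma scale_prod_subset: "x \<in> A \<Longrightarrow> scale x B \<subseteq> A \<cdot> B"
  by (auto simp: scale_def intro: prod_mem)

lemma prod_sum_subset:
  assumes "ideal A R" "ideal B R" "ideal b R"
  shows "A \<cdot> (B <+> b) \<subseteq> (A \<cdot> B) <+> b"
  unfolding ideal_prod_distr(1)[OF assms] by (intro isum_mono prod_subset2 assms order_refl)

lemma prime_prod:
  assumes P: "primeideal P R" and "ideal A R" "ideal B R" "A \<cdot> B \<subseteq> P"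
  shows "A \<subseteq> P \<or> B \<subseteq> P"
proof (rule ccontr)
  assume "\<not> (A \<subseteq> P \<or> B \<subseteq> P)"
  then obtain a b where ab: "a \<in> A" "a \<notin> P" "b \<in> B" "b \<notin> P" by blast
  then have "a \<otimes> b \<in> P" using assms(4) prod_mem[of a A b B] by blast
  then show False using primeideal.I_prime[OF P, of a b] ab ideal_carr[OF assms(2)] ideal_carr[OF assms(3)] by blast
qed

section \<open>Powers, finite products and monomials of ideals\<close>

definition ipow :: "'a set \<Rightarrow> nat \<Rightarrow> 'a set" where
  "ipow A n = A [^]\<^bsub>ideals_set R\<^esub> n"

lemma ipow_0 [simp]: "ipow A 0 = carrier R"
proof -
  interpret ideals: comm_monoid "ideals_set R" by (rule ideals_set_is_comm_monoid)
  show ?thesis by (simp add: ipow_def) (simp add: ideals_set_def)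
qed

lemma ipow_Suc_right: "ipow A (Suc n) = ipow A n \<cdot> A"
proof -
  interpret ideals: comm_monoid "ideals_set R" by (rule ideals_set_is_comm_monoid)
  show ?thesis by (simp add: ipow_def) (simp add: ideals_set_def)
qed

lemma ipow_ideal: "ideal A R \<Longrightarrow> ideal (ipow A n) R"
  by (induction n) (simp_all add: oneideal ipow_Suc_right prod_ideal)

lemma ipow_Suc: "ideal A R \<Longrightarrow> ipow A (Suc n) = A \<cdot> ipow A n"
  by (simp add: ipow_Suc_right ideal_prod_commute ipow_ideal)

lemma ipow_1: "ideal A R \<Longrightarrow> ipow A 1 = A"
  by (simp add: ipow_Suc ideal_prod_one)

lemma ipow_add: "ideal A R \<Longrightarrow> ipow A (m + n) = ipow A m \<cdot> ipow A n"
  by (induction m) (simp_all add: prod_one ipow_ideal ipow_Suc ideal_prod_assoc)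

lemma ipow_Suc_subset: "ideal A R \<Longrightarrow> ipow A (Suc n) \<subseteq> ipow A n"
  by (simp add: ipow_Suc prod_subset2 ipow_ideal)

lemma ipow_antimono: "ideal A R \<Longrightarrow> m \<le> n \<Longrightarrow> ipow A n \<subseteq> ipow A m"
  by (rule lift_Suc_antimono_le[of "ipow A", OF ipow_Suc_subset])

lemma ipow_mono: "ideal A R \<Longrightarrow> ideal B R \<Longrightarrow> A \<subseteq> B \<Longrightarrow> ipow A n \<subseteq> ipow B n"
  by (induction n) (simp_all add: ipow_Suc ideal_prod_mono ipow_ideal)

lemma ipow_mult: "ideal A R \<Longrightarrow> ipow A (m * n) = ipow (ipow A m) n"
  by (induction n) (simp_all add: ipow_add ipow_Suc ipow_ideal)

lemma prime_ipow: "primeideal P R \<Longrightarrow> ideal A R \<Longrightarrow> ipow A n \<subseteq> P \<Longrightarrow> A \<subseteq> P"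
proof (induction n)
  case 0
  then have "carrier R \<subseteq> P" by simp
  then show ?case using ideal_subset[OF \<open>ideal A R\<close>] by blast
next
  case (Suc n)
  then show ?case using prime_prod[of P A "ipow A n"] by (auto simp: ipow_Suc ipow_ideal)
qed

lemma pow_mem_ipow: "ideal A R \<Longrightarrow> x \<in> A \<Longrightarrow> x [^] (n::nat) \<in> ipow A n"
  by (induction n) (auto simp: ipow_Suc_right intro: prod_mem)

definition iprod :: "(nat \<Rightarrow> 'a set) \<Rightarrow> nat set \<Rightarrow> 'a set" where
  "iprod f S = (\<Otimes>\<^bsub>ideals_set R\<^esub> i\<in>S. f i)"

lemma iprod_empty: "iprod f {} = carrier R"
proof -
  interpret ideals: comm_monoid "ideals_set R" by (rule ideals_set_is_comm_monoid)
  show ?thesis by (simp add: iprod_def) (simp add: ideals_set_def)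
qed

lemma iprod_insert:
  assumes "finite S" "i \<notin> S" "\<And>j. j \<in> insert i S \<Longrightarrow> ideal (f j) R"
  shows "iprod f (insert i S) = f i \<cdot> iprod f S"
proof -
  interpret ideals: comm_monoid "ideals_set R" by (rule ideals_set_is_comm_monoid)
  have "(\<Otimes>\<^bsub>ideals_set R\<^esub> j\<in>insert i S. f j) = f i \<otimes>\<^bsub>ideals_set R\<^esub> (\<Otimes>\<^bsub>ideals_set R\<^esub> j\<in>S. f j)"
    using assms by (intro ideals.finprod_insert) (auto simp: ideals_set_def)
  then show ?thesis by (simp add: iprod_def ideals_set_def)
qed

lemma iprod_singleton: "ideal (f i) R \<Longrightarrow> iprod f {i} = f i"
  using iprod_insert[of "{}" i f] by (simp add: iprod_empty ideal_prod_one)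

lemma iprod_cong: "(\<And>i. i \<in> S \<Longrightarrow> ideal (f i) R) \<Longrightarrow> (\<And>i. i \<in> S \<Longrightarrow> f i = g i) \<Longrightarrow> iprod f S = iprod g S"
proof -
  interpret ideals: comm_monoid "ideals_set R" by (rule ideals_set_is_comm_monoid)
  assume "\<And>i. i \<in> S \<Longrightarrow> ideal (f i) R" "\<And>i. i \<in> S \<Longrightarrow> f i = g i"
  then show ?thesis
    unfolding iprod_def by (intro ideals.finprod_cong') (auto simp: ideals_set_def)
qed

lemma iprod_ideal:
  assumes "finite S" "\<And>i. i \<in> S \<Longrightarrow> ideal (f i) R"
  shows "ideal (iprod f S) R"
  using assms
proof (induction S rule: finite_induct)
  case (insert i S)
  have "iprod f (insert i S) = f i \<cdot> iprod f S"
    by (rule iprod_insert[OF insert.hyps insert.prems])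
  then show ?case using insert by (simp add: prod_ideal)
qed (simp add: iprod_empty oneideal)

lemma iprod_mono:
  assumes "finite S" "\<And>i. i \<in> S \<Longrightarrow> ideal (f i) R" "\<And>i. i \<in> S \<Longrightarrow> ideal (g i) R" "\<And>i. i \<in> S \<Longrightarrow> f i \<subseteq> g i"
  shows "iprod f S \<subseteq> iprod g S"
  using assms
proof (induction S rule: finite_induct)
  case (insert i S)
  have "iprod f (insert i S) = f i \<cdot> iprod f S" "iprod g (insert i S) = g i \<cdot> iprod g S"
    by (rule iprod_insert[OF insert.hyps]; use insert.prems in simp)+
  then show ?case using insert by (simp add: ideal_prod_mono iprod_ideal)
qed (simp add: iprod_empty)

lemma iprod_subset:
  assumes "finite S" "\<And>i. i \<in> S \<Longrightarrow> ideal (f i) R" "i \<in> S"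
  shows "iprod f S \<subseteq> f i"
proof -
  have "iprod f (insert i (S - {i})) = f i \<cdot> iprod f (S - {i})"
    by (rule iprod_insert) (use assms in auto)
  moreover have "f i \<cdot> iprod f (S - {i}) \<subseteq> f i"
    by (intro prod_subset1 iprod_ideal) (use assms in auto)
  ultimately show ?thesis using assms(3) by (simp add: insert_absorb)
qed

lemma iprod_mult:
  assumes "finite S" "\<And>i. i \<in> S \<Longrightarrow> ideal (f i) R" "\<And>i. i \<in> S \<Longrightarrow> ideal (g i) R"
  shows "iprod (\<lambda>i. f i \<cdot> g i) S = iprod f S \<cdot> iprod g S"
proof -
  interpret ideals: comm_monoid "ideals_set R" by (rule ideals_set_is_comm_monoid)
  have "(\<Otimes>\<^bsub>ideals_set R\<^esub> i\<in>S. f i \<otimes>\<^bsub>ideals_set R\<^esub> g i)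
      = (\<Otimes>\<^bsub>ideals_set R\<^esub> i\<in>S. f i) \<otimes>\<^bsub>ideals_set R\<^esub> (\<Otimes>\<^bsub>ideals_set R\<^esub> i\<in>S. g i)"
    using assms by (intro ideals.finprod_multf) (auto simp: ideals_set_def)
  then show ?thesis by (simp add: iprod_def ideals_set_def)
qed

lemma prime_iprod:
  assumes P: "primeideal P R" and "finite S" "\<And>i. i \<in> S \<Longrightarrow> ideal (f i) R" "iprod f S \<subseteq> P"
  shows "\<exists>i\<in>S. f i \<subseteq> P"
  using assms(2-)
proof (induction S rule: finite_induct)
  case empty
  then have "P = carrier R" using ideal_subset[OF primeideal.axioms(1)[OF P]] by (simp add: iprod_empty antisym)
  then show ?case using primeideal.I_notcarr[OF P] by simp
next
  case (insert i S)
  have "iprod f (insert i S) = f i \<cdot> iprod f S"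
    by (rule iprod_insert[OF insert.hyps]) (use insert.prems in simp)
  then have "f i \<subseteq> P \<or> iprod f S \<subseteq> P"
    using insert by (intro prime_prod[OF P] iprod_ideal) simp_all
  then show ?case using insert by auto
qed

text \<open>The monomial without its power of \<open>I 0\<close>. The two factors are kept apart
  since \<open>I 0\<close> drives the Hilbert-Samuel filtration, while the rest becomes powers of
  one ideal along a ray.\<close>

definition tail_monomial :: "(nat \<Rightarrow> 'a set) \<Rightarrow> nat \<Rightarrow> (nat \<Rightarrow> nat) \<Rightarrow> 'a set" where
  "tail_monomial I s n = iprod (\<lambda>i. ipow (I i) (n i)) {1..s}"

lemma ideal_monomial_eq: "ideal_monomial R I s n = iprod (\<lambda>i. ipow (I i) (n i)) {0..s}"
  by (simp add: ideal_monomial_def iprod_def ipow_def)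

lemma ideal_product_eq: "ideal_product R I s = iprod I {1..s}"
  by (simp add: ideal_product_def iprod_def)

context
  fixes I :: "nat \<Rightarrow> 'a set" and s :: nat
  assumes fam: "\<And>i. i \<le> s \<Longrightarrow> ideal (I i) R"
begin

lemma monomial_ideal: "ideal (ideal_monomial R I s n) R"
  unfolding ideal_monomial_eq by (intro iprod_ideal ipow_ideal fam) auto

lemma tail_monomial_ideal: "ideal (tail_monomial I s n) R"
  unfolding tail_monomial_def by (intro iprod_ideal ipow_ideal fam) auto

lemma ideal_product_ideal: "ideal (ideal_product R I s) R"
  unfolding ideal_product_eq by (intro iprod_ideal fam) auto

lemma monomial_cong: "(\<And>i. i \<le> s \<Longrightarrow> n i = n' i) \<Longrightarrow> ideal_monomial R I s n = ideal_monomial R I s n'"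
  unfolding ideal_monomial_eq by (intro iprod_cong ipow_ideal fam) auto

lemma monomial_cut: "ideal_monomial R I s (cut s n) = ideal_monomial R I s n"
  by (rule monomial_cong) (simp add: cut_apply)

lemma monomial_remove:
  assumes i: "i \<le> s"
  shows "ideal_monomial R I s n = ipow (I i) (n i) \<cdot> iprod (\<lambda>i. ipow (I i) (n i)) ({0..s} - {i})"
proof -
  have "{0..s} = insert i ({0..s} - {i})" using i by auto
  moreover have "iprod (\<lambda>i. ipow (I i) (n i)) (insert i ({0..s} - {i}))
      = ipow (I i) (n i) \<cdot> iprod (\<lambda>i. ipow (I i) (n i)) ({0..s} - {i})"
    by (rule iprod_insert) (use i in \<open>auto intro: ipow_ideal fam\<close>)
  ultimately show ?thesis unfolding ideal_monomial_eq by simp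
qed

lemma monomial_Suc:
  assumes i: "i \<le> s"
  shows "ideal_monomial R I s (n(i := Suc (n i))) = I i \<cdot> ideal_monomial R I s n"
proof -
  let ?T = "iprod (\<lambda>i. ipow (I i) (n i)) ({0..s} - {i})"
  have T: "ideal ?T R" by (intro iprod_ideal ipow_ideal fam) auto
  have "iprod (\<lambda>j. ipow (I j) ((n(i := Suc (n i))) j)) ({0..s} - {i}) = ?T"
    by (rule iprod_cong) (auto intro!: ipow_ideal fam)
  then show ?thesis
    unfolding monomial_remove[OF i]
    by (simp add: ipow_Suc fam i ideal_prod_assoc ipow_ideal T)
qed

lemma monomial_inc: "i \<le> s \<Longrightarrow> ideal_monomial R I s (inc i 1 n) = I i \<cdot> ideal_monomial R I s n"
  using monomial_Suc[of i n] by (simp add: inc_def)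

lemma monomial_split: "ideal_monomial R I s n = ipow (I 0) (n 0) \<cdot> tail_monomial I s n"
proof -
  have "{0..s} - {0} = {1..s}" by auto
  then show ?thesis unfolding monomial_remove[of 0, simplified] tail_monomial_def by simp
qed

lemma tail_monomial_add: "tail_monomial I s (\<lambda>i. m i + n i) = tail_monomial I s m \<cdot> tail_monomial I s n"
proof -
  have "iprod (\<lambda>i. ipow (I i) (m i + n i)) {1..s} = iprod (\<lambda>i. ipow (I i) (m i) \<cdot> ipow (I i) (n i)) {1..s}"
    by (rule iprod_cong) (auto simp: ipow_add fam intro!: ipow_ideal prod_ideal)
  also have "\<dots> = iprod (\<lambda>i. ipow (I i) (m i)) {1..s} \<cdot> iprod (\<lambda>i. ipow (I i) (n i)) {1..s}"
    by (rule iprod_mult) (auto intro: ipow_ideal fam)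
  finally show ?thesis by (simp add: tail_monomial_def)
qed

lemma tail_monomial_scale: "tail_monomial I s (\<lambda>i. t * c i) = ipow (tail_monomial I s c) t"
proof (induction t)
  case 0
  have "iprod (\<lambda>i. carrier R) {1..s} = carrier R"
  proof -
    have "iprod (\<lambda>i. carrier R) S = carrier R" if "finite S" for S
      using that by (induction S rule: finite_induct)
        (simp_all add: iprod_empty iprod_insert oneideal ideal_prod_one)
    then show ?thesis by simp
  qed
  then show ?case by (simp add: tail_monomial_def)
next
  case (Suc t)
  then show ?case
    using tail_monomial_add[of c "\<lambda>i. t * c i"] by (simp add: ipow_Suc tail_monomial_ideal)
qed

lemma tail_monomial_subset_product:
  assumes "\<And>i. i \<le> s \<Longrightarrow> 1 \<le> c i"
  shows "tail_monomial I s c \<subseteq> ideal_product R I s"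
  unfolding tail_monomial_def ideal_product_eq
proof (rule iprod_mono)
  fix i assume i: "i \<in> {1..s}"
  then have "ipow (I i) (c i) \<subseteq> ipow (I i) 1" using assms[of i] fam[of i] by (intro ipow_antimono) auto
  moreover have "ipow (I i) 1 = I i" using i by (intro ipow_1 fam) simp
  ultimately show "ipow (I i) (c i) \<subseteq> I i" by simp
qed (auto intro: ipow_ideal fam)

lemma monomial_subset_ipow: "ideal_monomial R I s n \<subseteq> ipow (I 0) (n 0)"
  unfolding monomial_split by (intro prod_subset1 ipow_ideal tail_monomial_ideal fam) simp

lemma monomial_scale:
  "ideal_monomial R I s (\<lambda>i. t * c i) = ipow (ipow (I 0) (c 0)) t \<cdot> ipow (tail_monomial I s c) t"
  unfolding monomial_split tail_monomial_scale using ipow_mult[of "I 0" "c 0" t] fam[of 0] by (simp add: mult.commute)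

lemma prime_monomial:
  assumes P: "primeideal P R" and sub: "ideal_monomial R I s n \<subseteq> P"
  shows "\<exists>i\<le>s. I i \<subseteq> P"
proof -
  have "\<exists>i\<in>{0..s}. ipow (I i) (n i) \<subseteq> P"
    by (rule prime_iprod[OF P _ _ sub[unfolded ideal_monomial_eq]]) (auto intro: ipow_ideal fam)
  then obtain i where i: "i \<le> s" "ipow (I i) (n i) \<subseteq> P" by auto
  then show ?thesis using prime_ipow[OF P fam[OF i(1)] i(2)] by (intro exI conjI)
qed

end

text \<open>The multipliers that carry \<open>B\<close> into \<open>W\<close> form an ideal, so it
  is enough to test generators.\<close>

lemma genideal_prod_subset:
  assumes G: "G \<subseteq> carrier R" and B: "ideal B R" and W: "ideal W R"
    and sub: "\<And>g. g \<in> G \<Longrightarrow> scale g B \<subseteq> W"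
  shows "(Idl G) \<cdot> B \<subseteq> W"
proof -
  define Q where "Q = {r \<in> carrier R. \<forall>b\<in>B. r \<otimes> b \<in> W}"
  have "ideal Q R"
  proof (rule idealI_mult)
    show "r \<otimes> a \<in> Q" if "r \<in> carrier R" "a \<in> Q" for r a
      using that ideal_lmult[OF W] ideal_carr[OF B] by (auto simp: Q_def m_assoc)
    show "a \<oplus> b \<in> Q" if "a \<in> Q" "b \<in> Q" for a b
      using that ideal_add[OF W] ideal_carr[OF B] by (auto simp: Q_def l_distr)
  qed (use ideal_0[OF W] ideal_carr[OF B] in \<open>auto simp: Q_def\<close>)
  moreover have "G \<subseteq> Q" using G sub by (auto simp: Q_def scale_def)
  ultimately have "Idl G \<subseteq> Q" by (rule genideal_minimal)
  then have "\<forall>a\<in>Idl G. \<forall>b\<in>B. a \<otimes> b \<in> W" by (auto simp: Q_def)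
  then show ?thesis by (rule iffD2[OF prod_le_iff[OF W]])
qed

text \<open>The multi-Rees algebra modulo \<open>b\<close>, with generators of the ideals as actors.
  If coordinate \<open>j\<close> is positive, the monomial is \<open>I j\<close> times the monomial
  one step below, so generation holds beyond \<open>D = 0\<close>.\<close>

lemma generated_monomials:
  assumes fam: "\<And>i. i \<le> s \<Longrightarrow> ideal (I i) R" and b: "ideal b R"
    and G: "\<And>i. i \<le> s \<Longrightarrow> finite (G i) \<and> G i \<subseteq> carrier R \<and> I i = Idl (G i)"
  defines "Y \<equiv> Sigma {..s} G" and "U \<equiv> \<lambda>n. ideal_monomial R I s n <+> b"
  shows "actors s Y" "stable s Y U" "stable s Y (\<lambda>n. b)" "generated s Y U (\<lambda>n. b)"
proof -
  have mono: "ideal (ideal_monomial R I s n) R" for n by (rule monomial_ideal[of s I, OF fam])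
  have U: "ideal (U n) R" for n unfolding U_def by (rule isum_ideal[OF mono b])
  have YI: "y \<in> I i" "y \<in> carrier R" "i \<le> s" if "(i, y) \<in> Y" for i y
    using that G[of i] genideal_self[of "G i"] by (auto simp: Y_def)
  show "actors s Y"
    using G YI(2) unfolding actors_def Y_def by auto
  show "stable s Y U"
    unfolding stable_def
  proof (intro ballI conjI)
    fix n assume "n \<in> degrees s"
    show "ideal (U n) R" by (rule U)
    fix iy assume "iy \<in> Y"
    then obtain i y where iy: "iy = (i, y)" "(i, y) \<in> Y" by (cases iy) auto
    have "scale y (U n) = scale y (ideal_monomial R I s n) <+> scale y b"
      unfolding U_def by (rule scale_sum[OF YI(2)[OF iy(2)] ideal_subset[OF mono] ideal_subset[OF b]])
    also have "\<dots> \<subseteq> I i \<cdot> ideal_monomial R I s n <+> b"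
      by (intro isum_mono scale_prod_subset scale_subset b YI[OF iy(2)])
    also have "\<dots> = U (inc i 1 n)"
      unfolding U_def by (simp only: monomial_inc[of s I i, OF fam YI(3)[OF iy(2)]])
    finally show "case iy of (i, y) \<Rightarrow> scale y (U n) \<subseteq> U (inc i 1 n)" by (simp add: iy)
  qed
  show "stable s Y (\<lambda>n. b)"
    unfolding stable_def
  proof (intro ballI conjI b)
    fix n iy assume "iy \<in> Y"
    then obtain i y where iy: "iy = (i, y)" "(i, y) \<in> Y" by (cases iy) auto
    then show "case iy of (i, y) \<Rightarrow> scale y b \<subseteq> b" using scale_subset[OF YI(2)[OF iy(2)] b] by simp
  qed
  show "generated s Y U (\<lambda>n. b)"
  proof (rule generatedI[of s 0])
    fix n j W assume n: "n \<in> degrees s" and j: "j \<le> s" "0 < n j" and W: "ideal W R" and bW: "b \<subseteq> W"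
      and Y: "acts_into Y U n W"
    have "(Idl (G j)) \<cdot> ideal_monomial R I s (dec j 1 n) \<subseteq> W"
    proof (rule genideal_prod_subset[OF _ mono W])
      show "G j \<subseteq> carrier R" using G[OF j(1)] by simp
      fix g assume "g \<in> G j"
      then have "scale g (U (dec j 1 n)) \<subseteq> W" using j by (intro acts_intoD[OF Y]) (simp_all add: Y_def)
      moreover have "scale g (ideal_monomial R I s (dec j 1 n)) \<subseteq> scale g (U (dec j 1 n))"
        unfolding U_def by (rule scale_mono[OF isum_upper1[OF mono b]])
      ultimately show "scale g (ideal_monomial R I s (dec j 1 n)) \<subseteq> W" by blast
    qed
    moreover have "(Idl (G j)) \<cdot> ideal_monomial R I s (dec j 1 n) = ideal_monomial R I s n"
    proof -
      have "inc j 1 (dec j 1 n) = n" by (rule inc_dec) (use j in simp)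
      then show ?thesis
        using monomial_inc[of s I j "dec j 1 n", OF fam j(1)] G[OF j(1)] by simp
    qed
    ultimately show "U n \<subseteq> W" unfolding U_def by (intro isum_least[OF W] bW) simp
  qed
qed

end

section \<open>Artin-Rees lemmas\<close>

context noetherian_cring
begin

lemma family_generators:
  assumes "\<And>i. i \<le> s \<Longrightarrow> ideal (I i) R"
  shows "\<exists>G. \<forall>i\<le>s. finite (G i) \<and> G i \<subseteq> carrier R \<and> I i = Idl (G i)"
proof -
  have "\<forall>i. \<exists>G. i \<le> s \<longrightarrow> finite G \<and> G \<subseteq> carrier R \<and> I i = Idl G"
  proof
    fix i
    show "\<exists>G. i \<le> s \<longrightarrow> finite G \<and> G \<subseteq> carrier R \<and> I i = Idl G"
      using finetely_gen[of "I i"] assms[of i] by (cases "i \<le> s") auto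
  qed
  from choice[OF this] show ?thesis by (elim exE) (rule exI)
qed

text \<open>The basis theorem for graded submodules of the multi-Rees algebra, phrased with the
  ideals \<open>I i\<close> so that the choice of generators stays inside the proof.\<close>

lemma submodule_of_monomials:
  assumes fam: "\<And>i. i \<le> s \<Longrightarrow> ideal (I i) R" and b: "ideal b R"
    and M: "\<And>n. n \<in> degrees s \<Longrightarrow> ideal (M n) R"
    "\<And>i n. n \<in> degrees s \<Longrightarrow> i \<le> s \<Longrightarrow> I i \<cdot> M n \<subseteq> M (inc i 1 n)"
    "\<And>n. n \<in> degrees s \<Longrightarrow> b \<subseteq> M n"
    "\<And>n. n \<in> degrees s \<Longrightarrow> M n \<subseteq> ideal_monomial R I s n <+> b"
  shows "\<exists>D. \<forall>n\<in>degrees s. \<forall>j\<le>s. D < n j \<longrightarrow> (\<forall>W. ideal W R \<longrightarrow> b \<subseteq> W \<longrightarrow>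
    (\<forall>i\<le>s. 0 < n i \<longrightarrow> I i \<cdot> M (dec i 1 n) \<subseteq> W) \<longrightarrow> M n \<subseteq> W)"
proof -
  have "\<exists>G. \<forall>i\<le>s. finite (G i) \<and> G i \<subseteq> carrier R \<and> I i = Idl (G i)"
    by (rule family_generators) (rule fam)
  then obtain G where "\<forall>i\<le>s. finite (G i) \<and> G i \<subseteq> carrier R \<and> I i = Idl (G i)"
    by (elim exE)
  then have G: "finite (G i) \<and> G i \<subseteq> carrier R \<and> I i = Idl (G i)" if "i \<le> s" for i using that by simp
  define Y where "Y = Sigma {..s} G"
  have YI: "y \<in> I i" "i \<le> s" if "(i, y) \<in> Y" for i y
    using that G[of i] genideal_self[of "G i"] by (auto simp: Y_def)
  have gen: "actors s Y" "stable s Y (\<lambda>n. ideal_monomial R I s n <+> b)" "stable s Y (\<lambda>n. b)"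
    "generated s Y (\<lambda>n. ideal_monomial R I s n <+> b) (\<lambda>n. b)"
    unfolding Y_def by (rule generated_monomials[of s I b G], erule fam, rule b, erule G)+
  have "stable s Y M"
    unfolding stable_def
  proof (intro ballI conjI)
    fix n assume n: "n \<in> degrees s"
    show "ideal (M n) R" by (rule M(1)[OF n])
    fix iy assume "iy \<in> Y"
    then obtain i y where iy: "iy = (i, y)" "(i, y) \<in> Y" by (cases iy) auto
    have "scale y (M n) \<subseteq> I i \<cdot> M n" by (rule scale_prod_subset[OF YI(1)[OF iy(2)]])
    also have "\<dots> \<subseteq> M (inc i 1 n)" by (rule M(2)[OF n YI(2)[OF iy(2)]])
    finally show "case iy of (i, y) \<Rightarrow> scale y (M n) \<subseteq> M (inc i 1 n)" by (simp add: iy)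
  qed
  then have "generated s Y M (\<lambda>n. b)"
    by (rule generated_submodule[OF gen(1,2,3) _ _ _ gen(4)]) (erule M(3) M(4))+
  then obtain D where D: "generated_beyond s Y M (\<lambda>n. b) D" unfolding generated_def by (elim exE)
  show ?thesis
  proof (intro exI[of _ D] ballI allI impI)
    fix n j W assume n: "n \<in> degrees s" and j: "j \<le> s" "D < n j" and W: "ideal W R" and bW: "b \<subseteq> W"
      and sub: "\<forall>i\<le>s. 0 < n i \<longrightarrow> I i \<cdot> M (dec i 1 n) \<subseteq> W"
    show "M n \<subseteq> W"
    proof (rule generatedD[OF D n j W bW acts_intoI])
      fix i y assume iy: "(i, y) \<in> Y" "0 < n i"
      have "scale y (M (dec i 1 n)) \<subseteq> I i \<cdot> M (dec i 1 n)" by (rule scale_prod_subset[OF YI(1)[OF iy(1)]])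
      also have "\<dots> \<subseteq> W" using sub YI(2)[OF iy(1)] iy(2) by simp
      finally show "scale y (M (dec i 1 n)) \<subseteq> W" .
    qed
  qed
qed

text \<open>The traces \<open>(K^t + a) \<inter> b\<close> form a graded submodule of the Rees
  algebra of \<open>K\<close> modulo \<open>a\<close>. Past its generation bound \<open>D\<close>,
  each trace comes from \<open>K\<close> times the preceding one, modulo \<open>a\<close>.\<close>

lemma artin_rees:
  assumes K: "ideal K R" and a: "ideal a R" and b: "ideal b R" and ab: "a \<subseteq> b"
  shows "\<exists>D. \<forall>t\<ge>D. (ipow K t <+> a) \<inter> b \<subseteq> (ipow K (t - D) \<cdot> b) <+> a"
proof -
  let ?I = "\<lambda>i::nat. K"
  have mono: "ideal_monomial R ?I 0 n = ipow K (n 0)" for n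
    using monomial_split[of 0 ?I n, OF K] by (simp add: tail_monomial_def iprod_empty ideal_prod_one ipow_ideal K)
  define M where "M n = (ipow K (n 0) <+> a) \<inter> b" for n :: "nat \<Rightarrow> nat"
  have Ka: "ideal (ipow K t <+> a) R" for t by (intro isum_ideal ipow_ideal K a)
  have Mid: "ideal (M n) R" for n unfolding M_def by (intro inter_ideal Ka b)
  have "\<exists>D. \<forall>n\<in>degrees 0. \<forall>j\<le>0. D < n j \<longrightarrow> (\<forall>W. ideal W R \<longrightarrow> a \<subseteq> W \<longrightarrow>
    (\<forall>i\<le>0. 0 < n i \<longrightarrow> ?I i \<cdot> M (dec i 1 n) \<subseteq> W) \<longrightarrow> M n \<subseteq> W)"
  proof (rule submodule_of_monomials[OF K a Mid])
    fix i n assume "i \<le> (0::nat)"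
    have "K \<cdot> M n \<subseteq> K \<cdot> (ipow K (n 0) <+> a)" unfolding M_def by (rule ideal_prod_mono[OF K Ka]) auto
    also have "\<dots> \<subseteq> ipow K (Suc (n 0)) <+> a"
      unfolding ipow_Suc[OF K] by (rule prod_sum_subset[OF K ipow_ideal[OF K] a])
    finally have "K \<cdot> M n \<subseteq> ipow K (Suc (n 0)) <+> a" .
    moreover have "K \<cdot> M n \<subseteq> b"
      using prod_subset2[OF K Mid] unfolding M_def by blast
    moreover have "M (inc i 1 n) = (ipow K (Suc (n 0)) <+> a) \<inter> b"
      using \<open>i \<le> 0\<close> by (simp add: M_def inc_apply)
    ultimately show "K \<cdot> M n \<subseteq> M (inc i 1 n)" by simp
  next
    fix n :: "nat \<Rightarrow> nat"
    show "a \<subseteq> M n" unfolding M_def using isum_upper2[OF ipow_ideal[OF K] a] ab by blast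
    show "M n \<subseteq> ideal_monomial R ?I 0 n <+> a" unfolding M_def mono by blast
  qed
  then obtain D where "\<forall>n\<in>degrees 0. \<forall>j\<le>0. D < n j \<longrightarrow> (\<forall>W. ideal W R \<longrightarrow> a \<subseteq> W \<longrightarrow>
    (\<forall>i\<le>0. 0 < n i \<longrightarrow> ?I i \<cdot> M (dec i 1 n) \<subseteq> W) \<longrightarrow> M n \<subseteq> W)"
    by (elim exE)
  note D_all = bspec[OF this]
  have D: "M n \<subseteq> W" if "n \<in> degrees 0" "D < n 0" "ideal W R" "a \<subseteq> W" "K \<cdot> M (dec 0 1 n) \<subseteq> W" for n W
    using D_all[OF that(1)] that(2-) by simp
  have "(ipow K t <+> a) \<inter> b \<subseteq> (ipow K (t - D) \<cdot> b) <+> a" if "D \<le> t" for t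
    using that
  proof (induction t rule: dec_induct)
    case base
    \<comment> \<open>At \<open>t = D\<close> the power \<open>K^(t - D)\<close> is the whole
      ring.\<close>
    show ?case using isum_upper1[OF b a] prod_one[OF b] by auto
  next
    case (step t)
    define n :: "nat \<Rightarrow> nat" where "n = (\<lambda>i. if i = 0 then Suc t else 0)"
    have Q: "ideal (ipow K (Suc t - D) \<cdot> b <+> a) R" by (intro isum_ideal prod_ideal ipow_ideal K b a)
    have "M n \<subseteq> ipow K (Suc t - D) \<cdot> b <+> a"
    proof (rule D)
      show "n \<in> degrees 0" "D < n 0" using step by (auto simp: n_def degrees_def)
      show "ideal (ipow K (Suc t - D) \<cdot> b <+> a) R" by (rule Q)
      show "a \<subseteq> ipow K (Suc t - D) \<cdot> b <+> a" by (intro isum_upper2 prod_ideal ipow_ideal K b a)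
      have "M (dec 0 1 n) = (ipow K t <+> a) \<inter> b" by (simp add: M_def n_def dec_apply)
      then have "K \<cdot> M (dec 0 1 n) \<subseteq> K \<cdot> (ipow K (t - D) \<cdot> b <+> a)"
        using step.IH by (intro ideal_prod_mono K isum_ideal prod_ideal ipow_ideal b a order_refl) simp
      also have "\<dots> \<subseteq> K \<cdot> (ipow K (t - D) \<cdot> b) <+> a"
        by (intro prod_sum_subset K prod_ideal ipow_ideal b a)
      also have "K \<cdot> (ipow K (t - D) \<cdot> b) = ipow K (Suc t - D) \<cdot> b"
        using step by (simp add: Suc_diff_le ipow_Suc K ideal_prod_assoc[symmetric] ipow_ideal b)
      finally show "K \<cdot> M (dec 0 1 n) \<subseteq> ipow K (Suc t - D) \<cdot> b <+> a" .
    qed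
    then show ?case by (simp add: M_def n_def)
  qed
  then show ?thesis by blast
qed

text \<open>Artin--Rees in the Rees algebra of \<open>K\<close>, which makes the bound uniform in \<open>t\<close>.\<close>
lemma artin_rees_rees_algebra:
  assumes J: "ideal J R" and K: "ideal K R" and b: "ideal b R"
  shows "\<exists>D. \<forall>t. \<forall>m\<ge>D. (ipow J m \<cdot> ipow K t <+> b) \<inter> (ipow K (Suc t) <+> b)
    \<subseteq> ipow J (m - D) \<cdot> ipow K (Suc t) <+> b"
proof -
  \<comment> \<open>Two gradings: coordinate 0 counts powers of \<open>J\<close>, coordinate 1
    powers of \<open>K\<close>.\<close>
  define L where "L i = (if i = 0 then J else K)" for i :: nat
  have L: "ideal (L i) R" for i using J K by (simp add: L_def)
  have tail: "tail_monomial L 1 n = ipow K (n 1)" for n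
  proof -
    have "{1..1::nat} = insert 1 {}" by auto
    then show ?thesis
      unfolding tail_monomial_def
      using iprod_singleton[of "\<lambda>i. ipow (L i) (n i)" 1, OF ipow_ideal[OF L]] by (simp add: L_def)
  qed
  have mono: "ideal_monomial R L 1 n = ipow J (n 0) \<cdot> ipow K (n 1)" for n
    using monomial_split[of 1 L n, OF L] unfolding tail by (simp add: L_def)
  define A where "A n = ipow J (n 0) \<cdot> ipow K (n 1) <+> b" for n :: "nat \<Rightarrow> nat"
  \<comment> \<open>The exponent of \<open>K\<close> is one ahead of that in \<open>A\<close>. As
    \<open>t\<close> is now a grading coordinate, the generation bound of
    \<open>A n \<inter> B n\<close> is a single number that serves all \<open>t\<close>.\<close>
  define B where "B n = ipow K (Suc (n 1)) <+> b" for n :: "nat \<Rightarrow> nat"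
  have A: "ideal (A n) R" for n unfolding A_def by (intro isum_ideal prod_ideal ipow_ideal J K b)
  have B: "ideal (B n) R" for n unfolding B_def by (intro isum_ideal ipow_ideal K b)
  have AB: "ideal (A n \<inter> B n) R" for n by (intro inter_ideal A B)
  have "\<exists>D. \<forall>n\<in>degrees 1. \<forall>j\<le>1. D < n j \<longrightarrow> (\<forall>W. ideal W R \<longrightarrow> b \<subseteq> W \<longrightarrow>
    (\<forall>i\<le>1. 0 < n i \<longrightarrow> L i \<cdot> (A (dec i 1 n) \<inter> B (dec i 1 n)) \<subseteq> W) \<longrightarrow> A n \<inter> B n \<subseteq> W)"
  proof (rule submodule_of_monomials[OF L b AB])
    fix i n assume i: "i \<le> (1::nat)"
    have "L i \<cdot> (A n \<inter> B n) \<subseteq> L i \<cdot> A n" by (intro ideal_prod_mono L A) auto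
    also have "\<dots> \<subseteq> L i \<cdot> (ipow J (n 0) \<cdot> ipow K (n 1)) <+> b"
      unfolding A_def by (intro prod_sum_subset prod_ideal ipow_ideal J K L b)
    also have "\<dots> = A (inc i 1 n)"
      using monomial_inc[of 1 L i n, OF L i] unfolding mono A_def by simp
    finally have 1: "L i \<cdot> (A n \<inter> B n) \<subseteq> A (inc i 1 n)" .
    have 2: "L i \<cdot> (A n \<inter> B n) \<subseteq> B (inc i 1 n)"
    proof (cases "i = 0")
      case True
      then have "B (inc i 1 n) = B n" by (simp add: B_def inc_apply)
      then show ?thesis using prod_subset2[OF L AB] by blast
    next
      case False
      then have i1: "i = 1" using i by simp
      have "L i \<cdot> (A n \<inter> B n) \<subseteq> K \<cdot> B n"
        unfolding i1 L_def by (simp, intro ideal_prod_mono K B) auto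
      also have "\<dots> \<subseteq> K \<cdot> ipow K (Suc (n 1)) <+> b"
        unfolding B_def by (intro prod_sum_subset ipow_ideal K b)
      also have "\<dots> = B (inc i 1 n)" by (simp add: B_def i1 inc_apply ipow_Suc K)
      finally show ?thesis .
    qed
    show "L i \<cdot> (A n \<inter> B n) \<subseteq> A (inc i 1 n) \<inter> B (inc i 1 n)" using 1 2 by blast
  next
    fix n :: "nat \<Rightarrow> nat"
    show "b \<subseteq> A n \<inter> B n" unfolding A_def B_def
      by (intro Int_greatest isum_upper2 prod_ideal ipow_ideal J K b)
    show "A n \<inter> B n \<subseteq> ideal_monomial R L 1 n <+> b" unfolding A_def mono by blast
  qed
  then obtain D where D: "\<forall>n\<in>degrees 1. \<forall>j\<le>1. D < n j \<longrightarrow> (\<forall>W. ideal W R \<longrightarrow> b \<subseteq> W \<longrightarrow>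
    (\<forall>i\<le>1. 0 < n i \<longrightarrow> L i \<cdot> (A (dec i 1 n) \<inter> B (dec i 1 n)) \<subseteq> W) \<longrightarrow> A n \<inter> B n \<subseteq> W)"
    by (elim exE)
  \<comment> \<open>Generation applies as soon as the exponent of \<open>J\<close> alone exceeds
    \<open>D\<close>, so the induction may lower either coordinate and stops at
    \<open>n 0 = D\<close>.\<close>
  have main: "A n \<inter> B n \<subseteq> ipow J (n 0 - D) \<cdot> ipow K (Suc (n 1)) <+> b" if "n \<in> degrees 1" "D \<le> n 0" for n
    using that
  proof (induction "n 0 + n 1" arbitrary: n rule: less_induct)
    case less
    let ?W = "ipow J (n 0 - D) \<cdot> ipow K (Suc (n 1)) <+> b"
    have W: "ideal ?W R" by (intro isum_ideal prod_ideal ipow_ideal J K b)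
    have bW: "b \<subseteq> ?W" by (intro isum_upper2 prod_ideal ipow_ideal J K b)
    show ?case
    proof (cases "n 0 = D")
      case True
      then show ?thesis by (simp add: B_def prod_one ipow_ideal K)
    next
      case False
      then have n0: "D < n 0" using less.prems by simp
      have "\<forall>i\<le>1. 0 < n i \<longrightarrow> L i \<cdot> (A (dec i 1 n) \<inter> B (dec i 1 n)) \<subseteq> ?W"
      proof (intro allI impI)
        fix i assume i: "i \<le> (1::nat)" and pos: "0 < n i"
        let ?n = "dec i 1 n"
        have i': "i = 0 \<or> i = 1" using i by auto
        have "?n 0 + ?n 1 < n 0 + n 1" using pos i' by (auto simp: dec_apply)
        moreover have "D \<le> ?n 0" using n0 by (auto simp: dec_apply)
        ultimately have "A ?n \<inter> B ?n \<subseteq> ipow J (?n 0 - D) \<cdot> ipow K (Suc (?n 1)) <+> b"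
          by (intro less.hyps dec_degrees less.prems)
        then have "L i \<cdot> (A ?n \<inter> B ?n) \<subseteq> L i \<cdot> (ipow J (?n 0 - D) \<cdot> ipow K (Suc (?n 1)) <+> b)"
          by (intro ideal_prod_mono L isum_ideal prod_ideal ipow_ideal J K b order_refl)
        also have "\<dots> \<subseteq> L i \<cdot> (ipow J (?n 0 - D) \<cdot> ipow K (Suc (?n 1))) <+> b"
          by (intro prod_sum_subset L prod_ideal ipow_ideal J K b)
        also have "L i \<cdot> (ipow J (?n 0 - D) \<cdot> ipow K (Suc (?n 1))) = ipow J (n 0 - D) \<cdot> ipow K (Suc (n 1))"
        proof (cases "i = 0")
          case True
          have "n 0 - D = Suc (?n 0 - D)" "?n 1 = n 1" using n0 True by (auto simp: dec_apply)
          then show ?thesis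
            using True by (simp add: L_def ipow_Suc J K ideal_prod_assoc[symmetric] ipow_ideal prod_ideal)
        next
          case False
          then have i1: "i = 1" using i' by simp
          then have n1: "Suc (?n 1) = n 1" "?n 0 = n 0" using pos by (auto simp: dec_apply)
          have "K \<cdot> (ipow J (n 0 - D) \<cdot> ipow K (n 1)) = ipow J (n 0 - D) \<cdot> (K \<cdot> ipow K (n 1))"
            by (metis J K ideal_prod_assoc ideal_prod_commute ipow_ideal)
          then show ?thesis unfolding n1 by (simp add: L_def i1 ipow_Suc K)
        qed
        finally show "L i \<cdot> (A ?n \<inter> B ?n) \<subseteq> ?W" .
      qed
      then show ?thesis using D[rule_format, OF less.prems(1) _ n0, of ?W] W bW by simp
    qed
  qed
  have "(ipow J m \<cdot> ipow K t <+> b) \<inter> (ipow K (Suc t) <+> b) \<subseteq> ipow J (m - D) \<cdot> ipow K (Suc t) <+> b"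
    if "D \<le> m" for t m
    using main[of "(\<lambda>_. 0)(0 := m, 1 := t)"] that by (simp add: A_def B_def degrees_def)
  then show ?thesis by blast
qed

text \<open>Each passage from \<open>K^t\<close> to \<open>K^(t+1)\<close> costs the same
  \<open>D\<close> powers of \<open>J\<close>, hence \<open>D * t\<close> in all.\<close>

lemma linear_artin_rees:
  assumes J: "ideal J R" and K: "ideal K R" and b: "ideal b R"
  shows "\<exists>D. \<forall>t. \<forall>m\<ge>D * t. (ipow J m <+> b) \<inter> (ipow K t <+> b) \<subseteq> ipow J (m - D * t) \<cdot> ipow K t <+> b"
proof -
  obtain D where D: "\<And>t m. D \<le> m \<Longrightarrow> (ipow J m \<cdot> ipow K t <+> b) \<inter> (ipow K (Suc t) <+> b)
    \<subseteq> ipow J (m - D) \<cdot> ipow K (Suc t) <+> b"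
    using artin_rees_rees_algebra[OF assms] by blast
  have "(ipow J m <+> b) \<inter> (ipow K t <+> b) \<subseteq> ipow J (m - D * t) \<cdot> ipow K t <+> b" if "D * t \<le> m" for t m
    using that
  proof (induction t)
    case 0
    then show ?case by (auto simp: ideal_prod_one ipow_ideal J)
  next
    case (Suc t)
    have le: "D * t \<le> m" "D \<le> m - D * t" using Suc.prems by auto
    have "ipow K (Suc t) <+> b \<subseteq> ipow K t <+> b" by (intro isum_mono ipow_Suc_subset K order_refl)
    then have "(ipow J m <+> b) \<inter> (ipow K (Suc t) <+> b)
        \<subseteq> (ipow J (m - D * t) \<cdot> ipow K t <+> b) \<inter> (ipow K (Suc t) <+> b)"
      using Suc.IH[OF le(1)] by blast
    also have "\<dots> \<subseteq> ipow J (m - D * t - D) \<cdot> ipow K (Suc t) <+> b" by (rule D[OF le(2)])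
    also have "m - D * t - D = m - D * Suc t" by simp
    finally show ?case .
  qed
  then show ?thesis by blast
qed

end

section \<open>Prime ideals, dimension and lengths\<close>

lemma enat_add_finite: "a \<noteq> \<infinity> \<Longrightarrow> b \<noteq> \<infinity> \<Longrightarrow> a + b \<noteq> (\<infinity>::enat)"
  by (cases a; cases b) auto

context cring
begin

text \<open>Lists rather than sets of ideals, since a prime may have to occur several times.\<close>

definition lprod :: "'a set list \<Rightarrow> 'a set" where
  "lprod Ps = foldr (\<cdot>) Ps (carrier R)"

lemma lprod_Nil [simp]: "lprod [] = carrier R"
  by (simp add: lprod_def)

lemma lprod_Cons [simp]: "lprod (P # Ps) = P \<cdot> lprod Ps"
  by (simp add: lprod_def)

lemma lprod_ideal: "(\<And>P. P \<in> set Ps \<Longrightarrow> ideal P R) \<Longrightarrow> ideal (lprod Ps) R"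
  by (induction Ps) (simp_all add: oneideal prod_ideal)

lemma lprod_append:
  "(\<And>P. P \<in> set Ps \<union> set Qs \<Longrightarrow> ideal P R) \<Longrightarrow> lprod (Ps @ Qs) = lprod Ps \<cdot> lprod Qs"
  by (induction Ps) (simp_all add: prod_one lprod_ideal ideal_prod_assoc)

lemma lprod_subset: "(\<And>P. P \<in> set Ps \<Longrightarrow> ideal P R) \<Longrightarrow> Q \<in> set Ps \<Longrightarrow> lprod Ps \<subseteq> Q"
proof (induction Ps)
  case (Cons P Ps)
  have P: "ideal P R" and L: "ideal (lprod Ps) R" using Cons.prems by (auto intro: lprod_ideal)
  show ?case
  proof (cases "Q = P")
    case True
    then show ?thesis using prod_subset1[OF P L] by simp
  next
    case False
    then have "lprod Ps \<subseteq> Q" using Cons by simp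
    then show ?thesis using prod_subset2[OF P L] by auto
  qed
qed simp

lemma prime_lprod:
  assumes P: "primeideal P R"
  shows "(\<And>Q. Q \<in> set Qs \<Longrightarrow> ideal Q R) \<Longrightarrow> lprod Qs \<subseteq> P \<Longrightarrow> \<exists>Q\<in>set Qs. Q \<subseteq> P"
proof (induction Qs)
  case Nil
  then have "P = carrier R" using ideal_subset[OF primeideal.axioms(1)[OF P]] by auto
  then show ?case using primeideal.I_notcarr[OF P] by simp
next
  case (Cons Q Qs)
  then have "Q \<subseteq> P \<or> lprod Qs \<subseteq> P" by (intro prime_prod[OF P] lprod_ideal) simp_all
  then show ?case using Cons by auto
qed

lemma prime_ideal: "primeideal P R \<Longrightarrow> ideal P R"
  by (rule primeideal.axioms(1))

text \<open>If one member contains another, the smaller one may be dropped. In an antichain, an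
  element \<open>x\<close> avoiding all members but \<open>P\<close> is corrected by some
  \<open>z\<close> in \<open>J\<close> that lies in all the others and outside
  \<open>P\<close>.\<close>

lemma prime_avoidance:
  assumes "finite F" "ideal J R" "\<And>P. P \<in> F \<Longrightarrow> primeideal P R" "\<And>P. P \<in> F \<Longrightarrow> \<not> J \<subseteq> P"
  shows "\<exists>x\<in>J. \<forall>P\<in>F. x \<notin> P"
  using assms(1,3,4)
proof (induction F rule: finite_psubset_induct)
  case (psubset F)
  show ?case
  proof (cases "\<exists>P\<in>F. \<exists>Q\<in>F. P \<noteq> Q \<and> Q \<subseteq> P")
    case True
    then obtain P Q where PQ: "P \<in> F" "Q \<in> F" "P \<noteq> Q" "Q \<subseteq> P" by blast
    have "\<exists>x\<in>J. \<forall>P\<in>F - {Q}. x \<notin> P" by (rule psubset.IH) (use PQ psubset.prems in auto)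
    then show ?thesis using PQ by blast
  next
    case antichain: False
    show ?thesis
    proof (cases "F = {}")
      case True
      then show ?thesis using ideal_0[OF assms(2)] by auto
    next
      case False
      then obtain P where P: "P \<in> F" by blast
      have "\<exists>x\<in>J. \<forall>Q\<in>F - {P}. x \<notin> Q" by (rule psubset.IH) (use P psubset.prems in auto)
      then obtain x where x: "x \<in> J" "\<And>Q. Q \<in> F - {P} \<Longrightarrow> x \<notin> Q" by blast
      show ?thesis
      proof (cases "x \<in> P")
        case False
        then show ?thesis using x by blast
      next
        case True
        obtain Qs where Qs: "set Qs = F - {P}" using finite_list[of "F - {P}"] psubset.hyps by auto
        have id: "ideal Q R" if "Q \<in> set (J # Qs)" for Q
          using that Qs assms(2) prime_ideal psubset.prems(1) by auto
        \<comment> \<open>Neither \<open>J\<close> nor another member of the antichain lies in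
          \<open>P\<close>, so primality excludes their product.\<close>
        have "\<not> lprod (J # Qs) \<subseteq> P"
        proof
          assume "lprod (J # Qs) \<subseteq> P"
          then obtain Q where "Q \<in> set (J # Qs)" "Q \<subseteq> P"
            using prime_lprod[OF psubset.prems(1)[OF P] id] by blast
          then show False using Qs psubset.prems(2)[OF P] antichain P by auto
        qed
        then obtain z where z: "z \<in> lprod (J # Qs)" "z \<notin> P" by blast
        have zmem: "z \<in> Q" if "Q \<in> set (J # Qs)" for Q
          using lprod_subset[of "J # Qs" Q] id that z(1) by blast
        have zJ: "z \<in> J" by (rule zmem) simp
        have zQ: "z \<in> Q" if "Q \<in> F - {P}" for Q by (rule zmem) (use Qs that in simp)
        have car: "x \<in> carrier R" "z \<in> carrier R" using x(1) zJ ideal_carr[OF assms(2)] by auto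
        have "x \<oplus> z \<notin> Q" if Q: "Q \<in> F" for Q
        proof
          assume sum: "x \<oplus> z \<in> Q"
          have Qi: "ideal Q R" using prime_ideal[OF psubset.prems(1)[OF Q]] .
          show False
          proof (cases "Q = P")
            case True
            then show False
              using ideal_minus[OF Qi sum, of x] \<open>x \<in> P\<close> z(2) add_minus_cancel_left[OF car] by simp
          next
            case False
            then have "Q \<in> F - {P}" using Q by blast
            then show False
              using ideal_minus[OF Qi sum, of z] zQ x(2) add_minus_cancel_right[OF car] by force
          qed
        qed
        then show ?thesis using ideal_add[OF assms(2) x(1) zJ] by blast
      qed
    qed
  qed
qed

definition prime_chain :: "'a set \<Rightarrow> (nat \<Rightarrow> 'a set) \<Rightarrow> nat \<Rightarrow> bool" where
  "prime_chain b P n \<longleftrightarrow> (\<forall>i\<le>n. primeideal (P i) R \<and> b \<subseteq> P i) \<and> (\<forall>i<n. P i \<subset> P (Suc i))"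

text \<open>The dimension of \<open>R / b\<close>, computed in \<open>R\<close>. If no prime
  contains \<open>b\<close> the value is 0, the same convention as for the zero ring in
  \<open>krull_dim\<close>.\<close>

definition pdim :: "'a set \<Rightarrow> enat" where
  "pdim b = Sup {enat n | n. \<exists>P. prime_chain b P n}"

lemma pdim_leI: "(\<And>P n. prime_chain b P n \<Longrightarrow> enat n \<le> L) \<Longrightarrow> pdim b \<le> L"
  unfolding pdim_def by (rule Sup_least) blast

lemma pdim_geI: "prime_chain b P n \<Longrightarrow> enat n \<le> pdim b"
  unfolding pdim_def by (rule Sup_upper) blast

lemma prime_chain_cons:
  assumes chain: "prime_chain b' P n" and Q: "primeideal Q R" "b \<subseteq> Q" "Q \<subset> P 0"
  shows "prime_chain b (case_nat Q P) (Suc n)"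
  unfolding prime_chain_def
proof (intro conjI allI impI)
  have mono: "P 0 \<subseteq> P i" if "i \<le> n" for i
    using that
  proof (induction i)
    case (Suc i)
    then show ?case using chain unfolding prime_chain_def by (meson Suc_le_eq less_imp_le psubset_imp_subset subset_trans)
  qed simp
  fix i assume i: "i \<le> Suc n"
  show "primeideal (case_nat Q P i) R"
    using i chain Q by (cases i) (simp_all add: prime_chain_def)
  show "b \<subseteq> case_nat Q P i"
  proof (cases i)
    case (Suc j)
    then show ?thesis using mono[of j] i Q by auto
  qed (use Q in simp)
next
  fix i assume "i < Suc n"
  then show "case_nat Q P i \<subset> case_nat Q P (Suc i)"
    using chain Q by (cases i) (simp_all add: prime_chain_def)
qed

lemma ilen_telescope:
  assumes "\<And>t. ideal (F t) R" "\<And>t. F (Suc t) \<subseteq> F t"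
  shows "(\<Sum>t<T. ilen (F (Suc t)) (F t)) = ilen (F T) (F 0)"
proof (induction T)
  case (Suc T)
  have "F T \<subseteq> F 0" using lift_Suc_antimono_le[of F 0 T, OF assms(2)] by simp
  then have "ilen (F (Suc T)) (F 0) = ilen (F (Suc T)) (F T) + ilen (F T) (F 0)"
    by (intro ilen_add assms)
  then show ?case using Suc by (simp add: add.commute)
qed simp

text \<open>The condition \<open>A \<inter> c \<subseteq> B\<close> makes the map from
  \<open>A / B\<close> to \<open>(A + c) / (B + c)\<close> injective, so no length is lost by
  reducing modulo \<open>c\<close>.\<close>

lemma ilen_sum_right:
  assumes A: "ideal A R" and B: "ideal B R" and c: "ideal c R" and Ac: "A \<inter> c \<subseteq> B"
  shows "ilen B A \<le> ilen (B <+> c) (A <+> c)"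
proof (rule ilen_map[where f = "\<lambda>H. H <+> c"])
  fix H assume "ideal H R" "B \<subseteq> H" "H \<subseteq> A"
  then show "ideal (H <+> c) R \<and> B <+> c \<subseteq> H <+> c \<and> H <+> c \<subseteq> A <+> c"
    by (intro conjI isum_ideal isum_mono c order_refl)
next
  fix H H' assume H: "ideal H R" "ideal H' R" "B \<subseteq> H" "H \<subset> H'" "H' \<subseteq> A"
  have "H' \<subseteq> H" if eq: "H <+> c = H' <+> c"
  proof -
    have "H' \<subseteq> H' \<inter> (H <+> c)" unfolding eq using isum_upper1[OF H(2) c] by blast
    also have "\<dots> \<subseteq> H <+> (H' \<inter> c)" by (rule modular_law[OF H(2,1) c]) (use H in blast)
    also have "\<dots> \<subseteq> H" using H Ac by (intro isum_least) auto
    finally show ?thesis .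
  qed
  moreover have "H <+> c \<subseteq> H' <+> c" using H by (intro isum_mono) auto
  ultimately show "H <+> c \<subset> H' <+> c" using H by blast
qed

text \<open>Each generator adds a cyclic module annihilated by \<open>J\<close>, of length at most
  that of \<open>R / J\<close>.\<close>

lemma ilen_prod_finite:
  assumes J: "ideal J R" and fin: "ilen J (carrier R) \<noteq> \<infinity>" and "finite G" and "G \<subseteq> carrier R"
    and B: "ideal B R" and "\<And>g. g \<in> G \<Longrightarrow> scale g J \<subseteq> B"
  shows "ilen B ((Idl G) <+> B) \<noteq> \<infinity>"
  using assms(3,4,6)
proof (induction G rule: finite_induct)
  case empty
  have "Idl {} \<subseteq> B" by (rule genideal_minimal[OF B]) simp
  then have "(Idl {}) <+> B = B" by (intro isum_absorb2 genideal_ideal B) simp_all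
  then show ?case by simp
next
  case (insert g G)
  have g: "g \<in> carrier R" and G: "G \<subseteq> carrier R" using insert.prems by auto
  have IG: "ideal (Idl G) R" and Ig: "ideal (PIdl g) R" using genideal_ideal[OF G] cgenideal_ideal[OF g] .
  define E where "E = (Idl G) <+> B"
  have E: "ideal E R" unfolding E_def by (rule isum_ideal[OF IG B])
  have BE: "B \<subseteq> E" unfolding E_def by (rule isum_upper2[OF IG B])
  have gE: "ideal (PIdl g <+> E) R" by (rule isum_ideal[OF Ig E])
  have "ilen E (PIdl g <+> E) = ilen (preimage g E (carrier R)) (carrier R)"
    using ilen_scale[OF g oneideal E] by (simp add: scale_carrier g)
  also have "\<dots> \<le> ilen J (carrier R)"
  proof (rule ilen_mono[OF _ order_refl])
    show "J \<subseteq> preimage g E (carrier R)"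
      unfolding subset_preimage_iff using ideal_subset[OF J] insert.prems(2)[of g] BE by auto
  qed
  finally have 1: "ilen E (PIdl g <+> E) \<noteq> \<infinity>" by (rule enat_finite_le[OF _ fin])
  have 2: "ilen B E \<noteq> \<infinity>" unfolding E_def using insert by auto
  have "ilen B (PIdl g <+> E) = ilen B E + ilen E (PIdl g <+> E)"
    by (rule ilen_add[OF B E gE BE isum_upper2[OF Ig E]])
  then have 3: "ilen B (PIdl g <+> E) \<noteq> \<infinity>" using enat_add_finite[OF 2 1] by simp
  have "(Idl (insert g G)) <+> B \<subseteq> PIdl g <+> E"
  proof (rule isum_least[OF gE])
    have "g \<in> PIdl g <+> E" using cgenideal_self[OF g] isum_upper1[OF Ig E] by blast
    moreover have "G \<subseteq> PIdl g <+> E"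
      using genideal_self[OF G] isum_upper1[OF IG B] isum_upper2[OF Ig E] unfolding E_def by blast
    ultimately show "Idl (insert g G) \<subseteq> PIdl g <+> E" by (intro genideal_minimal[OF gE]) simp
    show "B \<subseteq> PIdl g <+> E" using BE isum_upper2[OF Ig E] by (rule subset_trans)
  qed
  then have "ilen B ((Idl (insert g G)) <+> B) \<le> ilen B (PIdl g <+> E)" by (intro ilen_mono order_refl)
  then show ?case by (rule enat_finite_le[OF _ 3])
qed

end

context noetherian_cring
begin

lemma maximal_ideal_of_set:
  assumes "S \<noteq> {}" "\<And>A. A \<in> S \<Longrightarrow> ideal A R"
  shows "\<exists>M\<in>S. \<forall>A\<in>S. M \<subseteq> A \<longrightarrow> A = M"
proof (rule subset_Zorn)
  fix C assume C: "subset.chain S C"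
  show "\<exists>U\<in>S. \<forall>A\<in>C. A \<subseteq> U"
  proof (cases "C = {}")
    case True
    then show ?thesis using assms(1) by blast
  next
    case False
    have "subset.chain {I. ideal I R} C"
      using C assms(2) unfolding pred_on.chain_def by blast
    then have "\<Union> C \<in> C" by (rule ideal_chain_is_trivial[OF False])
    moreover have "C \<subseteq> S" using C unfolding pred_on.chain_def by blast
    ultimately show ?thesis by blast
  qed
qed

text \<open>This stands in for the finiteness of the set of minimal primes. A maximal counterexample
  \<open>M\<close> is not prime; for \<open>xy\<close> in \<open>M\<close> the prime products inside
  \<open>(x) + M\<close> and \<open>(y) + M\<close> multiply into \<open>M\<close>. The empty list
  covers the case \<open>b = R\<close>.\<close>

lemma prime_product:
  assumes "ideal b R"
  shows "\<exists>Ps. (\<forall>P\<in>set Ps. primeideal P R \<and> b \<subseteq> P) \<and> lprod Ps \<subseteq> b"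
proof (rule ccontr)
  assume neg: "\<not> ?thesis"
  define S where "S = {b. ideal b R \<and> \<not> (\<exists>Ps. (\<forall>P\<in>set Ps. primeideal P R \<and> b \<subseteq> P) \<and> lprod Ps \<subseteq> b)}"
  have "b \<in> S" using assms neg by (simp add: S_def)
  then have "S \<noteq> {}" by blast
  moreover have "\<And>c. c \<in> S \<Longrightarrow> ideal c R" by (simp add: S_def)
  ultimately have "\<exists>M\<in>S. \<forall>c\<in>S. M \<subseteq> c \<longrightarrow> c = M" by (rule maximal_ideal_of_set)
  then obtain M where M: "M \<in> S" "\<And>A. A \<in> S \<Longrightarrow> M \<subseteq> A \<Longrightarrow> A = M"
    by blast
  have Mid: "ideal M R" using M(1) by (simp add: S_def)
  have Mno: False if "\<forall>P\<in>set Ps. primeideal P R \<and> M \<subseteq> P" "lprod Ps \<subseteq> M" for Ps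
    using M(1) that unfolding S_def by blast
  have "M \<noteq> carrier R" using Mno[of "[]"] by auto
  moreover have "\<not> primeideal M R"
    using Mno[of "[M]"] by (auto simp: ideal_prod_one Mid)
  ultimately obtain x y where xy: "x \<in> carrier R" "y \<in> carrier R" "x \<otimes> y \<in> M" "x \<notin> M" "y \<notin> M"
    using primeidealI[OF Mid is_cring] by metis
  have ex: "\<exists>Ps. (\<forall>P\<in>set Ps. primeideal P R \<and> PIdl z <+> M \<subseteq> P) \<and> lprod Ps \<subseteq> PIdl z <+> M"
    if z: "z \<in> carrier R" "z \<notin> M" for z
  proof (rule ccontr)
    note Iz = cgenideal_ideal[OF z(1)]
    assume "\<not> ?thesis"
    then have "PIdl z <+> M \<in> S" unfolding S_def using isum_ideal[OF Iz Mid] by blast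
    then have "PIdl z <+> M = M" by (rule M(2)) (rule isum_upper2[OF Iz Mid])
    then show False using z(2) cgenideal_self[OF z(1)] isum_upper1[OF Iz Mid] by blast
  qed
  obtain Ps where Ps: "\<And>P. P \<in> set Ps \<Longrightarrow> primeideal P R" "\<And>P. P \<in> set Ps \<Longrightarrow> PIdl x <+> M \<subseteq> P"
      "lprod Ps \<subseteq> PIdl x <+> M"
    using ex[OF xy(1,4)] by blast
  obtain Qs where Qs: "\<And>P. P \<in> set Qs \<Longrightarrow> primeideal P R" "\<And>P. P \<in> set Qs \<Longrightarrow> PIdl y <+> M \<subseteq> P"
      "lprod Qs \<subseteq> PIdl y <+> M"
    using ex[OF xy(2,5)] by blast
  note Ix = cgenideal_ideal[OF xy(1)] and Iy = cgenideal_ideal[OF xy(2)]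
  have "lprod (Ps @ Qs) = lprod Ps \<cdot> lprod Qs"
    by (rule lprod_append) (use Ps(1) Qs(1) prime_ideal in auto)
  also have "\<dots> \<subseteq> (PIdl x <+> M) \<cdot> (PIdl y <+> M)"
    by (intro ideal_prod_mono isum_ideal Ix Iy Mid Ps(3) Qs(3))
  also have "\<dots> \<subseteq> M"
    unfolding prod_le_iff[OF Mid]
  proof (intro ballI)
    fix u v assume "u \<in> PIdl x <+> M" "v \<in> PIdl y <+> M"
    then obtain r m r' m' where u: "u = r \<otimes> x \<oplus> m" "r \<in> carrier R" "m \<in> M"
      and v: "v = r' \<otimes> y \<oplus> m'" "r' \<in> carrier R" "m' \<in> M"
      unfolding isum_mem cgenideal_def by blast
    note car = u(2) v(2) xy(1,2) ideal_carr[OF Mid u(3)] ideal_carr[OF Mid v(3)]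
    have "u \<otimes> v = ((r \<otimes> r') \<otimes> (x \<otimes> y) \<oplus> (r \<otimes> x) \<otimes> m') \<oplus> (r' \<otimes> y \<oplus> m') \<otimes> m"
      unfolding u v using car by algebra
    moreover have "\<dots> \<in> M"
      by (intro ideal_add[OF Mid])
         (rule ideal_lmult[OF Mid], use car u(3) v(3) xy(3) in simp_all)+
    ultimately show "u \<otimes> v \<in> M" by simp
  qed
  finally have "lprod (Ps @ Qs) \<subseteq> M" .
  moreover have "\<forall>P\<in>set (Ps @ Qs). primeideal P R \<and> M \<subseteq> P"
  proof
    fix P assume "P \<in> set (Ps @ Qs)"
    then consider "P \<in> set Ps" | "P \<in> set Qs" by auto
    then show "primeideal P R \<and> M \<subseteq> P"
    proof cases
      case 1
      then show ?thesis using Ps(1,2)[of P] isum_upper2[OF Ix Mid] by blast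
    next
      case 2
      then show ?thesis using Qs(1,2)[of P] isum_upper2[OF Iy Mid] by blast
    qed
  qed
  ultimately show False by (intro Mno)
qed

end

sublocale noetherian_local_ring \<subseteq> noetherian_cring ..

section \<open>Nakayama, Krull intersection and finite length over the local ring\<close>

context noetherian_local_ring
begin

lemma nn_ideal: "ideal \<nn> R"
  by (rule maximalideal.axioms(1)[OF maximal])

lemma nn_prime: "primeideal \<nn> R"
  by (rule maximalideal_prime[OF maximal])

lemma proper_subset_nn:
  assumes A: "ideal A R" "A \<noteq> carrier R"
  shows "A \<subseteq> \<nn>"
proof -
  define S where "S = {M. ideal M R \<and> A \<subseteq> M \<and> M \<noteq> carrier R}"
  have "A \<in> S" using A by (simp add: S_def)
  then have "S \<noteq> {}" by blast
  moreover have "\<And>c. c \<in> S \<Longrightarrow> ideal c R" by (simp add: S_def)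
  ultimately have "\<exists>M\<in>S. \<forall>c\<in>S. M \<subseteq> c \<longrightarrow> c = M" by (rule maximal_ideal_of_set)
  then obtain M where M: "M \<in> S" "\<And>B. B \<in> S \<Longrightarrow> M \<subseteq> B \<Longrightarrow> B = M"
    by blast
  have "maximalideal M R"
  proof (rule maximalidealI)
    show "ideal M R" "carrier R \<noteq> M" using M(1) by (auto simp: S_def)
    show "J = M \<or> J = carrier R" if "ideal J R" "M \<subseteq> J" "J \<subseteq> carrier R" for J
      using M that by (auto simp: S_def)
  qed
  then have "M = \<nn>" by (rule maximal_unique)
  then show ?thesis using M(1) by (simp add: S_def)
qed

lemma prime_subset_nn: "primeideal P R \<Longrightarrow> P \<subseteq> \<nn>"
  using proper_subset_nn[OF prime_ideal] primeideal.I_notcarr by metis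

lemma one_minus_unit:
  assumes "j \<in> \<nn>"
  shows "\<exists>u\<in>carrier R. u \<otimes> (\<one> \<ominus> j) = \<one>"
proof -
  have j: "j \<in> carrier R" using assms ideal_carr[OF nn_ideal] by blast
  then have d: "\<one> \<ominus> j \<in> carrier R" by simp
  have "PIdl (\<one> \<ominus> j) = carrier R"
  proof (rule ccontr)
    assume "PIdl (\<one> \<ominus> j) \<noteq> carrier R"
    then have "PIdl (\<one> \<ominus> j) \<subseteq> \<nn>" by (rule proper_subset_nn[OF cgenideal_ideal[OF d]])
    then have "\<one> \<ominus> j \<in> \<nn>" using cgenideal_self[OF d] by blast
    then have "(\<one> \<ominus> j) \<oplus> j \<in> \<nn>" using assms by (rule ideal_add[OF nn_ideal])
    then have "\<one> \<in> \<nn>" using j by (simp add: minus_add_cancel)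
    then show False
      using ideal.one_imp_carrier[OF nn_ideal] primeideal.I_notcarr[OF nn_prime] by simp
  qed
  then have "\<one> \<in> PIdl (\<one> \<ominus> j)" by simp
  then show ?thesis by (force simp: cgenideal_def)
qed

text \<open>Instead of counting generators, choose \<open>M\<close> maximal with
  \<open>a \<subseteq> M \<subset> b\<close>. Then \<open>b = (g) + M\<close>, so
  \<open>g (1 - j)\<close> lies in \<open>M\<close> for some \<open>j\<close> in \<open>J\<close>,
  and \<open>1 - j\<close> is a unit.\<close>

lemma nakayama:
  assumes J: "ideal J R" "J \<subseteq> \<nn>" and a: "ideal a R" and b: "ideal b R" and ab: "a \<subseteq> b"
    and sub: "b \<subseteq> J \<cdot> b <+> a"
  shows "b \<subseteq> a"
proof (rule ccontr)
  assume "\<not> b \<subseteq> a"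
  define S where "S = {c. ideal c R \<and> a \<subseteq> c \<and> c \<subset> b}"
  have "a \<in> S" using a ab \<open>\<not> b \<subseteq> a\<close> by (auto simp: S_def)
  then have "S \<noteq> {}" by blast
  moreover have "\<And>c. c \<in> S \<Longrightarrow> ideal c R" by (simp add: S_def)
  ultimately have "\<exists>M\<in>S. \<forall>c\<in>S. M \<subseteq> c \<longrightarrow> c = M" by (rule maximal_ideal_of_set)
  then obtain M where M: "M \<in> S" "\<And>c. c \<in> S \<Longrightarrow> M \<subseteq> c \<Longrightarrow> c = M"
    by blast
  have Mid: "ideal M R" and aM: "a \<subseteq> M" and Mb: "M \<subset> b" using M(1) by (auto simp: S_def)
  obtain g where g: "g \<in> b" "g \<notin> M" using Mb by blast
  have gc: "g \<in> carrier R" using g(1) ideal_carr[OF b] by blast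
  note Ig = cgenideal_ideal[OF gc]
  have gM: "ideal (PIdl g <+> M) R" by (rule isum_ideal[OF Ig Mid])
  have sub_b: "PIdl g <+> M \<subseteq> b"
    using cgenideal_minimal[OF b g(1)] Mb by (intro isum_least[OF b]) auto
  have g_in: "g \<in> PIdl g <+> M" using cgenideal_self[OF gc] isum_upper1[OF Ig Mid] by blast
  have "b \<subseteq> PIdl g <+> M"
  proof (rule ccontr)
    assume "\<not> b \<subseteq> PIdl g <+> M"
    then have "PIdl g <+> M \<in> S"
      unfolding S_def using gM sub_b isum_upper2[OF Ig Mid] aM by blast
    then have "PIdl g <+> M = M" by (rule M(2)) (rule isum_upper2[OF Ig Mid])
    then show False using g_in g(2) by simp
  qed
  then have "J \<cdot> b \<subseteq> J \<cdot> (PIdl g <+> M)" by (intro ideal_prod_mono J gM order_refl)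
  also have "\<dots> \<subseteq> (J \<cdot> (PIdl g)) <+> M" by (rule prod_sum_subset[OF J(1) Ig Mid])
  also have "\<dots> \<subseteq> scale g J <+> M"
  proof (intro isum_mono order_refl)
    show "J \<cdot> (PIdl g) \<subseteq> scale g J"
      unfolding prod_le_iff[OF scale_ideal[OF gc J(1)]]
    proof (intro ballI)
      fix j w assume j: "j \<in> J" and "w \<in> PIdl g"
      then obtain r where r: "r \<in> carrier R" "w = r \<otimes> g" by (auto simp: cgenideal_def)
      have jc: "j \<in> carrier R" using j ideal_carr[OF J(1)] by blast
      have "j \<otimes> w = g \<otimes> (j \<otimes> r)" unfolding r(2) using r(1) jc gc by algebra
      moreover have "j \<otimes> r \<in> J" by (rule ideal_rmult[OF J(1) j r(1)])
      ultimately show "j \<otimes> w \<in> scale g J" by (simp add: scale_mem)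
    qed
  qed
  finally have "J \<cdot> b <+> a \<subseteq> scale g J <+> M"
    using aM isum_upper2[OF scale_ideal[OF gc J(1)] Mid]
    by (intro isum_least isum_ideal scale_ideal gc J Mid) auto
  then have "g \<in> scale g J <+> M" using sub g(1) by blast
  then obtain j m where jm: "j \<in> J" "m \<in> M" "g = g \<otimes> j \<oplus> m" by (auto simp: isum_mem scale_def)
  have jc: "j \<in> carrier R" and mc: "m \<in> carrier R"
    using jm ideal_carr[OF J(1)] ideal_carr[OF Mid] by auto
  obtain u where u: "u \<in> carrier R" "u \<otimes> (\<one> \<ominus> j) = \<one>" using one_minus_unit jm(1) J(2) by blast
  have "g \<ominus> g \<otimes> j = m"
    using add_minus_cancel_left[of "g \<otimes> j" m] gc jc mc jm(3) by simp
  moreover have "g \<ominus> g \<otimes> j = g \<otimes> (\<one> \<ominus> j)" using gc jc by algebra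
  ultimately have "u \<otimes> m = u \<otimes> (g \<otimes> (\<one> \<ominus> j))" by simp
  also have "\<dots> = g \<otimes> (u \<otimes> (\<one> \<ominus> j))" using u(1) gc jc by algebra
  also have "\<dots> = g" unfolding u(2) using gc by simp
  finally show False using g(2) ideal_lmult[OF Mid jm(2) u(1)] by simp
qed

text \<open>For the intersection \<open>b\<close>, Artin-Rees one step past its bound gives
  \<open>b \<subseteq> J b + a\<close>, and Nakayama applies.\<close>

lemma krull_intersection:
  assumes J: "ideal J R" "J \<subseteq> \<nn>" and a: "ideal a R"
  shows "(\<Inter>m. ipow J m <+> a) \<subseteq> a"
proof -
  define b where "b = (\<Inter>m. ipow J m <+> a)"
  have Ja: "ideal (ipow J m <+> a) R" for m by (intro isum_ideal ipow_ideal J a)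
  have "ideal (\<Inter> (range (\<lambda>m. ipow J m <+> a))) R" by (rule i_Intersect) (use Ja in auto)
  then have b: "ideal b R" by (simp add: b_def)
  have ab: "a \<subseteq> b" unfolding b_def using isum_upper2[OF ipow_ideal[OF J(1)] a] by blast
  obtain D where D: "\<And>t. D \<le> t \<Longrightarrow> (ipow J t <+> a) \<inter> b \<subseteq> ipow J (t - D) \<cdot> b <+> a"
    using artin_rees[OF J(1) a b ab] by blast
  have "b \<subseteq> (ipow J (Suc D) <+> a) \<inter> b" unfolding b_def by blast
  also have "\<dots> \<subseteq> ipow J (Suc D - D) \<cdot> b <+> a" by (rule D) simp
  also have "Suc D - D = 1" by simp
  finally have "b \<subseteq> J \<cdot> b <+> a" unfolding ipow_1[OF J(1)] .
  then show ?thesis using nakayama[OF J a b ab] by (simp add: b_def)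
qed

text \<open>The working form of being primary to the maximal ideal: a power of \<open>\<nn>\<close>
  inside \<open>J\<close> is what yields finite length.\<close>

definition nn_primary :: "'a set \<Rightarrow> bool" where
  "nn_primary J \<longleftrightarrow> ideal J R \<and> J \<subseteq> \<nn> \<and> (\<exists>r. ipow \<nn> r \<subseteq> J)"

lemma lprod_nn: "\<forall>P\<in>set Ps. P = \<nn> \<Longrightarrow> lprod Ps = ipow \<nn> (length Ps)"
  by (induction Ps) (simp_all add: ipow_Suc nn_ideal)

text \<open>If only \<open>\<nn>\<close> can lie over \<open>J\<close>, the product of primes inside
  \<open>J\<close> from \<open>prime_product\<close> is a power of \<open>\<nn>\<close>; an empty
  product gives exponent 0.\<close>

lemma nn_primary_iff_primes:
  assumes "ideal J R"
  shows "(\<exists>r. ipow \<nn> r \<subseteq> J) \<longleftrightarrow> (\<forall>P. primeideal P R \<longrightarrow> J \<subseteq> P \<longrightarrow> P = \<nn>)"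
proof
  assume "\<exists>r. ipow \<nn> r \<subseteq> J"
  then obtain r where r: "ipow \<nn> r \<subseteq> J" by blast
  show "\<forall>P. primeideal P R \<longrightarrow> J \<subseteq> P \<longrightarrow> P = \<nn>"
  proof (intro allI impI)
    fix P assume P: "primeideal P R" "J \<subseteq> P"
    then have "\<nn> \<subseteq> P" using r by (intro prime_ipow[OF P(1) nn_ideal, of r]) auto
    then show "P = \<nn>" using prime_subset_nn[OF P(1)] by blast
  qed
next
  assume *: "\<forall>P. primeideal P R \<longrightarrow> J \<subseteq> P \<longrightarrow> P = \<nn>"
  obtain Ps where "\<forall>P\<in>set Ps. primeideal P R \<and> J \<subseteq> P" "lprod Ps \<subseteq> J"
    using prime_product[OF assms] by blast
  then show "\<exists>r. ipow \<nn> r \<subseteq> J" using lprod_nn[of Ps] * by metis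
qed

lemma is_primary_to_nn:
  assumes "is_primary_to R \<nn> J"
  shows "nn_primary J"
proof -
  have J: "ideal J R" and rad: "ideal_radical R J = \<nn>" using assms by (auto simp: is_primary_to_def)
  have "J \<subseteq> \<nn>"
  proof
    fix x assume "x \<in> J"
    then have "x \<in> carrier R" "x [^] (1::nat) \<in> J" using ideal_carr[OF J] by auto
    then show "x \<in> \<nn>" unfolding rad[symmetric] ideal_radical_def by blast
  qed
  moreover have "P = \<nn>" if P: "primeideal P R" "J \<subseteq> P" for P
  proof -
    have pow: "x \<in> P" if "x \<in> carrier R" "x [^] (n::nat) \<in> P" for x n
      using that(2)
    proof (induction n)
      case 0
      then show ?case
        using ideal.one_imp_carrier[OF prime_ideal[OF P(1)]] that(1) by simp
    next
      case (Suc n)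
      then show ?case using primeideal.I_prime[OF P(1), of "x [^] n" x] that(1) by auto
    qed
    have "\<nn> \<subseteq> P" unfolding rad[symmetric] ideal_radical_def using P(2) pow by blast
    then show ?thesis using prime_subset_nn[OF P(1)] by blast
  qed
  ultimately show ?thesis unfolding nn_primary_def using J nn_primary_iff_primes[OF J] by blast
qed

lemma prime_over_nn_primary: "nn_primary J \<Longrightarrow> primeideal P R \<Longrightarrow> J \<subseteq> P \<Longrightarrow> P = \<nn>"
  using nn_primary_iff_primes[of J] unfolding nn_primary_def by blast

lemma nn_primary_ipow:
  assumes "nn_primary J" "1 \<le> c"
  shows "nn_primary (ipow J c)"
proof -
  have J: "ideal J R" "J \<subseteq> \<nn>" using assms(1) by (auto simp: nn_primary_def)
  have "ipow J c \<subseteq> ipow J 1" by (rule ipow_antimono[OF J(1) assms(2)])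
  then have "ipow J c \<subseteq> \<nn>" using J(2) unfolding ipow_1[OF J(1)] by blast
  moreover have "P = \<nn>" if "primeideal P R" "ipow J c \<subseteq> P" for P
    using prime_over_nn_primary[OF assms(1) that(1)] prime_ipow[OF that(1) J(1) that(2)] by blast
  ultimately show ?thesis
    unfolding nn_primary_def using ipow_ideal[OF J(1)] nn_primary_iff_primes[of "ipow J c"] by blast
qed

lemma ilen_nn: "ilen \<nn> (carrier R) \<noteq> \<infinity>"
proof -
  have "ilen \<nn> (carrier R) \<le> 1"
  proof (rule ilen_leI)
    fix H n assume H: "ideal_chain \<nn> (carrier R) H n"
    have two: "H i = \<nn> \<or> H i = carrier R" if "i \<le> n" for i
      using maximalideal.I_maximal[OF maximal, of "H i"] ideal_chainD(1-3)[OF H that] by blast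
    have "n \<le> 1"
    proof (rule ccontr)
      assume "\<not> n \<le> 1"
      then have "H 0 \<subset> H 1" "H 1 \<subset> H 2"
        using ideal_chainD(4)[OF H, of 0] ideal_chainD(4)[OF H, of 1] by (auto simp: numeral_2_eq_2)
      moreover have "H 2 \<subseteq> carrier R" "\<nn> \<subseteq> H 0"
        using ideal_chainD(2,3)[OF H] \<open>\<not> n \<le> 1\<close> by auto
      ultimately show False using two[of 1] \<open>\<not> n \<le> 1\<close> by auto
    qed
    then show "enat n \<le> 1" by (simp add: one_enat_def)
  qed
  then show ?thesis by (rule enat_finite_le) simp
qed

lemma ilen_ideal_prod_finite:
  assumes J: "ideal J R" "ilen J (carrier R) \<noteq> \<infinity>" and A: "ideal A R"
  shows "ilen (J \<cdot> A) A \<noteq> \<infinity>"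
proof -
  obtain G where G: "finite G" "G \<subseteq> carrier R" "A = Idl G" using finetely_gen[OF A] by blast
  have JA: "ideal (J \<cdot> A) R" by (rule prod_ideal[OF J(1) A])
  have "scale g J \<subseteq> J \<cdot> A" if "g \<in> G" for g
  proof -
    have "g \<in> A" using that genideal_self[OF G(2)] G(3) by blast
    then have "scale g J \<subseteq> A \<cdot> J" by (rule scale_prod_subset)
    then show ?thesis by (simp add: ideal_prod_commute[OF A J(1)])
  qed
  then have "ilen (J \<cdot> A) ((Idl G) <+> (J \<cdot> A)) \<noteq> \<infinity>" by (rule ilen_prod_finite[OF J G(1,2) JA])
  then show ?thesis
    using isum_absorb[OF A JA prod_subset2[OF J(1) A]] G(3) by simp
qed

lemma ilen_nn_power: "ilen (ipow \<nn> r) (carrier R) \<noteq> \<infinity>"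
proof (induction r)
  case (Suc r)
  have "ilen (ipow \<nn> (Suc r)) (carrier R)
      = ilen (ipow \<nn> (Suc r)) (ipow \<nn> r) + ilen (ipow \<nn> r) (carrier R)"
    by (intro ilen_add ipow_ideal nn_ideal oneideal ipow_Suc_subset ideal_subset)
  moreover have "ilen (ipow \<nn> (Suc r)) (ipow \<nn> r) \<noteq> \<infinity>"
    unfolding ipow_Suc[OF nn_ideal]
    by (rule ilen_ideal_prod_finite[OF nn_ideal ilen_nn ipow_ideal[OF nn_ideal]])
  ultimately show ?case using enat_add_finite[OF _ Suc.IH] by simp
qed simp

lemma ilen_of_nn_power: "ipow \<nn> r \<subseteq> b \<Longrightarrow> ilen b (carrier R) \<noteq> \<infinity>"
  by (rule enat_finite_le[OF ilen_mono[OF _ order_refl] ilen_nn_power])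

lemma ilen_nn_primary: "nn_primary J \<Longrightarrow> ilen J (carrier R) \<noteq> \<infinity>"
  unfolding nn_primary_def using ilen_of_nn_power by blast

lemma prime_chain_nn:
  assumes "prime_chain b P n" "P 0 = \<nn>"
  shows "n = 0"
proof (rule ccontr)
  assume "n \<noteq> 0"
  then have "P 0 \<subset> P 1" "primeideal (P 1) R" using assms(1) by (auto simp: prime_chain_def)
  then show False using prime_subset_nn[of "P 1"] assms(2) by blast
qed

text \<open>Cut down by an element \<open>x\<close> of \<open>J\<close> outside the relevant primes, and use \<open>x\<^sup>m \<in> J\<^sup>m\<close>.\<close>
lemma hilbert_samuel_bound:
  assumes J: "nn_primary J"
  shows "ideal b R \<Longrightarrow> pdim b \<le> enat q \<Longrightarrow> \<exists>C. \<forall>m. ilen (ipow J m <+> b) (carrier R) \<le> enat (C * m ^ q)"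
proof (induction q arbitrary: b)
  case 0
  note b = 0(1)
  have Ji: "ideal J R" using J by (simp add: nn_primary_def)
  have "P = \<nn>" if P: "primeideal P R" "b \<subseteq> P" for P
  proof (rule ccontr)
    assume "P \<noteq> \<nn>"
    then have "P \<subset> \<nn>" using prime_subset_nn[OF P(1)] by blast
    moreover have "prime_chain b (\<lambda>_. \<nn>) 0"
      using nn_prime P prime_subset_nn[OF P(1)] by (auto simp: prime_chain_def)
    ultimately have "prime_chain b (case_nat P (\<lambda>_. \<nn>)) (Suc 0)" using P by (intro prime_chain_cons)
    then have "enat (Suc 0) \<le> pdim b" by (rule pdim_geI)
    then have "enat (Suc 0) \<le> enat 0" using 0(2) by (rule order_trans)
    then show False by simp
  qed
  \<comment> \<open>In dimension 0 only \<open>\<nn>\<close> can lie over \<open>b\<close>, so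
    \<open>R / b\<close> has finite length, which bounds all terms at once.\<close>
  then obtain r where "ipow \<nn> r \<subseteq> b" using nn_primary_iff_primes[OF b] by blast
  then have "ilen b (carrier R) \<noteq> \<infinity>" by (rule ilen_of_nn_power)
  then obtain C where C: "ilen b (carrier R) = enat C" by (cases "ilen b (carrier R)") auto
  show ?case
  proof (intro exI allI)
    fix m
    have "ilen (ipow J m <+> b) (carrier R) \<le> ilen b (carrier R)"
      by (intro ilen_mono isum_upper2 ipow_ideal Ji b order_refl)
    then show "ilen (ipow J m <+> b) (carrier R) \<le> enat (C * m ^ 0)" by (simp add: C)
  qed
next
  case (Suc q)
  note b = Suc.prems(1)
  have Ji: "ideal J R" using J by (simp add: nn_primary_def)
  obtain Ps where Ps: "\<And>P. P \<in> set Ps \<Longrightarrow> primeideal P R" "\<And>P. P \<in> set Ps \<Longrightarrow> b \<subseteq> P" "lprod Ps \<subseteq> b"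
    using prime_product[OF b] by blast
  \<comment> \<open>\<open>\<nn>\<close> contains \<open>J\<close> and cannot be avoided; if it
    occurs among the factors it is handled separately below.\<close>
  have "\<exists>x\<in>J. \<forall>P\<in>set Ps - {\<nn>}. x \<notin> P"
  proof (rule prime_avoidance[OF _ Ji])
    fix P assume P: "P \<in> set Ps - {\<nn>}"
    then show "primeideal P R" using Ps(1) by simp
    then show "\<not> J \<subseteq> P" using P prime_over_nn_primary[OF J, of P] by blast
  qed simp
  then obtain x where x: "x \<in> J" "\<And>P. P \<in> set Ps \<Longrightarrow> P \<noteq> \<nn> \<Longrightarrow> x \<notin> P" by blast
  have xc: "x \<in> carrier R" using x(1) ideal_carr[OF Ji] by blast
  note Ix = cgenideal_ideal[OF xc]
  define b' where "b' = PIdl x <+> b"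
  have b': "ideal b' R" unfolding b'_def by (rule isum_ideal[OF Ix b])
  have "pdim b' \<le> enat q"
  proof (rule pdim_leI)
    fix P n assume chain: "prime_chain b' P n"
    then have P0: "primeideal (P 0) R" "b' \<subseteq> P 0" by (auto simp: prime_chain_def)
    have "lprod Ps \<subseteq> P 0" using Ps(3) P0(2) isum_upper2[OF Ix b] unfolding b'_def by blast
    then obtain Q where Q: "Q \<in> set Ps" "Q \<subseteq> P 0"
      using prime_lprod[OF P0(1), of Ps] Ps(1) prime_ideal by blast
    show "enat n \<le> enat q"
    \<comment> \<open>A chain that starts at \<open>\<nn>\<close> has length 0. Otherwise
      \<open>x\<close> separates \<open>Q\<close> from \<open>P 0\<close>, and \<open>Q\<close> can
      be put in front of the chain.\<close>
    proof (cases "Q = \<nn>")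
      case True
      then have "P 0 = \<nn>" using Q(2) prime_subset_nn[OF P0(1)] by blast
      then show ?thesis using prime_chain_nn[OF chain] by simp
    next
      case False
      have "x \<in> P 0" using P0(2) cgenideal_self[OF xc] isum_upper1[OF Ix b] unfolding b'_def by blast
      then have "Q \<subset> P 0" using Q(2) x(2)[OF Q(1) False] by blast
      then have "prime_chain b (case_nat Q P) (Suc n)"
        by (rule prime_chain_cons[OF chain Ps(1)[OF Q(1)] Ps(2)[OF Q(1)]])
      then have "enat (Suc n) \<le> enat (Suc q)" using pdim_geI Suc.prems(2) order_trans by blast
      then show ?thesis by simp
    qed
  qed
  then obtain C where C: "\<And>m. ilen (ipow J m <+> b') (carrier R) \<le> enat (C * m ^ q)"
    using Suc.IH[OF b'] by blast
  show ?case
  proof (intro exI allI)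
    fix m
    let ?c = "ipow J m <+> b"
    have Jm: "ideal (ipow J m) R" by (rule ipow_ideal[OF Ji])
    have c: "ideal ?c R" by (rule isum_ideal[OF Jm b])
    \<comment> \<open>Adding \<open>x^m\<close> thus changes nothing, and the length of
      \<open>R / (J^m + b)\<close> is at most \<open>m\<close> times that of
      \<open>R / ((x) + J^m + b)\<close>: the exponent of \<open>m\<close> grows by one.\<close>
    have "x [^] m \<in> ?c" using pow_mem_ipow[OF Ji x(1)] isum_upper1[OF Jm b] by blast
    then have "PIdl (x [^] m) <+> ?c \<subseteq> ?c" by (rule isum_least[OF c cgenideal_minimal[OF c] order_refl])
    then have "ilen ?c (carrier R) \<le> ilen (PIdl (x [^] m) <+> ?c) (carrier R)"
      by (intro ilen_mono order_refl)
    also have "\<dots> \<le> of_nat m * ilen (PIdl x <+> ?c) (carrier R)" by (rule ilen_power_le[OF c xc])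
    also have "\<dots> \<le> of_nat m * enat (C * m ^ q)"
    proof (rule mult_left_mono)
      have "ipow J m <+> b' \<subseteq> PIdl x <+> ?c"
        unfolding b'_def
      proof (intro isum_ideal[OF Ix c] isum_least)
        show "ipow J m \<subseteq> PIdl x <+> ?c" using isum_upper1[OF Jm b] isum_upper2[OF Ix c] by blast
        show "PIdl x \<subseteq> PIdl x <+> ?c" by (rule isum_upper1[OF Ix c])
        show "b \<subseteq> PIdl x <+> ?c" using isum_upper2[OF Jm b] isum_upper2[OF Ix c] by blast
      qed
      then have "ilen (PIdl x <+> ?c) (carrier R) \<le> ilen (ipow J m <+> b') (carrier R)"
        by (intro ilen_mono order_refl)
      also have "\<dots> \<le> enat (C * m ^ q)" by (rule C)
      finally show "ilen (PIdl x <+> ?c) (carrier R) \<le> enat (C * m ^ q)" .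
    qed simp
    also have "\<dots> = enat (C * m ^ Suc q)" by (simp add: of_nat_eq_enat mult_ac)
    finally show "ilen ?c (carrier R) \<le> enat (C * m ^ Suc q)" .
  qed
qed

end

section \<open>The Hilbert polynomial and its degree\<close>

context cring
begin

lemma colon_ideal:
  assumes A: "ideal A R" and B: "B \<subseteq> carrier R"
  shows "ideal (colon R A B) R"
proof (rule idealI_mult)
  show "r \<otimes> a \<in> colon R A B" if "r \<in> carrier R" "a \<in> colon R A B" for r a
    using that ideal_lmult[OF A] B by (auto simp: colon_def m_assoc subset_iff)
  show "a \<oplus> b \<in> colon R A B" if "a \<in> colon R A B" "b \<in> colon R A B" for a b
    using that ideal_add[OF A] B by (auto simp: colon_def l_distr subset_iff)
qed (use ideal_0[OF A] B in \<open>auto simp: colon_def\<close>)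

lemma colon_prod: "ideal A R \<Longrightarrow> colon R A B \<cdot> B \<subseteq> A"
  by (subst prod_le_iff) (auto simp: colon_def)

lemma saturation_eq_union: "saturation R A B = (\<Union>n. colon R A (ipow B n))"
  by (simp add: saturation_def ipow_def)

lemma saturation_subset_prime:
  assumes P: "primeideal P R" and A: "A \<subseteq> P" and B: "ideal B R" "\<not> B \<subseteq> P"
  shows "saturation R A B \<subseteq> P"
proof
  fix r assume "r \<in> saturation R A B"
  then obtain n where r: "r \<in> carrier R" "\<forall>b\<in>ipow B n. r \<otimes> b \<in> A"
    unfolding saturation_eq_union colon_def by blast
  have "\<not> ipow B n \<subseteq> P" using prime_ipow[OF P B(1)] B(2) by blast
  then obtain b where b: "b \<in> ipow B n" "b \<notin> P" by blast
  have "b \<in> carrier R" using b(1) ideal_carr[OF ipow_ideal[OF B(1)]] by blast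
  then show "r \<in> P" using primeideal.I_prime[OF P r(1), of b] r(2) b A by blast
qed

text \<open>The Hilbert function of the quotient ring \<open>R / a\<close>, expressed by ideals of
  \<open>R\<close>; \<open>proj_hilbert_function\<close> makes the identification.\<close>

definition hlen :: "(nat \<Rightarrow> 'a set) \<Rightarrow> nat \<Rightarrow> 'a set \<Rightarrow> (nat \<Rightarrow> nat) \<Rightarrow> enat" where
  "hlen I s a n = ilen (ideal_monomial R I s (n(0 := Suc (n 0))) <+> a) (ideal_monomial R I s n <+> a)"

definition is_hilb :: "(nat \<Rightarrow> 'a set) \<Rightarrow> nat \<Rightarrow> 'a set \<Rightarrow> multipoly \<Rightarrow> bool" where
  "is_hilb I s a P \<longleftrightarrow> vars_le s P \<and>
     for_large s (\<lambda>n. \<exists>l. hlen I s a n = enat l \<and> of_nat l = multipoly_eval P n)"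

lemma is_hilb_unique:
  assumes "is_hilb I s a P" "is_hilb I s a Q"
  shows "P = Q"
proof -
  have "for_large s (\<lambda>n. multipoly_eval P n = multipoly_eval Q n)"
    using assms unfolding is_hilb_def
    by (elim conjE) (rule for_large_mono[OF for_large_conj], assumption, assumption, auto)
  then obtain N where "\<forall>n. (\<forall>j\<le>s. N \<le> n j) \<longrightarrow> multipoly_eval P n = multipoly_eval Q n"
    unfolding for_large_def by (elim exE)
  then show ?thesis
    using multipoly_eqI[of s P Q N] assms by (simp add: is_hilb_def)
qed

text \<open>Two Hilbert polynomials agree at all large arguments and are therefore equal, so the
  description has a single candidate.\<close>

lemma the_hilb_coefficient:
  assumes "D" "is_hilb I s a P" "c \<noteq> 0"
  shows "(THE e. D \<and> (\<exists>P. is_hilb I s a P \<and> Poly_Mapping.lookup P \<kappa> = e / c)) = Poly_Mapping.lookup P \<kappa> * c"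
proof (rule the_equality)
  show "D \<and> (\<exists>P'. is_hilb I s a P' \<and> Poly_Mapping.lookup P' \<kappa> = Poly_Mapping.lookup P \<kappa> * c / c)"
    using assms by (intro conjI exI[of _ P]) simp_all
  fix e assume "D \<and> (\<exists>P. is_hilb I s a P \<and> Poly_Mapping.lookup P \<kappa> = e / c)"
  then obtain P' where "is_hilb I s a P'" "Poly_Mapping.lookup P' \<kappa> = e / c" by (elim conjE exE)
  then show "e = Poly_Mapping.lookup P \<kappa> * c"
    using is_hilb_unique[OF assms(2), of P'] assms(3) by (simp add: field_simps)
qed

end

context noetherian_cring
begin

lemma saturation_eq_colon:
  assumes A: "ideal A R" and B: "ideal B R"
  shows "\<exists>N. saturation R A B = colon R A (ipow B N)"
  unfolding saturation_eq_union
proof (rule increasing_union)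
  show "ideal (colon R A (ipow B p)) R" for p
    by (rule colon_ideal[OF A ideal_subset[OF ipow_ideal[OF B]]])
  show "colon R A (ipow B p) \<subseteq> colon R A (ipow B (Suc p))" for p
    using ipow_Suc_subset[OF B] by (auto simp: colon_def)
qed

lemma saturation_ideal: "ideal A R \<Longrightarrow> ideal B R \<Longrightarrow> ideal (saturation R A B) R"
  using saturation_eq_colon[of A B] colon_ideal[OF _ ideal_subset[OF ipow_ideal[of B]]] by metis

lemma saturation_upper:
  assumes A: "ideal A R" and B: "ideal B R" shows "A \<subseteq> saturation R A B"
proof -
  have "A \<subseteq> colon R A (ipow B 0)" using ideal_rmult[OF A] ideal_carr[OF A] by (auto simp: colon_def)
  then show ?thesis unfolding saturation_eq_union by blast
qed

lemma saturation_annihilated: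
  assumes A: "ideal A R" and B: "ideal B R" shows "\<exists>N. ipow B N \<cdot> saturation R A B \<subseteq> A"
proof -
  obtain N where N: "saturation R A B = colon R A (ipow B N)" using saturation_eq_colon[OF A B] by blast
  have "ipow B N \<cdot> saturation R A B = colon R A (ipow B N) \<cdot> ipow B N"
    unfolding N by (rule ideal_prod_commute[OF ipow_ideal[OF B] colon_ideal[OF A ideal_subset[OF ipow_ideal[OF B]]]])
  then show ?thesis using colon_prod[OF A] by auto
qed

end

section \<open>Growth of lengths and the degree bound\<close>

context noetherian_local_ring
begin

text \<open>The linear Artin--Rees lemma allows one to compare the graded pieces \<open>J\<^sup>tK\<^sup>t / J\<^sup>t\<^sup>+\<^sup>1K\<^sup>t\<close>, \<open>t < T\<close>, with
  consecutive pieces of a single filtration of \<open>R / (J\<^sup>m + b)\<close> with \<open>m\<close> proportional to \<open>T\<close>.\<close>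
lemma growth_bound:
  assumes J: "nn_primary J" and K: "ideal K R" and a: "ideal a R" and b: "ideal b R" and ab: "a \<subseteq> b"
    and Kb: "ipow K N \<cdot> b \<subseteq> a" and q: "pdim b \<le> enat q"
  shows "\<exists>t0 C. \<forall>T. (\<Sum>t\<in>{t0..<T}. ilen (ipow J (Suc t) \<cdot> ipow K t <+> a) (ipow J t \<cdot> ipow K t <+> a))
    \<le> enat (C * T ^ q)"
proof -
  have Ji: "ideal J R" using J by (simp add: nn_primary_def)
  have JK: "ideal (ipow J i \<cdot> ipow K t) R" for i t by (intro prod_ideal ipow_ideal Ji K)
  have JKc: "ideal (ipow J i \<cdot> ipow K t <+> c) R" if "ideal c R" for i t c by (rule isum_ideal[OF JK that])
  obtain D1 where D1: "\<And>t. D1 \<le> t \<Longrightarrow> (ipow K t <+> a) \<inter> b \<subseteq> ipow K (t - D1) \<cdot> b <+> a"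
    using artin_rees[OF K a b ab] by blast
  obtain D where D: "\<And>t m. D * t \<le> m \<Longrightarrow>
      (ipow J m <+> b) \<inter> (ipow K t <+> b) \<subseteq> ipow J (m - D * t) \<cdot> ipow K t <+> b"
    using linear_artin_rees[OF Ji K b] by blast
  obtain C where C: "\<And>m. ilen (ipow J m <+> b) (carrier R) \<le> enat (C * m ^ q)"
    using hilbert_samuel_bound[OF J b q] by blast
  \<comment> \<open>From here on Artin-Rees leaves at least \<open>N\<close> powers of
    \<open>K\<close> in front of \<open>b\<close>, and \<open>Kb\<close> sends them into
    \<open>a\<close>.\<close>
  define t0 where "t0 = D1 + N"
  have absorb: "ipow J i \<cdot> ipow K t <+> a <+> b = ipow J i \<cdot> ipow K t <+> b" for i t
    by (subst isum_assoc[OF JK a b]) (simp add: isum_absorb2[OF a b ab])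
  \<comment> \<open>For such \<open>t\<close> the piece meets \<open>b\<close> inside
    \<open>a\<close>, so \<open>a\<close> may be replaced by \<open>b\<close>, whose dimension is
    the one bounded by \<open>q\<close>.\<close>
  have step1: "ilen (ipow J (Suc t) \<cdot> ipow K t <+> a) (ipow J t \<cdot> ipow K t <+> a)
      \<le> ilen (ipow J (Suc t) \<cdot> ipow K t <+> b) (ipow J t \<cdot> ipow K t <+> b)" if t: "t0 \<le> t" for t
  proof -
    have "(ipow J t \<cdot> ipow K t <+> a) \<inter> b \<subseteq> (ipow K t <+> a) \<inter> b"
      using isum_mono[OF prod_subset2[OF ipow_ideal[OF Ji] ipow_ideal[OF K]] order_refl] by blast
    also have "\<dots> \<subseteq> ipow K (t - D1) \<cdot> b <+> a" by (rule D1) (use t in \<open>simp add: t0_def\<close>)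
    also have "\<dots> \<subseteq> a"
    proof (rule isum_least[OF a _ order_refl])
      have "ipow K (t - D1) \<cdot> b \<subseteq> ipow K N \<cdot> b"
        by (intro ideal_prod_mono ipow_ideal ipow_antimono K b order_refl) (use t in \<open>simp add: t0_def\<close>)
      then show "ipow K (t - D1) \<cdot> b \<subseteq> a" using Kb by (rule subset_trans)
    qed
    also have "a \<subseteq> ipow J (Suc t) \<cdot> ipow K t <+> a" by (rule isum_upper2[OF JK a])
    finally show ?thesis
      using ilen_sum_right[OF JKc[OF a] JKc[OF a] b, of t t "Suc t" t] by (simp add: absorb)
  qed
  have "(\<Sum>t\<in>{t0..<T}. ilen (ipow J (Suc t) \<cdot> ipow K t <+> a) (ipow J t \<cdot> ipow K t <+> a))
    \<le> enat (C * (D + 1) ^ q * T ^ q)" for T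
  proof -
    \<comment> \<open>For \<open>t < T\<close> this leaves \<open>m - D * t \<ge> t + 1\<close>, so
      linear Artin-Rees puts the intersection with \<open>J^m + b\<close> into
      \<open>J^(t+1) K^t + b\<close>.\<close>
    define m where "m = (D + 1) * T"
    define c where "c = ipow J m <+> b"
    have Jm: "ideal (ipow J m) R" by (rule ipow_ideal[OF Ji])
    have c: "ideal c R" unfolding c_def by (rule isum_ideal[OF Jm b])
    have bc: "b \<subseteq> c" unfolding c_def by (rule isum_upper2[OF Jm b])
    \<comment> \<open>Taking \<open>K^(t+1)\<close> in place of \<open>K^t\<close> in the
      denominators enlarges the quotients, and then their lengths telescope.\<close>
    define F where "F t = ipow J t \<cdot> ipow K t <+> c" for t
    have F: "ideal (F t) R" for t unfolding F_def by (rule JKc[OF c])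
    have JKsub: "ipow J (Suc t) \<cdot> ipow K (Suc t) \<subseteq> ipow J (Suc t) \<cdot> ipow K t" for t
      by (intro ideal_prod_mono ipow_ideal Ji K order_refl ipow_Suc_subset)
    have absorb_c: "ipow J i \<cdot> ipow K t <+> b <+> c = ipow J i \<cdot> ipow K t <+> c" for i t
      by (subst isum_assoc[OF JK b c]) (simp add: isum_absorb2[OF b c bc])
    have step2: "ilen (ipow J (Suc t) \<cdot> ipow K t <+> b) (ipow J t \<cdot> ipow K t <+> b) \<le> ilen (F (Suc t)) (F t)"
      if t: "t < T" for t
    proof -
      have "(ipow J t \<cdot> ipow K t <+> b) \<inter> c \<subseteq> (ipow J m <+> b) \<inter> (ipow K t <+> b)"
        unfolding c_def
        using isum_mono[OF prod_subset2[OF ipow_ideal[OF Ji] ipow_ideal[OF K]] order_refl, of t t b] by blast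
      also have "\<dots> \<subseteq> ipow J (m - D * t) \<cdot> ipow K t <+> b"
      proof (rule D)
        have "D * t \<le> D * T" using t by simp
        then show "D * t \<le> m" unfolding m_def add_mult_distrib by linarith
      qed
      also have "\<dots> \<subseteq> ipow J (Suc t) \<cdot> ipow K t <+> b"
      proof (intro isum_mono ideal_prod_mono ipow_ideal Ji K order_refl ipow_antimono)
        have "D * t \<le> D * T" using t by simp
        then show "Suc t \<le> m - D * t" using t unfolding m_def add_mult_distrib by linarith
      qed
      finally have "ilen (ipow J (Suc t) \<cdot> ipow K t <+> b) (ipow J t \<cdot> ipow K t <+> b)
          \<le> ilen (ipow J (Suc t) \<cdot> ipow K t <+> c) (F t)"
        using ilen_sum_right[OF JKc[OF b] JKc[OF b] c, of t t "Suc t" t] by (simp add: absorb_c F_def)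
      also have "\<dots> \<le> ilen (F (Suc t)) (F t)"
        unfolding F_def by (intro ilen_mono isum_mono JKsub order_refl)
      finally show ?thesis .
    qed
    have "(\<Sum>t\<in>{t0..<T}. ilen (ipow J (Suc t) \<cdot> ipow K t <+> a) (ipow J t \<cdot> ipow K t <+> a))
        \<le> (\<Sum>t\<in>{t0..<T}. ilen (F (Suc t)) (F t))"
      by (rule sum_mono) (use order_trans[OF step1 step2] in auto)
    also have "\<dots> \<le> (\<Sum>t<T. ilen (F (Suc t)) (F t))"
      by (rule sum_mono2) auto
    also have "\<dots> = ilen (F T) (F 0)"
    proof (rule ilen_telescope[OF F])
      fix t
      have "ipow J (Suc t) \<cdot> ipow K (Suc t) \<subseteq> ipow J t \<cdot> ipow K t"
        by (intro ideal_prod_mono ipow_ideal Ji K ipow_Suc_subset)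
      then show "F (Suc t) \<subseteq> F t" unfolding F_def by (intro isum_mono order_refl)
    qed
    also have "\<dots> \<le> ilen c (carrier R)"
      unfolding F_def by (intro ilen_mono isum_upper2 JK c ideal_subset JKc)
    also have "\<dots> \<le> enat (C * m ^ q)" unfolding c_def by (rule C)
    also have "C * m ^ q = C * (D + 1) ^ q * T ^ q" by (simp only: m_def power_mult_distrib mult.assoc)
    finally show ?thesis .
  qed
  then show ?thesis by blast
qed

end

context noetherian_local_ring
begin

context
  fixes I :: "nat \<Rightarrow> 'a set" and s :: nat
  assumes fam: "\<And>i. i \<le> s \<Longrightarrow> ideal (I i) R" and I0: "nn_primary (I 0)"
begin

text \<open>On the ray through \<open>c\<close> the monomial is \<open>J^t K^t\<close> with
  \<open>J = I_0^(c_0)\<close>. Since \<open>J \<subseteq> I 0\<close>, the ideal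
  \<open>J^(t+1) K^t\<close> lies in the true denominator, so the quotients of
  \<open>growth_bound\<close> are at least as long.\<close>

lemma hlen_growth:
  assumes a: "ideal a R" and q: "pdim (saturation R a (ideal_product R I s)) \<le> enat q"
    and c: "\<And>i. i \<le> s \<Longrightarrow> 1 \<le> c i"
  shows "\<exists>t0 C. \<forall>T. (\<Sum>t\<in>{t0..<T}. hlen I s a (\<lambda>i. t * c i)) \<le> enat (C * T ^ q)"
proof -
  let ?I = "ideal_product R I s"
  define J where "J = ipow (I 0) (c 0)"
  define K where "K = tail_monomial I s c"
  have II: "ideal ?I R" by (rule ideal_product_ideal[of s I, OF fam])
  have K: "ideal K R" unfolding K_def by (rule tail_monomial_ideal[of s I, OF fam])
  have KI: "K \<subseteq> ?I" unfolding K_def by (rule tail_monomial_subset_product[of s I, OF fam c])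
  have J: "nn_primary J" unfolding J_def by (rule nn_primary_ipow[OF I0]) (use c[of 0] in simp)
  then have Ji: "ideal J R" by (simp add: nn_primary_def)
  have I0i: "ideal (I 0) R" by (rule fam) simp
  define b where "b = saturation R a ?I"
  have b: "ideal b R" unfolding b_def by (rule saturation_ideal[OF a II])
  have ab: "a \<subseteq> b" unfolding b_def by (rule saturation_upper[OF a II])
  obtain N where N: "ipow ?I N \<cdot> b \<subseteq> a" using saturation_annihilated[OF a II] unfolding b_def by blast
  have "ipow K N \<cdot> b \<subseteq> ipow ?I N \<cdot> b" by (intro ideal_prod_mono ipow_ideal ipow_mono K II KI b order_refl)
  then have Kb: "ipow K N \<cdot> b \<subseteq> a" using N by (rule subset_trans)
  have "hlen I s a (\<lambda>i. t * c i) \<le> ilen (ipow J (Suc t) \<cdot> ipow K t <+> a) (ipow J t \<cdot> ipow K t <+> a)" for t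
  proof -
    let ?n = "\<lambda>i. t * c i"
    let ?M = "ideal_monomial R I s ?n"
    have M: "?M = ipow J t \<cdot> ipow K t"
      unfolding J_def K_def by (rule monomial_scale[of s I, OF fam])
    have Mid: "ideal ?M R" by (rule monomial_ideal[of s I, OF fam])
    have "ideal_monomial R I s (?n(0 := Suc (?n 0))) = I 0 \<cdot> ?M"
      by (rule monomial_Suc[of s I 0, OF fam]) simp_all
    moreover have "ipow J (Suc t) \<cdot> ipow K t = J \<cdot> ?M"
      unfolding M by (simp add: ipow_Suc Ji ideal_prod_assoc ipow_ideal K)
    moreover have "J \<subseteq> I 0"
      using ipow_antimono[OF I0i, of 1 "c 0"] c[of 0] ipow_1[OF I0i] by (simp add: J_def)
    ultimately have "ipow J (Suc t) \<cdot> ipow K t \<subseteq> ideal_monomial R I s (?n(0 := Suc (?n 0)))"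
      by (simp add: ideal_prod_mono I0i Mid)
    then show ?thesis
      unfolding hlen_def M by (intro ilen_mono isum_mono order_refl)
  qed
  moreover obtain t0 C where "\<And>T. (\<Sum>t\<in>{t0..<T}. ilen (ipow J (Suc t) \<cdot> ipow K t <+> a) (ipow J t \<cdot> ipow K t <+> a))
    \<le> enat (C * T ^ q)"
    using growth_bound[OF J K a b ab Kb q[folded b_def]] by blast
  ultimately have "(\<Sum>t\<in>{t0..<T}. hlen I s a (\<lambda>i. t * c i)) \<le> enat (C * T ^ q)" for T
    by (meson sum_mono order_trans)
  then show ?thesis by blast
qed

lemma hilb_degree:
  assumes a: "ideal a R" and P: "is_hilb I s a P"
    and q: "pdim (saturation R a (ideal_product R I s)) \<le> enat q" and \<mu>: "\<mu> \<in> Poly_Mapping.keys P"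
  shows "tdeg s \<mu> < q"
proof (rule tdeg_less_of_sum_bound[OF _ _ _ \<mu>])
  show vars: "vars_le s P" using P by (simp add: is_hilb_def)
  have large: "for_large s (\<lambda>n. \<exists>l. hlen I s a n = enat l \<and> of_nat l = multipoly_eval P n)"
    using P by (simp add: is_hilb_def)
  show "for_large s (\<lambda>n. 0 \<le> multipoly_eval P n)"
    by (rule for_large_mono[OF large]) (metis of_nat_0_le_iff)
  obtain N where N: "\<And>n. \<forall>j\<le>s. N \<le> n j \<Longrightarrow> \<exists>l. hlen I s a n = enat l \<and> of_nat l = multipoly_eval P n"
    using large unfolding for_large_def by blast
  fix c :: "nat \<Rightarrow> nat" assume c: "\<And>i. i \<le> s \<Longrightarrow> 1 \<le> c i"
  obtain t0 C where C: "\<And>T. (\<Sum>t\<in>{t0..<T}. hlen I s a (\<lambda>i. t * c i)) \<le> enat (C * T ^ q)"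
    using hlen_growth[OF a q, of c] c by blast
  \<comment> \<open>From \<open>max t0 N\<close> on the values of \<open>P\<close> are lengths, and
    dropping earlier lengths can only decrease the sum.\<close>
  have "(\<Sum>t\<in>{max t0 N..<T}. multipoly_eval P (\<lambda>i. t * c i)) \<le> of_nat C * of_nat T ^ q" for T
  proof -
    have "\<exists>l. hlen I s a (\<lambda>i. t * c i) = enat l \<and> of_nat l = multipoly_eval P (\<lambda>i. t * c i)"
      if "t \<in> {max t0 N..<T}" for t
    proof (rule N, intro allI impI)
      fix j assume "j \<le> s"
      have "N * 1 \<le> t * c j" by (rule mult_le_mono) (use that c[OF \<open>j \<le> s\<close>] in auto)
      then show "N \<le> t * c j" by simp
    qed
    then obtain l where l: "\<And>t. t \<in> {max t0 N..<T} \<Longrightarrow> hlen I s a (\<lambda>i. t * c i) = enat (l t)"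
      "\<And>t. t \<in> {max t0 N..<T} \<Longrightarrow> of_nat (l t) = multipoly_eval P (\<lambda>i. t * c i)"
      by metis
    have "enat (\<Sum>t\<in>{max t0 N..<T}. l t) = (\<Sum>t\<in>{max t0 N..<T}. hlen I s a (\<lambda>i. t * c i))"
      unfolding of_nat_eq_enat[symmetric] of_nat_sum by (rule sum.cong) (simp_all add: l of_nat_eq_enat)
    also have "\<dots> \<le> (\<Sum>t\<in>{t0..<T}. hlen I s a (\<lambda>i. t * c i))" by (rule sum_mono2) auto
    also have "\<dots> \<le> enat (C * T ^ q)" by (rule C)
    finally have "(\<Sum>t\<in>{max t0 N..<T}. l t) \<le> C * T ^ q" by simp
    then have "of_nat (\<Sum>t\<in>{max t0 N..<T}. l t) \<le> (of_nat (C * T ^ q) :: rat)" by (rule of_nat_mono)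
    moreover have "of_nat (\<Sum>t\<in>{max t0 N..<T}. l t) = (\<Sum>t\<in>{max t0 N..<T}. multipoly_eval P (\<lambda>i. t * c i))"
      unfolding of_nat_sum by (rule sum.cong) (simp_all add: l)
    ultimately show ?thesis by simp
  qed
  then show "\<exists>t0 C. \<forall>T. (\<Sum>t\<in>{t0..<T}. multipoly_eval P (\<lambda>i. t * c i)) \<le> of_nat C * of_nat T ^ q"
    by blast
qed

text \<open>Hilbert-Serre is applied for the zero ideal; modulo superficial elements the Hilbert
  polynomial is obtained as a backward difference in \<open>superficial_mod_hilb\<close>.\<close>

lemma hilb_exists: "\<exists>P. is_hilb I s {\<zero>} P"
proof -
  have "\<exists>G. \<forall>i\<le>s. finite (G i) \<and> G i \<subseteq> carrier R \<and> I i = Idl (G i)"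
    by (rule family_generators) (rule fam)
  then obtain G where "\<forall>i\<le>s. finite (G i) \<and> G i \<subseteq> carrier R \<and> I i = Idl (G i)" by (elim exE)
  then have G: "finite (G i) \<and> G i \<subseteq> carrier R \<and> I i = Idl (G i)" if "i \<le> s" for i using that by simp
  define Y where "Y = Sigma {..s} G"
  define U where "U = (\<lambda>n. ideal_monomial R I s n <+> {\<zero>})"
  define V where "V = (\<lambda>n. U (inc 0 1 n))"
  have gen: "actors s Y" "stable s Y U" "generated s Y U (\<lambda>n. {\<zero>})"
    unfolding Y_def U_def by (rule generated_monomials[of s I "{\<zero>}" G], erule fam, rule zeroideal, erule G)+
  have mono: "ideal (ideal_monomial R I s n) R" for n by (rule monomial_ideal[of s I, OF fam])
  have U_eq: "U n = ideal_monomial R I s n" for n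
    unfolding U_def using ideal_0[OF mono] by (intro isum_absorb mono zeroideal) simp
  have Uid: "ideal (U n) R" for n unfolding U_eq by (rule mono)
  have V_eq: "V n = I 0 \<cdot> U n" for n
    unfolding V_def U_eq by (rule monomial_inc[of s I 0, OF fam]) simp_all
  have I0i: "ideal (I 0) R" by (rule fam) simp
  have V: "stable s Y V"
    unfolding stable_def
  proof (intro ballI conjI)
    fix n assume n: "n \<in> degrees s"
    show "ideal (V n) R" unfolding V_def by (rule Uid)
    fix iy assume "iy \<in> Y"
    then obtain i y where iy: "iy = (i, y)" "(i, y) \<in> Y" by (cases iy) auto
    have "scale y (V n) \<subseteq> U (inc i 1 (inc 0 1 n))"
      unfolding V_def by (rule stableD(2)[OF gen(2) inc_degrees[OF n] iy(2)]) simp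
    then show "case iy of (i, y) \<Rightarrow> scale y (V n) \<subseteq> V (inc i 1 n)"
      by (simp add: iy V_def inc_inc)
  qed
  have VU: "V n \<subseteq> U n" for n unfolding V_eq by (rule prod_subset2[OF I0i Uid])
  obtain D where D: "generated_beyond s Y U (\<lambda>n. {\<zero>}) D" using gen(3) unfolding generated_def by (elim exE)
  have "generated s Y U V"
  proof (rule generatedI[of s D])
    fix n j W assume "n \<in> degrees s" "j \<le> s" "D < n j" and W: "ideal W R" and "V n \<subseteq> W" "acts_into Y U n W"
    then show "U n \<subseteq> W" using ideal_0[OF W] by (intro generatedD[OF D]) auto
  qed
  moreover have fin: "ilen (V n) (U n) \<noteq> \<infinity>" for n
    unfolding V_eq by (rule ilen_ideal_prod_finite[OF I0i ilen_nn_primary[OF I0] Uid])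
  ultimately have "ev_polyfun s (hilb s V U)"
    by (intro hilbert_serre[OF gen(1,2) V]) (use VU in auto)
  then obtain g where g: "polyfun s g" "for_large s (\<lambda>n. hilb s V U n = g n)"
    unfolding ev_polyfun_def by (elim exE conjE)
  obtain P where P: "vars_le s P" "multipoly_eval P = g" using polyfun_imp_multipoly[OF g(1)] by (elim exE conjE)
  have "hlen I s {\<zero>} n = ilen (V (cut s n)) (U (cut s n))" for n
  proof -
    have "U (cut s n) = U n" for n
      unfolding U_eq by (rule monomial_cut[of s I, OF fam])
    moreover have "V (cut s n) = U (cut s (n(0 := Suc (n 0))))"
      unfolding V_def by (subst cut_inc) simp_all
    ultimately show ?thesis by (simp add: hlen_def U_def)
  qed
  then have "\<exists>l. hlen I s {\<zero>} n = enat l \<and> of_nat l = multipoly_eval P n" if "hilb s V U n = g n" for n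
    using that fin[of "cut s n"] unfolding P(2) hilb_def by auto
  then have "for_large s (\<lambda>n. \<exists>l. hlen I s {\<zero>} n = enat l \<and> of_nat l = multipoly_eval P n)"
    by (rule for_large_mono[OF g(2)])
  then show ?thesis unfolding is_hilb_def using P(1) by blast
qed

end

end

section \<open>Passing to quotient rings\<close>

context cring
begin

lemma coset_eq_iff:
  "ideal a R \<Longrightarrow> x \<in> carrier R \<Longrightarrow> y \<in> carrier R \<Longrightarrow> a +> x = a +> y \<longleftrightarrow> x \<ominus> y \<in> a"
  using quotient_eq_iff_same_a_r_cos[of a x y] by simp

lemma coset_self: "ideal a R \<Longrightarrow> x \<in> carrier R \<Longrightarrow> x \<in> a +> x"
  using ideal_0[of a] l_zero[of x] by (force simp: a_r_coset_def')

lemma coset_mem_iff: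
  assumes a: "ideal a R" and A: "ideal A R" and z: "z \<in> carrier R"
  shows "a +> z \<in> (\<lambda>x. a +> x) ` A \<longleftrightarrow> z \<in> A <+> a"
proof
  assume "a +> z \<in> (\<lambda>x. a +> x) ` A"
  then obtain y where y: "y \<in> A" "a +> z = a +> y" by blast
  have yc: "y \<in> carrier R" using y(1) ideal_carr[OF A] by blast
  then have "z \<ominus> y \<in> a" using y(2) coset_eq_iff[OF a z yc] by simp
  moreover have "z = y \<oplus> (z \<ominus> y)"
    using minus_add_cancel[OF z yc] a_comm[of y "z \<ominus> y"] z yc by simp
  ultimately show "z \<in> A <+> a" using y(1) unfolding isum_mem by blast
next
  assume "z \<in> A <+> a"
  then obtain y b where y: "y \<in> A" "b \<in> a" "z = y \<oplus> b" unfolding isum_mem by blast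
  have yc: "y \<in> carrier R" "b \<in> carrier R" using y ideal_carr[OF A] ideal_carr[OF a] by auto
  have "z \<ominus> y = b" unfolding y(3) by (rule add_minus_cancel_left[OF yc])
  then have "a +> z = a +> y" using coset_eq_iff[OF a z yc(1)] y(2) by simp
  then show "a +> z \<in> (\<lambda>x. a +> x) ` A" using y(1) by blast
qed

lemma coset_add:
  "ideal a R \<Longrightarrow> x \<in> carrier R \<Longrightarrow> y \<in> carrier R \<Longrightarrow> (a +> x) <+> (a +> y) = a +> (x \<oplus> y)"
  by (rule abelian_subgroup.a_rcos_sum[OF abelian_subgroupI3]) (auto intro: ideal.axioms abelian_group_axioms)

text \<open>The union in \<open>ideal_quotient_module\<close> runs over equal cosets.\<close>

lemma coset_smult:
  assumes B: "ideal B R" and r: "r \<in> carrier R" and x: "x \<in> carrier R"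
  shows "(\<Union>c\<in>B +> x. B +> (r \<otimes> c)) = B +> (r \<otimes> x)"
proof -
  have "B +> (r \<otimes> c) = B +> (r \<otimes> x)" if c: "c \<in> B +> x" for c
  proof -
    obtain b where b: "b \<in> B" "c = b \<oplus> x" using c by (auto simp: a_r_coset_def')
    have bc: "b \<in> carrier R" using b(1) ideal_carr[OF B] by blast
    have "r \<otimes> c \<ominus> r \<otimes> x = r \<otimes> b" unfolding b(2) using r x bc by algebra
    moreover have "r \<otimes> b \<in> B" by (rule ideal_lmult[OF B b(1) r])
    ultimately show ?thesis using coset_eq_iff[OF B, of "r \<otimes> c" "r \<otimes> x"] r x bc b(2) by simp
  qed
  then show ?thesis using coset_self[OF B x] by blast
qed

text \<open>Correspondence of submodules of \<open>A / B\<close> with ideals from \<open>B\<close>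
  to \<open>A\<close>, checked directly on the fields of the record that
  \<open>ideal_quotient_module\<close> specifies.\<close>

lemma module_length_eq_ilen:
  assumes A: "ideal A R" and B: "ideal B R" and BA: "B \<subseteq> A"
  shows "module_length R (ideal_quotient_module R A B) = ilen B A"
proof (rule antisym)
  let ?M = "ideal_quotient_module R A B"
  have M: "carrier ?M = (\<lambda>x. B +> x) ` A" "ring.add ?M = set_add R" "ring.zero ?M = B"
    "module.smult ?M = (\<lambda>r C. \<Union>c\<in>C. B +> (r \<otimes> c))" by (simp_all add: ideal_quotient_module_def)
  have Bz: "B +> \<zero> = B"
    using a_coset_add_zero[OF ideal_subset[OF B]] .
  show "module_length R ?M \<le> ilen B A"
    unfolding module_length_def
  proof (rule Sup_least, clarify)
    fix n H assume H: "\<forall>i\<le>n. submodule (H i) R ?M" "\<forall>i<n. H i \<subset> H (Suc i)"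
    define K where "K i = {r \<in> A. B +> r \<in> H i}" for i
    have sub: "H i \<subseteq> (\<lambda>x. B +> x) ` A" "B \<in> H i"
      "\<And>C D. C \<in> H i \<Longrightarrow> D \<in> H i \<Longrightarrow> C <+> D \<in> H i"
      "\<And>r C. r \<in> carrier R \<Longrightarrow> C \<in> H i \<Longrightarrow> (\<Union>c\<in>C. B +> (r \<otimes> c)) \<in> H i" if "i \<le> n" for i
    proof -
      have sm: "submodule (H i) R ?M" using H(1) that by blast
      show "H i \<subseteq> (\<lambda>x. B +> x) ` A"
        using subgroup.subset[OF submodule.axioms(1)[OF sm]] by (simp add: M)
      show "B \<in> H i" using subgroup.one_closed[OF submodule.axioms(1)[OF sm]] by (simp add: M)
      show "C <+> D \<in> H i" if "C \<in> H i" "D \<in> H i" for C D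
        using subgroup.m_closed[OF submodule.axioms(1)[OF sm] that] by (simp add: M)
      show "(\<Union>c\<in>C. B +> (r \<otimes> c)) \<in> H i" if "r \<in> carrier R" "C \<in> H i" for r C
        using submodule.smult_closed[OF sm that] by (simp add: M)
    qed
    have Kid: "ideal (K i) R" if i: "i \<le> n" for i
    proof (rule idealI_mult)
      show "K i \<subseteq> carrier R" using ideal_carr[OF A] by (auto simp: K_def)
      show "\<zero> \<in> K i" using sub(2)[OF i] ideal_0[OF A] by (simp add: K_def Bz)
      show "x \<oplus> y \<in> K i" if "x \<in> K i" "y \<in> K i" for x y
      proof -
        have "x \<in> A" "y \<in> A" "B +> x \<in> H i" "B +> y \<in> H i" using that by (auto simp: K_def)
        then show ?thesis
          using sub(3)[OF i, of "B +> x" "B +> y"] coset_add[OF B, of x y] ideal_carr[OF A] ideal_add[OF A]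
          by (simp add: K_def)
      qed
      show "r \<otimes> x \<in> K i" if "r \<in> carrier R" "x \<in> K i" for r x
      proof -
        have "x \<in> A" "B +> x \<in> H i" using that by (auto simp: K_def)
        then show ?thesis
          using sub(4)[OF i that(1), of "B +> x"] coset_smult[OF B that(1), of x] ideal_carr[OF A]
            ideal_lmult[OF A _ that(1)] by (simp add: K_def)
      qed
    qed
    have "ideal_chain B A K n"
      unfolding ideal_chain_def
    proof (intro conjI allI impI)
      fix i assume i: "i \<le> n"
      show "ideal (K i) R" by (rule Kid[OF i])
      show "B \<subseteq> K i"
      proof
        fix b assume b: "b \<in> B"
        then have "B +> b = B +> \<zero>"
          using coset_eq_iff[OF B, of b \<zero>] ideal_carr[OF B b] by (simp add: a_minus_def)
        then show "b \<in> K i" using b BA sub(2)[OF i] by (auto simp: K_def Bz)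
      qed
      show "K i \<subseteq> A" by (auto simp: K_def)
    next
      fix i assume i: "i < n"
      then have HH: "H i \<subset> H (Suc i)" using H(2) by blast
      then obtain C where C: "C \<in> H (Suc i)" "C \<notin> H i" by blast
      then obtain x where "x \<in> A" "C = B +> x" using sub(1)[of "Suc i"] i by auto
      then have "x \<in> K (Suc i)" "x \<notin> K i" using C by (auto simp: K_def)
      moreover have "K i \<subseteq> K (Suc i)" using HH by (auto simp: K_def)
      ultimately show "K i \<subset> K (Suc i)" by blast
    qed
    then show "enat n \<le> ilen B A" by (rule ilen_geI)
  qed
  show "ilen B A \<le> module_length R ?M"
  proof (rule ilen_leI)
    fix K n assume K: "ideal_chain B A K n"
    define H where "H i = (\<lambda>x. B +> x) ` K i" for i
    have "submodule (H i) R ?M" if i: "i \<le> n" for i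
    proof -
      note Ki = ideal_chainD(1)[OF K i] and KA = ideal_chainD(3)[OF K i]
      have "subgroup (H i) (add_monoid ?M)"
      proof
        show "H i \<subseteq> carrier (add_monoid ?M)" using KA by (auto simp: M H_def)
        show "\<one>\<^bsub>add_monoid ?M\<^esub> \<in> H i"
          using ideal_0[OF Ki] Bz by (auto simp: M H_def intro!: image_eqI[of _ _ \<zero>])
        show "C \<otimes>\<^bsub>add_monoid ?M\<^esub> D \<in> H i" if CD: "C \<in> H i" "D \<in> H i" for C D
        proof -
          obtain x y where xy: "x \<in> K i" "y \<in> K i" "C = B +> x" "D = B +> y" using CD unfolding H_def by blast
          then have "C <+> D = B +> (x \<oplus> y)" using coset_add[OF B] ideal_carr[OF Ki] by simp
          then show ?thesis using ideal_add[OF Ki xy(1,2)] by (auto simp: M H_def)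
        qed
        show "inv\<^bsub>add_monoid ?M\<^esub> C \<in> H i" if Ch: "C \<in> H i" for C
        proof -
          obtain x where x: "x \<in> K i" "C = B +> x" using Ch unfolding H_def by blast
          have xc: "x \<in> carrier R" using ideal_carr[OF Ki x(1)] .
          have nx: "\<ominus> x \<in> K i" by (rule ideal_neg[OF Ki x(1)])
          \<comment> \<open>\<open>inv\<close> is a definite description over the additive monoid of
            the record, so existence and uniqueness of the inverse coset are verified by
            hand.\<close>
          have "inv\<^bsub>add_monoid ?M\<^esub> C = B +> (\<ominus> x)"
            unfolding m_inv_def
          proof (rule the_equality)
            show "B +> (\<ominus> x) \<in> carrier (add_monoid ?M) \<and> C \<otimes>\<^bsub>add_monoid ?M\<^esub> (B +> (\<ominus> x)) = \<one>\<^bsub>add_monoid ?M\<^esub> \<and>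
              (B +> (\<ominus> x)) \<otimes>\<^bsub>add_monoid ?M\<^esub> C = \<one>\<^bsub>add_monoid ?M\<^esub>"
              using nx KA xc by (auto simp: M x(2) coset_add[OF B] r_neg l_neg Bz)
            fix D assume D: "D \<in> carrier (add_monoid ?M) \<and> C \<otimes>\<^bsub>add_monoid ?M\<^esub> D = \<one>\<^bsub>add_monoid ?M\<^esub> \<and>
              D \<otimes>\<^bsub>add_monoid ?M\<^esub> C = \<one>\<^bsub>add_monoid ?M\<^esub>"
            then obtain y where y: "y \<in> A" "D = B +> y" by (auto simp: M)
            have yc: "y \<in> carrier R" using ideal_carr[OF A y(1)] .
            have "B +> (y \<oplus> x) = B +> \<zero>" using D y xc yc by (simp add: M x(2) coset_add[OF B] Bz)
            then have "y \<oplus> x \<in> B" using coset_eq_iff[OF B, of "y \<oplus> x" \<zero>] xc yc by (simp add: a_minus_def)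
            then have "y \<ominus> (\<ominus> x) \<in> B" using xc yc by (simp add: a_minus_def)
            then show "D = B +> (\<ominus> x)" using coset_eq_iff[OF B, of y "\<ominus> x"] xc yc y(2) by simp
          qed
          then show ?thesis using nx by (simp add: H_def)
        qed
      qed
      moreover have "r \<odot>\<^bsub>?M\<^esub> C \<in> H i" if rC: "r \<in> carrier R" "C \<in> H i" for r C
      proof -
        obtain x where x: "x \<in> K i" "C = B +> x" using rC unfolding H_def by blast
        then show ?thesis
          using coset_smult[OF B rC(1) ideal_carr[OF Ki x(1)]] ideal_lmult[OF Ki x(1) rC(1)]
          by (simp add: M H_def)
      qed
      ultimately show ?thesis by (simp add: submodule_def submodule_axioms_def)
    qed
    moreover have "H i \<subset> H (Suc i)" if i: "i < n" for i
    proof -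
      note Ki = ideal_chainD(1)[OF K less_imp_le[OF i]] and KS = ideal_chainD(4)[OF K i]
      have BKi: "B \<subseteq> K i" by (rule ideal_chainD(2)[OF K less_imp_le[OF i]])
      obtain x where x: "x \<in> K (Suc i)" "x \<notin> K i" using KS by blast
      have xc: "x \<in> carrier R" using x(1) ideal_carr[OF ideal_chainD(1)[OF K, of "Suc i"]] i by simp
      have "B +> x \<notin> H i"
        using coset_mem_iff[OF B Ki xc] isum_absorb[OF Ki B BKi] x(2) by (simp add: H_def)
      moreover have "B +> x \<in> H (Suc i)" using x(1) by (simp add: H_def)
      moreover have "H i \<subseteq> H (Suc i)" using KS by (auto simp: H_def)
      ultimately show ?thesis by blast
    qed
    ultimately have "enat n \<in> {enat n |n. \<exists>H. (\<forall>i\<le>n. submodule (H i) R ?M) \<and> (\<forall>i<n. H i \<subset> H (Suc i))}"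
      by blast
    then show "enat n \<le> module_length R ?M" unfolding module_length_def by (rule Sup_upper)
  qed
qed

lemma hilbert_function_eq:
  assumes fam: "\<And>i. i \<le> s \<Longrightarrow> ideal (I i) R"
  shows "hilbert_function R I s n = ilen (ideal_monomial R I s (n(0 := Suc (n 0)))) (ideal_monomial R I s n)"
  unfolding hilbert_function_def
proof (rule module_length_eq_ilen)
  have mono: "ideal (ideal_monomial R I s n) R" for n by (rule monomial_ideal[of s I, OF fam])
  show "ideal (ideal_monomial R I s n) R" "ideal (ideal_monomial R I s (n(0 := Suc (n 0)))) R" by (rule mono)+
  have "ideal_monomial R I s (n(0 := Suc (n 0))) = I 0 \<cdot> ideal_monomial R I s n"
    by (rule monomial_Suc[of s I 0, OF fam]) simp_all
  then show "ideal_monomial R I s (n(0 := Suc (n 0))) \<subseteq> ideal_monomial R I s n"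
    by (simp add: prod_subset2 fam mono)
qed

lemma krull_dim_eq_pdim: "krull_dim R = pdim {\<zero>}"
proof -
  have "{\<zero>} \<subseteq> P" if "primeideal P R" for P using ideal_0[OF prime_ideal[OF that]] by simp
  then have "(\<exists>P. (\<forall>i\<le>n. primeideal (P i) R) \<and> (\<forall>i<n. P i \<subset> P (Suc i))) \<longleftrightarrow> (\<exists>P. prime_chain {\<zero>} P n)" for n
    unfolding prime_chain_def by meson
  then show ?thesis unfolding krull_dim_def pdim_def by simp
qed

end

section \<open>Correspondence between ideals of R and of R / a\<close>

locale quotient_by = cring R for R (structure) +
  fixes a :: "'a set"
  assumes a: "ideal a R"
begin

abbreviation Q :: "'a set ring" where "Q \<equiv> R Quot a"

definition proj :: "'a set \<Rightarrow> 'a set set" where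
  "proj A = (\<lambda>x. a +> x) ` A"

lemma image_mod_eq: "image_mod R a = proj"
  by (simp add: image_mod_def proj_def fun_eq_iff)

sublocale Q: cring "R Quot a"
  by (rule ideal.quotient_is_cring[OF a is_cring])

lemma coset_hom:
  "x \<in> carrier R \<Longrightarrow> a +> x \<in> carrier Q"
  "x \<in> carrier R \<Longrightarrow> y \<in> carrier R \<Longrightarrow> a +> (x \<otimes> y) = (a +> x) \<otimes>\<^bsub>Q\<^esub> (a +> y)"
  "x \<in> carrier R \<Longrightarrow> y \<in> carrier R \<Longrightarrow> a +> (x \<oplus> y) = (a +> x) \<oplus>\<^bsub>Q\<^esub> (a +> y)"
  using ring_hom_closed[OF ideal.rcos_ring_hom[OF a]] ring_hom_mult[OF ideal.rcos_ring_hom[OF a]]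
    ring_hom_add[OF ideal.rcos_ring_hom[OF a]] by auto

lemma zero_quot: "\<zero>\<^bsub>Q\<^esub> = a"
  by (simp add: FactRing_def)

lemma coset_carrier: "C \<in> carrier Q \<Longrightarrow> \<exists>x\<in>carrier R. C = a +> x"
  by (auto simp: FactRing_def A_RCOSETS_def')

lemma proj_carrier: "proj (carrier R) = carrier Q"
  using coset_carrier coset_hom(1) by (auto simp: proj_def)

lemma proj_ideal: "ideal A R \<Longrightarrow> ideal (proj A) Q"
  unfolding proj_def by (rule ring_ideal_imp_quot_ideal[OF a])

lemma proj_mono: "A \<subseteq> B \<Longrightarrow> proj A \<subseteq> proj B"
  by (auto simp: proj_def)

lemma proj_mem: "x \<in> A \<Longrightarrow> a +> x \<in> proj A"
  by (simp add: proj_def)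

lemma proj_mem_iff: "ideal A R \<Longrightarrow> z \<in> carrier R \<Longrightarrow> a +> z \<in> proj A \<longleftrightarrow> z \<in> A <+> a"
  unfolding proj_def by (rule coset_mem_iff[OF a])

definition lift :: "'a set set \<Rightarrow> 'a set" where
  "lift L = {r \<in> carrier R. a +> r \<in> L}"

lemma lift_ideal: "ideal L Q \<Longrightarrow> ideal (lift L) R"
  unfolding lift_def by (rule ring_hom_ring.ideal_vimage[OF ideal.rcos_ring_hom_ring[OF a]])

lemma coset_of_a: "x \<in> a \<Longrightarrow> a +> x = a"
  using coset_eq_iff[OF a, of x \<zero>] ideal_carr[OF a, of x] a_coset_add_zero[OF ideal_subset[OF a]]
  by (simp add: a_minus_def)

lemma lift_upper: "ideal L Q \<Longrightarrow> a \<subseteq> lift L"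
  using coset_of_a Q.ideal_0[of L] ideal_carr[OF a] by (auto simp: lift_def zero_quot)

lemma lift_strict: "ideal L' Q \<Longrightarrow> L \<subset> L' \<Longrightarrow> lift L \<subset> lift L'"
proof -
  assume L': "ideal L' Q" and sub: "L \<subset> L'"
  then obtain C where C: "C \<in> L'" "C \<notin> L" by blast
  then obtain x where "x \<in> carrier R" "C = a +> x" using coset_carrier Q.ideal_carr[OF L'] by blast
  then have "x \<in> lift L'" "x \<notin> lift L" using C by (auto simp: lift_def)
  moreover have "lift L \<subseteq> lift L'" using sub by (auto simp: lift_def)
  ultimately show ?thesis by blast
qed

lemma proj_strict:
  assumes "ideal A R" "ideal B R" "a \<subseteq> A" "A \<subset> B"
  shows "proj A \<subset> proj B"
proof -
  obtain x where x: "x \<in> B" "x \<notin> A" using assms by blast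
  have "a +> x \<notin> proj A"
    using proj_mem_iff[OF assms(1) ideal_carr[OF assms(2) x(1)]] isum_absorb[OF assms(1) a assms(3)] x(2) by simp
  moreover have "a +> x \<in> proj B" by (rule proj_mem[OF x(1)])
  moreover have "proj A \<subseteq> proj B" using assms(4) by (intro proj_mono) auto
  ultimately show ?thesis by blast
qed

lemma proj_prime:
  assumes P: "primeideal P R" and aP: "a \<subseteq> P"
  shows "primeideal (proj P) Q"
proof -
  have Pi: "ideal P R" by (rule prime_ideal[OF P])
  have mem: "a +> z \<in> proj P \<longleftrightarrow> z \<in> P" if "z \<in> carrier R" for z
    using proj_mem_iff[OF Pi that] isum_absorb[OF Pi a aP] by simp
  show ?thesis
  proof (rule primeidealI[OF proj_ideal[OF Pi] Q.is_cring])
    show "carrier Q \<noteq> proj P"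
    proof
      assume "carrier Q = proj P"
      then have "carrier R \<subseteq> P" using mem coset_hom(1) by blast
      then show False using primeideal.I_notcarr[OF P] ideal_subset[OF Pi] by blast
    qed
    fix C D assume "C \<in> carrier Q" "D \<in> carrier Q" and CD: "C \<otimes>\<^bsub>Q\<^esub> D \<in> proj P"
    then obtain x y where xy: "x \<in> carrier R" "C = a +> x" "y \<in> carrier R" "D = a +> y"
      using coset_carrier by metis
    then have "x \<otimes> y \<in> P" using CD mem[of "x \<otimes> y"] coset_hom(2) by simp
    then have "x \<in> P \<or> y \<in> P" using primeideal.I_prime[OF P] xy by blast
    then show "C \<in> proj P \<or> D \<in> proj P" using xy by (auto intro: proj_mem)
  qed
qed

lemma lift_prime:
  assumes P: "primeideal P Q"
  shows "primeideal (lift P) R"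
proof (rule primeidealI[OF lift_ideal[OF Q.prime_ideal[OF P]] is_cring])
  show "carrier R \<noteq> lift P"
  proof
    assume eq: "carrier R = lift P"
    have "carrier Q \<subseteq> P"
    proof
      fix C assume "C \<in> carrier Q"
      then obtain x where x: "x \<in> carrier R" "C = a +> x" using coset_carrier by blast
      have "x \<in> lift P" using x(1) eq by blast
      then show "C \<in> P" by (simp add: lift_def x(2))
    qed
    then show False using primeideal.I_notcarr[OF P] Q.ideal_subset[OF Q.prime_ideal[OF P]] by blast
  qed
  fix x y assume xy: "x \<in> carrier R" "y \<in> carrier R" "x \<otimes> y \<in> lift P"
  then have "(a +> x) \<otimes>\<^bsub>Q\<^esub> (a +> y) \<in> P" using coset_hom(2) by (simp add: lift_def)
  then have "a +> x \<in> P \<or> a +> y \<in> P"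
    using primeideal.I_prime[OF P] coset_hom(1) xy by blast
  then show "x \<in> lift P \<or> y \<in> lift P" using xy by (auto simp: lift_def)
qed

lemma proj_pdim:
  assumes B: "ideal B R" and aB: "a \<subseteq> B"
  shows "Q.pdim (proj B) = pdim B"
proof (rule antisym)
  show "Q.pdim (proj B) \<le> pdim B"
  proof (rule Q.pdim_leI)
    fix P n assume P: "Q.prime_chain (proj B) P n"
    have "prime_chain B (\<lambda>i. lift (P i)) n"
      unfolding prime_chain_def
    proof (intro conjI allI impI)
      fix i assume "i \<le> n"
      then have Pi: "primeideal (P i) Q" "proj B \<subseteq> P i" using P by (auto simp: Q.prime_chain_def)
      show "primeideal (lift (P i)) R" by (rule lift_prime[OF Pi(1)])
      show "B \<subseteq> lift (P i)" using Pi(2) ideal_carr[OF B] by (auto simp: lift_def proj_def)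
    next
      fix i assume "i < n"
      then show "lift (P i) \<subset> lift (P (Suc i))"
        using P by (intro lift_strict Q.prime_ideal) (auto simp: Q.prime_chain_def)
    qed
    then show "enat n \<le> pdim B" by (rule pdim_geI)
  qed
  show "pdim B \<le> Q.pdim (proj B)"
  proof (rule pdim_leI)
    fix P n assume P: "prime_chain B P n"
    then have Pi: "primeideal (P i) R" "B \<subseteq> P i" if "i \<le> n" for i
      using that by (auto simp: prime_chain_def)
    have "Q.prime_chain (proj B) (\<lambda>i. proj (P i)) n"
      unfolding Q.prime_chain_def
    proof (intro conjI allI impI)
      fix i assume i: "i \<le> n"
      show "primeideal (proj (P i)) Q" using Pi[OF i] aB by (intro proj_prime) auto
      show "proj B \<subseteq> proj (P i)" using Pi[OF i] by (intro proj_mono)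
    next
      fix i assume "i < n"
      then show "proj (P i) \<subset> proj (P (Suc i))"
        using Pi[of i] Pi[of "Suc i"] aB P prime_ideal
        by (intro proj_strict) (simp_all add: prime_chain_def subset_trans[OF aB])
    qed
    then show "enat n \<le> Q.pdim (proj B)" by (rule Q.pdim_geI)
  qed
qed

lemma proj_a: "proj a = {\<zero>\<^bsub>Q\<^esub>}"
  using coset_of_a ideal_0[OF a] by (auto simp: proj_def zero_quot)

lemma krull_dim_quot: "krull_dim Q = pdim a"
  unfolding Q.krull_dim_eq_pdim proj_a[symmetric] by (rule proj_pdim[OF a order_refl])

lemma proj_ilen:
  assumes A: "ideal A R" and B: "ideal B R"
  shows "Q.ilen (proj B) (proj A) = ilen (B <+> a) (A <+> a)"
proof (rule antisym)
  note Aa = isum_ideal[OF A a] and Ba = isum_ideal[OF B a]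
  show "Q.ilen (proj B) (proj A) \<le> ilen (B <+> a) (A <+> a)"
  proof (rule Q.ilen_leI)
    fix H n assume H: "Q.ideal_chain (proj B) (proj A) H n"
    have "ideal_chain (B <+> a) (A <+> a) (\<lambda>i. lift (H i)) n"
      unfolding ideal_chain_def
    proof (intro conjI allI impI)
      fix i assume i: "i \<le> n"
      note Hi = Q.ideal_chainD(1-3)[OF H i]
      show "ideal (lift (H i)) R" by (rule lift_ideal[OF Hi(1)])
      have "B \<subseteq> lift (H i)" using Hi(2) ideal_carr[OF B] by (auto simp: lift_def proj_def)
      then show "B <+> a \<subseteq> lift (H i)"
        by (rule isum_least[OF lift_ideal[OF Hi(1)] _ lift_upper[OF Hi(1)]])
      show "lift (H i) \<subseteq> A <+> a"
        using Hi(3) proj_mem_iff[OF A] by (auto simp: lift_def)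
    next
      fix i assume i: "i < n"
      show "lift (H i) \<subset> lift (H (Suc i))"
        using Q.ideal_chainD(1)[OF H, of "Suc i"] Q.ideal_chainD(4)[OF H i] i by (intro lift_strict) auto
    qed
    then show "enat n \<le> ilen (B <+> a) (A <+> a)" by (rule ilen_geI)
  qed
  show "ilen (B <+> a) (A <+> a) \<le> Q.ilen (proj B) (proj A)"
  proof (rule ilen_leI)
    fix H n assume H: "ideal_chain (B <+> a) (A <+> a) H n"
    have proj_sum: "proj (A <+> a) = proj A"
    proof
      show "proj A \<subseteq> proj (A <+> a)" by (rule proj_mono[OF isum_upper1[OF A a]])
      show "proj (A <+> a) \<subseteq> proj A"
        using proj_mem_iff[OF A] ideal_carr[OF Aa] by (auto simp: proj_def[of "A <+> a"])
    qed
    have "Q.ideal_chain (proj B) (proj A) (\<lambda>i. proj (H i)) n"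
      unfolding Q.ideal_chain_def
    proof (intro conjI allI impI)
      fix i assume i: "i \<le> n"
      note Hi = ideal_chainD(1-3)[OF H i]
      show "ideal (proj (H i)) Q" by (rule proj_ideal[OF Hi(1)])
      show "proj B \<subseteq> proj (H i)" using Hi(2) isum_upper1[OF B a] by (intro proj_mono) blast
      show "proj (H i) \<subseteq> proj A" using proj_mono[OF Hi(3)] proj_sum by simp
    next
      fix i assume i: "i < n"
      have "a \<subseteq> H i" using ideal_chainD(2)[OF H, of i] i isum_upper2[OF B a] by auto
      then show "proj (H i) \<subset> proj (H (Suc i))"
        using ideal_chainD(1)[OF H, of i] ideal_chainD(1)[OF H, of "Suc i"] ideal_chainD(4)[OF H i] i
        by (intro proj_strict) auto
    qed
    then show "enat n \<le> Q.ilen (proj B) (proj A)" by (rule Q.ilen_geI)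
  qed
qed

lemma proj_prod:
  assumes A: "ideal A R" and B: "ideal B R"
  shows "proj (A \<cdot> B) = proj A \<cdot>\<^bsub>Q\<^esub> proj B"
proof
  note AB = prod_ideal[OF A B]
  note pAB = Q.prod_ideal[OF proj_ideal[OF A] proj_ideal[OF B]]
  show "proj (A \<cdot> B) \<subseteq> proj A \<cdot>\<^bsub>Q\<^esub> proj B"
  proof -
    have "A \<cdot> B \<subseteq> lift (proj A \<cdot>\<^bsub>Q\<^esub> proj B)"
      unfolding prod_le_iff[OF lift_ideal[OF pAB]]
    proof (intro ballI)
      fix x y assume xy: "x \<in> A" "y \<in> B"
      then have "x \<in> carrier R" "y \<in> carrier R" using ideal_carr[OF A] ideal_carr[OF B] by auto
      then show "x \<otimes> y \<in> lift (proj A \<cdot>\<^bsub>Q\<^esub> proj B)"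
        using xy by (simp add: lift_def coset_hom(2) Q.prod_mem proj_mem)
    qed
    then show ?thesis by (auto simp: proj_def[of "A \<cdot> B"] lift_def)
  qed
  show "proj A \<cdot>\<^bsub>Q\<^esub> proj B \<subseteq> proj (A \<cdot> B)"
    unfolding Q.prod_le_iff[OF proj_ideal[OF AB]]
  proof (intro ballI)
    fix C D assume "C \<in> proj A" "D \<in> proj B"
    then obtain x y where xy: "x \<in> A" "C = a +> x" "y \<in> B" "D = a +> y" by (auto simp: proj_def)
    then have "C \<otimes>\<^bsub>Q\<^esub> D = a +> (x \<otimes> y)"
      using coset_hom(2)[of x y] ideal_carr[OF A] ideal_carr[OF B] by simp
    then show "C \<otimes>\<^bsub>Q\<^esub> D \<in> proj (A \<cdot> B)" using prod_mem[OF xy(1,3)] by (simp add: proj_mem)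
  qed
qed

lemma proj_ipow: "ideal A R \<Longrightarrow> proj (ipow A n) = Q.ipow (proj A) n"
  by (induction n) (simp_all add: proj_carrier ipow_Suc Q.ipow_Suc proj_ideal proj_prod ipow_ideal)

lemma proj_iprod:
  assumes "finite S" "\<And>i. i \<in> S \<Longrightarrow> ideal (f i) R"
  shows "proj (iprod f S) = Q.iprod (\<lambda>i. proj (f i)) S"
  using assms
proof (induction S rule: finite_induct)
  case (insert i S)
  have "iprod f (insert i S) = f i \<cdot> iprod f S"
    by (rule iprod_insert[OF insert.hyps insert.prems])
  moreover have "Q.iprod (\<lambda>i. proj (f i)) (insert i S) = proj (f i) \<cdot>\<^bsub>Q\<^esub> Q.iprod (\<lambda>i. proj (f i)) S"
    by (rule Q.iprod_insert[OF insert.hyps]) (use insert.prems proj_ideal in simp)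
  ultimately show ?case using insert by (simp add: proj_prod iprod_ideal)
qed (simp add: iprod_empty Q.iprod_empty proj_carrier)

lemma proj_colon:
  assumes K: "ideal K R"
  shows "colon Q {\<zero>\<^bsub>Q\<^esub>} (proj K) = proj (colon R a K)"
proof -
  have iff: "(a +> r) \<otimes>\<^bsub>Q\<^esub> (a +> k) = \<zero>\<^bsub>Q\<^esub> \<longleftrightarrow> r \<otimes> k \<in> a" if "r \<in> carrier R" "k \<in> K" for r k
  proof -
    have k: "k \<in> carrier R" using that(2) ideal_carr[OF K] by blast
    have "(a +> r) \<otimes>\<^bsub>Q\<^esub> (a +> k) = \<zero>\<^bsub>Q\<^esub> \<longleftrightarrow> a +> (r \<otimes> k) = a +> \<zero>"
      using coset_hom(2)[OF that(1) k] a_coset_add_zero[OF ideal_subset[OF a]] by (simp add: zero_quot)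
    also have "\<dots> \<longleftrightarrow> r \<otimes> k \<in> a"
      using coset_eq_iff[OF a, of "r \<otimes> k" \<zero>] that(1) k by (simp add: a_minus_def)
    finally show ?thesis .
  qed
  show ?thesis
  proof (intro equalityI subsetI)
    fix C assume C: "C \<in> colon Q {\<zero>\<^bsub>Q\<^esub>} (proj K)"
    then obtain r where r: "r \<in> carrier R" "C = a +> r" using coset_carrier[of C] by (auto simp: colon_def)
    have "r \<otimes> k \<in> a" if "k \<in> K" for k
      using C iff[OF r(1) that] proj_mem[OF that] unfolding r(2) colon_def by blast
    then show "C \<in> proj (colon R a K)" using r by (auto simp: colon_def proj_def)
  next
    fix C assume "C \<in> proj (colon R a K)"
    then obtain r where r: "r \<in> carrier R" "\<And>k. k \<in> K \<Longrightarrow> r \<otimes> k \<in> a" "C = a +> r"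
      by (auto simp: colon_def proj_def)
    then show "C \<in> colon Q {\<zero>\<^bsub>Q\<^esub>} (proj K)"
      using iff[OF r(1)] coset_hom(1)[OF r(1)] by (auto simp: colon_def proj_def[of K])
  qed
qed

lemma proj_saturation:
  assumes "ideal B R"
  shows "saturation Q {\<zero>\<^bsub>Q\<^esub>} (proj B) = proj (saturation R a B)"
proof -
  have "saturation Q {\<zero>\<^bsub>Q\<^esub>} (proj B) = (\<Union>n. proj (colon R a (ipow B n)))"
    unfolding Q.saturation_eq_union
    by (simp add: proj_ipow[OF assms, symmetric] proj_colon ipow_ideal assms)
  also have "\<dots> = proj (saturation R a B)"
    unfolding saturation_eq_union proj_def by blast
  finally show ?thesis .
qed

text \<open>Superficiality of \<open>a +> x\<close> in \<open>R / a\<close>, pulled back to \<open>R\<close>; only the nontrivial inclusions are kept.\<close>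
definition superficial_mod :: "(nat \<Rightarrow> 'a set) \<Rightarrow> nat \<Rightarrow> nat \<Rightarrow> 'a \<Rightarrow> bool" where
  "superficial_mod I s i x \<longleftrightarrow> i \<le> s \<and>
    for_large s (\<lambda>n. \<forall>r\<in>ideal_monomial R I s n <+> a.
      r \<otimes> x \<in> (I 0 \<cdot> ideal_monomial R I s (n(i := Suc (n i)))) <+> a \<longrightarrow> r \<in> (I 0 \<cdot> ideal_monomial R I s n) <+> a) \<and>
    for_large s (\<lambda>n. \<forall>y\<in>ideal_monomial R I s (n(i := Suc (n i))) <+> a.
      y \<in> PIdl x <+> a \<longrightarrow> y \<in> scale x (ideal_monomial R I s n) <+> a)"

context
  fixes I :: "nat \<Rightarrow> 'a set" and s :: nat
  assumes fam: "\<And>i. i \<le> s \<Longrightarrow> ideal (I i) R"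
begin

lemma proj_monomial: "ideal_monomial Q (\<lambda>i. proj (I i)) s n = proj (ideal_monomial R I s n)"
proof -
  have "proj (iprod (\<lambda>i. ipow (I i) (n i)) {0..s}) = Q.iprod (\<lambda>i. proj (ipow (I i) (n i))) {0..s}"
    by (rule proj_iprod) (auto intro: ipow_ideal fam)
  also have "\<dots> = Q.iprod (\<lambda>i. Q.ipow (proj (I i)) (n i)) {0..s}"
    by (rule Q.iprod_cong) (auto simp: proj_ipow[symmetric] fam intro!: proj_ideal ipow_ideal)
  finally show ?thesis by (simp add: ideal_monomial_eq Q.ideal_monomial_eq)
qed

lemma proj_product: "ideal_product Q (\<lambda>i. proj (I i)) s = proj (ideal_product R I s)"
  unfolding ideal_product_eq Q.ideal_product_eq by (rule proj_iprod[symmetric]) (auto intro: fam)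

lemma proj_hilbert_function: "hilbert_function Q (\<lambda>i. proj (I i)) s n = hlen I s a n"
proof -
  have mono: "ideal (ideal_monomial R I s n) R" for n by (rule monomial_ideal[of s I, OF fam])
  have "hilbert_function Q (\<lambda>i. proj (I i)) s n
      = Q.ilen (proj (ideal_monomial R I s (n(0 := Suc (n 0))))) (proj (ideal_monomial R I s n))"
    unfolding proj_monomial[symmetric] by (rule Q.hilbert_function_eq) (rule proj_ideal[OF fam])
  then show ?thesis unfolding hlen_def proj_ilen[OF mono mono] .
qed

lemma proj_is_hilbert_polynomial:
  "is_hilbert_polynomial Q (\<lambda>i. proj (I i)) s P \<longleftrightarrow> is_hilb I s a P"
  by (simp add: is_hilbert_polynomial_def is_hilb_def vars_le_def proj_hilbert_function)

text \<open>A quotient of a quotient: \<open>quotient_by\<close> is interpreted once more over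
  \<open>R / a\<close>, and the two correspondences of primes are composed.\<close>

lemma proj_krull_dim:
  assumes "a \<subseteq> saturation R a (ideal_product R I s)" "ideal (saturation R a (ideal_product R I s)) R"
  shows "krull_dim (Q Quot saturation Q {\<zero>\<^bsub>Q\<^esub>} (ideal_product Q (\<lambda>i. proj (I i)) s))
    = pdim (saturation R a (ideal_product R I s))"
proof -
  have II: "ideal (ideal_product R I s) R" by (rule ideal_product_ideal[of s I, OF fam])
  let ?S = "saturation R a (ideal_product R I s)"
  have eq: "saturation Q {\<zero>\<^bsub>Q\<^esub>} (ideal_product Q (\<lambda>i. proj (I i)) s) = proj ?S"
    unfolding proj_product by (rule proj_saturation[OF II])
  interpret QQ: quotient_by Q "proj ?S"
    by (rule quotient_by.intro[OF Q.is_cring quotient_by_axioms.intro[OF proj_ideal[OF assms(2)]]])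
  show ?thesis unfolding eq QQ.krull_dim_quot by (rule proj_pdim[OF assms(2,1)])
qed

lemma proj_mixed_multiplicity:
  assumes sat: "a \<subseteq> saturation R a (ideal_product R I s)" "ideal (saturation R a (ideal_product R I s)) R"
    and dim: "pdim (saturation R a (ideal_product R I s)) = enat (\<Sum>i\<in>{0..s}. k i) + 1"
    and P: "is_hilb I s a P"
  shows "mixed_multiplicity Q (\<lambda>i. proj (I i)) s k
    = Poly_Mapping.lookup P (exponents s k) * (\<Prod>i\<in>{0..s}. fact (k i))"
  unfolding mixed_multiplicity_def proj_krull_dim[OF sat] proj_is_hilbert_polynomial
  by (rule the_hilb_coefficient[OF dim P]) simp

lemma superficial_mod_of_superficial_at:
  assumes x: "x \<in> carrier R" and sup: "superficial_at Q (\<lambda>i. proj (I i)) s i (a +> x)"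
  shows "superficial_mod I s i x"
proof -
  have mono: "ideal (ideal_monomial R I s n) R" for n by (rule monomial_ideal[of s I, OF fam])
  have I0: "ideal (I 0) R" by (rule fam) simp
  have I0m: "ideal (I 0 \<cdot> ideal_monomial R I s n) R" for n by (rule prod_ideal[OF I0 mono])
  note Px = cgenideal_ideal[OF x]
  have i: "i \<le> s"
    and l1: "for_large s (\<lambda>n. colon Q (proj (I 0 \<cdot> ideal_monomial R I s (n(i := Suc (n i))))) {a +> x}
        \<inter> proj (ideal_monomial R I s n) = proj (I 0 \<cdot> ideal_monomial R I s n))"
    and l2: "for_large s (\<lambda>n. PIdl\<^bsub>Q\<^esub> (a +> x) \<inter> proj (ideal_monomial R I s (n(i := Suc (n i))))
        = (\<lambda>C. (a +> x) \<otimes>\<^bsub>Q\<^esub> C) ` proj (ideal_monomial R I s n))"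
    using sup unfolding superficial_at_def proj_monomial proj_prod[OF I0 mono, symmetric] by simp_all
  show ?thesis
    unfolding superficial_mod_def
  proof (intro conjI i)
    show "for_large s (\<lambda>n. \<forall>r\<in>ideal_monomial R I s n <+> a.
      r \<otimes> x \<in> (I 0 \<cdot> ideal_monomial R I s (n(i := Suc (n i)))) <+> a \<longrightarrow> r \<in> (I 0 \<cdot> ideal_monomial R I s n) <+> a)"
    proof (rule for_large_mono[OF l1], intro ballI impI)
      fix n r
      assume eq: "colon Q (proj (I 0 \<cdot> ideal_monomial R I s (n(i := Suc (n i))))) {a +> x}
          \<inter> proj (ideal_monomial R I s n) = proj (I 0 \<cdot> ideal_monomial R I s n)"
        and r: "r \<in> ideal_monomial R I s n <+> a"
        and rx: "r \<otimes> x \<in> (I 0 \<cdot> ideal_monomial R I s (n(i := Suc (n i)))) <+> a"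
      have rc: "r \<in> carrier R" using r ideal_carr[OF isum_ideal[OF mono a]] by blast
      have "a +> r \<in> proj (ideal_monomial R I s n)" using r proj_mem_iff[OF mono rc] by simp
      moreover have "(a +> r) \<otimes>\<^bsub>Q\<^esub> (a +> x) \<in> proj (I 0 \<cdot> ideal_monomial R I s (n(i := Suc (n i))))"
        using rx proj_mem_iff[OF I0m, of "r \<otimes> x"] coset_hom(2)[OF rc x] rc x by simp
      ultimately have "a +> r \<in> proj (I 0 \<cdot> ideal_monomial R I s n)"
        using coset_hom(1)[OF rc] unfolding eq[symmetric] colon_def by simp
      then show "r \<in> (I 0 \<cdot> ideal_monomial R I s n) <+> a" using proj_mem_iff[OF I0m rc] by simp
    qed
    show "for_large s (\<lambda>n. \<forall>y\<in>ideal_monomial R I s (n(i := Suc (n i))) <+> a.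
      y \<in> PIdl x <+> a \<longrightarrow> y \<in> scale x (ideal_monomial R I s n) <+> a)"
    proof (rule for_large_mono[OF l2], intro ballI impI)
      fix n y
      assume eq: "PIdl\<^bsub>Q\<^esub> (a +> x) \<inter> proj (ideal_monomial R I s (n(i := Suc (n i))))
          = (\<lambda>C. (a +> x) \<otimes>\<^bsub>Q\<^esub> C) ` proj (ideal_monomial R I s n)"
        and y: "y \<in> ideal_monomial R I s (n(i := Suc (n i))) <+> a" and yx: "y \<in> PIdl x <+> a"
      have yc: "y \<in> carrier R" using y ideal_carr[OF isum_ideal[OF mono a]] by blast
      have "a +> y \<in> proj (PIdl x)" using yx proj_mem_iff[OF Px yc] by simp
      then obtain r where r: "r \<in> carrier R" "a +> y = a +> (r \<otimes> x)" by (auto simp: proj_def cgenideal_def)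
      then have "a +> y = (a +> r) \<otimes>\<^bsub>Q\<^esub> (a +> x)" using coset_hom(2)[OF r(1) x] by simp
      then have "a +> y \<in> PIdl\<^bsub>Q\<^esub> (a +> x)" using coset_hom(1)[OF r(1)] by (auto simp: cgenideal_def)
      moreover have "a +> y \<in> proj (ideal_monomial R I s (n(i := Suc (n i))))"
        using y proj_mem_iff[OF mono yc] by simp
      ultimately have "a +> y \<in> (\<lambda>C. (a +> x) \<otimes>\<^bsub>Q\<^esub> C) ` proj (ideal_monomial R I s n)"
        unfolding eq[symmetric] by simp
      then obtain u where u: "u \<in> ideal_monomial R I s n" "a +> y = (a +> x) \<otimes>\<^bsub>Q\<^esub> (a +> u)"
        by (auto simp: proj_def)
      then have "a +> y = a +> (x \<otimes> u)" using coset_hom(2)[OF x] ideal_carr[OF mono] by simp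
      moreover have "x \<otimes> u \<in> scale x (ideal_monomial R I s n)" by (rule scale_mem[OF u(1)])
      ultimately have "a +> y \<in> proj (scale x (ideal_monomial R I s n))" by (auto simp: proj_def)
      then show "y \<in> scale x (ideal_monomial R I s n) <+> a"
        using proj_mem_iff[OF scale_ideal[OF x mono] yc] by simp
    qed
  qed
qed

end

end

section \<open>Superficial elements\<close>

context quotient_by
begin

context
  fixes I :: "nat \<Rightarrow> 'a set" and s :: nat
  assumes fam: "\<And>i. i \<le> s \<Longrightarrow> ideal (I i) R"
begin

text \<open>With the names introduced below, multiplication by \<open>x\<close> maps
  \<open>U / V\<close> into \<open>A / B\<close>. The colon condition makes this map injective, and
  the intersection condition identifies its cokernel with \<open>(A + B') / B'\<close>, the piece of
  the next quotient ring.\<close>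

lemma superficial_mod_hlen:
  assumes sup: "superficial_mod I s i x" and x: "x \<in> I i"
  shows "for_large s (\<lambda>n. hlen I s a (n(i := Suc (n i)))
    = hlen I s (PIdl x <+> a) (n(i := Suc (n i))) + hlen I s a n)"
proof -
  let ?m = "ideal_monomial R I s"
  have i: "i \<le> s"
    and l1: "for_large s (\<lambda>n. \<forall>r\<in>?m n <+> a. r \<otimes> x \<in> (I 0 \<cdot> ?m (n(i := Suc (n i)))) <+> a \<longrightarrow> r \<in> (I 0 \<cdot> ?m n) <+> a)"
    and l2: "for_large s (\<lambda>n. \<forall>y\<in>?m (n(i := Suc (n i))) <+> a. y \<in> PIdl x <+> a \<longrightarrow> y \<in> scale x (?m n) <+> a)"
    using sup unfolding superficial_mod_def by simp_all
  have xc: "x \<in> carrier R" using x ideal_carr[OF fam[OF i]] by blast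
  have mono: "ideal (?m n) R" for n by (rule monomial_ideal[of s I, OF fam])
  have I0: "ideal (I 0) R" by (rule fam) simp
  have Suc0: "?m (n(0 := Suc (n 0))) = I 0 \<cdot> ?m n" for n by (rule monomial_Suc[of s I 0, OF fam]) simp_all
  have I0m: "ideal (I 0 \<cdot> ?m n) R" for n by (rule prod_ideal[OF I0 mono])
  note Px = cgenideal_ideal[OF xc]
  show ?thesis
  proof (rule for_large_mono[OF for_large_conj[OF l1 l2]], elim conjE)
    fix n
    let ?n = "n(i := Suc (n i))"
    define U where "U = ?m n <+> a"
    define V where "V = (I 0 \<cdot> ?m n) <+> a"
    define A where "A = ?m ?n <+> a"
    define B where "B = (I 0 \<cdot> ?m ?n) <+> a"
    assume "\<forall>r\<in>?m n <+> a. r \<otimes> x \<in> (I 0 \<cdot> ?m ?n) <+> a \<longrightarrow> r \<in> (I 0 \<cdot> ?m n) <+> a"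
      and "\<forall>y\<in>?m ?n <+> a. y \<in> PIdl x <+> a \<longrightarrow> y \<in> scale x (?m n) <+> a"
    then have sup1: "\<And>r. r \<in> U \<Longrightarrow> r \<otimes> x \<in> B \<Longrightarrow> r \<in> V"
      and sup2: "\<And>y. y \<in> A \<Longrightarrow> y \<in> PIdl x <+> a \<Longrightarrow> y \<in> scale x (?m n) <+> a"
      unfolding U_def V_def A_def B_def by simp_all
    have U: "ideal U R" and V: "ideal V R" and A: "ideal A R" and B: "ideal B R"
      unfolding U_def V_def A_def B_def by (intro isum_ideal mono I0m a)+
    have BA: "B \<subseteq> A" unfolding A_def B_def by (intro isum_mono prod_subset2 I0 mono order_refl)
    have VU: "V \<subseteq> U" unfolding U_def V_def by (intro isum_mono prod_subset2 I0 mono order_refl)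
    have aB: "a \<subseteq> B" unfolding B_def by (rule isum_upper2[OF I0m a])
    note xU = scale_ideal[OF xc U]
    have m_Suc: "?m ?n = I i \<cdot> ?m n" by (rule monomial_Suc[of s I i, OF fam i])
    have xUA: "scale x U \<subseteq> A"
    proof -
      have "scale x U = scale x (?m n) <+> scale x a"
        unfolding U_def by (rule scale_sum[OF xc ideal_subset[OF mono] ideal_subset[OF a]])
      also have "\<dots> \<subseteq> ?m ?n <+> a"
        unfolding m_Suc by (intro isum_mono scale_prod_subset x scale_subset xc a)
      finally show ?thesis unfolding A_def .
    qed
    have xVB: "scale x V \<subseteq> B"
    proof -
      have "scale x V = scale x (I 0 \<cdot> ?m n) <+> scale x a"
        unfolding V_def by (rule scale_sum[OF xc ideal_subset[OF I0m] ideal_subset[OF a]])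
      also have "\<dots> \<subseteq> (I i \<cdot> (I 0 \<cdot> ?m n)) <+> a"
        by (intro isum_mono scale_prod_subset x scale_subset xc a)
      also have "I i \<cdot> (I 0 \<cdot> ?m n) = I 0 \<cdot> ?m ?n"
        unfolding m_Suc using ideal_prod_assoc[OF fam[OF i] I0 mono] ideal_prod_assoc[OF I0 fam[OF i] mono]
          ideal_prod_commute[OF fam[OF i] I0] by simp
      finally show ?thesis unfolding B_def .
    qed
    define M where "M = scale x U <+> B"
    have M: "ideal M R" unfolding M_def by (rule isum_ideal[OF xU B])
    have BM: "B \<subseteq> M" unfolding M_def by (rule isum_upper2[OF xU B])
    have MA: "M \<subseteq> A" unfolding M_def by (rule isum_least[OF A xUA BA])
    define B' where "B' = PIdl x <+> B"
    have B': "ideal B' R" unfolding B'_def by (rule isum_ideal[OF Px B])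
    \<comment> \<open>Because \<open>B \<subseteq> A\<close>, the modular law reduces the claim to
      \<open>A \<inter> (x)\<close>, which the intersection condition controls.\<close>
    have AB': "A \<inter> B' = M"
    proof
      have "A \<inter> B' \<subseteq> A \<inter> (B <+> PIdl x)" unfolding B'_def using isum_comm[OF Px B] by simp
      also have "\<dots> \<subseteq> B <+> (A \<inter> PIdl x)" by (rule modular_law[OF A B Px BA])
      also have "\<dots> \<subseteq> M"
      proof (rule isum_least[OF M BM])
        show "A \<inter> PIdl x \<subseteq> M"
        proof
          fix y assume y: "y \<in> A \<inter> PIdl x"
          then have "y \<in> scale x (?m n) <+> a" using sup2 isum_upper1[OF Px a] by blast
          moreover have "scale x (?m n) <+> a \<subseteq> M"
          proof (rule isum_least[OF M])
            have "scale x (?m n) \<subseteq> scale x U" unfolding U_def by (rule scale_mono[OF isum_upper1[OF mono a]])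
            then show "scale x (?m n) \<subseteq> M" unfolding M_def using isum_upper1[OF xU B] by (rule subset_trans)
            show "a \<subseteq> M" using aB BM by (rule subset_trans)
          qed
          ultimately show "y \<in> M" by blast
        qed
      qed
      finally show "A \<inter> B' \<subseteq> M" .
      have "scale x U \<subseteq> PIdl x"
        unfolding scale_carrier[OF xc, symmetric] by (rule scale_mono[OF ideal_subset[OF U]])
      then have "M \<subseteq> B'" unfolding M_def B'_def by (rule isum_mono[OF _ order_refl])
      then show "M \<subseteq> A \<inter> B'" using MA by blast
    qed
    have pre: "preimage x B U = V"
    proof
      show "preimage x B U \<subseteq> V"
      proof
        fix r assume "r \<in> preimage x B U"
        then have r: "r \<in> U" "x \<otimes> r \<in> B" by (auto simp: preimage_def)
        then have "r \<otimes> x \<in> B" using m_comm[OF xc, of r] ideal_carr[OF U] by simp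
        then show "r \<in> V" by (rule sup1[OF r(1)])
      qed
      show "V \<subseteq> preimage x B U" unfolding subset_preimage_iff using VU xVB by simp
    qed
    have Am: "?m ?n <+> (PIdl x <+> a) = A <+> B'"
    proof -
      have "A <+> B' = (A <+> B) <+> PIdl x"
        unfolding B'_def using isum_comm[OF Px B] isum_assoc[OF A B Px] by simp
      also have "A <+> B = A" by (rule isum_absorb[OF A B BA])
      also have "A <+> PIdl x = ?m ?n <+> (PIdl x <+> a)"
        unfolding A_def using isum_assoc[OF mono a Px] isum_comm[OF a Px] by simp
      finally show ?thesis by simp
    qed
    have Bm: "(I 0 \<cdot> ?m ?n) <+> (PIdl x <+> a) = B'"
      unfolding B'_def B_def using isum_assoc[OF I0m a Px] isum_comm[OF a Px]
        isum_comm[OF Px isum_ideal[OF I0m a]] by simp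
    have "ilen B A = ilen B M + ilen M A" by (rule ilen_add[OF B M A BM MA])
    also have "ilen B M = ilen V U" unfolding M_def ilen_scale[OF xc U B] pre ..
    also have "ilen M A = ilen B' (A <+> B')" unfolding ilen_diamond[OF A B'] AB' ..
    finally show "hlen I s a ?n = hlen I s (PIdl x <+> a) ?n + hlen I s a n"
      unfolding hlen_def Suc0 Am Bm A_def[symmetric] B_def[symmetric] U_def[symmetric] V_def[symmetric]
      by (simp add: add.commute)
  qed
qed

lemma superficial_mod_hilb:
  assumes sup: "superficial_mod I s i x" and x: "x \<in> I i" and P: "is_hilb I s a P" and Q': "is_bdiff s i d P Q'"
  shows "is_hilb I s (PIdl x <+> a) Q'"
proof -
  have i: "i \<le> s" using sup unfolding superficial_mod_def by simp
  obtain N1 where N1: "\<And>n. \<forall>j\<le>s. N1 \<le> n j \<Longrightarrow> hlen I s a (n(i := Suc (n i)))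
    = hlen I s (PIdl x <+> a) (n(i := Suc (n i))) + hlen I s a n"
    using superficial_mod_hlen[OF sup x] unfolding for_large_def by blast
  obtain N2 where N2: "\<And>n. \<forall>j\<le>s. N2 \<le> n j \<Longrightarrow> \<exists>l. hlen I s a n = enat l \<and> of_nat l = multipoly_eval P n"
    using P unfolding is_hilb_def for_large_def by blast
  have "for_large s (\<lambda>n. \<exists>l. hlen I s (PIdl x <+> a) n = enat l \<and> of_nat l = multipoly_eval Q' n)"
    unfolding for_large_def
  \<comment> \<open>One more than both thresholds, so that \<open>n - e_i\<close> is still beyond
    them.\<close>
  proof (rule exI[of _ "Suc (max N1 N2)"], intro allI impI)
    fix n assume n: "\<forall>j\<le>s. Suc (max N1 N2) \<le> n j"
    define m where "m = n(i := n i - 1)"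
    have ni: "1 \<le> n i" using n i by auto
    have nm: "m(i := Suc (m i)) = n" using ni by (simp add: m_def)
    have m: "\<forall>j\<le>s. max N1 N2 \<le> m j" using n by (auto simp: m_def)
    have eq: "hlen I s a n = hlen I s (PIdl x <+> a) n + hlen I s a m"
      using N1[of m] m unfolding nm by simp
    obtain l where l: "hlen I s a n = enat l" "of_nat l = multipoly_eval P n"
      using N2[of n] n by (meson Suc_leD max.boundedE)
    obtain l0 where l0: "hlen I s a m = enat l0" "of_nat l0 = multipoly_eval P m"
      using N2[of m] m by (meson max.boundedE)
    obtain l1 where l1: "hlen I s (PIdl x <+> a) n = enat l1"
      using eq unfolding l(1) by (cases "hlen I s (PIdl x <+> a) n") auto
    have "l = l1 + l0" using eq unfolding l(1) l0(1) l1 by simp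
    then have "of_nat l1 = multipoly_eval P n - multipoly_eval P m"
      unfolding l(2)[symmetric] l0(2)[symmetric] by simp
    also have "\<dots> = multipoly_eval Q' n"
      using Q' ni unfolding is_bdiff_def m_def by simp
    finally show "\<exists>l. hlen I s (PIdl x <+> a) n = enat l \<and> of_nat l = multipoly_eval Q' n"
      using l1 by blast
  qed
  then show ?thesis using Q' unfolding is_hilb_def is_bdiff_def by blast
qed

end

end

section \<open>The dimension drop at a superficial element\<close>

context noetherian_local_ring
begin

context
  fixes I :: "nat \<Rightarrow> 'a set" and s :: nat
  assumes fam: "\<And>i. i \<le> s \<Longrightarrow> ideal (I i) R" and I0: "nn_primary (I 0)"
begin

text \<open>If \<open>r x\<close> lies in \<open>a\<close>, the colon condition can be applied
  repeatedly with a growing exponent of \<open>I 0\<close>, so \<open>r\<close> lies in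
  \<open>I_0^p + a\<close> for every \<open>p\<close>; Krull's intersection theorem puts it into
  \<open>a\<close>.\<close>

lemma superficial_mod_annihilator:
  assumes a: "ideal a R" and x: "x \<in> carrier R" and sup: "quotient_by.superficial_mod R a I s i x"
  shows "\<exists>N. \<forall>r\<in>ideal_monomial R I s (\<lambda>_. N) <+> a. r \<otimes> x \<in> a \<longrightarrow> r \<in> a"
proof -
  interpret quotient_by R a by (rule quotient_by.intro[OF is_cring quotient_by_axioms.intro[OF a]])
  let ?m = "ideal_monomial R I s"
  have mono: "ideal (?m n) R" for n by (rule monomial_ideal[of s I, OF fam])
  have I0i: "ideal (I 0) R" by (rule fam) simp
  have I0nn: "I 0 \<subseteq> \<nn>" using I0 by (simp add: nn_primary_def)
  have "for_large s (\<lambda>n. \<forall>r\<in>?m n <+> a. r \<otimes> x \<in> (I 0 \<cdot> ?m (n(i := Suc (n i)))) <+> a \<longrightarrow> r \<in> (I 0 \<cdot> ?m n) <+> a)"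
    using sup unfolding superficial_mod_def by simp
  then obtain N where N: "\<And>n. \<forall>j\<le>s. N \<le> n j \<Longrightarrow>
      \<forall>r\<in>?m n <+> a. r \<otimes> x \<in> (I 0 \<cdot> ?m (n(i := Suc (n i)))) <+> a \<longrightarrow> r \<in> (I 0 \<cdot> ?m n) <+> a"
    unfolding for_large_def by blast
  have "r \<in> a" if r: "r \<in> ?m (\<lambda>_. N) <+> a" "r \<otimes> x \<in> a" for r
  proof -
    have "r \<in> ?m (inc 0 p (\<lambda>_. N)) <+> a" for p
    proof (induction p)
      case (Suc p)
      let ?n = "inc 0 p (\<lambda>_. N)"
      have "r \<otimes> x \<in> (I 0 \<cdot> ?m (?n(i := Suc (?n i)))) <+> a"
        using r(2) isum_upper2[OF prod_ideal[OF I0i mono] a] by blast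
      moreover have "\<forall>j\<le>s. N \<le> ?n j" by (auto simp: inc_apply)
      ultimately have "r \<in> (I 0 \<cdot> ?m ?n) <+> a" using N[of ?n] Suc.IH by blast
      moreover have "I 0 \<cdot> ?m ?n = ?m (inc 0 1 ?n)"
        by (rule monomial_inc[of s I 0, OF fam, symmetric]) simp_all
      ultimately show ?case by (simp add: inc_add)
    qed (simp add: r(1))
    moreover have "?m (inc 0 p (\<lambda>_. N)) <+> a \<subseteq> ipow (I 0) p <+> a" for p
    proof (intro isum_mono order_refl)
      have "?m (inc 0 p (\<lambda>_. N)) \<subseteq> ipow (I 0) (N + p)"
        using monomial_subset_ipow[of s I "inc 0 p (\<lambda>_. N)", OF fam] by (simp add: inc_apply)
      also have "\<dots> \<subseteq> ipow (I 0) p" by (rule ipow_antimono[OF I0i]) simp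
      finally show "?m (inc 0 p (\<lambda>_. N)) \<subseteq> ipow (I 0) p" .
    qed
    ultimately have "r \<in> (\<Inter>p. ipow (I 0) p <+> a)" by blast
    then show "r \<in> a" using krull_intersection[OF I0i I0nn a] by blast
  qed
  then show ?thesis by blast
qed

text \<open>A chain over the new saturation starts above a prime \<open>P'\<close> over
  \<open>(x) + a\<close> that does not contain the product ideal. Unless \<open>P'\<close> is
  maximal, a smaller prime over \<open>a\<close> exists, and putting it in front gives a longer
  chain over the old saturation.\<close>

lemma superficial_mod_pdim:
  assumes a: "ideal a R" and x: "x \<in> carrier R" and sup: "quotient_by.superficial_mod R a I s i x"
    and q: "pdim (saturation R a (ideal_product R I s)) \<le> enat (Suc q)"
  shows "pdim (saturation R (PIdl x <+> a) (ideal_product R I s)) \<le> enat q"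
proof -
  let ?I = "ideal_product R I s"
  note Px = cgenideal_ideal[OF x]
  define a' where "a' = PIdl x <+> a"
  have a': "ideal a' R" unfolding a'_def by (rule isum_ideal[OF Px a])
  have xa': "x \<in> a'" unfolding a'_def using cgenideal_self[OF x] isum_upper1[OF Px a] by blast
  have aa': "a \<subseteq> a'" unfolding a'_def by (rule isum_upper2[OF Px a])
  have II: "ideal ?I R" by (rule ideal_product_ideal[of s I, OF fam])
  obtain N where N: "\<And>r. r \<in> ideal_monomial R I s (\<lambda>_. N) <+> a \<Longrightarrow> r \<otimes> x \<in> a \<Longrightarrow> r \<in> a"
    using superficial_mod_annihilator[OF a x sup] by blast
  define M where "M = ideal_monomial R I s (\<lambda>_. N)"
  have M: "ideal M R" unfolding M_def by (rule monomial_ideal[of s I, OF fam])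
  have Mr: "r \<in> a" if "r \<in> M" "r \<otimes> x \<in> a" for r
    using N[of r] that isum_upper1[OF M a] unfolding M_def by blast
  \<comment> \<open>By \<open>Mr\<close>, each factor from \<open>M\<close> cancels one factor
    \<open>x\<close>.\<close>
  have ann: "scale t (ipow M e) \<subseteq> a" if "t \<in> carrier R" "x [^] e \<otimes> t \<in> a" for e :: nat and t
    using that
  proof (induction e arbitrary: t)
    case 0
    then have "t \<in> a" by simp
    then show ?case using ideal_rmult[OF a] by (auto simp: scale_def)
  next
    case (Suc e)
    have t: "t \<in> carrier R" by (rule Suc.prems(1))
    have "x [^] Suc e \<otimes> t = x [^] e \<otimes> (x \<otimes> t)" using x t by (simp add: m_assoc)
    then have IH: "scale (x \<otimes> t) (ipow M e) \<subseteq> a" using Suc.prems(2) x t by (intro Suc.IH) simp_all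
    have "M \<cdot> ipow M e \<subseteq> preimage t a (carrier R)"
      unfolding prod_le_iff[OF preimage_ideal[OF t a oneideal]]
    proof (intro ballI)
      fix w u assume wu: "w \<in> M" "u \<in> ipow M e"
      have wc: "w \<in> carrier R" and uc: "u \<in> carrier R"
        using wu ideal_carr[OF M] ideal_carr[OF ipow_ideal[OF M]] by auto
      have "(t \<otimes> (w \<otimes> u)) \<otimes> x = w \<otimes> ((x \<otimes> t) \<otimes> u)" using t x wc uc by algebra
      moreover have "(x \<otimes> t) \<otimes> u \<in> a" using IH scale_mem[OF wu(2)] by blast
      ultimately have "(t \<otimes> (w \<otimes> u)) \<otimes> x \<in> a" using ideal_lmult[OF a _ wc] by simp
      moreover have "t \<otimes> (w \<otimes> u) \<in> M"
        by (intro ideal_lmult[OF M] ideal_rmult[OF M] wu t uc)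
      ultimately have "t \<otimes> (w \<otimes> u) \<in> a" by (rule Mr[rotated])
      then show "w \<otimes> u \<in> preimage t a (carrier R)" using wc uc by (simp add: preimage_def)
    qed
    then show ?case
      unfolding ipow_Suc[OF M] subset_preimage_iff by simp
  qed
  \<comment> \<open>In a product of primes inside \<open>c\<close>, the factors containing
    \<open>?I\<close> are replaced by a power of \<open>?I\<close>. The product of the others then
    lies in the saturation, hence in \<open>P\<close>, and so does one of these others.\<close>
  have good_prime: "\<exists>Q'. primeideal Q' R \<and> c \<subseteq> Q' \<and> Q' \<subseteq> P \<and> \<not> ?I \<subseteq> Q'"
    if c: "ideal c R" and P: "primeideal P R" "saturation R c ?I \<subseteq> P" for c P
  proof -
    obtain Ps where Ps: "\<And>Q. Q \<in> set Ps \<Longrightarrow> primeideal Q R" "\<And>Q. Q \<in> set Ps \<Longrightarrow> c \<subseteq> Q" "lprod Ps \<subseteq> c"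
      using prime_product[OF c] by blast
    have id: "ideal Q R" if "Q \<in> set Ps" for Q by (rule prime_ideal[OF Ps(1)[OF that]])
    let ?g = "filter (\<lambda>Q. \<not> ?I \<subseteq> Q) Ps"
    let ?n = "length (filter (\<lambda>Q. ?I \<subseteq> Q) Ps)"
    have gid: "ideal (lprod ?g) R" by (rule lprod_ideal) (use id in simp)
    have "ipow ?I ?n \<cdot> lprod ?g \<subseteq> lprod Ps"
      using id
    proof (induction Ps)
      case (Cons Q Ps)
      let ?h = "lprod (filter (\<lambda>Q. \<not> ?I \<subseteq> Q) Ps)" and ?k = "length (filter (\<lambda>Q. ?I \<subseteq> Q) Ps)"
      have Q: "ideal Q R" and ids: "\<And>Q. Q \<in> set Ps \<Longrightarrow> ideal Q R" using Cons.prems by auto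
      have L: "ideal (lprod Ps) R" by (rule lprod_ideal[OF ids])
      have h: "ideal ?h R" by (rule lprod_ideal) (use ids in simp)
      have IH: "ipow ?I ?k \<cdot> ?h \<subseteq> lprod Ps" by (rule Cons.IH[OF ids])
      note Ik = ipow_ideal[OF II, of ?k]
      show ?case
      proof (cases "?I \<subseteq> Q")
        case True
        have "(?I \<cdot> ipow ?I ?k) \<cdot> ?h = ?I \<cdot> (ipow ?I ?k \<cdot> ?h)" by (rule ideal_prod_assoc[OF II Ik h])
        also have "\<dots> \<subseteq> Q \<cdot> lprod Ps" by (rule ideal_prod_mono[OF Q L True IH])
        finally show ?thesis using True by (simp add: ipow_Suc II)
      next
        case False
        have "ipow ?I ?k \<cdot> (Q \<cdot> ?h) = Q \<cdot> (ipow ?I ?k \<cdot> ?h)"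
          using ideal_prod_assoc[OF Ik Q h] ideal_prod_assoc[OF Q Ik h] ideal_prod_commute[OF Q Ik] by simp
        also have "\<dots> \<subseteq> Q \<cdot> lprod Ps" by (rule ideal_prod_mono[OF Q L order_refl IH])
        finally show ?thesis using False by simp
      qed
    qed (simp add: ideal_prod_one oneideal)
    then have "ipow ?I ?n \<cdot> lprod ?g \<subseteq> c" using Ps(3) by (rule subset_trans)
    then have "lprod ?g \<cdot> ipow ?I ?n \<subseteq> c" by (simp only: ideal_prod_commute[OF gid ipow_ideal[OF II]])
    then have "lprod ?g \<subseteq> colon R c (ipow ?I ?n)"
      unfolding prod_le_iff[OF c] colon_def
      using ideal_carr[OF gid] by blast
    then have "lprod ?g \<subseteq> P" using P(2) unfolding saturation_eq_union by blast
    then obtain Q' where "Q' \<in> set ?g" "Q' \<subseteq> P" using prime_lprod[OF P(1), of ?g] id by auto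
    then show ?thesis using Ps(1,2) by (intro exI[of _ Q']) simp
  qed
  have "enat n \<le> enat q" if chain: "prime_chain (saturation R a' ?I) P n" for P n
  proof -
    have P0: "primeideal (P 0) R" "saturation R a' ?I \<subseteq> P 0" using chain by (auto simp: prime_chain_def)
    obtain P' where P': "primeideal P' R" "a' \<subseteq> P'" "P' \<subseteq> P 0" "\<not> ?I \<subseteq> P'"
      using good_prime[OF a' P0] by blast
    show ?thesis
    \<comment> \<open>If \<open>P'\<close> is \<open>\<nn>\<close>, the chain has length 0.
      Excluding this case is also what rules out \<open>I 0 \<subseteq> P'\<close> below.\<close>
    proof (cases "P' = \<nn>")
      case True
      then have "P 0 = \<nn>" using P'(3) prime_subset_nn[OF P0(1)] by blast
      then show ?thesis using prime_chain_nn[OF chain] by simp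
    next
      case False
      obtain Ps where Ps: "\<And>Q. Q \<in> set Ps \<Longrightarrow> primeideal Q R" "\<And>Q. Q \<in> set Ps \<Longrightarrow> a \<subseteq> Q" "lprod Ps \<subseteq> a"
        using prime_product[OF a] by blast
      have id: "ideal Q R" if "Q \<in> set Ps" for Q by (rule prime_ideal[OF Ps(1)[OF that]])
      have "\<exists>Q\<in>set Ps. Q \<subset> P'"
      proof (rule ccontr)
        assume no: "\<not> (\<exists>Q\<in>set Ps. Q \<subset> P')"
        text \<open>Otherwise \<open>P'\<close> is minimal over \<open>a\<close>, so some \<open>t\<close> outside \<open>P'\<close> is annihilated by a power of \<open>x\<close>
          modulo \<open>a\<close>, whence a product of the given ideals lies in \<open>P'\<close>.\<close>
        have "\<exists>t\<in>carrier R. t \<notin> P' \<and> (\<exists>e::nat. x [^] e \<otimes> t \<in> lprod Ps)"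
          using id no
        proof (induction Ps)
          case Nil
          have "\<one> \<notin> P'" using ideal.one_imp_carrier[OF prime_ideal[OF P'(1)]] primeideal.I_notcarr[OF P'(1)] by blast
          then show ?case using x by (intro bexI[of _ \<one>] conjI exI[of _ 0]) simp_all
        next
          case (Cons Q Ps)
          have Q: "ideal Q R" using Cons.prems(1) by simp
          obtain t e where t: "t \<in> carrier R" "t \<notin> P'" "x [^] (e::nat) \<otimes> t \<in> lprod Ps"
            using Cons by auto
          show ?case
          \<comment> \<open>A factor equal to \<open>P'\<close> is represented by \<open>x\<close>
            and raises \<open>e\<close>; any other factor by an element outside \<open>P'\<close>,
            which goes into \<open>t\<close>.\<close>
          proof (cases "Q = P'")
            case True
            have "x \<in> Q" using True xa' P'(2) by blast
            then have "x \<otimes> (x [^] e \<otimes> t) \<in> lprod (Q # Ps)" using prod_mem[OF _ t(3)] by simp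
            moreover have "x \<otimes> (x [^] e \<otimes> t) = x [^] Suc e \<otimes> t" using x t(1) by (simp add: m_ac)
            ultimately have "x [^] Suc e \<otimes> t \<in> lprod (Q # Ps)" by simp
            then show ?thesis using t by blast
          next
            case False
            then have "\<not> Q \<subseteq> P'" using Cons.prems(2) by auto
            then obtain z where z: "z \<in> Q" "z \<notin> P'" by blast
            have zc: "z \<in> carrier R" using z(1) ideal_carr[OF Q] by blast
            have "z \<otimes> (x [^] e \<otimes> t) \<in> lprod (Q # Ps)" using prod_mem[OF z(1) t(3)] by simp
            moreover have "z \<otimes> (x [^] e \<otimes> t) = x [^] e \<otimes> (z \<otimes> t)"
              using x t(1) zc by (simp add: m_lcomm)
            ultimately have "x [^] e \<otimes> (z \<otimes> t) \<in> lprod (Q # Ps)" by simp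
            moreover have "z \<otimes> t \<notin> P'" using primeideal.I_prime[OF P'(1) zc t(1)] z(2) t(2) by blast
            ultimately show ?thesis using zc t(1) by blast
          qed
        qed
        then obtain t e where t: "t \<in> carrier R" "t \<notin> P'" "x [^] (e::nat) \<otimes> t \<in> lprod Ps" by blast
        have "scale t (ipow M e) \<subseteq> a" by (rule ann[OF t(1)]) (use t(3) Ps(3) in blast)
        then have sub: "scale t (ipow M e) \<subseteq> P'" using aa' P'(2) by blast
        have "ipow M e \<subseteq> P'"
        proof
          fix u assume u: "u \<in> ipow M e"
          have uc: "u \<in> carrier R" using u ideal_carr[OF ipow_ideal[OF M]] by blast
          have "t \<otimes> u \<in> P'" using sub scale_mem[OF u] by blast
          then show "u \<in> P'" using primeideal.I_prime[OF P'(1) t(1) uc] t(2) by blast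
        qed
        then have "M \<subseteq> P'" by (rule prime_ipow[OF P'(1) M])
        \<comment> \<open>For \<open>j = 0\<close> the prime would be \<open>\<nn>\<close>, and for
          \<open>j > 0\<close> it would contain the whole product \<open>?I\<close>.\<close>
        then obtain j where j: "j \<le> s" "I j \<subseteq> P'"
          using prime_monomial[of s I P' "\<lambda>_. N", OF fam P'(1)] unfolding M_def by blast
        show False
        proof (cases "j = 0")
          case True
          then show False using prime_over_nn_primary[OF I0 P'(1)] j(2) False by simp
        next
          case False
          have "?I \<subseteq> I j"
            unfolding ideal_product_eq by (rule iprod_subset) (use fam j False in auto)
          then show False using j(2) P'(4) by blast
        qed
      qed
      then obtain Q' where Q': "Q' \<in> set Ps" "Q' \<subset> P'" by blast
      have "\<not> ?I \<subseteq> Q'" using Q'(2) P'(4) by blast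
      then have satQ: "saturation R a ?I \<subseteq> Q'"
        by (rule saturation_subset_prime[OF Ps(1)[OF Q'(1)] Ps(2)[OF Q'(1)] II])
      have "Q' \<subset> P 0" using Q'(2) P'(3) by blast
      then have "prime_chain (saturation R a ?I) (case_nat Q' P) (Suc n)"
        by (rule prime_chain_cons[OF chain Ps(1)[OF Q'(1)] satQ])
      then have "enat (Suc n) \<le> enat (Suc q)" using pdim_geI q order_trans by blast
      then show ?thesis by simp
    qed
  qed
  then show ?thesis unfolding a'_def by (rule pdim_leI)
qed

end

end

section \<open>Mixed multiplicities modulo a superficial sequence\<close>

lemma exponents_fun_upd:
  assumes "i \<le> s" "1 \<le> k i"
  shows "exponents s (k(i := k i - 1)) + Poly_Mapping.single i 1 = exponents s k"
  by (rule poly_mapping_eqI) (use assms in \<open>auto simp: lookup_add lookup_exponents lookup_single when_def\<close>)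

lemma sum_fun_upd_pred:
  fixes k :: "nat \<Rightarrow> nat"
  assumes "i \<le> s" "1 \<le> k i"
  shows "(\<Sum>j\<in>{0..s}. k j) = Suc (\<Sum>j\<in>{0..s}. (k(i := k i - 1)) j)"
  using assms by (simp add: sum.remove[of "{0..s}" i])

lemma prod_fact_fun_upd_pred:
  fixes k :: "nat \<Rightarrow> nat"
  assumes "i \<le> s" "1 \<le> k i"
  shows "(\<Prod>j\<in>{0..s}. fact (k j)) = of_nat (k i) * (\<Prod>j\<in>{0..s}. fact ((k(i := k i - 1)) j) :: rat)"
proof -
  have "(\<Prod>j\<in>{0..s}. fact (k j)) = fact (k i) * (\<Prod>j\<in>{0..s} - {i}. fact (k j) :: rat)"
    using assms(1) by (intro prod.remove) simp_all
  also have "fact (k i) = (of_nat (k i) * fact ((k(i := k i - 1)) i) :: rat)"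
    using assms(2) fact_reduce[of "k i"] by simp
  also have "(\<Prod>j\<in>{0..s} - {i}. fact (k j) :: rat) = (\<Prod>j\<in>{0..s} - {i}. fact ((k(i := k i - 1)) j))"
    by (rule prod.cong) simp_all
  also have "of_nat (k i) * fact ((k(i := k i - 1)) i) * (\<Prod>j\<in>{0..s} - {i}. fact ((k(i := k i - 1)) j))
      = of_nat (k i) * (\<Prod>j\<in>{0..s}. fact ((k(i := k i - 1)) j) :: rat)"
    unfolding mult.assoc using assms(1) by (intro arg_cong2[where f = times] refl prod.remove[symmetric]) simp_all
  finally show ?thesis .
qed

context cring
begin

lemma isum_zero: "ideal A R \<Longrightarrow> A <+> {\<zero>} = A"
  using ideal_0 by (intro isum_absorb zeroideal) simp_all

lemma Idl_empty: "Idl {} = {\<zero>}"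
  using genideal_minimal[OF zeroideal, of "{}"] ideal_0[OF genideal_ideal[of "{}"]] by blast

lemma Idl_insert:
  assumes "x \<in> carrier R" "S \<subseteq> carrier R"
  shows "Idl (insert x S) = PIdl x <+> Idl S"
proof (rule subset_antisym)
  note Px = cgenideal_ideal[OF assms(1)] and S = genideal_ideal[OF assms(2)]
  have xS: "insert x S \<subseteq> carrier R" using assms by blast
  show "Idl (insert x S) \<subseteq> PIdl x <+> Idl S"
    by (rule genideal_minimal[OF isum_ideal[OF Px S]])
      (use cgenideal_self[OF assms(1)] genideal_self[OF assms(2)] isum_upper1[OF Px S] isum_upper2[OF Px S] in blast)
  note xS_ideal = genideal_ideal[OF xS]
  have "insert x S \<subseteq> Idl (insert x S)" by (rule genideal_self[OF xS])
  then show "PIdl x <+> Idl S \<subseteq> Idl (insert x S)"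
    by (intro isum_least[OF xS_ideal] cgenideal_minimal[OF xS_ideal] genideal_minimal[OF xS_ideal]) blast+
qed

end

context noetherian_local_ring
begin

context
  fixes I :: "nat \<Rightarrow> 'a set" and s :: nat
  assumes fam: "\<And>i. i \<le> s \<Longrightarrow> ideal (I i) R" and I0: "nn_primary (I 0)"
begin

text \<open>The difference in direction \<open>i\<close> multiplies the coefficient by
  \<open>k i\<close>, which is the quotient of the two factorials, so coefficient times factorials
  is preserved. The dimension enters as an upper bound, since a bound can be passed along the
  sequence before the exact dimension is known.\<close>

lemma superficial_mod_coefficient:
  assumes a: "ideal a R" and x: "x \<in> I i" and sup: "quotient_by.superficial_mod R a I s i x"
    and P: "is_hilb I s a P"
    and dim: "pdim (saturation R a (ideal_product R I s)) \<le> enat (Suc (\<Sum>j\<in>{0..s}. k j))"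
    and k: "1 \<le> k i"
  shows "\<exists>Q. is_hilb I s (PIdl x <+> a) Q \<and>
    pdim (saturation R (PIdl x <+> a) (ideal_product R I s)) \<le> enat (Suc (\<Sum>j\<in>{0..s}. (k(i := k i - 1)) j)) \<and>
    Poly_Mapping.lookup Q (exponents s (k(i := k i - 1))) * (\<Prod>j\<in>{0..s}. fact ((k(i := k i - 1)) j))
      = Poly_Mapping.lookup P (exponents s k) * (\<Prod>j\<in>{0..s}. fact (k j))"
proof -
  have qa: "quotient_by R a" by (rule quotient_by.intro[OF is_cring quotient_by_axioms.intro[OF a]])
  define k' where "k' = k(i := k i - 1)"
  have i: "i \<le> s" using sup unfolding quotient_by.superficial_mod_def[OF qa] by simp
  have xc: "x \<in> carrier R" using x ideal_carr[OF fam[OF i]] by blast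
  note sum = sum_fun_upd_pred[of i s k, OF i k, folded k'_def]
  \<comment> \<open>This places \<open>exponents s k\<close> in the top degree, where
    \<open>is_bdiff\<close> describes the coefficients.\<close>
  have "deg_le s (Suc (\<Sum>j\<in>{0..s}. k' j)) P"
    unfolding deg_le_def sum[symmetric]
  proof
    fix \<mu> assume \<mu>: "\<mu> \<in> Poly_Mapping.keys P"
    have "tdeg s \<mu> < Suc (\<Sum>j\<in>{0..s}. k j)" by (rule hilb_degree[of s I, OF fam I0 a P dim \<mu>])
    then show "tdeg s \<mu> \<le> (\<Sum>j\<in>{0..s}. k j)" by simp
  qed
  moreover have "vars_le s P" using P by (simp add: is_hilb_def)
  ultimately obtain Q where Q: "is_bdiff s i (\<Sum>j\<in>{0..s}. k' j) P Q"
    using backward_difference[OF _ _ i] by blast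
  have "is_hilb I s (PIdl x <+> a) Q"
    by (rule quotient_by.superficial_mod_hilb[OF qa _ sup x P Q]) (rule fam)
  moreover have "pdim (saturation R (PIdl x <+> a) (ideal_product R I s)) \<le> enat (Suc (\<Sum>j\<in>{0..s}. k' j))"
    by (rule superficial_mod_pdim[of s I, OF fam I0 a xc sup dim[unfolded sum]])
  moreover have "Poly_Mapping.lookup Q (exponents s k') = of_nat (k i) * Poly_Mapping.lookup P (exponents s k)"
  proof -
    have "Poly_Mapping.lookup Q (exponents s k') = of_nat (Suc (Poly_Mapping.lookup (exponents s k') i))
        * Poly_Mapping.lookup P (exponents s k' + Poly_Mapping.single i 1)"
      using Q unfolding is_bdiff_def by simp
    then show ?thesis
      using exponents_fun_upd[of i s k, OF i k] i k by (simp add: lookup_exponents k'_def)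
  qed
  ultimately show ?thesis
    using prod_fact_fun_upd_pred[of i s k, OF i k] unfolding k'_def by (intro exI[of _ Q]) simp
qed

text \<open>Induction appends on the right because each element is superficial modulo its
  predecessors; the exponents drop by the number of entries counted so far for each index.\<close>

lemma superficial_sequence_coefficient:
  assumes xs: "set xs \<subseteq> carrier R"
    and sup: "\<And>j. j < length xs \<Longrightarrow> xs ! j \<in> I (\<iota> j) \<and>
      superficial_at (quot_by R (take j xs)) (\<lambda>i. image_by R (take j xs) (I i)) s (\<iota> j)
        (Idl (set (take j xs)) +> xs ! j)"
    and k: "\<And>i. i \<le> s \<Longrightarrow> card {j. j < length xs \<and> \<iota> j = i} \<le> k i"
    and P: "is_hilb I s {\<zero>} P"
    and dim: "pdim (saturation R {\<zero>} (ideal_product R I s)) \<le> enat (Suc (\<Sum>i\<in>{0..s}. k i))"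
  shows "\<exists>Q. is_hilb I s (Idl (set xs)) Q \<and>
    pdim (saturation R (Idl (set xs)) (ideal_product R I s))
      \<le> enat (Suc (\<Sum>i\<in>{0..s}. k i - card {j. j < length xs \<and> \<iota> j = i})) \<and>
    Poly_Mapping.lookup Q (exponents s (\<lambda>i. k i - card {j. j < length xs \<and> \<iota> j = i}))
        * (\<Prod>i\<in>{0..s}. fact (k i - card {j. j < length xs \<and> \<iota> j = i}))
      = Poly_Mapping.lookup P (exponents s k) * (\<Prod>i\<in>{0..s}. fact (k i))"
  using xs sup k
proof (induction xs rule: rev_induct)
  case Nil
  show ?case using P dim by (intro exI[of _ P]) (simp add: Idl_empty)
next
  case (snoc x xs)
  let ?a = "Idl (set xs)" and ?i = "\<iota> (length xs)"
  define k1 where "k1 = (\<lambda>i. k i - card {j. j < length xs \<and> \<iota> j = i})"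
  define k2 where "k2 = (\<lambda>i. k i - card {j. j < length (xs @ [x]) \<and> \<iota> j = i})"
  have xc: "x \<in> carrier R" and xsc: "set xs \<subseteq> carrier R" using snoc.prems(1) by simp_all
  have a: "ideal ?a R" by (rule genideal_ideal[OF xsc])
  interpret qa: quotient_by R ?a by (rule quotient_by.intro[OF is_cring quotient_by_axioms.intro[OF a]])
  have split: "{j. j < length (xs @ [x]) \<and> \<iota> j = i}
      = (if i = ?i then insert (length xs) {j. j < length xs \<and> \<iota> j = i} else {j. j < length xs \<and> \<iota> j = i})" for i
    by (auto simp: less_Suc_eq)
  have card: "card {j. j < length (xs @ [x]) \<and> \<iota> j = i}
      = (if i = ?i then Suc (card {j. j < length xs \<and> \<iota> j = i}) else card {j. j < length xs \<and> \<iota> j = i})" for i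
    unfolding split by simp
  have x: "x \<in> I ?i" and "superficial_at qa.Q (\<lambda>i. qa.proj (I i)) s ?i (?a +> x)"
    using snoc.prems(2)[of "length xs"] by (simp_all add: qa.image_mod_eq)
  then have sup: "qa.superficial_mod I s ?i x" by (intro qa.superficial_mod_of_superficial_at[of s I, OF fam xc])
  then have i: "?i \<le> s" by (simp add: qa.superficial_mod_def)
  \<comment> \<open>The count that includes \<open>x\<close> is still at most \<open>k\<close>, so
    at least one unit is left at the index of \<open>x\<close>.\<close>
  have k1: "1 \<le> k1 ?i" using snoc.prems(3)[OF i] unfolding card k1_def by simp
  have k2: "k2 = k1(?i := k1 ?i - 1)"
    by (rule ext) (simp add: k1_def k2_def card del: length_append)
  have "\<exists>Q. is_hilb I s ?a Q \<and>
      pdim (saturation R ?a (ideal_product R I s)) \<le> enat (Suc (\<Sum>i\<in>{0..s}. k1 i)) \<and>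
      Poly_Mapping.lookup Q (exponents s k1) * (\<Prod>i\<in>{0..s}. fact (k1 i))
        = Poly_Mapping.lookup P (exponents s k) * (\<Prod>i\<in>{0..s}. fact (k i))"
    unfolding k1_def
  proof (rule snoc.IH[OF xsc])
    fix j assume "j < length xs"
    then show "xs ! j \<in> I (\<iota> j) \<and>
      superficial_at (quot_by R (take j xs)) (\<lambda>i. image_by R (take j xs) (I i)) s (\<iota> j)
        (Idl (set (take j xs)) +> xs ! j)"
      using snoc.prems(2)[of j] by (simp add: nth_append)
  next
    fix i assume "i \<le> s"
    then show "card {j. j < length xs \<and> \<iota> j = i} \<le> k i"
      using snoc.prems(3)[of i] unfolding card by (simp split: if_splits)
  qed
  then obtain Q1 where Q1: "is_hilb I s ?a Q1"
      "pdim (saturation R ?a (ideal_product R I s)) \<le> enat (Suc (\<Sum>i\<in>{0..s}. k1 i))"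
      "Poly_Mapping.lookup Q1 (exponents s k1) * (\<Prod>i\<in>{0..s}. fact (k1 i))
        = Poly_Mapping.lookup P (exponents s k) * (\<Prod>i\<in>{0..s}. fact (k i))"
    by (elim exE conjE)
  have "Idl (set (xs @ [x])) = PIdl x <+> ?a" using Idl_insert[OF xc xsc] by simp
  then show ?case
    using superficial_mod_coefficient[of ?a x ?i Q1 k1, OF a x sup Q1(1,2) k1, folded k2] 
    unfolding Q1(3) k2_def by simp
qed

lemma mixed_multiplicity_eq:
  assumes dim: "pdim (saturation R {\<zero>} (ideal_product R I s)) = enat (\<Sum>i\<in>{0..s}. k i) + 1"
    and P: "is_hilb I s {\<zero>} P"
  shows "mixed_multiplicity R I s k = Poly_Mapping.lookup P (exponents s k) * (\<Prod>i\<in>{0..s}. fact (k i))"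
proof -
  have II: "ideal (ideal_product R I s) R" by (rule ideal_product_ideal[of s I, OF fam])
  have sat: "ideal (saturation R {\<zero>} (ideal_product R I s)) R"
    by (rule saturation_ideal[OF zeroideal II])
  have krull: "krull_dim (R Quot saturation R {\<zero>} (ideal_product R I s))
      = pdim (saturation R {\<zero>} (ideal_product R I s))"
    by (rule quotient_by.krull_dim_quot[OF quotient_by.intro[OF is_cring quotient_by_axioms.intro[OF sat]]])
  have mono: "ideal (ideal_monomial R I s n) R" for n by (rule monomial_ideal[of s I, OF fam])
  have "hilbert_function R I s = hlen I s {\<zero>}"
  proof
    show "hilbert_function R I s n = hlen I s {\<zero>} n" for n
      unfolding hlen_def isum_zero[OF mono] by (rule hilbert_function_eq[OF fam])
  qed
  then have hilb: "is_hilbert_polynomial R I s P' \<longleftrightarrow> is_hilb I s {\<zero>} P'" for P'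
    by (simp add: is_hilbert_polynomial_def is_hilb_def vars_le_def)
  show ?thesis
    unfolding mixed_multiplicity_def krull hilb by (rule the_hilb_coefficient[OF dim P]) simp
qed

end

end

theorem proposition4p4:
  fixes R :: "('a, 'b) ring_scheme" (structure)
    and \<nn> J :: "'a set" and I :: "nat \<Rightarrow> 'a set" and s :: nat and k :: "nat \<Rightarrow> nat"
  assumes "noetherian_local_ring R \<nn>"
    and "krull_dim R > 0"
    and "infinite (carrier (R Quot \<nn>))"
    and "is_primary_to R \<nn> J"
    and "I 0 = J"
    and "\<And>i. 1 \<le> i \<Longrightarrow> i \<le> s \<Longrightarrow> ideal (I i) R"
    and "\<not> nilpotent_ideal R (ideal_product R I s)"
    and "krull_dim (R Quot saturation R {\<zero>} (ideal_product R I s)) = enat (\<Sum>i\<in>{0..s}. k i) + 1"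
  shows
    "(mixed_multiplicity R I s k \<noteq> 0 \<longrightarrow>
       (\<forall>m xs. (\<forall>i\<le>s. m i \<le> k i) \<and> superficial_sequence_of_type R I s m xs \<longrightarrow>
          krull_dim (R Quot saturation R (Idl (set xs)) (ideal_product R I s)) + enat (length xs)
            = krull_dim (R Quot saturation R {\<zero>} (ideal_product R I s)) \<and>
          mixed_multiplicity (quot_by R xs) (\<lambda>i. image_by R xs (I i)) s (\<lambda>i. k i - m i) \<noteq> 0))
     \<and>
     ((\<exists>m xs. (\<forall>i\<le>s. m i \<le> k i) \<and> superficial_sequence_of_type R I s m xs \<and>
          krull_dim (R Quot saturation R (Idl (set xs)) (ideal_product R I s)) + enat (length xs)
            = krull_dim (R Quot saturation R {\<zero>} (ideal_product R I s)) \<and>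
          mixed_multiplicity (quot_by R xs) (\<lambda>i. image_by R xs (I i)) s (\<lambda>i. k i - m i) \<noteq> 0) \<longrightarrow>
       mixed_multiplicity R I s k \<noteq> 0)
     \<and>
     (\<forall>m xs. mixed_multiplicity R I s k \<noteq> 0 \<and> (\<forall>i\<le>s. m i \<le> k i) \<and>
          superficial_sequence_of_type R I s m xs \<longrightarrow>
        mixed_multiplicity R I s k
          = mixed_multiplicity (quot_by R xs) (\<lambda>i. image_by R xs (I i)) s (\<lambda>i. k i - m i))"
proof -
  interpret noetherian_local_ring R \<nn> by (rule assms(1))
  let ?I = "ideal_product R I s" and ?d = "\<Sum>i\<in>{0..s}. k i"
  have J: "nn_primary (I 0)" unfolding assms(5) by (rule is_primary_to_nn[OF assms(4)])
  have fam: "ideal (I i) R" if "i \<le> s" for i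
    using that assms(6) J by (cases "i = 0") (simp_all add: nn_primary_def)
  have II: "ideal ?I R" by (rule ideal_product_ideal[of s I, OF fam])
  have krull: "krull_dim (R Quot saturation R a ?I) = pdim (saturation R a ?I)" if "ideal a R" for a
    by (rule quotient_by.krull_dim_quot)
      (rule quotient_by.intro[OF is_cring quotient_by_axioms.intro[OF saturation_ideal[OF that II]]])
  have dim: "pdim (saturation R {\<zero>} ?I) = enat ?d + 1"
    using assms(8) unfolding krull[OF zeroideal] .
  obtain P where P: "is_hilb I s {\<zero>} P" using hilb_exists[of s I, OF fam J] by blast
  have mm: "mixed_multiplicity R I s k = Poly_Mapping.lookup P (exponents s k) * (\<Prod>i\<in>{0..s}. fact (k i))"
    by (rule mixed_multiplicity_eq[of s I, OF fam J dim P])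
  \<comment> \<open>Both claims rest on the same coefficient identity. The second is conditional
    because \<open>mixed_multiplicity\<close> of the quotient is unspecified outside its dimension
    equation; the first supplies that equation when the multiplicity of \<open>R\<close> is
    nonzero.\<close>
  have key: "mixed_multiplicity R I s k \<noteq> 0 \<Longrightarrow>
        krull_dim (R Quot saturation R (Idl (set xs)) ?I) + enat (length xs)
          = krull_dim (R Quot saturation R {\<zero>} ?I)"
      "krull_dim (R Quot saturation R (Idl (set xs)) ?I) + enat (length xs)
          = krull_dim (R Quot saturation R {\<zero>} ?I) \<Longrightarrow>
        mixed_multiplicity (quot_by R xs) (\<lambda>i. image_by R xs (I i)) s (\<lambda>i. k i - m i)
          = mixed_multiplicity R I s k"
    if mk: "\<forall>i\<le>s. m i \<le> k i" and sup: "superficial_sequence_of_type R I s m xs" for m xs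
  proof -
    have m: "m i \<le> k i" if "i \<le> s" for i using mk that by blast
    let ?a = "Idl (set xs)" and ?k = "\<lambda>i. k i - m i"
    define e where "e = (\<Sum>i\<in>{0..s}. ?k i)"
    obtain \<iota> where xs: "set xs \<subseteq> carrier R"
      and \<iota>: "\<And>j. j < length xs \<Longrightarrow> xs ! j \<in> I (\<iota> j) \<and>
        superficial_at (quot_by R (take j xs)) (\<lambda>i. image_by R (take j xs) (I i)) s (\<iota> j)
          (Idl (set (take j xs)) +> xs ! j)"
      and card: "\<And>i. i \<le> s \<Longrightarrow> card {j. j < length xs \<and> \<iota> j = i} = m i"
      using sup unfolding superficial_sequence_of_type_def by blast
    have a: "ideal ?a R" by (rule genideal_ideal[OF xs])
    interpret qa: quotient_by R ?a by (rule quotient_by.intro[OF is_cring quotient_by_axioms.intro[OF a]])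
    note sat = saturation_upper[OF a II] saturation_ideal[OF a II]
    \<comment> \<open>Superficiality includes \<open>\<iota> j \<le> s\<close>, so the fibres of
      \<open>\<iota>\<close> cover all positions.\<close>
    have len: "length xs = (\<Sum>i\<in>{0..s}. m i)"
    proof -
      have "{..<length xs} = (\<Union>i\<in>{0..s}. {j. j < length xs \<and> \<iota> j = i})"
        using \<iota> by (auto simp: superficial_at_def)
      then have "card {..<length xs} = (\<Sum>i\<in>{0..s}. card {j. j < length xs \<and> \<iota> j = i})"
        by (simp only:) (rule card_UN_disjoint, auto)
      then show ?thesis using card by simp
    qed
    have d: "?d = e + length xs"
      unfolding e_def len sum.distrib[symmetric] by (rule sum.cong) (use m in auto)
    have ex: "exponents s (\<lambda>i. k i - card {j. j < length xs \<and> \<iota> j = i}) = exponents s ?k"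
      unfolding exponents_def by (rule sum.cong) (use card in simp_all)
    obtain Q where Q: "is_hilb I s ?a Q" and le: "pdim (saturation R ?a ?I) \<le> enat (Suc e)"
      and coeff: "Poly_Mapping.lookup Q (exponents s ?k) * (\<Prod>i\<in>{0..s}. fact (?k i)) = mixed_multiplicity R I s k"
    proof -
      have "\<exists>Q. is_hilb I s ?a Q \<and>
        pdim (saturation R ?a ?I) \<le> enat (Suc (\<Sum>i\<in>{0..s}. k i - card {j. j < length xs \<and> \<iota> j = i})) \<and>
        Poly_Mapping.lookup Q (exponents s (\<lambda>i. k i - card {j. j < length xs \<and> \<iota> j = i}))
            * (\<Prod>i\<in>{0..s}. fact (k i - card {j. j < length xs \<and> \<iota> j = i}))
          = Poly_Mapping.lookup P (exponents s k) * (\<Prod>i\<in>{0..s}. fact (k i))"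
      proof (rule superficial_sequence_coefficient[of s I, OF fam J xs \<iota> _ P])
        show "card {j. j < length xs \<and> \<iota> j = i} \<le> k i" if "i \<le> s" for i using card m that by simp
        show "pdim (saturation R {\<zero>} ?I) \<le> enat (Suc ?d)" unfolding dim by (simp add: one_enat_def)
      qed
      then show ?thesis unfolding ex using that card by (auto simp: e_def mm)
    qed
    \<comment> \<open>Cancelling the finite length turns the dimension statement into the guard of
      the description for the exponents \<open>?k\<close>.\<close>
    have eq: "pdim (saturation R ?a ?I) + enat (length xs) = enat ?d + 1 \<longleftrightarrow> pdim (saturation R ?a ?I) = enat e + 1"
      unfolding d by (cases "pdim (saturation R ?a ?I)") (simp_all add: one_enat_def)
    show "krull_dim (R Quot saturation R ?a ?I) + enat (length xs) = krull_dim (R Quot saturation R {\<zero>} ?I)"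
      if "mixed_multiplicity R I s k \<noteq> 0"
      unfolding krull[OF a] krull[OF zeroideal] dim eq
    \<comment> \<open>A smaller dimension would force every monomial of \<open>Q\<close> to have
      degree below \<open>e\<close>, but \<open>?k\<close> has degree \<open>e\<close> and a nonzero
      coefficient.\<close>
    proof (rule ccontr)
      assume "pdim (saturation R ?a ?I) \<noteq> enat e + 1"
      then have le': "pdim (saturation R ?a ?I) \<le> enat e"
        using le by (cases "pdim (saturation R ?a ?I)") (simp_all add: one_enat_def)
      have "exponents s ?k \<in> Poly_Mapping.keys Q" using that coeff by (auto simp: in_keys_iff)
      then have "tdeg s (exponents s ?k) < e" by (intro hilb_degree[of s I, OF fam J a Q le'])
      then show False by (simp add: e_def)
    qed
    assume "krull_dim (R Quot saturation R ?a ?I) + enat (length xs) = krull_dim (R Quot saturation R {\<zero>} ?I)"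
    then have "pdim (saturation R ?a ?I) = enat (\<Sum>i\<in>{0..s}. ?k i) + 1"
      unfolding krull[OF a] krull[OF zeroideal] dim eq e_def .
    then show "mixed_multiplicity (quot_by R xs) (\<lambda>i. image_by R xs (I i)) s ?k = mixed_multiplicity R I s k"
      unfolding qa.image_mod_eq coeff[symmetric]
      by (intro qa.proj_mixed_multiplicity[of s I, OF fam sat _ Q])
  qed
  show ?thesis
  proof (intro conjI impI allI; elim exE conjE)
    \<comment> \<open>This block serves the first and the third part, which share their hypotheses;
      the next block is the second part.\<close>
    fix m xs
    assume nz: "mixed_multiplicity R I s k \<noteq> 0" and sup: "\<forall>i\<le>s. m i \<le> k i" "superficial_sequence_of_type R I s m xs"
    note dim_eq = key(1)[OF sup nz]
    show "krull_dim (R Quot saturation R (Idl (set xs)) ?I) + enat (length xs)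
        = krull_dim (R Quot saturation R {\<zero>} ?I)" by (rule dim_eq)
    show mm_eq: "mixed_multiplicity R I s k
        = mixed_multiplicity (quot_by R xs) (\<lambda>i. image_by R xs (I i)) s (\<lambda>i. k i - m i)"
      by (rule key(2)[OF sup dim_eq, symmetric])
    show "mixed_multiplicity (quot_by R xs) (\<lambda>i. image_by R xs (I i)) s (\<lambda>i. k i - m i) \<noteq> 0"
      using nz unfolding mm_eq .
  next
    fix m xs
    assume sup: "\<forall>i\<le>s. m i \<le> k i" "superficial_sequence_of_type R I s m xs"
      and dim_eq: "krull_dim (R Quot saturation R (Idl (set xs)) ?I) + enat (length xs)
        = krull_dim (R Quot saturation R {\<zero>} ?I)"
      and "mixed_multiplicity (quot_by R xs) (\<lambda>i. image_by R xs (I i)) s (\<lambda>i. k i - m i) \<noteq> 0"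
    then show "mixed_multiplicity R I s k \<noteq> 0" unfolding key(2)[OF sup dim_eq] by blast
  qed
qed

end
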